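(* Let $K$ be an algebraic number field. The quotient of the equivalence relation $\mathcal R_{K,1}$ of commensurability of $1$-dimensional $K$-lattices by the scaling action of the connected component $(K_\infty^* )^\circ$ of the identity in $K_\infty^*$ is a groupoid that is isomorphic to $$(\mathbb A_{K,f}^*/\hat{\mathcal O}^* )\boxtimes\big((\mathbb A_K^*/K^*(K_\infty^* )^\circ)\times_{\hat{\mathcal O}^*}\hat{\mathcal O}\big).$$
   Context: Let $\mathcal O$ be the ring of integers of $K$. For a finite place $v$ of $K$, $K_v$ is the completion of $K$ at $v$ and $\mathcal O_v$ is the closure of $\mathcal O$ in $K_v$. Put $\hat{\mathcal O}=\prod_{v\text{ finite}}\mathcal O_v$, $\mathbb A_{K,f}=K\otimes_{\mathcal O}\hat{\mathcal O}$ (finite adeles), $K_\infty=\prod_{v\mid\infty}K_v$ (so $K_\infty\cong\mathbb R^{[K:\mathbb Q]}$ additively), $\mathbb A_K=K_\infty\times\mathbb A_{K,f}$ (adeles). $K^*$ is embedded diagonally in $\mathbb A_K^*$, and $K_\infty^*$, $\mathbb A_{K,f}^*$ are embedded with component $1$ in the other factor. A $1$-dimensional $\mathcal O$-lattice is a lattice $L$ in $K_\infty$ with $\mathcal OL=L$. A $1$-dimensional $K$-lattice is a pair $(L,\varphi)$ where $L\subset K_\infty$ is a $1$-dimensional $\mathcal O$-lattice and $\varphi\colon K/\mathcal O\to KL/L$ is an $\mathcal O$-module map. Two $K$-lattices $(L_1,\varphi_1)$, $(L_2,\varphi_2)$ are commensurable if the lattices $L_1$ and $L_2$ are commensurable and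 $\varphi_1=\varphi_2$ modulo $L_1+L_2$ (i.e. their compositions with $KL_i/L_i\to K(L_1+L_2)/(L_1+L_2)$ coincide); this is an equivalence relation, denoted $\mathcal R_{K,1}$ and regarded as a groupoid. The scaling action of $k\in K_\infty^*$ is $k(L,\varphi)=(kL,k\varphi)$, inducing an action on $\mathcal R_{K,1}$ (applied simultaneously to both $K$-lattices of a pair). The group $\mathbb A_{K,f}^*$ acts on $(\mathbb A_K^*/K^*(K_\infty^* )^\circ)\times\mathbb A_{K,f}$ by $g(s,t)=(sg^{-1},gt)$; $(\mathbb A_K^*/K^*(K_\infty^* )^\circ)\times_{\hat{\mathcal O}^*}\mathbb A_{K,f}$ denotes the quotient by the action of $\hat{\mathcal O}^*$, on which $\mathbb A_{K,f}^*/\hat{\mathcal O}^*$ acts, and $(\mathbb A_K^*/K^*(K_\infty^* )^\circ)\times_{\hat{\mathcal O}^*}\hat{\mathcal O}$ is the image of $(\mathbb A_K^*/K^*(K_\infty^* )^\circ)\times\hat{\mathcal O}$ in it. For a group $G$ acting on a set $X$ and $Y\subset X$, $G\boxtimes Y=\{(g,x)\mid g\in G,\ x\in Y,\ gx\in Y\}$ is the corresponding subgroupoid of the transformation groupoid $G\times X$. *)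

theory Defs
  imports "HOL-Analysis.Analysis" "HOL-Algebra.Algebra" "HOL-Algebra.Algebraic_Closure_Type"
begin

section \<open>Groupoids\<close>

record ('o, 'a) groupoid =
  Obj :: "'o set"
  Arr :: "'a set"
  src :: "'a \<Rightarrow> 'o"
  rng :: "'a \<Rightarrow> 'o"
  comp :: "'a \<Rightarrow> 'a \<Rightarrow> 'a"
  ide :: "'o \<Rightarrow> 'a"

text \<open>\<open>comp \<G> f g\<close> is the product \<open>fg\<close>, meaningful when \<open>src f = rng g\<close>.\<close>

definition is_groupoid :: "('o, 'a) groupoid \<Rightarrow> bool" where
  "is_groupoid \<G> \<longleftrightarrow>
     (\<forall>f\<in>Arr \<G>. src \<G> f \<in> Obj \<G> \<and> rng \<G> f \<in> Obj \<G>) \<and>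
     (\<forall>f\<in>Arr \<G>. \<forall>g\<in>Arr \<G>. src \<G> f = rng \<G> g \<longrightarrow>
        comp \<G> f g \<in> Arr \<G> \<and> src \<G> (comp \<G> f g) = src \<G> g \<and> rng \<G> (comp \<G> f g) = rng \<G> f) \<and>
     (\<forall>f\<in>Arr \<G>. \<forall>g\<in>Arr \<G>. \<forall>h\<in>Arr \<G>. src \<G> f = rng \<G> g \<longrightarrow> src \<G> g = rng \<G> h \<longrightarrow>
        comp \<G> (comp \<G> f g) h = comp \<G> f (comp \<G> g h)) \<and>
     (\<forall>x\<in>Obj \<G>. ide \<G> x \<in> Arr \<G> \<and> src \<G> (ide \<G> x) = x \<and> rng \<G> (ide \<G> x) = x) \<and>
     (\<forall>f\<in>Arr \<G>. comp \<G> f (ide \<G> (src \<G> f)) = f \<and> comp \<G> (ide \<G> (rng \<G> f)) f = f) \<and>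
     (\<forall>f\<in>Arr \<G>. \<exists>g\<in>Arr \<G>. src \<G> g = rng \<G> f \<and> rng \<G> g = src \<G> f \<and>
        comp \<G> f g = ide \<G> (rng \<G> f) \<and> comp \<G> g f = ide \<G> (src \<G> f))"

definition groupoid_isomorphic :: "('o, 'a) groupoid \<Rightarrow> ('p, 'b) groupoid \<Rightarrow> bool" where
  "groupoid_isomorphic \<G> \<H> \<longleftrightarrow>
     (\<exists>F0 F1. bij_betw F0 (Obj \<G>) (Obj \<H>) \<and> bij_betw F1 (Arr \<G>) (Arr \<H>) \<and>
        (\<forall>f\<in>Arr \<G>. src \<H> (F1 f) = F0 (src \<G> f) \<and> rng \<H> (F1 f) = F0 (rng \<G> f)) \<and>
        (\<forall>x\<in>Obj \<G>. F1 (ide \<G> x) = ide \<H> (F0 x)) \<and>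
        (\<forall>f\<in>Arr \<G>. \<forall>g\<in>Arr \<G>. src \<G> f = rng \<G> g \<longrightarrow>
           F1 (comp \<G> f g) = comp \<H> (F1 f) (F1 g)))"

text \<open>
  The pair \<open>(x, y)\<close> of a relation \<open>R\<close> is an arrow from \<open>y\<close> to \<open>x\<close>.
\<close>

definition relation_groupoid :: "'o set \<Rightarrow> ('o \<times> 'o) set \<Rightarrow> ('o, 'o \<times> 'o) groupoid" where
  "relation_groupoid E R =
     \<lparr>Obj = E, Arr = R, src = snd, rng = fst,
      comp = (\<lambda>f g. (fst f, snd g)), ide = (\<lambda>x. (x, x))\<rparr>"

text \<open>
  Quotient by a group \<open>S\<close> acting by \<open>\<alpha>\<close> on objects and by \<open>\<beta>\<close> on arrows. The product of two orbits
  consists of the products of all their composable representatives. When the action on objects is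
  not free this need not be a single orbit, so that being a groupoid is a genuine assertion.
\<close>

definition orbit_groupoid ::
  "('s, 'm) monoid_scheme \<Rightarrow> ('s \<Rightarrow> 'o \<Rightarrow> 'o) \<Rightarrow> ('s \<Rightarrow> 'a \<Rightarrow> 'a) \<Rightarrow> ('o, 'a) groupoid
     \<Rightarrow> ('o set, 'a set) groupoid" where
  "orbit_groupoid S \<alpha> \<beta> \<G> =
     \<lparr>Obj = orbits S (Obj \<G>) \<alpha>, Arr = orbits S (Arr \<G>) \<beta>,
      src = (\<lambda>A. src \<G> ` A), rng = (\<lambda>A. rng \<G> ` A),
      comp = (\<lambda>A B. {comp \<G> f g | f g. f \<in> A \<and> g \<in> B \<and> src \<G> f = rng \<G> g}),
      ide = (\<lambda>E. ide \<G> ` E)\<rparr>"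

definition boxtimes ::
  "('g, 'm) monoid_scheme \<Rightarrow> ('g \<Rightarrow> 'x \<Rightarrow> 'x) \<Rightarrow> 'x set \<Rightarrow> ('x, 'g \<times> 'x) groupoid" where
  "boxtimes G \<alpha> Y =
     \<lparr>Obj = Y, Arr = {(g, x). g \<in> carrier G \<and> x \<in> Y \<and> \<alpha> g x \<in> Y},
      src = (\<lambda>(g, x). x), rng = (\<lambda>(g, x). \<alpha> g x),
      comp = (\<lambda>(g, y) (h, x). (g \<otimes>\<^bsub>G\<^esub> h, x)), ide = (\<lambda>x. (\<one>\<^bsub>G\<^esub>, x))\<rparr>"


section \<open>Rings, modules and topology\<close>

definition product_ring :: "'i set \<Rightarrow> ('i \<Rightarrow> ('a, 'm) ring_scheme) \<Rightarrow> ('i \<Rightarrow> 'a) ring" where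
  "product_ring I R =
     \<lparr>carrier = (\<Pi>\<^sub>E i\<in>I. carrier (R i)),
      monoid.mult = (\<lambda>x y. \<lambda>i\<in>I. x i \<otimes>\<^bsub>R i\<^esub> y i), one = (\<lambda>i\<in>I. \<one>\<^bsub>R i\<^esub>),
      ring.zero = (\<lambda>i\<in>I. \<zero>\<^bsub>R i\<^esub>), add = (\<lambda>x y. \<lambda>i\<in>I. x i \<oplus>\<^bsub>R i\<^esub> y i)\<rparr>"

text \<open>
  The tensor product of two commutative algebras \<open>A\<close>, \<open>B\<close> over \<open>S\<close> with structure maps \<open>f\<close>, \<open>g\<close>:
  the free abelian group on \<open>A \<times> B\<close> modulo the usual relations. The free abelian group is the
  monoid ring of the multiplicative monoid \<open>A \<times> B\<close>, which provides the product
  \<open>(a \<otimes> b)(a' \<otimes> b') = aa' \<otimes> bb'\<close>. The set of relations is stable under multiplication by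
  generators, so the ideal it generates is just the subgroup it generates.
\<close>

definition free_pair_ring ::
  "('a, 'm) ring_scheme \<Rightarrow> ('b, 'n) ring_scheme \<Rightarrow> ('a \<times> 'b \<Rightarrow>\<^sub>0 int) ring" where
  "free_pair_ring A B =
     \<lparr>carrier = {c. Poly_Mapping.keys c \<subseteq> carrier A \<times> carrier B},
      monoid.mult = (\<lambda>c d. frag_extend (\<lambda>(a, b).
                frag_extend (\<lambda>(a', b'). frag_of (a \<otimes>\<^bsub>A\<^esub> a', b \<otimes>\<^bsub>B\<^esub> b')) d) c),
      one = frag_of (\<one>\<^bsub>A\<^esub>, \<one>\<^bsub>B\<^esub>), ring.zero = 0, add = (+)\<rparr>"

definition tensor_relations ::
  "('s, 'l) ring_scheme \<Rightarrow> ('s \<Rightarrow> 'a) \<Rightarrow> ('s \<Rightarrow> 'b) \<Rightarrow> ('a, 'm) ring_scheme \<Rightarrow> ('b, 'n) ring_scheme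
     \<Rightarrow> ('a \<times> 'b \<Rightarrow>\<^sub>0 int) set" where
  "tensor_relations S f g A B =
     {frag_of (a \<oplus>\<^bsub>A\<^esub> a', b) - frag_of (a, b) - frag_of (a', b) | a a' b.
        a \<in> carrier A \<and> a' \<in> carrier A \<and> b \<in> carrier B} \<union>
     {frag_of (a, b \<oplus>\<^bsub>B\<^esub> b') - frag_of (a, b) - frag_of (a, b') | a b b'.
        a \<in> carrier A \<and> b \<in> carrier B \<and> b' \<in> carrier B} \<union>
     {frag_of (f s \<otimes>\<^bsub>A\<^esub> a, b) - frag_of (a, g s \<otimes>\<^bsub>B\<^esub> b) | s a b.
        s \<in> carrier S \<and> a \<in> carrier A \<and> b \<in> carrier B}"

definition tensor_ideal ::
  "('s, 'l) ring_scheme \<Rightarrow> ('s \<Rightarrow> 'a) \<Rightarrow> ('s \<Rightarrow> 'b) \<Rightarrow> ('a, 'm) ring_scheme \<Rightarrow> ('b, 'n) ring_scheme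
     \<Rightarrow> ('a \<times> 'b \<Rightarrow>\<^sub>0 int) set" where
  "tensor_ideal S f g A B = Idl\<^bsub>free_pair_ring A B\<^esub> (tensor_relations S f g A B)"

definition tensor_ring ::
  "('s, 'l) ring_scheme \<Rightarrow> ('s \<Rightarrow> 'a) \<Rightarrow> ('s \<Rightarrow> 'b) \<Rightarrow> ('a, 'm) ring_scheme \<Rightarrow> ('b, 'n) ring_scheme
     \<Rightarrow> ('a \<times> 'b \<Rightarrow>\<^sub>0 int) set ring" where
  "tensor_ring S f g A B = free_pair_ring A B Quot tensor_ideal S f g A B"

definition pure_tensor ::
  "('s, 'l) ring_scheme \<Rightarrow> ('s \<Rightarrow> 'a) \<Rightarrow> ('s \<Rightarrow> 'b) \<Rightarrow> ('a, 'm) ring_scheme \<Rightarrow> ('b, 'n) ring_scheme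
     \<Rightarrow> 'a \<Rightarrow> 'b \<Rightarrow> ('a \<times> 'b \<Rightarrow>\<^sub>0 int) set" where
  "pure_tensor S f g A B a b =
     tensor_ideal S f g A B +>\<^bsub>free_pair_ring A B\<^esub> frag_of (a, b)"

definition set_span :: "('a, 'm) ring_scheme \<Rightarrow> 'a set \<Rightarrow> 'a set \<Rightarrow> 'a set" where
  "set_span R A L = generate (add_monoid R) (A <#>\<^bsub>R\<^esub> L)"

text \<open>Multiplication by \<open>a\<close> on the quotient by an additive subgroup \<open>N\<close> that is stable under it.\<close>

definition coset_smult :: "('a, 'm) ring_scheme \<Rightarrow> 'a set \<Rightarrow> 'a \<Rightarrow> 'a set \<Rightarrow> 'a set" where
  "coset_smult R N a E = (\<Union>x\<in>E. N +>\<^bsub>R\<^esub> (a \<otimes>\<^bsub>R\<^esub> x))"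

definition commensurable_subgroups :: "('a, 'm) monoid_scheme \<Rightarrow> 'a set \<Rightarrow> 'a set \<Rightarrow> bool" where
  "commensurable_subgroups G H1 H2 \<longleftrightarrow>
     finite (rcosets\<^bsub>G\<lparr>carrier := H1\<rparr>\<^esub> (H1 \<inter> H2)) \<and>
     finite (rcosets\<^bsub>G\<lparr>carrier := H2\<rparr>\<^esub> (H1 \<inter> H2))"

definition quotient_topology :: "'a topology \<Rightarrow> ('a \<Rightarrow> 'b) \<Rightarrow> 'b topology" where
  "quotient_topology E q =
     topology (\<lambda>U. U \<subseteq> q ` topspace E \<and> openin E {x \<in> topspace E. q x \<in> U})"

lemma openin_quotient_topology:
  "openin (quotient_topology E q) U \<longleftrightarrow>
     U \<subseteq> q ` topspace E \<and> openin E {x \<in> topspace E. q x \<in> U}"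
proof -
  have "istopology (\<lambda>U. U \<subseteq> q ` topspace E \<and> openin E {x \<in> topspace E. q x \<in> U})"
    unfolding istopology_def
  proof (intro conjI allI impI)
    fix S T
    assume S: "S \<subseteq> q ` topspace E \<and> openin E {x \<in> topspace E. q x \<in> S}"
      and T: "T \<subseteq> q ` topspace E \<and> openin E {x \<in> topspace E. q x \<in> T}"
    have "{x \<in> topspace E. q x \<in> S \<inter> T} =
        {x \<in> topspace E. q x \<in> S} \<inter> {x \<in> topspace E. q x \<in> T}" by auto
    with S T show "openin E {x \<in> topspace E. q x \<in> S \<inter> T}" by auto
    from S show "S \<inter> T \<subseteq> q ` topspace E" by auto
  next
    fix \<K>
    assume K: "\<forall>U\<in>\<K>. U \<subseteq> q ` topspace E \<and> openin E {x \<in> topspace E. q x \<in> U}"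
    have "{x \<in> topspace E. q x \<in> \<Union>\<K>} = \<Union>((\<lambda>U. {x \<in> topspace E. q x \<in> U}) ` \<K>)" by auto
    with K show "openin E {x \<in> topspace E. q x \<in> \<Union>\<K>}" by (auto intro!: openin_Union)
    from K show "\<Union>\<K> \<subseteq> q ` topspace E" by auto
  qed
  then show ?thesis by (simp add: quotient_topology_def)
qed


section \<open>Number fields and their completions\<close>

text \<open>
  The field \<open>K\<close> is the type \<open>'k\<close>; it is a number field if it has finite degree over the rationals.
\<close>

definition number_field :: "'k::field_char_0 itself \<Rightarrow> bool" where
  "number_field _ \<longleftrightarrow>
     (\<exists>B :: 'k set. finite B \<and> Modules.module.span (\<lambda>q x. of_rat q * x) B = UNIV)"

abbreviation K_ring :: "'k::field_char_0 ring" where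
  "K_ring \<equiv> ring_of_type_algebra"

definition O_ring :: "'k::field_char_0 ring" where
  "O_ring = K_ring\<lparr>carrier := {x. algebraic_int x}\<rparr>"

text \<open>Places are represented by absolute values.\<close>

type_synonym 'k place = "'k \<Rightarrow> real"

text \<open>
  Two embeddings induce the same absolute value iff they are equal or complex conjugate.
\<close>

definition infinite_places :: "'k::field_char_0 place set" where
  "infinite_places =
     {\<lambda>x. cmod (\<sigma> x) | \<sigma>. \<sigma> \<in> ring_hom K_ring (ring_of_type_algebra :: complex ring)}"

text \<open>\<open>int_ord P a\<close> is the exponent of \<open>P\<close> in the nonzero integer \<open>a\<close>.\<close>

definition int_ord :: "'k::field_char_0 set \<Rightarrow> 'k \<Rightarrow> nat" where
  "int_ord P a = (GREATEST n. a \<in> (ideal_prod O_ring P ^^ n) (carrier O_ring))"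

definition prime_ord :: "'k::field_char_0 set \<Rightarrow> 'k \<Rightarrow> int" where
  "prime_ord P x =
     (THE z. \<exists>a\<in>carrier O_ring - {0}. \<exists>b\<in>carrier O_ring - {0}.
        x = a / b \<and> z = int (int_ord P a) - int (int_ord P b))"

text \<open>Any base greater than \<open>1\<close> in place of \<open>exp 1\<close> gives the same completion.\<close>

definition prime_abs :: "'k::field_char_0 set \<Rightarrow> 'k place" where
  "prime_abs P x = (if x = 0 then 0 else exp (- real_of_int (prime_ord P x)))"

definition finite_places :: "'k::field_char_0 place set" where
  "finite_places = {prime_abs P | P. primeideal P O_ring \<and> P \<noteq> {0}}"

type_synonym 'k completion = "(nat \<Rightarrow> 'k) set"

definition Cauchy_ring :: "'k::field_char_0 place \<Rightarrow> (nat \<Rightarrow> 'k) ring" where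
  "Cauchy_ring v =
     \<lparr>carrier = {s. \<forall>e>0. \<exists>N. \<forall>m\<ge>N. \<forall>n\<ge>N. v (s m - s n) < e},
      monoid.mult = (\<lambda>s t n. s n * t n), one = (\<lambda>n. 1),
      ring.zero = (\<lambda>n. 0), add = (\<lambda>s t n. s n + t n)\<rparr>"

definition null_ideal :: "'k::field_char_0 place \<Rightarrow> (nat \<Rightarrow> 'k) set" where
  "null_ideal v = {s \<in> carrier (Cauchy_ring v). (\<lambda>n. v (s n)) \<longlonglongrightarrow> 0}"

definition completion :: "'k::field_char_0 place \<Rightarrow> 'k completion ring" where
  "completion v = Cauchy_ring v Quot null_ideal v"

definition embed :: "'k::field_char_0 place \<Rightarrow> 'k \<Rightarrow> 'k completion" where
  "embed v x = null_ideal v +>\<^bsub>Cauchy_ring v\<^esub> (\<lambda>n. x)"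

definition completion_dist :: "'k::field_char_0 place \<Rightarrow> 'k completion \<Rightarrow> 'k completion \<Rightarrow> real" where
  "completion_dist v x y =
     (if x \<in> carrier (completion v) \<and> y \<in> carrier (completion v)
      then THE r. \<exists>s\<in>x. \<exists>t\<in>y. (\<lambda>n. v (s n - t n)) \<longlonglongrightarrow> r
      else 0)"

definition completion_topology :: "'k::field_char_0 place \<Rightarrow> 'k completion topology" where
  "completion_topology v = Metric_space.mtopology (carrier (completion v)) (completion_dist v)"

definition local_integers :: "'k::field_char_0 place \<Rightarrow> 'k completion ring" where
  "local_integers v =
     (completion v)\<lparr>carrier := completion_topology v closure_of (embed v ` carrier O_ring)\<rparr>"


section \<open>Adeles\<close>

definition O_hat :: "('k::field_char_0 place \<Rightarrow> 'k completion) ring" where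
  "O_hat = product_ring finite_places local_integers"

definition K_inf :: "('k::field_char_0 place \<Rightarrow> 'k completion) ring" where
  "K_inf = product_ring infinite_places completion"

definition K_inf_topology :: "('k::field_char_0 place \<Rightarrow> 'k completion) topology" where
  "K_inf_topology = product_topology completion_topology infinite_places"

definition diag_fin :: "'k::field_char_0 \<Rightarrow> 'k place \<Rightarrow> 'k completion" where
  "diag_fin x = (\<lambda>v\<in>finite_places. embed v x)"

definition diag_inf :: "'k::field_char_0 \<Rightarrow> 'k place \<Rightarrow> 'k completion" where
  "diag_inf x = (\<lambda>v\<in>infinite_places. embed v x)"

type_synonym 'k inf_adele = "'k place \<Rightarrow> 'k completion"
type_synonym 'k fin_adele = "('k \<times> ('k place \<Rightarrow> 'k completion) \<Rightarrow>\<^sub>0 int) set"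
type_synonym 'k adele = "'k inf_adele \<times> 'k fin_adele"

definition finite_adeles :: "'k::field_char_0 fin_adele ring" where
  "finite_adeles = tensor_ring O_ring (\<lambda>a. a) diag_fin K_ring O_hat"

definition fin_tensor :: "'k::field_char_0 \<Rightarrow> ('k place \<Rightarrow> 'k completion) \<Rightarrow> 'k fin_adele" where
  "fin_tensor = pure_tensor O_ring (\<lambda>a. a) diag_fin K_ring O_hat"

definition adeles :: "'k::field_char_0 adele ring" where
  "adeles = RDirProd K_inf finite_adeles"

definition K_inf_units_component :: "'k::field_char_0 inf_adele set" where
  "K_inf_units_component =
     connected_component_of_set (subtopology K_inf_topology (Units K_inf)) \<one>\<^bsub>K_inf\<^esub>"

definition principal_ideles :: "'k::field_char_0 adele set" where
  "principal_ideles = {(diag_inf x, fin_tensor x \<one>\<^bsub>O_hat\<^esub>) | x. x \<noteq> 0}"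

definition idele_quotient :: "'k::field_char_0 adele set monoid" where
  "idele_quotient = units_of adeles Mod
     (principal_ideles <#>\<^bsub>units_of adeles\<^esub> (K_inf_units_component \<times> {\<one>\<^bsub>finite_adeles\<^esub>}))"

definition O_hat_in_adeles :: "'k::field_char_0 fin_adele set" where
  "O_hat_in_adeles = fin_tensor 1 ` carrier O_hat"

definition O_hat_units :: "'k::field_char_0 fin_adele set" where
  "O_hat_units = fin_tensor 1 ` Units O_hat"

text \<open>
  The action \<open>g(s, t) = (sg\<^sup>-\<^sup>1, gt)\<close>; here \<open>s\<close> is a coset, and \<open>g\<close> is viewed as an idele with
  infinite component \<open>1\<close>.
\<close>

definition idele_act ::
  "'k::field_char_0 fin_adele \<Rightarrow> 'k adele set \<times> 'k fin_adele \<Rightarrow> 'k adele set \<times> 'k fin_adele" where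
  "idele_act g = (\<lambda>(s, t).
     (s #>\<^bsub>units_of adeles\<^esub> inv\<^bsub>units_of adeles\<^esub> (\<one>\<^bsub>K_inf\<^esub>, g), g \<otimes>\<^bsub>finite_adeles\<^esub> t))"

definition balanced_class ::
  "'k::field_char_0 adele set \<times> 'k fin_adele \<Rightarrow> ('k adele set \<times> 'k fin_adele) set" where
  "balanced_class = orbit ((units_of finite_adeles)\<lparr>carrier := O_hat_units\<rparr>) idele_act"

text \<open>
  The quotient by the units of \<open>O_hat\<close> is formed in the product with all finite adeles; this is the
  image of the part with integral second component.
\<close>

definition balanced_integral :: "('k::field_char_0 adele set \<times> 'k fin_adele) set set" where
  "balanced_integral = balanced_class ` (carrier idele_quotient \<times> O_hat_in_adeles)"

definition fin_idele_classes :: "'k::field_char_0 fin_adele set monoid" where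
  "fin_idele_classes = units_of finite_adeles Mod O_hat_units"

definition class_act ::
  "'k::field_char_0 fin_adele set \<Rightarrow> ('k adele set \<times> 'k fin_adele) set
     \<Rightarrow> ('k adele set \<times> 'k fin_adele) set" where
  "class_act c E = (\<Union>g\<in>c. idele_act g ` E)"


section \<open>One-dimensional K-lattices\<close>

definition is_lattice :: "'k::field_char_0 inf_adele set \<Rightarrow> bool" where
  "is_lattice L \<longleftrightarrow>
     subgroup L (add_monoid K_inf) \<and>
     subtopology K_inf_topology L = discrete_topology L \<and>
     compact_space (quotient_topology K_inf_topology (\<lambda>x. L +>\<^bsub>K_inf\<^esub> x))"

definition O_lattice :: "'k::field_char_0 inf_adele set \<Rightarrow> bool" where
  "O_lattice L \<longleftrightarrow> is_lattice L \<and> set_span K_inf (diag_inf ` carrier O_ring) L = L"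

definition K_span :: "'k::field_char_0 inf_adele set \<Rightarrow> 'k inf_adele set" where
  "K_span L = set_span K_inf (range diag_inf) L"

definition K_mod_O :: "'k::field_char_0 set monoid" where
  "K_mod_O = add_monoid K_ring Mod carrier O_ring"

definition KL_mod_L :: "'k::field_char_0 inf_adele set \<Rightarrow> 'k inf_adele set monoid" where
  "KL_mod_L L = (add_monoid K_inf)\<lparr>carrier := K_span L\<rparr> Mod L"

type_synonym 'k lattice = "'k inf_adele set \<times> ('k set \<Rightarrow> 'k inf_adele set)"

definition K_lattices :: "'k::field_char_0 lattice set" where
  "K_lattices = {(L, \<phi>). O_lattice L \<and>
     \<phi> \<in> extensional (carrier K_mod_O) \<and> \<phi> \<in> hom K_mod_O (KL_mod_L L) \<and>
     (\<forall>a\<in>carrier O_ring. \<forall>E\<in>carrier K_mod_O.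
        \<phi> (coset_smult K_ring (carrier O_ring) a E) = coset_smult K_inf L (diag_inf a) (\<phi> E))}"

text \<open>The coset \<open>E\<close> of \<open>L\<^sub>i\<close> is mapped to the coset \<open>E + (L\<^sub>1 + L\<^sub>2)\<close> of \<open>L\<^sub>1 + L\<^sub>2\<close>.\<close>

definition commensurable :: "'k::field_char_0 lattice \<Rightarrow> 'k lattice \<Rightarrow> bool" where
  "commensurable = (\<lambda>(L1, \<phi>1) (L2, \<phi>2).
     commensurable_subgroups (add_monoid K_inf) L1 L2 \<and>
     (\<forall>E\<in>carrier K_mod_O.
        \<phi>1 E <+>\<^bsub>K_inf\<^esub> (L1 <+>\<^bsub>K_inf\<^esub> L2) = \<phi>2 E <+>\<^bsub>K_inf\<^esub> (L1 <+>\<^bsub>K_inf\<^esub> L2)))"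

definition commensurability :: "('k::field_char_0 lattice, 'k lattice \<times> 'k lattice) groupoid" where
  "commensurability = relation_groupoid K_lattices
     {(x, y). x \<in> K_lattices \<and> y \<in> K_lattices \<and> commensurable x y}"

definition scale :: "'k::field_char_0 inf_adele \<Rightarrow> 'k lattice \<Rightarrow> 'k lattice" where
  "scale k = (\<lambda>(L, \<phi>). (k <#\<^bsub>K_inf\<^esub> L, \<lambda>E\<in>carrier K_mod_O. k <#\<^bsub>K_inf\<^esub> \<phi> E))"

definition commensurability_mod_scaling ::
  "('k::field_char_0 lattice set, ('k lattice \<times> 'k lattice) set) groupoid" where
  "commensurability_mod_scaling =
     orbit_groupoid ((units_of K_inf)\<lparr>carrier := K_inf_units_component\<rparr>)
       scale (\<lambda>k. map_prod (scale k) (scale k)) commensurability"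

end

theory Submission
  imports Defs "Jordan_Normal_Form.Char_Poly"
begin

text \<open>
  Write \<open>A_f\<close> for the finite adeles. Every \<open>K\<close>-lattice is of the form \<open>(s (K \<inter> g O_hat), \<phi>)\<close> with a unit \<open>s\<close> of
  \<open>K_inf\<close>, a finite idele \<open>g\<close> and \<open>\<phi>\<close> induced by multiplication by some \<open>w \<in> g O_hat\<close>, as a map from \<open>K/O\<close> to
  \<open>A_f / g O_hat = K / (K \<inter> g O_hat)\<close>: up to scaling the lattice is a fractional ideal, hence given by local
  conditions, and the values of \<open>\<phi>\<close> on the classes of \<open>1/N\<close> determine an adele \<open>w\<close> by completeness.
  The triple \<open>(s, g, w)\<close> is unique up to changing \<open>g\<close> by a unit of \<open>O_hat\<close> and up to
  \<open>(s, g, w) \<mapsto> (s/k, k g, k w)\<close> for nonzero \<open>k\<close> in \<open>K\<close>. Two \<open>K\<close>-lattices are commensurable iff they can be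
  given by triples with the same \<open>s\<close> and \<open>w\<close>: commensurable lattices have a common nonzero vector, so
  that \<open>s\<close> can be made equal, and then \<open>w\<close> is determined because no nonzero finite adele is divisible
  by all positive integers. The isomorphism
  sends the orbit of \<open>(s, g, w)\<close> to the class of \<open>((1/s, g), w/g)\<close>, and the orbit of the pair of \<open>(s, h, w)\<close>
  and \<open>(s, g, w)\<close> to the arrow given by \<open>g/h\<close> at that class.
\<close>

section \<open>Algebraic integers and embeddings of a number field\<close>

text \<open>The arithmetic of \<open>K\<close> is drawn from one finiteness statement: there are
  finitely many algebraic integers with bounded absolute values at all infinite places, so
  \<open>O/aO\<close> is finite for nonzero \<open>a\<close>. Pigeonhole arguments on it replace the
  theory of Dedekind domains: they give prime ideals above proper ideals, an inverse uniformizer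
  \<open>\<gamma>\<close> at each prime, density of \<open>O\<close> in the local integers and the
  Chinese remainder theorem. The inverse in \<open>((1/s, g), w/g)\<close> is forced by the
  ambiguity of the triple: \<open>(s/k, k g, k w)\<close> turns \<open>(1/s, g)\<close> into
  \<open>k (1/s, g)\<close>, so \<open>k\<close> becomes a principal idele, while \<open>w/g\<close>
  stays; replacing \<open>g\<close> by \<open>g/u\<close> with a unit \<open>u\<close> turns
  \<open>w/g\<close> into \<open>u w/g\<close>, which is the balancing relation. The obstacle to the
  groupoid structure is that scaling need not be free on \<open>K\<close>-lattices: a scaling that
  fixes one comes from some \<open>k\<close> in \<open>K\<close> that is a unit at every finite
  place and fixes \<open>w\<close>. It therefore fixes every \<open>K\<close>-lattice with the same
  \<open>s\<close> and \<open>w\<close>, and this keeps the product of two orbits a single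
  orbit.\<close>

interpretation int_module: Modules.module "\<lambda>(c::int) (x::'a::field_char_0). of_int c * x"
  by unfold_locales (auto simp: algebra_simps)

text \<open>The determinant trick: the vector of the \<open>b i\<close> is an eigenvector of the
  integer matrix \<open>A\<close>, so \<open>z\<close> is a root of its characteristic polynomial,
  which is monic with integer coefficients.\<close>

lemma algebraic_int_if_int_matrix:
  fixes z :: "'a::field_char_0" and b :: "nat \<Rightarrow> 'a"
  assumes eq: "\<And>i. i < n \<Longrightarrow> z * b i = (\<Sum>j<n. of_int (A i j) * b j)"
    and nz: "k < n" "b k \<noteq> 0"
  shows "algebraic_int z"
proof -
  define M where "M = mat n n (\<lambda>(i, j). A i j)"
  define MK where "MK = map_mat (of_int :: int \<Rightarrow> 'a) M"
  have M: "M \<in> carrier_mat n n" and MK: "MK \<in> carrier_mat n n"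
    by (auto simp: M_def MK_def)
  have "eigenvector MK (vec n b) z"
    unfolding eigenvector_def
  proof (intro conjI)
    show "vec n b \<in> carrier_vec (dim_row MK)" using MK by auto
    show "vec n b \<noteq> 0\<^sub>v (dim_row MK)" using nz MK
      by (metis carrier_matD(1) index_vec index_zero_vec(1))
    show "MK *\<^sub>v vec n b = z \<cdot>\<^sub>v vec n b"
      using eq by (intro eq_vecI) (auto simp: MK_def M_def scalar_prod_def atLeast0LessThan)
  qed
  then have "poly (char_poly MK) z = 0"
    using eigenvalue_root_char_poly[OF MK] unfolding eigenvalue_def by blast
  moreover have "char_poly MK = map_poly of_int (char_poly M)"
    unfolding MK_def by (rule of_int_hom.char_poly_hom[OF M])
  ultimately show ?thesis
    unfolding algebraic_int_altdef_ipoly using degree_monic_char_poly[OF M] by metis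
qed

text \<open>Multiplication by \<open>z\<close> on a nonzero finitely generated subgroup is given by
  an integer matrix. Integrality of sums, of products and of multiples by a denominator is
  established in this form.\<close>

lemma algebraic_int_if_int_span:
  fixes z :: "'a::field_char_0"
  assumes fin: "finite B" and nz: "b0 \<in> B" "b0 \<noteq> 0"
    and stable: "\<And>b. b \<in> B \<Longrightarrow> z * b \<in> int_module.span B"
  shows "algebraic_int z"
proof -
  obtain e n where e: "bij_betw e {..<n::nat} B"
    using ex_bij_betw_nat_finite[OF fin] by (metis atLeast0LessThan)
  have "\<exists>u. z * b = (\<Sum>a\<in>B. of_int (u a) * a)" if "b \<in> B" for b
    using stable[OF that] unfolding int_module.span_finite[OF fin] by auto
  then obtain u where u: "\<And>b. b \<in> B \<Longrightarrow> z * b = (\<Sum>a\<in>B. of_int (u b a) * a)" by metis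
  obtain k where "k < n" "e k = b0" using e nz(1) by (metis bij_betw_iff_bijections lessThan_iff)
  moreover have "z * e i = (\<Sum>j<n. of_int (u (e i) (e j)) * e j)" if "i < n" for i
    using u[of "e i"] e that
    by (subst sum.reindex_bij_betw[OF e, where g="\<lambda>a. of_int (u (e i) a) * a"]) (auto simp: bij_betw_def)
  ultimately show ?thesis
    using algebraic_int_if_int_matrix[of n z e "\<lambda>i j. u (e i) (e j)" k] nz by auto
qed

lemma int_span_mult_right:
  fixes w :: "'a::field_char_0"
  assumes "u \<in> int_module.span A"
  shows "u * w \<in> int_module.span ((\<lambda>a. a * w) ` A)"
  using assms
proof (induction rule: int_module.span_induct_alt)
  case base
  show ?case by (simp add: int_module.span_zero)
next
  case (step c x y)
  have "of_int c * (x * w) + y * w \<in> int_module.span ((\<lambda>a. a * w) ` A)"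
    by (intro int_module.span_add int_module.span_scale int_module.span_base step) (use step in auto)
  then show ?case by (simp add: algebra_simps)
qed

lemma algebraic_int_power_in_span:
  fixes x :: "'a::field_char_0"
  assumes "algebraic_int x"
  shows "\<exists>n>0. x ^ n \<in> int_module.span ((\<lambda>i. x ^ i) ` {..<n})"
proof -
  from assms obtain p :: "int poly" where p: "Polynomial.lead_coeff p = 1" "poly (map_poly of_int p) x = 0"
    unfolding algebraic_int_altdef_ipoly by auto
  define n where "n = Polynomial.degree p"
  \<comment> \<open>A monic constant polynomial is 1 and has no root.\<close>
  have "n > 0"
  proof (rule ccontr)
    assume "\<not> n > 0"
    then have "p = 1" using p(1) unfolding n_def
      by (metis bot_nat_0.not_eq_extremum degree_eq_zeroE lead_coeff_pCons(2) one_pCons)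
    with p(2) show False by simp
  qed
  have "0 = (\<Sum>i\<le>n. of_int (Polynomial.coeff p i) * x ^ i)"
    using p(2) by (simp add: poly_altdef n_def)
  also have "\<dots> = (\<Sum>i<n. of_int (Polynomial.coeff p i) * x ^ i) + x ^ n"
    using p(1) by (simp add: n_def lessThan_Suc_atMost[symmetric])
  finally have "x ^ n = - (\<Sum>i<n. of_int (Polynomial.coeff p i) * x ^ i)" by (simp add: add_eq_0_iff)
  also have "\<dots> \<in> int_module.span ((\<lambda>i. x ^ i) ` {..<n})"
    by (intro int_module.span_neg int_module.span_sum int_module.span_scale int_module.span_base) auto
  finally show ?thesis using \<open>n > 0\<close> by blast
qed

text \<open>The monomials \<open>x ^ i * y ^ j\<close> with \<open>i < n\<close> and
  \<open>j < m\<close> span a subgroup that is stable under \<open>x\<close> and under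
  \<open>y\<close>: powers that leave the range are folded back by the two monic relations.\<close>

lemma
  fixes x y :: "'a::field_char_0"
  assumes x: "algebraic_int x" and y: "algebraic_int y"
  shows algebraic_int_add: "algebraic_int (x + y)"
    and algebraic_int_mult: "algebraic_int (x * y)"
proof -
  obtain n m where n: "n > 0" "x ^ n \<in> int_module.span ((\<lambda>i. x ^ i) ` {..<n})"
    and m: "m > 0" "y ^ m \<in> int_module.span ((\<lambda>i. y ^ i) ` {..<m})"
    using algebraic_int_power_in_span x y by blast
  define B where "B = (\<lambda>(i, j). x ^ i * y ^ j) ` ({..<n} \<times> {..<m})"
  have B: "x ^ i * y ^ j \<in> B" if "i < n" "j < m" for i j using that unfolding B_def by force
  have fin: "finite B" unfolding B_def by simp
  have one: "1 \<in> B" using B[of 0 0] n m by simp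
  have X: "x * b \<in> int_module.span B" if "b \<in> B" for b
  proof -
    obtain i j where ij: "i < n" "j < m" "b = x ^ i * y ^ j" using \<open>b \<in> B\<close> B_def by auto
    show ?thesis
    proof (cases "Suc i < n")
      case True
      then have "x * b \<in> B" using B[of "Suc i" j] ij by (simp add: algebra_simps)
      then show ?thesis by (rule int_module.span_base)
    next
      case False
      then have "x * b = x ^ n * y ^ j" using ij by (metis Suc_lessI mult.assoc power_Suc)
      also have "\<dots> \<in> int_module.span ((\<lambda>a. a * y ^ j) ` (\<lambda>i. x ^ i) ` {..<n})"
        by (rule int_span_mult_right[OF n(2)])
      also have "\<dots> \<subseteq> int_module.span B"
        by (rule int_module.span_mono) (use B ij in auto)
      finally show ?thesis .
    qed
  qed
  have Y: "y * b \<in> int_module.span B" if "b \<in> B" for b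
  proof -
    obtain i j where ij: "i < n" "j < m" "b = x ^ i * y ^ j" using \<open>b \<in> B\<close> B_def by auto
    show ?thesis
    proof (cases "Suc j < m")
      case True
      then have "y * b \<in> B" using B[of i "Suc j"] ij by (simp add: algebra_simps)
      then show ?thesis by (rule int_module.span_base)
    next
      case False
      then have "y * b = y ^ m * x ^ i" using ij by (metis Suc_lessI mult.assoc mult.commute power_Suc)
      also have "\<dots> \<in> int_module.span ((\<lambda>a. a * x ^ i) ` (\<lambda>i. y ^ i) ` {..<m})"
        by (rule int_span_mult_right[OF m(2)])
      also have "\<dots> \<subseteq> int_module.span B"
        by (rule int_module.span_mono) (use B ij in \<open>auto simp: mult.commute\<close>)
      finally show ?thesis .
    qed
  qed
  show "algebraic_int (x + y)"
    by (rule algebraic_int_if_int_span[OF fin one])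
      (auto simp: distrib_right intro: int_module.span_add X Y)
  show "algebraic_int (x * y)"
  proof (rule algebraic_int_if_int_span[OF fin one])
    fix b assume "b \<in> B"
    \<comment> \<open>Multiplying \<open>b\<close> by \<open>y\<close> lands in the span of
      \<open>B\<close>; multiplying the result by \<open>x\<close> lands in the span of the products
      \<open>x * b\<close>, which lies in the span of \<open>B\<close> again.\<close>
    from Y[OF this] have "y * b * x \<in> int_module.span ((\<lambda>a. a * x) ` B)" by (rule int_span_mult_right)
    also have "\<dots> \<subseteq> int_module.span B"
      by (rule int_module.span_minimal) (use X int_module.subspace_span in \<open>auto simp: mult.commute[of _ x]\<close>)
    finally show "x * y * b \<in> int_module.span B" by (simp add: algebra_simps)
  qed simp
qed

lemma algebraic_int_diff:
  "algebraic_int (x::'a::field_char_0) \<Longrightarrow> algebraic_int y \<Longrightarrow> algebraic_int (x - y)"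
  using algebraic_int_add[of x "- y"] by simp

lemma algebraic_int_of_nat [simp]: "algebraic_int (of_nat n :: 'a::field_char_0)"
  by (simp add: int_imp_algebraic_int)

lemma algebraic_int_1 [simp]: "algebraic_int (1 :: 'a::field_char_0)"
  using algebraic_int_of_nat[of 1] by (simp del: algebraic_int_of_nat)

lemma algebraic_int_power: "algebraic_int (x::'a::field_char_0) \<Longrightarrow> algebraic_int (x ^ n)"
  by (induction n) (auto intro: algebraic_int_mult)

lemma algebraic_int_sum:
  "(\<And>i. i \<in> A \<Longrightarrow> algebraic_int (f i :: 'a::field_char_0)) \<Longrightarrow> algebraic_int (sum f A)"
  by (induction A rule: infinite_finite_induct) (auto intro: algebraic_int_add)

lemma algebraic_int_prod:
  "(\<And>i. i \<in> A \<Longrightarrow> algebraic_int (f i :: 'a::field_char_0)) \<Longrightarrow> algebraic_int (prod f A)"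
  by (induction A rule: infinite_finite_induct) (auto intro: algebraic_int_mult)

section \<open>Denominators in a number field\<close>

interpretation rat_module: Vector_Spaces.vector_space "\<lambda>q (x::'a::field_char_0). of_rat q * x"
  by unfold_locales (auto simp: algebra_simps of_rat_add of_rat_mult)

lemma rat_common_denominator:
  assumes "finite S"
  shows "\<exists>n>0::nat. \<forall>q\<in>S. \<exists>m::int. of_nat n * (q::rat) = of_int m"
  using assms
proof (induction S rule: finite_induct)
  case empty
  show ?case by (auto intro: exI[of _ 1])
next
  case (insert q S)
  then obtain n where n: "n > 0" "\<forall>q\<in>S. \<exists>m::int. of_nat n * (q::rat) = of_int m" by auto
  obtain a b where ab: "quotient_of q = (a, b)" by force
  have b: "b > 0" and q: "q = of_int a / of_int b"
    using quotient_of_denom_pos[OF ab] quotient_of_div[OF ab] by auto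
  show ?case
  proof (rule exI[of _ "nat b * n"], intro conjI ballI)
    show "0 < nat b * n" using b n by simp
    fix r assume "r \<in> insert q S"
    then consider "r = q" | "r \<in> S" by blast
    then show "\<exists>m::int. of_nat (nat b * n) * r = of_int m"
    proof cases
      case 1
      then have "of_nat (nat b * n) * r = of_int (a * int n)" using b by (simp add: q)
      then show ?thesis by blast
    next
      case 2
      then obtain m where "of_nat n * r = of_int m" using n by blast
      then have "of_nat (nat b * n) * r = of_int (b * m)" using b by simp
      then show ?thesis by blast
    qed
  qed
qed

text \<open>The parameter is a dummy that carries the type \<open>'k\<close>.\<close>

locale number_field_type =
  fixes K :: "'k::field_char_0 itself"
  assumes number_field_K: "number_field TYPE('k)"
begin

text \<open>Only a finite spanning set over the rationals: coordinates exist but need not be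
  unique.\<close>

definition basis :: "'k set" where
  "basis = (SOME B. finite B \<and> rat_module.span B = UNIV)"

lemma finite_basis: "finite basis" and span_basis: "rat_module.span basis = UNIV"
  using number_field_K someI_ex[of "\<lambda>B::'k set. finite B \<and> rat_module.span B = UNIV"]
  unfolding number_field_def basis_def by auto

lemma basis_expansion: "\<exists>u. (x::'k) = (\<Sum>b\<in>basis. of_rat (u b) * b)"
proof -
  have "x \<in> rat_module.span basis" by (simp add: span_basis)
  then show ?thesis unfolding rat_module.span_finite[OF finite_basis] by auto
qed

text \<open>Multiplication by \<open>x\<close> is given on the spanning set by a rational matrix; a
  common denominator of its entries makes the integer span stable.\<close>

lemma exists_nat_mult_algebraic_int: "\<exists>n>0. algebraic_int (of_nat n * (x::'k))"
proof -
  obtain u where u: "\<And>a. x * a = (\<Sum>b\<in>basis. of_rat (u a b) * b)"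
    using basis_expansion by metis
  obtain n where n: "n > 0" "\<forall>q\<in>(\<lambda>(a, b). u a b) ` (basis \<times> basis). \<exists>m::int. of_nat n * q = of_int m"
    using rat_common_denominator[of "(\<lambda>(a, b). u a b) ` (basis \<times> basis)"] finite_basis by blast
  obtain b0 where b0: "b0 \<in> basis" "b0 \<noteq> 0"
  proof (rule ccontr)
    assume "\<not> thesis"
    then have "1 = (0::'k)" using basis_expansion[of 1] that by (metis (no_types, lifting) mult_zero_right sum.neutral)
    then show False by simp
  qed
  have "algebraic_int (of_nat n * x)"
  proof (rule algebraic_int_if_int_span[OF finite_basis b0])
    fix a assume a: "a \<in> basis"
    have "of_nat n * (of_rat (u a b) * b) \<in> int_module.span basis" if b: "b \<in> basis" for b
    proof -
      obtain m where m: "of_nat n * u a b = of_int m" using n a b by blast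
      have "of_nat n * (of_rat (u a b) * b) = of_rat (of_nat n * u a b) * b"
        by (simp add: of_rat_mult)
      also have "\<dots> = of_int m * b" by (simp add: m)
      finally show ?thesis using int_module.span_scale[OF int_module.span_base[OF b]] by metis
    qed
    then show "of_nat n * x * a \<in> int_module.span basis"
      by (simp add: mult.assoc u sum_distrib_left int_module.span_sum)
  qed
  with n show ?thesis by blast
qed

end

section \<open>Extension of embeddings into the complex numbers\<close>

hide_const (open) Polynomials.lead_coeff Polynomials.degree up_ring.coeff up_ring.monom Coset.order module.smult

text \<open>Subfields are treated as sets inside the one type \<open>'k\<close>, so polynomials over
  a subfield are polynomials over \<open>'k\<close> with restricted coefficients.\<close>

definition poly_over :: "'a::comm_ring_1 set \<Rightarrow> 'a poly set" where
  "poly_over F = {f. \<forall>i. coeff f i \<in> F}"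

text \<open>In a number field such a set is automatically a subfield, by
  \<open>rat_subalgebra_inverse\<close>.\<close>

locale rat_subalgebra =
  fixes F :: "'k::field_char_0 set"
  assumes rat: "of_rat q \<in> F"
    and add: "x \<in> F \<Longrightarrow> y \<in> F \<Longrightarrow> x + y \<in> F"
    and mult: "x \<in> F \<Longrightarrow> y \<in> F \<Longrightarrow> x * y \<in> F"
begin

lemma zero: "0 \<in> F" and one: "1 \<in> F" and int: "of_int n \<in> F"
  using rat[of 0] rat[of 1] rat[of "of_int n"] by simp_all

lemma Ints_sub: "x \<in> \<int> \<Longrightarrow> x \<in> F"
  by (auto elim: Ints_cases simp: int)

lemma neg: "x \<in> F \<Longrightarrow> - x \<in> F"
  using mult[of "of_int (-1)" x] int[of "-1"] by simp

lemma diff: "x \<in> F \<Longrightarrow> y \<in> F \<Longrightarrow> x - y \<in> F"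
  using add[of x "- y"] neg by simp

lemma sum: "(\<And>i. i \<in> A \<Longrightarrow> f i \<in> F) \<Longrightarrow> sum f A \<in> F"
  by (induction A rule: infinite_finite_induct) (auto simp: zero add)

lemma pow: "x \<in> F \<Longrightarrow> x ^ n \<in> F"
  by (induction n) (auto simp: one mult)

lemma poly_over_0: "0 \<in> poly_over F"
  and poly_over_add: "f \<in> poly_over F \<Longrightarrow> g \<in> poly_over F \<Longrightarrow> f + g \<in> poly_over F"
  and poly_over_diff: "f \<in> poly_over F \<Longrightarrow> g \<in> poly_over F \<Longrightarrow> f - g \<in> poly_over F"
  and poly_over_mult: "f \<in> poly_over F \<Longrightarrow> g \<in> poly_over F \<Longrightarrow> f * g \<in> poly_over F"
  and poly_over_monom: "c \<in> F \<Longrightarrow> monom c n \<in> poly_over F"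
  and poly_over_pCons: "c \<in> F \<Longrightarrow> f \<in> poly_over F \<Longrightarrow> pCons c f \<in> poly_over F"
  by (auto simp: poly_over_def zero add diff coeff_mult mult sum coeff_pCons split: nat.splits)

lemma poly_in: "f \<in> poly_over F \<Longrightarrow> x \<in> F \<Longrightarrow> poly f x \<in> F"
  unfolding poly_altdef by (intro sum mult pow) (auto simp: poly_over_def)

text \<open>Long division by a monic polynomial keeps all coefficients in \<open>F\<close>, which
  division over the field type would not show. The induction measure is 0 for the zero polynomial
  and one more than the degree otherwise, since nonzero constants also have degree 0.\<close>

lemma poly_over_division:
  assumes m: "m \<in> poly_over F" "lead_coeff m = 1"
  shows "f \<in> poly_over F \<Longrightarrow>
    \<exists>q\<in>poly_over F. \<exists>r\<in>poly_over F. f = q * m + r \<and> (r = 0 \<or> degree r < degree m)"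
proof (induction "if f = 0 then 0 else Suc (degree f)" arbitrary: f rule: less_induct)
  case less
  show ?case
  proof (cases "f = 0 \<or> degree f < degree m")
    case True
    then show ?thesis using less.prems poly_over_0
      by (intro bexI[of _ 0] bexI[of _ f]) simp_all
  next
    case False
    define t where "t = monom (lead_coeff f) (degree f - degree m)"
    define g where "g = f - t * m"
    have t: "t \<in> poly_over F"
      unfolding t_def using less.prems by (intro poly_over_monom) (auto simp: poly_over_def)
    have g: "g \<in> poly_over F"
      unfolding g_def using t less.prems m by (intro poly_over_diff poly_over_mult)
    have "degree (t * m) \<le> degree f"
      using degree_mult_le[of t m] degree_monom_le[of "lead_coeff f" "degree f - degree m"] False
      by (auto simp: t_def)
    then have "degree g \<le> degree f" unfolding g_def by (simp add: degree_diff_le)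
    moreover have "coeff (t * m) (degree f) = lead_coeff f"
      using m False coeff_monom_mult[of "lead_coeff f" "degree f - degree m" m "degree f"] by (auto simp: t_def)
    then have "coeff g (degree f) = 0" by (simp add: g_def)
    ultimately have "g = 0 \<or> degree g < degree f" by (rule eq_zero_or_degree_less)
    then have "(if g = 0 then 0 else Suc (degree g)) < (if f = 0 then 0 else Suc (degree f))"
      using False by auto
    then obtain q r where "q \<in> poly_over F" "r \<in> poly_over F" "g = q * m + r" "r = 0 \<or> degree r < degree m"
      using less.hyps[of g] g by blast
    then show ?thesis
      by (intro bexI[of _ "q + t"] bexI[of _ r])
        (auto simp: g_def algebra_simps intro: poly_over_add t)
  qed
qed

end

text \<open>\<open>\<sigma>\<close> is a total function whose values outside \<open>F\<close> are
  arbitrary.\<close>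

locale partial_embedding = rat_subalgebra F for F :: "'k::field_char_0 set" +
  fixes \<sigma> :: "'k \<Rightarrow> complex"
  assumes \<sigma>_one: "\<sigma> 1 = 1"
    and \<sigma>_add: "x \<in> F \<Longrightarrow> y \<in> F \<Longrightarrow> \<sigma> (x + y) = \<sigma> x + \<sigma> y"
    and \<sigma>_mult: "x \<in> F \<Longrightarrow> y \<in> F \<Longrightarrow> \<sigma> (x * y) = \<sigma> x * \<sigma> y"
begin

lemma \<sigma>_zero: "\<sigma> 0 = 0"
  using \<sigma>_add[OF zero zero] by simp

lemma \<sigma>_sum: "(\<And>i. i \<in> A \<Longrightarrow> f i \<in> F) \<Longrightarrow> \<sigma> (sum f A) = (\<Sum>i\<in>A. \<sigma> (f i))"
  by (induction A rule: infinite_finite_induct) (auto simp: \<sigma>_zero \<sigma>_add sum)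

lemma coeff_map_\<sigma>: "coeff (map_poly \<sigma> f) i = \<sigma> (coeff f i)"
  by (simp add: coeff_map_poly \<sigma>_zero)

lemma map_\<sigma>_pCons: "map_poly \<sigma> (pCons c f) = pCons (\<sigma> c) (map_poly \<sigma> f)"
  by (rule poly_eqI) (auto simp: coeff_map_\<sigma> coeff_pCons split: nat.splits)

lemma map_\<sigma>_add:
  "f \<in> poly_over F \<Longrightarrow> g \<in> poly_over F \<Longrightarrow> map_poly \<sigma> (f + g) = map_poly \<sigma> f + map_poly \<sigma> g"
  by (rule poly_eqI) (auto simp: coeff_map_\<sigma> \<sigma>_add poly_over_def)

lemma map_\<sigma>_mult:
  "f \<in> poly_over F \<Longrightarrow> g \<in> poly_over F \<Longrightarrow> map_poly \<sigma> (f * g) = map_poly \<sigma> f * map_poly \<sigma> g"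
  by (rule poly_eqI) (auto simp: coeff_map_\<sigma> coeff_mult \<sigma>_sum \<sigma>_mult mult poly_over_def)

end

text \<open>Characterized by least degree rather than by irreducibility, because it is used by
  comparing degrees of remainders.\<close>

definition min_poly_over :: "'a::field set \<Rightarrow> 'a \<Rightarrow> 'a poly \<Rightarrow> bool" where
  "min_poly_over F b m \<longleftrightarrow> m \<in> poly_over F \<and> lead_coeff m = 1 \<and> poly m b = 0 \<and>
     (\<forall>f\<in>poly_over F. poly f b = 0 \<longrightarrow> f = 0 \<or> degree m \<le> degree f)"

context number_field_type
begin

text \<open>Substitute \<open>n X\<close> into a monic integer equation of
  \<open>n x\<close>.\<close>

lemma exists_int_poly: "\<exists>p::'k poly. p \<noteq> 0 \<and> (\<forall>i. coeff p i \<in> \<int>) \<and> poly p x = 0"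
proof -
  obtain n where n: "n > 0" "algebraic_int (of_nat n * x)"
    using exists_nat_mult_algebraic_int by blast
  then obtain p where p: "lead_coeff p = 1" "\<forall>i. coeff p i \<in> \<int>" "poly p (of_nat n * x) = 0"
    by (auto simp: algebraic_int.simps)
  show ?thesis
  proof (intro exI conjI allI)
    show "pcompose p [:0, of_nat n:] \<noteq> 0"
    proof
      assume "pcompose p [:0, of_nat n:] = 0"
      then have "coeff (pcompose p [:0, of_nat n:]) (degree p) = 0" by simp
      then show False using p(1) n(1) by (simp add: coeff_pcompose_linear)
    qed
    show "coeff (pcompose p [:0, of_nat n:]) i \<in> \<int>" for i
      using p(2) by (simp add: coeff_pcompose_linear)
    show "poly (pcompose p [:0, of_nat n:]) x = 0"
      using p(3) by (simp add: poly_pcompose mult.commute)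
  qed
qed

text \<open>In an integer equation of least degree the constant term \<open>c\<close> is nonzero,
  since otherwise a factor \<open>X\<close> could be cancelled. Then \<open>c + x q(x) = 0\<close>
  exhibits the inverse of \<open>x\<close> as \<open>- q(x) / c\<close>.\<close>

lemma rat_subalgebra_inverse:
  assumes "rat_subalgebra F" "x \<in> F"
  shows "inverse (x::'k) \<in> F"
proof (cases "x = 0")
  case True
  then show ?thesis using assms by simp
next
  case False
  interpret rat_subalgebra F by fact
  obtain p :: "'k poly" where p: "p \<noteq> 0" "\<forall>i. coeff p i \<in> \<int>" "poly p x = 0"
    and min: "\<And>q::'k poly. q \<noteq> 0 \<and> (\<forall>i. coeff q i \<in> \<int>) \<and> poly q x = 0 \<Longrightarrow> degree p \<le> degree q"
    using ex_has_least_nat[of "\<lambda>p. p \<noteq> 0 \<and> (\<forall>i. coeff p i \<in> \<int>) \<and> poly p x = 0" _ degree]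
      exists_int_poly by metis
  obtain c q where cq: "p = pCons c q" by (cases p) auto
  have q: "coeff q i \<in> \<int>" for i using p(2) by (metis cq coeff_pCons_Suc)
  have "c \<noteq> 0"
  proof
    assume "c = 0"
    then have "poly q x = 0" "q \<noteq> 0" using p False by (auto simp: cq)
    with min[of q] q show False by (simp add: cq \<open>c = 0\<close>)
  qed
  obtain n where n: "c = of_int n" using p(2) by (metis cq coeff_pCons_0 Ints_cases)
  have "q \<in> poly_over F" unfolding poly_over_def using q Ints_sub by auto
  then have Q: "poly q x \<in> F" by (rule poly_in) fact
  have "c + x * poly q x = 0" using p(3) by (simp add: cq)
  then have "inverse x = - (inverse c * poly q x)"
    using False \<open>c \<noteq> 0\<close> by (simp add: field_simps add_eq_0_iff)
  also have "inverse c = of_rat (inverse (of_int n))" by (simp add: n of_rat_inverse)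
  finally have "inverse x = - (of_rat (inverse (of_int n)) * poly q x)" .
  then show ?thesis using neg mult rat Q by metis
qed

lemma exists_min_poly:
  assumes "rat_subalgebra F"
  shows "\<exists>m. min_poly_over F (b::'k) m"
proof -
  interpret rat_subalgebra F by fact
  obtain p0 :: "'k poly" where p0: "p0 \<noteq> 0" "\<forall>i. coeff p0 i \<in> \<int>" "poly p0 b = 0"
    using exists_int_poly by blast
  then have "p0 \<noteq> 0 \<and> p0 \<in> poly_over F \<and> poly p0 b = 0"
    using Ints_sub by (auto simp: poly_over_def)
  then obtain p where p: "p \<noteq> 0" "p \<in> poly_over F" "poly p b = 0"
    and min: "\<And>q. q \<noteq> 0 \<and> q \<in> poly_over F \<and> poly q b = 0 \<Longrightarrow> degree p \<le> degree q"
    using ex_has_least_nat[of "\<lambda>p. p \<noteq> 0 \<and> p \<in> poly_over F \<and> poly p b = 0" _ degree] by metis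
  have "min_poly_over F b (smult (inverse (lead_coeff p)) p)"
    unfolding min_poly_over_def
  proof (intro conjI ballI impI)
    have "inverse (lead_coeff p) \<in> F"
      by (rule rat_subalgebra_inverse[OF assms]) (use p in \<open>auto simp: poly_over_def\<close>)
    then show "smult (inverse (lead_coeff p)) p \<in> poly_over F"
      using p by (auto simp: poly_over_def mult)
    fix f assume "f \<in> poly_over F" "poly f b = 0"
    then show "f = 0 \<or> degree (smult (inverse (lead_coeff p)) p) \<le> degree f"
      using min[of f] p by auto
  qed (use p in auto)
  then show ?thesis by blast
qed

text \<open>\<open>F'\<close> is \<open>F[b]\<close>, the image of evaluation at \<open>b\<close>.
  Two polynomials with the same value at \<open>b\<close> differ by a multiple of \<open>m\<close>,
  and the transported \<open>m\<close> vanishes at \<open>\<beta>\<close>; so sending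
  \<open>b\<close> to \<open>\<beta>\<close> is well defined.\<close>

lemma extend_partial_embedding:
  assumes pe: "partial_embedding F \<sigma>" and m: "min_poly_over F (b::'k) m"
    and \<beta>: "poly (map_poly \<sigma> m) \<beta> = 0"
  shows "\<exists>F' \<sigma>'. partial_embedding F' \<sigma>' \<and> F \<subseteq> F' \<and> b \<in> F' \<and> (\<forall>x\<in>F. \<sigma>' x = \<sigma> x) \<and> \<sigma>' b = \<beta>"
proof -
  interpret partial_embedding F \<sigma> by fact
  define F' where "F' = (\<lambda>f. poly f b) ` poly_over F"
  define \<sigma>' where "\<sigma>' x = poly (map_poly \<sigma> (SOME f. f \<in> poly_over F \<and> poly f b = x)) \<beta>" for x
  have wd: "poly (map_poly \<sigma> f) \<beta> = poly (map_poly \<sigma> g) \<beta>"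
    if fg: "f \<in> poly_over F" "g \<in> poly_over F" "poly f b = poly g b" for f g
  proof -
    have d: "f - g \<in> poly_over F" using fg by (intro poly_over_diff)
    obtain q r where qr: "q \<in> poly_over F" "r \<in> poly_over F" "f - g = q * m + r" "r = 0 \<or> degree r < degree m"
      using poly_over_division[OF _ _ d, of m] m unfolding min_poly_over_def by blast
    have "poly r b = poly (f - g) b - poly (q * m) b" unfolding qr(3) by simp
    also have "\<dots> = 0" using fg m by (simp add: min_poly_over_def)
    finally have "r = 0" using qr m by (auto simp: min_poly_over_def)
    then have f: "f = q * m + g" using qr by (simp add: algebra_simps)
    have "m \<in> poly_over F" using m by (simp add: min_poly_over_def)
    then show ?thesis unfolding f using \<beta> qr fg
      by (simp add: map_\<sigma>_add map_\<sigma>_mult poly_over_mult)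
  qed
  have \<sigma>': "\<sigma>' (poly f b) = poly (map_poly \<sigma> f) \<beta>" if "f \<in> poly_over F" for f
  proof -
    have "\<exists>g. g \<in> poly_over F \<and> poly g b = poly f b" using that by blast
    from someI_ex[OF this] show ?thesis
      unfolding \<sigma>'_def using wd that by blast
  qed
  have const: "[:x:] \<in> poly_over F" if "x \<in> F" for x
    using that by (auto simp: poly_over_def zero coeff_pCons split: nat.splits)
  have sub: "F \<subseteq> F'" unfolding F'_def using const by force
  have ag: "\<sigma>' x = \<sigma> x" if "x \<in> F" for x
    using \<sigma>'[OF const[OF that]] by (simp add: map_\<sigma>_pCons)
  have X: "[:0, 1:] \<in> poly_over F"
    by (intro poly_over_pCons zero one poly_over_0)
  have pe': "partial_embedding F' \<sigma>'"
  proof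
    show "of_rat q \<in> F'" for q using rat sub by blast
    show "\<sigma>' 1 = 1" using ag[OF one] \<sigma>_one by simp
    fix x y assume "x \<in> F'" "y \<in> F'"
    then obtain f g where fg: "f \<in> poly_over F" "x = poly f b" "g \<in> poly_over F" "y = poly g b"
      unfolding F'_def by auto
    show "x + y \<in> F'" unfolding F'_def fg by (rule image_eqI[of _ _ "f + g"]) (use fg in \<open>auto intro: poly_over_add\<close>)
    show "x * y \<in> F'" unfolding F'_def fg by (rule image_eqI[of _ _ "f * g"]) (use fg in \<open>auto intro: poly_over_mult\<close>)
    show "\<sigma>' (x + y) = \<sigma>' x + \<sigma>' y"
      using fg \<sigma>'[OF poly_over_add[of f g]] by (simp add: \<sigma>' map_\<sigma>_add)
    show "\<sigma>' (x * y) = \<sigma>' x * \<sigma>' y"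
      using fg \<sigma>'[OF poly_over_mult[of f g]] by (simp add: \<sigma>' map_\<sigma>_mult)
  qed
  have "b = poly [:0, 1:] b" by simp
  then have "b \<in> F'" unfolding F'_def using X by blast
  moreover have "\<sigma>' b = \<beta>" using \<sigma>'[OF X] by (simp add: map_\<sigma>_pCons \<sigma>_zero \<sigma>_one)
  ultimately show ?thesis using pe' sub ag by blast
qed

definition embeddings :: "('k \<Rightarrow> complex) set" where
  "embeddings = {\<sigma>. \<sigma> 1 = 1 \<and> (\<forall>x y. \<sigma> (x + y) = \<sigma> x + \<sigma> y) \<and> (\<forall>x y. \<sigma> (x * y) = \<sigma> x * \<sigma> y)}"

text \<open>The elements of the spanning set are adjoined one after another; each time the
  transported minimal polynomial is nonconstant and so has a complex root.\<close>

lemma extend_embedding: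
  assumes "partial_embedding (F::'k set) \<sigma>"
  shows "\<exists>\<tau>\<in>embeddings. \<forall>x\<in>F. \<tau> x = \<sigma> x"
proof -
  have step: "\<exists>F' \<sigma>'. partial_embedding F' \<sigma>' \<and> F \<subseteq> F' \<and> B \<subseteq> F' \<and> (\<forall>x\<in>F. \<sigma>' x = \<sigma> x)"
    if "finite B" for B
    using that
  proof (induction B rule: finite_induct)
    case empty
    show ?case using assms by blast
  next
    case (insert b B)
    then obtain F' \<sigma>' where *: "partial_embedding F' \<sigma>'" "F \<subseteq> F'" "B \<subseteq> F'" "\<forall>x\<in>F. \<sigma>' x = \<sigma> x"
      by blast
    interpret partial_embedding F' \<sigma>' by (fact *(1))
    obtain m where m: "min_poly_over F' b m"
      using exists_min_poly rat_subalgebra_axioms by blast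
    have "degree m \<noteq> 0"
    proof
      assume "degree m = 0"
      then have "m = 1" using m unfolding min_poly_over_def
        by (metis degree_eq_zeroE lead_coeff_pCons(2) one_pCons)
      then show False using m by (simp add: min_poly_over_def)
    qed
    moreover have "degree (map_poly \<sigma>' m) = degree m"
      using m \<sigma>_one by (intro map_poly_degree_eq) (auto simp: min_poly_over_def)
    ultimately obtain \<beta> where "poly (map_poly \<sigma>' m) \<beta> = 0"
      using fundamental_theorem_of_algebra constant_degree by metis
    from extend_partial_embedding[OF *(1) m this] show ?case
      using * by (metis insert_subset subset_trans subsetD)
  qed
  from step[OF finite_basis] obtain F' \<sigma>' where
    *: "partial_embedding F' \<sigma>'" "F \<subseteq> F'" "basis \<subseteq> F'" "\<forall>x\<in>F. \<sigma>' x = \<sigma> x" by blast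
  interpret partial_embedding F' \<sigma>' by (fact *(1))
  have "x \<in> F'" for x
  proof -
    obtain u where u: "x = (\<Sum>b\<in>basis. of_rat (u b) * b)" using basis_expansion by blast
    show ?thesis unfolding u by (intro sum mult rat) (use *(3) in auto)
  qed
  then have "\<sigma>' \<in> embeddings" by (auto simp: embeddings_def \<sigma>_one \<sigma>_add \<sigma>_mult)
  then show ?thesis using *(4) by blast
qed

text \<open>The only embedding of the rationals, from which extensions start. Off the rationals its
  value is unspecified.\<close>

definition rat_embed :: "'k \<Rightarrow> complex" where
  "rat_embed x = of_rat (THE q. x = of_rat q)"

lemma rat_embed [simp]: "rat_embed (of_rat q) = of_rat q"
  by (simp add: rat_embed_def)

lemma partial_embedding_Rats: "partial_embedding \<rat> rat_embed"
proof
  show "rat_embed 1 = 1" using rat_embed[of 1] by (metis of_rat_1)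
  fix x y :: 'k
  assume "x \<in> \<rat>" "y \<in> \<rat>"
  then obtain p q where "x = of_rat p" "y = of_rat q" by (auto elim!: Rats_cases)
  then show "rat_embed (x + y) = rat_embed x + rat_embed y" "rat_embed (x * y) = rat_embed x * rat_embed y"
    using rat_embed[of "p + q"] rat_embed[of "p * q"] by (simp_all only: of_rat_add of_rat_mult rat_embed)
qed (auto intro: Rats_add Rats_mult)

lemma embeddings_hom:
  assumes "\<sigma> \<in> embeddings"
  shows "\<sigma> 1 = 1" "\<sigma> (x + y) = \<sigma> x + \<sigma> y" "\<sigma> (x * y) = \<sigma> x * \<sigma> y"
    "\<sigma> 0 = 0" "\<sigma> (- x) = - \<sigma> x" "\<sigma> (x - y) = \<sigma> x - \<sigma> y"
    "\<sigma> (of_nat n) = of_nat n" "\<sigma> x = 0 \<longleftrightarrow> x = 0" "\<sigma> (x ^ n) = \<sigma> x ^ n"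
    "\<sigma> (inverse x) = inverse (\<sigma> x)" "\<sigma> (of_int i) = of_int i" "\<sigma> (of_rat q) = of_rat q"
proof -
  have 1: "\<sigma> 1 = 1" and a: "\<And>x y. \<sigma> (x + y) = \<sigma> x + \<sigma> y" and m: "\<And>x y. \<sigma> (x * y) = \<sigma> x * \<sigma> y"
    using assms by (auto simp: embeddings_def)
  have z: "\<sigma> 0 = 0" using a[of 0 0] by simp
  have neg: "\<sigma> (- x) = - \<sigma> x" for x using a[of "- x" x] z by (simp add: add_eq_0_iff2)
  have n: "\<sigma> (of_nat n) = of_nat n" for n by (induction n) (auto simp: z 1 a)
  have i: "\<sigma> (of_int i) = of_int i" for i by (cases i rule: int_cases2) (auto simp: n neg)
  have z': "\<sigma> x = 0 \<longleftrightarrow> x = 0" for x using m[of x "inverse x"] 1 z by (cases "x = 0") auto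
  have inv: "\<sigma> (inverse x) = inverse (\<sigma> x)" for x
  proof (cases "x = 0")
    case False
    then have "\<sigma> x * \<sigma> (inverse x) = 1" using m[of x "inverse x"] 1 by simp
    then show ?thesis by (metis inverse_unique)
  qed (simp add: z)
  obtain c d where q: "q = of_int c / of_int d" by (metis quotient_of_div surj_pair)
  have r: "\<sigma> (of_rat q) = of_rat q"
    by (simp only: q of_rat_mult of_rat_inverse of_rat_of_int_eq divide_inverse m i inv)
  have p: "\<sigma> (x ^ n) = \<sigma> x ^ n" by (induction n) (auto simp: 1 m)
  have d: "\<sigma> (x - y) = \<sigma> x - \<sigma> y" using a[of x "- y"] neg by simp
  show "\<sigma> 1 = 1" "\<sigma> (x + y) = \<sigma> x + \<sigma> y" "\<sigma> (x * y) = \<sigma> x * \<sigma> y"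
    "\<sigma> 0 = 0" "\<sigma> (- x) = - \<sigma> x" "\<sigma> (x - y) = \<sigma> x - \<sigma> y"
    "\<sigma> (of_nat n) = of_nat n" "\<sigma> x = 0 \<longleftrightarrow> x = 0" "\<sigma> (x ^ n) = \<sigma> x ^ n"
    "\<sigma> (inverse x) = inverse (\<sigma> x)" "\<sigma> (of_int i) = of_int i" "\<sigma> (of_rat q) = of_rat q"
    by (fact 1, fact a, fact m, fact z, fact neg, fact d, fact n, fact z', fact p, fact inv, fact i, fact r)
qed

lemma embeddings_nonempty: "embeddings \<noteq> {}"
  using extend_embedding[OF partial_embedding_Rats] by blast

lemma embedding_int_poly:
  assumes \<sigma>: "\<sigma> \<in> embeddings" and p: "\<And>i. coeff p i \<in> \<int>"
  shows "\<sigma> (poly p x) = poly (map_poly \<sigma> p) (\<sigma> x)" "coeff (map_poly \<sigma> p) i \<in> \<int>"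
proof -
  note h = embeddings_hom[OF \<sigma>]
  show "\<sigma> (poly p x) = poly (map_poly \<sigma> p) (\<sigma> x)"
    by (induction p) (auto simp: h map_poly_pCons)
  obtain n where "coeff p i = of_int n" using p[of i] by (auto elim: Ints_cases)
  then show "coeff (map_poly \<sigma> p) i \<in> \<int>" by (simp add: coeff_map_poly h)
qed

lemma embedding_algebraic_int:
  assumes \<sigma>: "\<sigma> \<in> embeddings" and x: "algebraic_int x"
  shows "algebraic_int (\<sigma> x)"
proof -
  from x obtain p where p: "lead_coeff p = 1" "\<forall>i. coeff p i \<in> \<int>" "poly p x = 0"
    by (auto simp: algebraic_int.simps)
  note h = embeddings_hom[OF \<sigma>]
  show ?thesis
  proof (rule algebraic_int.intros)
    have "degree (map_poly \<sigma> p) = degree p" using p(1) h by (intro map_poly_degree_eq) auto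
    then show "lead_coeff (map_poly \<sigma> p) = 1" using p(1) h by (simp add: coeff_map_poly)
    show "\<forall>i. coeff (map_poly \<sigma> p) i \<in> \<int>" using embedding_int_poly[OF \<sigma>] p(2) by blast
    show "poly (map_poly \<sigma> p) (\<sigma> x) = 0" using embedding_int_poly(1)[OF \<sigma>, of p x] p h by auto
  qed
qed

text \<open>An embedding is determined by its values on the spanning set. Each value is a root of a
  nonzero complex polynomial that does not depend on the embedding, because integer coefficients are
  fixed.\<close>

lemma finite_embeddings: "finite embeddings"
proof -
  obtain p :: "'k \<Rightarrow> 'k poly" where
    p: "\<And>b. p b \<noteq> 0" "\<And>b i. coeff (p b) i \<in> \<int>" "\<And>b. poly (p b) b = 0"
    using exists_int_poly by metis
  define q where "q b = map_poly rat_embed (p b)" for b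
  have q: "map_poly \<sigma> (p b) = q b" if "\<sigma> \<in> embeddings" for \<sigma> b
  proof (rule poly_eqI)
    fix i
    obtain n where n: "coeff (p b) i = of_int n" using p(2) by (metis Ints_cases)
    have 1: "rat_embed (of_int n) = of_int n" for n using rat_embed[of "of_int n"] by simp
    have 2: "rat_embed 0 = 0" using rat_embed[of 0] by simp
    show "coeff (map_poly \<sigma> (p b)) i = coeff (q b) i"
      using embeddings_hom[OF that] by (simp add: q_def coeff_map_poly n 1 2)
  qed
  have "q b \<noteq> 0" for b
  proof -
    obtain \<sigma> where \<sigma>: "\<sigma> \<in> embeddings" using embeddings_nonempty by blast
    have "coeff (map_poly \<sigma> (p b)) (degree (p b)) \<noteq> 0"
      using p(1)[of b] embeddings_hom[OF \<sigma>] by (simp add: coeff_map_poly)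
    then show ?thesis using q[OF \<sigma>, of b] by auto
  qed
  then have fin: "finite (PiE basis (\<lambda>b. {z. poly (q b) z = 0}))"
    by (intro finite_PiE finite_basis) (auto simp: poly_roots_finite)
  show ?thesis
  proof (rule inj_on_finite[OF _ _ fin])
    show "inj_on (\<lambda>\<sigma>. restrict \<sigma> basis) embeddings"
    proof (intro inj_onI ext)
      fix \<sigma> \<tau> x assume \<sigma>: "\<sigma> \<in> embeddings" and \<tau>: "\<tau> \<in> embeddings"
        and eq: "restrict \<sigma> basis = restrict \<tau> basis"
      obtain u where u: "x = (\<Sum>b\<in>basis. of_rat (u b) * b)" using basis_expansion by blast
      have s: "\<rho> (Groups_Big.sum f basis) = (\<Sum>b\<in>basis. \<rho> (f b))" if "\<rho> \<in> embeddings" for \<rho> f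
        using finite_basis by (induction rule: finite_induct) (auto simp: embeddings_hom[OF that])
      show "\<sigma> x = \<tau> x"
        unfolding u s[OF \<sigma>] s[OF \<tau>]
      proof (rule sum.cong)
        fix b assume "b \<in> basis"
        then have "\<sigma> b = \<tau> b" using eq by (metis restrict_apply')
        then show "\<sigma> (of_rat (u b) * b) = \<tau> (of_rat (u b) * b)"
          by (simp add: embeddings_hom[OF \<sigma>] embeddings_hom[OF \<tau>])
      qed simp
    qed
    show "(\<lambda>\<sigma>. restrict \<sigma> basis) ` embeddings \<subseteq> PiE basis (\<lambda>b. {z. poly (q b) z = 0})"
    proof clarify
      fix \<sigma> assume \<sigma>: "\<sigma> \<in> embeddings"
      have "poly (q b) (\<sigma> b) = 0" for b
        using embedding_int_poly(1)[OF \<sigma>, of "p b" b] p q[OF \<sigma>] embeddings_hom[OF \<sigma>] by simp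
      then show "restrict \<sigma> basis \<in> PiE basis (\<lambda>b. {z. poly (q b) z = 0})" by simp
    qed
  qed
qed

text \<open>The product of the conjugates of an algebraic integer is a nonzero integer.\<close>

lemma exists_embedding_ge_1:
  assumes a: "algebraic_int a" "a \<noteq> 0"
  shows "\<exists>\<sigma>\<in>embeddings. 1 \<le> cmod (\<sigma> a)"
proof (rule ccontr)
  assume contra: "\<not> ?thesis"
  interpret partial_embedding \<rat> rat_embed by (rule partial_embedding_Rats)
  obtain m where m: "min_poly_over \<rat> a m" using exists_min_poly rat_subalgebra_axioms by blast
  define f where "f = map_poly rat_embed m"
  \<comment> \<open>Every complex root of the minimal polynomial is a conjugate of \<open>a\<close>:
    sending \<open>a\<close> to it extends to an embedding of the whole field.\<close>
  have root: "algebraic_int z \<and> cmod z < 1" if "poly f z = 0" for z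
  proof -
    obtain F \<sigma> where *: "partial_embedding F \<sigma>" "\<sigma> a = z" "a \<in> F"
      using extend_partial_embedding[OF partial_embedding_Rats m \<open>poly f z = 0\<close>[unfolded f_def]] by metis
    obtain \<tau> where "\<tau> \<in> embeddings" "\<tau> a = z" using extend_embedding[OF *(1)] * by blast
    then show ?thesis using contra embedding_algebraic_int[of \<tau> a] a(1) by (metis linorder_not_le)
  qed
  have lead: "lead_coeff f = 1" "degree f = degree m"
  proof -
    show "degree f = degree m" unfolding f_def
      using m \<sigma>_one by (intro map_poly_degree_eq) (auto simp: min_poly_over_def)
    then show "lead_coeff f = 1" using m \<sigma>_one by (simp add: f_def coeff_map_\<sigma> min_poly_over_def)
  qed
  obtain A where A: "size A = degree f" "f = smult (lead_coeff f) (\<Prod>x\<in>#A. [:-x, 1:])"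
    using alg_closed_imp_factorization[of f] lead(1) by (metis leading_coeff_0_iff zero_neq_one)
  then have f: "f = (\<Prod>x\<in>#A. [:-x, 1:])" using lead by simp
  have "poly f 0 = (\<Prod>x\<in>#A. - x)" unfolding f by (simp add: poly_prod_mset image_mset.compositionality o_def)
  moreover have "poly f x = 0" if "x \<in># A" for x
    unfolding f using that by (auto simp: poly_prod_mset intro!: image_eqI[of _ _ x])
  then have "algebraic_int x \<and> cmod x < 1" if "x \<in># A" for x using root that by blast
  \<comment> \<open>The bound by 1 is carried along for the empty product; strictness needs at least
    one factor.\<close>
  then have "algebraic_int (\<Prod>x\<in>#A. - x) \<and> cmod (\<Prod>x\<in>#A. - x) \<le> 1 \<and> (A \<noteq> {#} \<longrightarrow> cmod (\<Prod>x\<in>#A. - x) < 1)"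
  proof (induction A)
    case (add x A)
    then have *: "algebraic_int x" "cmod x < 1" "algebraic_int (\<Prod>x\<in>#A. - x)" "cmod (\<Prod>x\<in>#A. - x) \<le> 1"
      by auto
    have "cmod x * cmod (\<Prod>x\<in>#A. - x) \<le> cmod x * 1" by (intro mult_left_mono *) simp
    then show ?case using * by (auto intro: algebraic_int_mult simp: norm_mult)
  qed simp
  moreover have "A \<noteq> {#}"
  proof
    assume "A = {#}"
    then have "m = 1" using A(1) lead(2) m unfolding min_poly_over_def
      by (metis degree_eq_zeroE lead_coeff_pCons(2) one_pCons size_empty pCons_0_0)
    then show False using m by (simp add: min_poly_over_def)
  qed
  moreover have "poly f 0 = rat_embed (coeff m 0)" by (simp add: f_def poly_0_coeff_0 coeff_map_\<sigma>)
  moreover have "coeff m 0 \<in> \<rat>" using m by (auto simp: min_poly_over_def poly_over_def)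
  then obtain r where r: "coeff m 0 = of_rat r" by (auto elim: Rats_cases)
  \<comment> \<open>The constant term is rational, integral and of absolute value below 1, hence 0.
    So \<open>X\<close> divides the minimal polynomial, and cancelling it contradicts minimality
    because \<open>a\<close> is nonzero.\<close>
  ultimately have "algebraic_int (of_rat r :: complex)" "cmod (of_rat r) < 1" by auto
  then have "(of_rat r :: complex) \<in> \<int>" using rational_algebraic_int_is_int Rats_of_rat by blast
  then obtain n where n: "(of_rat r :: complex) = of_int n" by (auto elim: Ints_cases)
  with \<open>cmod (of_rat r) < 1\<close> have "n = 0" by simp
  with n have "coeff m 0 = 0" using r by simp
  obtain c m' where m': "m = pCons c m'" by (cases m) auto
  then have "c = 0" using \<open>coeff m 0 = 0\<close> by simp
  with m m' a have "poly m' a = 0" "m' \<noteq> 0" by (auto simp: min_poly_over_def)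
  moreover have "m' \<in> poly_over \<rat>"
    using m unfolding min_poly_over_def poly_over_def m' by clarsimp (metis coeff_pCons_Suc)
  ultimately have "degree m \<le> degree m'" using m unfolding min_poly_over_def by blast
  then show False using \<open>m' \<noteq> 0\<close> by (simp add: m')
qed

end

hide_const (open) Ring_Hom.ring_hom

section \<open>Absolute values and the infinite places\<close>

text \<open>Common to the finite and the infinite places; the ultrametric inequality is added where
  it holds.\<close>

locale abs_value =
  fixes v :: "'k::field_char_0 \<Rightarrow> real"
  assumes nonneg [simp]: "0 \<le> v x"
    and eq_0_iff [simp]: "v x = 0 \<longleftrightarrow> x = 0"
    and mult: "v (x * y) = v x * v y"
    and triangle: "v (x + y) \<le> v x + v y"
begin

lemma zero [simp]: "v 0 = 0" by simp

lemma one [simp]: "v 1 = 1"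
  using mult[of 1 1] by simp

lemma minus [simp]: "v (- x) = v x"
proof -
  have "(v (- x))\<^sup>2 = (v x)\<^sup>2"
    using mult[of "- x" "- x"] mult[of x x] by (simp add: power2_eq_square)
  then show ?thesis by simp
qed

lemma diff_commute: "v (x - y) = v (y - x)"
  using minus[of "x - y"] by simp

lemma triangle_diff: "v (x - y) \<le> v x + v y"
  using triangle[of x "- y"] by simp

lemma triangle3: "v (x - z) \<le> v (x - y) + v (y - z)"
  using triangle[of "x - y" "y - z"] by simp

lemma abs_diff: "\<bar>v x - v y\<bar> \<le> v (x - y)"
  using triangle[of "x - y" y] triangle[of "y - x" x] diff_commute[of x y] by (simp add: abs_le_iff)

lemma power: "v (x ^ n) = v x ^ n"
  by (induction n) (auto simp: mult)

lemma inverse: "v (inverse x) = inverse (v x)"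
proof (cases "x = 0")
  case False
  then have "v x * v (inverse x) = 1" using mult[of x "inverse x"] by simp
  then show ?thesis by (metis inverse_unique)
qed simp

lemma divide: "v (x / y) = v x / v y"
  by (simp add: divide_inverse mult inverse)

lemma pos_iff: "0 < v x \<longleftrightarrow> x \<noteq> 0"
  using nonneg[of x] eq_0_iff[of x] by linarith

lemma sum_le: "v (sum f A) \<le> (\<Sum>i\<in>A. v (f i))"
  by (induction A rule: infinite_finite_induct) (auto intro: order_trans[OF triangle])

text \<open>The sequence \<open>z ^ n / (1 + z ^ n)\<close> acts as a switch: it tends to 1 at
  places with \<open>v z > 1\<close> and to 0 at places with \<open>v z < 1\<close>. Weak
  approximation is built from such switches.\<close>

lemma tendsto_1_if_gt_1:
  assumes "1 < v z"
  shows "(\<lambda>n. v (z ^ n / (1 + z ^ n) - 1)) \<longlonglongrightarrow> 0"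
proof -
  have ev: "\<forall>\<^sub>F n in sequentially. v (z ^ n / (1 + z ^ n) - 1) \<le> 1 / (v z ^ n - 1)"
    using eventually_gt_at_top[of 0]
  proof eventually_elim
    case (elim n)
    then have g: "v z ^ n > 1" using assms by (simp add: one_less_power)
    have "v z ^ n - 1 \<le> v (1 + z ^ n)"
      using triangle_diff[of "1 + z ^ n" 1] by (simp add: power)
    then have p: "v z ^ n - 1 \<le> v (1 + z ^ n)" "0 < v z ^ n - 1" using g by auto
    then have "1 + z ^ n \<noteq> 0" using pos_iff[of "1 + z ^ n"] by linarith
    then have "z ^ n / (1 + z ^ n) - 1 = - (1 / (1 + z ^ n))" by (simp add: field_simps)
    then have "v (z ^ n / (1 + z ^ n) - 1) = 1 / v (1 + z ^ n)"
      by (simp add: divide del: minus_divide_left)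
    also have "\<dots> \<le> 1 / (v z ^ n - 1)" using p by (intro divide_left_mono) auto
    finally show ?case .
  qed
  have "filterlim (\<lambda>n. v z ^ n) at_infinity sequentially"
    using assms by (intro filterlim_realpow_sequentially_gt1) auto
  then have "filterlim (\<lambda>n. v z ^ n + (-1)) at_infinity sequentially"
    by (rule tendsto_add_filterlim_at_infinity'[OF _ tendsto_const])
  then have "(\<lambda>n. 1 / (v z ^ n - 1)) \<longlonglongrightarrow> 0"
    by (intro tendsto_divide_0[OF tendsto_const]) simp
  then show ?thesis
    by (rule Lim_null_comparison[rotated]) (use ev in simp)
qed

lemma tendsto_0_if_lt_1:
  assumes "v z < 1"
  shows "(\<lambda>n. v (z ^ n / (1 + z ^ n))) \<longlonglongrightarrow> 0"
proof -
  have l: "(\<lambda>n. v z ^ n) \<longlonglongrightarrow> 0" using assms by (intro LIMSEQ_realpow_zero) auto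
  have ev: "\<forall>\<^sub>F n in sequentially. v (z ^ n / (1 + z ^ n)) \<le> v z ^ n / (1 - v z ^ n)"
    using eventually_gt_at_top[of 0]
  proof eventually_elim
    case (elim n)
    then have "v z ^ n < 1" using assms by (simp add: power_less_one_iff)
    moreover have "1 - v z ^ n \<le> v (1 + z ^ n)"
      using triangle_diff[of "1 + z ^ n" "z ^ n"] by (simp add: power)
    ultimately show ?case by (simp add: divide power frac_le)
  qed
  have "(\<lambda>n. v z ^ n / (1 - v z ^ n)) \<longlonglongrightarrow> 0 / (1 - 0)"
    by (intro tendsto_divide tendsto_diff tendsto_const l) simp
  then have "(\<lambda>n. v z ^ n / (1 - v z ^ n)) \<longlonglongrightarrow> 0" by simp
  then show ?thesis
    by (rule Lim_null_comparison[rotated]) (use ev in simp)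
qed

lemma tendsto_mult_right:
  assumes "(\<lambda>n. v (s n - 1)) \<longlonglongrightarrow> 0"
  shows "(\<lambda>n. v (s n * y)) \<longlonglongrightarrow> v y"
proof -
  have "(\<lambda>n. v (s n - 1) * v y) \<longlonglongrightarrow> 0" using tendsto_mult_left_zero[OF assms] .
  moreover have "norm (v (s n * y) - v y) \<le> v (s n - 1) * v y" for n
    using abs_diff[of "s n * y" y] by (simp add: mult[symmetric] algebra_simps)
  ultimately have "(\<lambda>n. v (s n * y) - v y) \<longlonglongrightarrow> 0"
    by (rule Lim_null_comparison[OF always_eventually, rotated, OF _ allI])
  then show ?thesis by (simp add: LIM_zero_iff)
qed

end

section \<open>Infinite places: weak approximation and finiteness\<close>

context number_field_type
begin

lemma infinite_places_eq: "infinite_places = (\<lambda>\<sigma> x. cmod (\<sigma> x)) ` embeddings"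
proof -
  have "\<sigma> \<in> ring_hom K_ring (ring_of_type_algebra :: complex ring) \<longleftrightarrow> \<sigma> \<in> embeddings" for \<sigma> :: "'k \<Rightarrow> complex"
    by (auto simp: Ring.ring_hom_def embeddings_def ring_of_type_algebra_def)
  then show ?thesis unfolding infinite_places_def by auto
qed

lemma finite_infinite_places: "finite (infinite_places :: 'k place set)"
  and infinite_places_nonempty: "(infinite_places :: 'k place set) \<noteq> {}"
  unfolding infinite_places_eq using finite_embeddings embeddings_nonempty by auto

lemma infinite_place_abs_value:
  assumes "v \<in> infinite_places"
  shows "abs_value (v :: 'k place)"
proof -
  obtain \<sigma> where \<sigma>: "\<sigma> \<in> embeddings" "v = (\<lambda>x. cmod (\<sigma> x))"
    using assms infinite_places_eq by auto
  then show ?thesis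
    by unfold_locales (auto simp: embeddings_hom[OF \<sigma>(1)] norm_mult norm_triangle_ineq)
qed

lemma infinite_place_of_rat:
  assumes "v \<in> infinite_places"
  shows "v (of_rat q :: 'k) = \<bar>of_rat q\<bar>"
proof -
  obtain \<sigma> where \<sigma>: "\<sigma> \<in> embeddings" "v = (\<lambda>x. cmod (\<sigma> x))"
    using assms infinite_places_eq by auto
  have "(of_rat q :: complex) = of_real (of_rat q)"
    by (cases q) (simp add: of_rat_rat)
  then show ?thesis by (simp add: \<sigma>(2) embeddings_hom[OF \<sigma>(1)])
qed

lemma exists_infinite_place_ge_1:
  assumes "algebraic_int a" "a \<noteq> (0::'k)"
  shows "\<exists>v\<in>infinite_places. 1 \<le> v a"
  using exists_embedding_ge_1[OF assms] unfolding infinite_places_eq by auto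

text \<open>All infinite places agree on the rationals, so a rational number strictly between
  \<open>v x\<close> and \<open>w x\<close> can be divided out of \<open>x\<close>, or
  \<open>x\<close> out of it.\<close>

lemma infinite_places_separate:
  assumes v: "v \<in> infinite_places" and w: "w \<in> infinite_places" and ne: "v \<noteq> w"
  shows "\<exists>y::'k. 1 < v y \<and> w y < 1"
proof -
  interpret v: abs_value v by (rule infinite_place_abs_value[OF v])
  interpret w: abs_value w by (rule infinite_place_abs_value[OF w])
  have *: "\<exists>q. q > 0 \<and> a < of_rat q \<and> of_rat q < b" if "a < b" "0 \<le> a" for a b :: real
  proof -
    obtain q where "a < of_rat q" "of_rat q < b" using of_rat_dense[OF \<open>a < b\<close>] by blast
    moreover from this that have "(0::real) < of_rat q" by linarith
    ultimately show ?thesis by auto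
  qed
  obtain x where "v x \<noteq> w x" using ne by auto
  then consider "w x < v x" | "v x < w x" by linarith
  then show ?thesis
  proof cases
    case 1
    then obtain q where q: "q > 0" "w x < of_rat q" "of_rat q < v x" using *[of "w x" "v x"] by auto
    moreover have "(0::real) < of_rat q" using q by simp
    ultimately show ?thesis
      by (intro exI[of _ "x / of_rat q"]) (simp add: v.divide w.divide infinite_place_of_rat v w)
  next
    case 2
    then obtain q where q: "q > 0" "v x < of_rat q" "of_rat q < w x" using *[of "v x" "w x"] by auto
    have "x \<noteq> 0" using 2 by auto
    then have "0 < v x" "0 < w x" by (simp_all add: v.pos_iff w.pos_iff)
    moreover have "(0::real) < of_rat q" using q by simp
    ultimately show ?thesis using q
      by (intro exI[of _ "of_rat q / x"]) (simp add: v.divide w.divide infinite_place_of_rat v w)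
  qed
qed

text \<open>Induction on \<open>W\<close>. If \<open>z\<close> does not exceed 1 at the new place
  \<open>w\<close>, a high power of \<open>z\<close> times a separating \<open>y\<close> works.
  Otherwise the power is replaced by the switch \<open>z ^ n / (1 + z ^ n)\<close>, which tends to 1
  at \<open>v\<close> and \<open>w\<close> and to 0 on \<open>W\<close>.\<close>

lemma infinite_places_isolate:
  assumes v: "v \<in> infinite_places" and "finite W" "W \<subseteq> infinite_places" "v \<notin> W"
  shows "\<exists>z::'k. 1 < v z \<and> (\<forall>w\<in>W. w z < 1)"
  using assms(2-)
proof (induction W rule: finite_induct)
  case empty
  have "v (of_rat 2) = 2" using infinite_place_of_rat[OF v, of 2] by simp
  then show ?case by (intro exI[of _ "of_rat 2"]) simp
next
  case (insert w W)
  then obtain z where z: "1 < v z" "\<forall>w\<in>W. w z < 1" by auto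
  have w: "w \<in> infinite_places" "w \<noteq> v" and W: "\<And>u. u \<in> W \<Longrightarrow> abs_value u"
    using insert infinite_place_abs_value by auto
  obtain y where y: "1 < v y" "w y < 1" using infinite_places_separate[OF v w(1)] w by auto
  interpret v: abs_value v by (rule infinite_place_abs_value[OF v])
  interpret w: abs_value w by (rule infinite_place_abs_value[OF w(1)])
  consider "w z \<le> 1" | "w z > 1" by linarith
  then show ?case
  proof cases
    case 1
    have "\<forall>\<^sub>F n in sequentially. u (z ^ n * y) < 1" if u: "u \<in> W" for u
    proof -
      interpret u: abs_value u by (rule W[OF u])
      have "(\<lambda>n. u z ^ n) \<longlonglongrightarrow> 0" using z u by (intro LIMSEQ_realpow_zero) auto
      then have "(\<lambda>n. u (z ^ n * y)) \<longlonglongrightarrow> 0"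
        unfolding u.mult u.power by (rule tendsto_mult_left_zero)
      then show ?thesis by (rule order_tendstoD(2)) simp
    qed
    then have "\<forall>\<^sub>F n in sequentially. \<forall>u\<in>W. u (z ^ n * y) < 1"
      using insert.hyps by (intro eventually_ball_finite) auto
    then obtain n where n: "\<forall>u\<in>W. u (z ^ n * y) < 1" by (auto simp: eventually_sequentially)
    have "1 < v (z ^ n * y)"
      using z(1) y(1) one_le_power[of "v z" n] mult_right_mono[of 1 "v z ^ n" "v y"]
      unfolding v.mult v.power by linarith
    moreover have "w (z ^ n * y) < 1"
      using 1 y power_le_one[of "w z" n] mult_right_mono[of "w z ^ n" 1 "w y"] by (simp add: w.mult w.power)
    ultimately show ?thesis using n by blast
  next
    case 2
    define q where "q n = z ^ n / (1 + z ^ n)" for n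
    have "\<forall>\<^sub>F n in sequentially. u (q n * y) < 1" if u: "u \<in> W" for u
    proof -
      interpret u: abs_value u by (rule W[OF u])
      have "(\<lambda>n. u (q n)) \<longlonglongrightarrow> 0" unfolding q_def using z u by (intro u.tendsto_0_if_lt_1) auto
      then have "(\<lambda>n. u (q n * y)) \<longlonglongrightarrow> 0"
        unfolding u.mult by (rule tendsto_mult_left_zero)
      then show ?thesis by (rule order_tendstoD(2)) simp
    qed
    then have "\<forall>\<^sub>F n in sequentially. \<forall>u\<in>W. u (q n * y) < 1"
      using insert.hyps by (intro eventually_ball_finite) auto
    moreover have "(\<lambda>n. v (q n * y)) \<longlonglongrightarrow> v y"
      unfolding q_def by (intro v.tendsto_mult_right v.tendsto_1_if_gt_1 z)
    then have "\<forall>\<^sub>F n in sequentially. 1 < v (q n * y)" by (rule order_tendstoD(1)) fact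
    moreover have "(\<lambda>n. w (q n * y)) \<longlonglongrightarrow> w y"
      unfolding q_def by (intro w.tendsto_mult_right w.tendsto_1_if_gt_1 2)
    then have "\<forall>\<^sub>F n in sequentially. w (q n * y) < 1" by (rule order_tendstoD(2)) fact
    ultimately have "\<forall>\<^sub>F n in sequentially. 1 < v (q n * y) \<and> (\<forall>u\<in>insert w W. u (q n * y) < 1)"
      by eventually_elim auto
    then show ?thesis by (auto simp: eventually_sequentially)
  qed
qed

text \<open>The switches of an isolating element approximate the idempotents of the product of the
  completions.\<close>

lemma infinite_places_idempotent:
  assumes v: "v \<in> infinite_places" and \<epsilon>: "0 < \<epsilon>"
  shows "\<exists>e::'k. v (e - 1) < \<epsilon> \<and> (\<forall>w\<in>infinite_places - {v}. w e < \<epsilon>)"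
proof -
  obtain z where z: "1 < v z" "\<forall>w\<in>infinite_places - {v}. w z < 1"
    using infinite_places_isolate[OF v, of "infinite_places - {v}"] finite_infinite_places by auto
  define q where "q n = z ^ n / (1 + z ^ n)" for n
  have "\<forall>\<^sub>F n in sequentially. w (q n) < \<epsilon>" if w: "w \<in> infinite_places - {v}" for w
  proof -
    interpret w: abs_value w using w by (intro infinite_place_abs_value) auto
    have "(\<lambda>n. w (q n)) \<longlonglongrightarrow> 0" unfolding q_def using z w by (intro w.tendsto_0_if_lt_1) auto
    then show ?thesis by (rule order_tendstoD(2)) fact
  qed
  then have "\<forall>\<^sub>F n in sequentially. \<forall>w\<in>infinite_places - {v}. w (q n) < \<epsilon>"
    using finite_infinite_places by (intro eventually_ball_finite) auto
  moreover interpret v: abs_value v by (rule infinite_place_abs_value[OF v])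
  have "(\<lambda>n. v (q n - 1)) \<longlonglongrightarrow> 0" unfolding q_def by (intro v.tendsto_1_if_gt_1 z)
  then have "\<forall>\<^sub>F n in sequentially. v (q n - 1) < \<epsilon>" by (rule order_tendstoD(2)) fact
  ultimately have "\<forall>\<^sub>F n in sequentially. v (q n - 1) < \<epsilon> \<and> (\<forall>w\<in>infinite_places - {v}. w (q n) < \<epsilon>)"
    by eventually_elim auto
  then show ?thesis by (auto simp: eventually_sequentially)
qed

lemma weak_approximation:
  fixes y :: "'k place \<Rightarrow> 'k"
  assumes \<epsilon>: "0 < \<epsilon>"
  shows "\<exists>x. \<forall>v\<in>infinite_places. v (x - y v) < \<epsilon>"
proof -
  let ?P = "infinite_places :: 'k place set"
  \<comment> \<open>\<open>M - 1\<close> bounds the sum of the \<open>v (y w)\<close> at each place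
    and the 1 makes \<open>M\<close> positive; so errors of size \<open>\<delta>\<close> in the
    approximate idempotents add up to less than \<open>\<epsilon>\<close>.\<close>
  define M where "M = (\<Sum>v\<in>?P. \<Sum>w\<in>?P. v (y w)) + 1"
  have nn: "0 \<le> v x" if "v \<in> ?P" for v x
    using infinite_place_abs_value[OF that] by (simp add: abs_value.nonneg)
  have M: "M \<ge> 1" unfolding M_def using nn by (auto intro!: sum_nonneg)
  define \<delta> where "\<delta> = \<epsilon> / M"
  have \<delta>: "0 < \<delta>" using \<epsilon> M by (simp add: \<delta>_def)
  obtain e :: "'k place \<Rightarrow> 'k" where e: "\<And>v. v \<in> ?P \<Longrightarrow> v (e v - 1) < \<delta>"
    "\<And>v w. v \<in> ?P \<Longrightarrow> w \<in> ?P \<Longrightarrow> w \<noteq> v \<Longrightarrow> w (e v) < \<delta>"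
    using infinite_places_idempotent[OF _ \<delta>] by (metis Diff_iff singletonD)
  show ?thesis
  proof (intro exI ballI)
    fix v assume v: "v \<in> ?P"
    interpret v: abs_value v by (rule infinite_place_abs_value[OF v])
    have "(\<Sum>w\<in>?P. y w * e w) - y v = (\<Sum>w\<in>?P. y w * (if w = v then e w - 1 else e w))"
      by (simp add: sum.remove[OF finite_infinite_places v] algebra_simps)
    also have "v \<dots> \<le> (\<Sum>w\<in>?P. v (y w * (if w = v then e w - 1 else e w)))" by (rule v.sum_le)
    also have "\<dots> \<le> (\<Sum>w\<in>?P. v (y w) * \<delta>)"
    proof (rule sum_mono)
      fix w assume w: "w \<in> ?P"
      have "v (if w = v then e w - 1 else e w) \<le> \<delta>" using e v w by (auto intro: less_imp_le)
      then show "v (y w * (if w = v then e w - 1 else e w)) \<le> v (y w) * \<delta>"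
        unfolding v.mult by (intro mult_left_mono) simp_all
    qed
    also have "\<dots> = (\<Sum>w\<in>?P. v (y w)) * \<delta>" by (simp add: sum_distrib_right)
    also have "(\<Sum>w\<in>?P. v (y w)) \<le> (\<Sum>v\<in>?P. \<Sum>w\<in>?P. v (y w))"
      using v nn finite_infinite_places by (intro member_le_sum[where f = "\<lambda>v. \<Sum>w\<in>?P. v (y w)"] sum_nonneg) auto
    then have "(\<Sum>w\<in>?P. v (y w)) * \<delta> \<le> (M - 1) * \<delta>"
      using \<delta> by (intro mult_right_mono) (auto simp: M_def)
    also have "\<dots> < \<epsilon>" using M \<epsilon> by (simp add: \<delta>_def field_simps)
    finally show "v ((\<Sum>w\<in>?P. y w * e w) - y v) < \<epsilon>" .
  qed
qed

text \<open>Rounding down the rational coordinates with respect to integral multiples of the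
  spanning elements leaves coordinates in \<open>[0, 1)\<close>. This is cocompactness of
  \<open>O\<close>, for points of \<open>K\<close>; density extends it to \<open>K_inf\<close>
  later.\<close>

lemma integers_cobounded: "\<exists>R. \<forall>x::'k. \<exists>a. algebraic_int a \<and> (\<forall>v\<in>infinite_places. v (x - a) \<le> R)"
proof -
  let ?P = "infinite_places :: 'k place set"
  obtain n :: "'k \<Rightarrow> nat" where n: "\<And>b. n b > 0" "\<And>b. algebraic_int (of_nat (n b) * b)"
    using exists_nat_mult_algebraic_int by metis
  define R where "R = (\<Sum>v\<in>?P. \<Sum>b\<in>basis. v (of_nat (n b) * b))"
  have nn: "0 \<le> v x" if "v \<in> ?P" for v x
    using infinite_place_abs_value[OF that] by (simp add: abs_value.nonneg)
  show ?thesis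
  proof (intro exI[of _ R] allI)
    fix x :: 'k
    obtain u where u: "x = (\<Sum>b\<in>basis. of_rat (u b) * b)" using basis_expansion by blast
    define q where "q b = u b / of_nat (n b)" for b
    have n0: "n b \<noteq> 0" for b using n(1)[of b] by simp
    have xq: "x = (\<Sum>b\<in>basis. of_rat (q b) * (of_nat (n b) * b))"
      unfolding u by (intro sum.cong) (simp_all add: q_def of_rat_divide n0)
    define a where "a = (\<Sum>b\<in>basis. of_int \<lfloor>q b\<rfloor> * (of_nat (n b) * b))"
    have "algebraic_int a" unfolding a_def
      by (intro algebraic_int_sum algebraic_int_mult[OF _ n(2)] int_imp_algebraic_int Ints_of_int)
    moreover have "v (x - a) \<le> R" if v: "v \<in> ?P" for v
    proof -
      interpret v: abs_value v by (rule infinite_place_abs_value[OF v])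
      have "x - a = (\<Sum>b\<in>basis. of_rat (frac (q b)) * (of_nat (n b) * b))"
        unfolding a_def xq by (simp add: sum_subtractf[symmetric] frac_def of_rat_diff algebra_simps)
      also have "v \<dots> \<le> (\<Sum>b\<in>basis. v (of_rat (frac (q b)) * (of_nat (n b) * b)))" by (rule v.sum_le)
      also have "\<dots> \<le> (\<Sum>b\<in>basis. v (of_nat (n b) * b))"
      proof (rule sum_mono)
        fix b
        have "0 \<le> frac (q b)" "frac (q b) \<le> 1" using frac_lt_1[of "q b"] by auto
        then have "\<bar>real_of_rat (frac (q b))\<bar> \<le> 1" by simp
        then show "v (of_rat (frac (q b)) * (of_nat (n b) * b)) \<le> v (of_nat (n b) * b)"
          unfolding v.mult infinite_place_of_rat[OF v] by (intro mult_left_le_one_le) auto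
      qed
      also have "\<dots> \<le> R" unfolding R_def using v nn finite_infinite_places
        by (intro member_le_sum[where f = "\<lambda>v. \<Sum>b\<in>basis. v (of_nat (n b) * b)"] sum_nonneg) auto
      finally show ?thesis .
    qed
    ultimately show "\<exists>a. algebraic_int a \<and> (\<forall>v\<in>?P. v (x - a) \<le> R)" by blast
  qed
qed

text \<open>Total boundedness of a disc in the complex plane, pulled back along an
  embedding.\<close>

lemma infinite_place_covering:
  assumes v: "v \<in> infinite_places" and \<epsilon>: "0 < \<epsilon>"
  shows "\<exists>C::'k set. finite C \<and> (\<forall>x. v x \<le> R \<longrightarrow> (\<exists>c\<in>C. v (x - c) < \<epsilon>))"
proof -
  obtain \<sigma> where \<sigma>: "\<sigma> \<in> embeddings" "v = (\<lambda>x. cmod (\<sigma> x))"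
    using v infinite_places_eq by auto
  have "\<exists>k. finite k \<and> k \<subseteq> cball (0::complex) R \<and> cball 0 R \<subseteq> (\<Union>x\<in>k. ball x (\<epsilon> / 2))"
    using seq_compact_imp_totally_bounded[OF compact_imp_seq_compact[OF compact_cball[of "0::complex" R]]] \<epsilon>
    by simp
  then obtain k where k: "finite k" "cball (0::complex) R \<subseteq> (\<Union>x\<in>k. ball x (\<epsilon> / 2))" by auto
  \<comment> \<open>Centres with no image of \<open>K\<close> nearby get an arbitrary value. For the
    centres that occur below, \<open>x\<close> itself shows that a suitable point exists.\<close>
  define c where "c z = (SOME x. cmod (z - \<sigma> x) < \<epsilon> / 2)" for z
  show ?thesis
  proof (intro exI[of _ "c ` k"] conjI allI impI)
    fix x assume "v x \<le> R"
    then have "\<sigma> x \<in> cball 0 R" by (simp add: \<sigma>(2))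
    then obtain z where z: "z \<in> k" "cmod (z - \<sigma> x) < \<epsilon> / 2" using k by (auto simp: dist_norm)
    then have "cmod (z - \<sigma> (c z)) < \<epsilon> / 2" unfolding c_def by (metis someI)
    then have "cmod (\<sigma> x - \<sigma> (c z)) < \<epsilon>"
      using z norm_triangle_ineq4[of "z - \<sigma> (c z)" "z - \<sigma> x"] by simp
    then show "\<exists>d\<in>c ` k. v (x - d) < \<epsilon>" using z by (auto simp: \<sigma>(2) embeddings_hom[OF \<sigma>(1)])
  qed (use k in auto)
qed

text \<open>Pigeonhole over the finitely many choices of a covering centre at every infinite
  place.\<close>

lemma infinite_place_close_pair:
  assumes inf: "infinite S" and bd: "\<And>x v. x \<in> S \<Longrightarrow> v \<in> infinite_places \<Longrightarrow> v x \<le> R v" and \<epsilon>: "0 < \<epsilon>"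
  shows "\<exists>x\<in>S. \<exists>y\<in>S. x \<noteq> (y::'k) \<and> (\<forall>v\<in>infinite_places. v (x - y) < \<epsilon>)"
proof -
  let ?P = "infinite_places :: 'k place set"
  have "\<exists>C::'k set. finite C \<and> (\<forall>x. v x \<le> R v \<longrightarrow> (\<exists>c\<in>C. v (x - c) < \<epsilon> / 2))" if "v \<in> ?P" for v
    using infinite_place_covering[OF that, of "\<epsilon> / 2" "R v"] \<epsilon> by simp
  then obtain C :: "'k place \<Rightarrow> 'k set" where C: "\<And>v. v \<in> ?P \<Longrightarrow> finite (C v)"
    "\<And>v x. v \<in> ?P \<Longrightarrow> v x \<le> R v \<Longrightarrow> \<exists>c\<in>C v. v (x - c) < \<epsilon> / 2" by metis
  then have "\<exists>c\<in>C v. v (x - c) < \<epsilon> / 2" if "x \<in> S" "v \<in> ?P" for x v using bd that by blast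
  then obtain c where c: "\<And>x v. x \<in> S \<Longrightarrow> v \<in> ?P \<Longrightarrow> c x v \<in> C v \<and> v (x - c x v) < \<epsilon> / 2"
    by metis
  have "\<not> inj_on (\<lambda>x. restrict (c x) ?P) S"
  proof
    assume inj: "inj_on (\<lambda>x. restrict (c x) ?P) S"
    have "finite (PiE ?P C)" by (intro finite_PiE finite_infinite_places C)
    then have "finite S" by (intro inj_on_finite[OF inj]) (use c in auto)
    with inf show False by simp
  qed
  then obtain x y where xy: "x \<in> S" "y \<in> S" "x \<noteq> y" "restrict (c x) ?P = restrict (c y) ?P"
    by (auto simp: inj_on_def)
  have "v (x - y) < \<epsilon>" if v: "v \<in> ?P" for v
  proof -
    interpret v: abs_value v by (rule infinite_place_abs_value[OF v])
    have "c x v = c y v" using xy(4) v by (metis restrict_apply')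
    then have "v (x - y) \<le> v (x - c x v) + v (y - c y v)"
      using v.triangle3[of x y "c x v"] v.diff_commute[of y] by simp
    then show ?thesis using c[OF xy(1) v] c[OF xy(2) v] by linarith
  qed
  then show ?thesis using xy by blast
qed

text \<open>Among infinitely many there would be two whose difference is a nonzero integer of
  absolute value below 1 at all infinite places, against
  \<open>exists_infinite_place_ge_1\<close>.\<close>

lemma finite_bounded_integers:
  "finite {a::'k. algebraic_int a \<and> (\<forall>v\<in>infinite_places. v a \<le> R v)}" (is "finite ?S")
proof (rule ccontr)
  assume "infinite ?S"
  then obtain x y where "x \<in> ?S" "y \<in> ?S" "x \<noteq> y" "\<forall>v\<in>infinite_places. v (x - y) < 1"
    using infinite_place_close_pair[OF \<open>infinite ?S\<close>, of R 1] by force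
  then show False
    using exists_infinite_place_ge_1[of "x - y"] algebraic_int_diff[of x y] by force
qed

text \<open>This is finiteness of \<open>O/aO\<close>: subtracting from \<open>b\<close> the product
  of \<open>a\<close> with an integer close to \<open>b / a\<close> leads into a bounded, hence
  finite, set of integers.\<close>

lemma finite_index:
  assumes a: "algebraic_int a" "a \<noteq> (0::'k)"
  shows "\<exists>T. finite T \<and> (\<forall>t\<in>T. algebraic_int t) \<and>
    (\<forall>b. algebraic_int b \<longrightarrow> (\<exists>t\<in>T. algebraic_int ((b - t) / a)))"
proof -
  obtain R where R: "\<And>x::'k. \<exists>c. algebraic_int c \<and> (\<forall>v\<in>infinite_places. v (x - c) \<le> R)"
    using integers_cobounded by blast
  define T where "T = {t. algebraic_int t \<and> (\<forall>v\<in>infinite_places. v t \<le> v a * R)}"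
  have "\<exists>t\<in>T. algebraic_int ((b - t) / a)" if b: "algebraic_int b" for b
  proof -
    obtain c where c: "algebraic_int c" "\<forall>v\<in>infinite_places. v (b / a - c) \<le> R" using R by blast
    have "v (b - a * c) \<le> v a * R" if v: "v \<in> infinite_places" for v
    proof -
      interpret v: abs_value v by (rule infinite_place_abs_value[OF v])
      have "b - a * c = a * (b / a - c)" using a by (simp add: field_simps)
      then have "v (b - a * c) = v a * v (b / a - c)" by (metis v.mult)
      then show ?thesis using c v by (simp add: mult_left_mono)
    qed
    moreover have "algebraic_int (b - a * c)" by (intro algebraic_int_diff algebraic_int_mult a b c)
    ultimately show ?thesis
      using c a by (intro bexI[of _ "b - a * c"]) (auto simp: T_def)
  qed
  moreover have "finite T" unfolding T_def by (rule finite_bounded_integers)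
  ultimately show ?thesis by (intro exI[of _ T]) (auto simp: T_def)
qed

lemma integer_sequence_pigeonhole:
  assumes a: "algebraic_int a" "a \<noteq> (0::'k)" and f: "\<And>n::nat. algebraic_int (f n)"
  shows "\<exists>i j. i < j \<and> algebraic_int ((f i - f j) / a)"
proof -
  obtain T where T: "finite T" "\<And>b. algebraic_int b \<Longrightarrow> \<exists>t\<in>T. algebraic_int ((b - t) / a)"
    using finite_index[OF a] by blast
  then have "\<exists>t\<in>T. algebraic_int ((f n - t) / a)" for n using f by blast
  then obtain t where t: "\<And>n. t n \<in> T" "\<And>n. algebraic_int ((f n - t n) / a)" by metis
  have "\<not> inj t"
    using T(1) t(1) by (metis finite_subset image_subsetI range_inj_infinite)
  then obtain i j where ij: "i \<noteq> j" "t i = t j" by (auto simp: inj_def)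
  have *: "algebraic_int ((f i - f j) / a)" if "t i = t j" for i j
    using algebraic_int_diff[OF t(2)[of i] t(2)[of j]] that by (simp add: diff_divide_distrib)
  then show ?thesis using ij by (metis linorder_neqE_nat)
qed

text \<open>It has two uses. For \<open>b\<close> outside a prime, \<open>b ^ i\<close> can be
  cancelled locally, so that \<open>1 - b ^ k\<close> is divisible by \<open>a\<close> there and
  \<open>b\<close> is invertible modulo \<open>a\<close>. For \<open>b\<close> inside the prime,
  \<open>1 - b ^ k\<close> is a local unit, so a power of \<open>b\<close> is divisible by
  \<open>a\<close> locally.\<close>

lemma power_pigeonhole:
  assumes "algebraic_int a" "a \<noteq> (0::'k)" "algebraic_int b"
  shows "\<exists>i k. 0 < k \<and> algebraic_int (b ^ i * (1 - b ^ k) / a)"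
proof -
  obtain i j where "i < j" "algebraic_int ((b ^ i - b ^ j) / a)"
    using integer_sequence_pigeonhole[of a "\<lambda>n. b ^ n"] assms algebraic_int_power by blast
  moreover have "b ^ i - b ^ j = b ^ i * (1 - b ^ (j - i))"
    using \<open>i < j\<close> by (simp add: algebra_simps power_add[symmetric])
  ultimately show ?thesis by (intro exI[of _ i] exI[of _ "j - i"]) simp
qed

text \<open>Two of the elements \<open>a * x ^ n\<close> are congruent modulo \<open>a\<close>;
  dividing by \<open>a\<close> gives a monic equation for \<open>x\<close> with an integral
  right-hand side.\<close>

lemma integrally_closed:
  assumes a: "algebraic_int a" "a \<noteq> (0::'k)" and x: "\<And>n. algebraic_int (a * x ^ n)"
  shows "algebraic_int x"
proof -
  obtain i j where ij: "i < j" "algebraic_int ((a * x ^ i - a * x ^ j) / a)"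
    using integer_sequence_pigeonhole[OF a x] by blast
  then have y: "algebraic_int (x ^ j - x ^ i)"
    using a algebraic_int_minus[of "x ^ i - x ^ j"] by (simp add: right_diff_distrib[symmetric])
  let ?p = "Polynomial.monom 1 j - Polynomial.monom 1 i :: 'k poly"
  have deg: "degree ?p = j" using ij(1)
    by (intro antisym degree_le le_degree) auto
  show ?thesis
  proof (rule algebraic_int_root[OF y])
    show "poly ?p x = x ^ j - x ^ i" by (simp add: poly_monom)
    show "\<forall>k. coeff ?p k \<in> \<int>" by auto
    show "lead_coeff ?p = 1" unfolding deg using ij(1) by simp
    show "degree ?p > 0" using deg ij(1) by simp
  qed
qed

end

section \<open>Prime ideals of the ring of integers and the finite places\<close>

lemma carrier_O_ring [simp]: "carrier O_ring = {x::'k::field_char_0. algebraic_int x}"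
  and mult_O_ring [simp]: "x \<otimes>\<^bsub>O_ring\<^esub> y = x * y"
  and add_O_ring [simp]: "x \<oplus>\<^bsub>O_ring\<^esub> y = x + y"
  and zero_O_ring [simp]: "\<zero>\<^bsub>O_ring\<^esub> = (0::'k)"
  and one_O_ring [simp]: "\<one>\<^bsub>O_ring\<^esub> = (1::'k)"
  by (auto simp: O_ring_def ring_of_type_algebra_def)

lemma cring_O_ring: "cring (O_ring :: 'k::field_char_0 ring)"
proof (intro cringI abelian_groupI comm_monoidI)
  fix x :: 'k assume "x \<in> carrier O_ring"
  then show "\<exists>y\<in>carrier O_ring. y \<oplus>\<^bsub>O_ring\<^esub> x = \<zero>\<^bsub>O_ring\<^esub>"
    by (intro bexI[of _ "- x"]) auto
qed (auto simp: algebra_simps intro: algebraic_int_add algebraic_int_mult)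

definition integral_ideal :: "'k::field_char_0 set \<Rightarrow> bool" where
  "integral_ideal I \<longleftrightarrow> (\<forall>x\<in>I. algebraic_int x) \<and> 0 \<in> I \<and> (\<forall>x\<in>I. \<forall>y\<in>I. x + y \<in> I) \<and>
     (\<forall>x\<in>I. \<forall>a. algebraic_int a \<longrightarrow> a * x \<in> I)"

lemma integral_idealD:
  assumes "integral_ideal I"
  shows "x \<in> I \<Longrightarrow> algebraic_int x" "0 \<in> I" "x \<in> I \<Longrightarrow> y \<in> I \<Longrightarrow> x + y \<in> I"
    "x \<in> I \<Longrightarrow> algebraic_int a \<Longrightarrow> a * x \<in> I"
  using assms unfolding integral_ideal_def by blast+

lemma integral_idealI:
  assumes "\<And>x. x \<in> I \<Longrightarrow> algebraic_int x" "0 \<in> I" "\<And>x y. x \<in> I \<Longrightarrow> y \<in> I \<Longrightarrow> x + y \<in> I"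
    "\<And>x a. x \<in> I \<Longrightarrow> algebraic_int a \<Longrightarrow> a * x \<in> I"
  shows "integral_ideal I"
  using assms unfolding integral_ideal_def by blast

lemma integral_ideal_minus: "integral_ideal I \<Longrightarrow> x \<in> I \<Longrightarrow> - x \<in> I"
  using integral_idealD(4)[of I x "-1"] by simp

lemma ideal_O_ring_iff: "ideal I O_ring \<longleftrightarrow> integral_ideal (I :: 'k::field_char_0 set)"
proof
  assume "ideal I O_ring"
  then interpret ideal I O_ring .
  show "integral_ideal I"
  proof (rule integral_idealI)
    show "algebraic_int x" if "x \<in> I" for x using a_subset that by auto
    show "0 \<in> I" using additive_subgroup.zero_closed[OF is_additive_subgroup] by simp
    show "x + y \<in> I" if "x \<in> I" "y \<in> I" for x y using additive_subgroup.a_closed[OF is_additive_subgroup that] by simp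
    show "a * x \<in> I" if "x \<in> I" "algebraic_int a" for x a using I_l_closed[OF that(1), of a] that by simp
  qed
next
  assume I: "integral_ideal I"
  interpret cring O_ring by (rule cring_O_ring)
  show "ideal I O_ring"
  proof (rule idealI)
    show "ring O_ring" by (rule ring_axioms)
    show "subgroup I (add_monoid O_ring)"
    proof (rule add.subgroupI)
      fix x assume x: "x \<in> I"
      then have "- x \<in> I" by (rule integral_ideal_minus[OF I])
      moreover have "\<ominus>\<^bsub>O_ring\<^esub> x = - x"
        by (rule minus_equality) (simp_all add: integral_idealD(1)[OF I x])
      ultimately show "\<ominus>\<^bsub>O_ring\<^esub> x \<in> I" by simp
    qed (use integral_idealD[OF I] in auto)
    fix a x :: 'k assume "a \<in> I" "x \<in> carrier O_ring"
    then have "x * a \<in> I" using integral_idealD(4)[OF I, of a x] by simp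
    then show "x \<otimes>\<^bsub>O_ring\<^esub> a \<in> I" "a \<otimes>\<^bsub>O_ring\<^esub> x \<in> I" by (simp_all add: mult.commute)
  qed
qed

lemma primeideal_O_ring_iff:
  "primeideal P O_ring \<longleftrightarrow> integral_ideal (P :: 'k::field_char_0 set) \<and> 1 \<notin> P \<and>
     (\<forall>a b. algebraic_int a \<longrightarrow> algebraic_int b \<longrightarrow> a * b \<in> P \<longrightarrow> a \<in> P \<or> b \<in> P)"
proof
  assume P: "primeideal P O_ring"
  then have I: "integral_ideal P" using ideal_O_ring_iff[of P] by (simp only: primeideal_def)
  have "1 \<notin> P"
  proof
    assume "1 \<in> P"
    then have "x \<in> P" if "algebraic_int x" for x
      using integral_idealD(4)[OF I _ that, of 1] by simp
    then have "carrier O_ring = P" using integral_idealD(1)[OF I] by auto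
    then show False using primeideal.I_notcarr[OF P] by simp
  qed
  then show "integral_ideal P \<and> 1 \<notin> P \<and>
     (\<forall>a b. algebraic_int a \<longrightarrow> algebraic_int b \<longrightarrow> a * b \<in> P \<longrightarrow> a \<in> P \<or> b \<in> P)"
    using I primeideal.I_prime[OF P] by simp
next
  assume "integral_ideal P \<and> 1 \<notin> P \<and>
     (\<forall>a b. algebraic_int a \<longrightarrow> algebraic_int b \<longrightarrow> a * b \<in> P \<longrightarrow> a \<in> P \<or> b \<in> P)"
  then show "primeideal P O_ring"
    by (intro primeidealI cring_O_ring) (simp_all add: ideal_O_ring_iff, metis algebraic_int_1 mem_Collect_eq)
qed

context number_field_type
begin

text \<open>Proper ideals above \<open>I\<close> are measured by how many members of a finite system
  of representatives modulo \<open>n\<close> they contain; one with the largest count is maximal,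
  hence prime.\<close>

lemma exists_prime_above:
  assumes I: "integral_ideal I" and n: "n \<in> I" "n \<noteq> (0::'k)" and "1 \<notin> I"
  shows "\<exists>P. primeideal P O_ring \<and> I \<subseteq> P"
proof -
  have na: "algebraic_int n" using I n by (auto simp: integral_ideal_def)
  obtain T where T: "finite T" "\<And>b. algebraic_int b \<Longrightarrow> \<exists>t\<in>T. algebraic_int ((b - t) / n)" "\<And>t. t \<in> T \<Longrightarrow> algebraic_int t"
    using finite_index[OF na n(2)] by blast
  define Q where "Q J \<longleftrightarrow> integral_ideal J \<and> I \<subseteq> J \<and> 1 \<notin> J" for J
  have "Q I" using assms by (simp add: Q_def)
  moreover have "\<forall>J. Q J \<longrightarrow> card (J \<inter> T) < Suc (card T)"
    using T(1) by (auto intro!: le_imp_less_Suc card_mono)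
  ultimately obtain P where P: "Q P" "\<And>J. Q J \<Longrightarrow> card (J \<inter> T) \<le> card (P \<inter> T)"
    using ex_has_greatest_nat[of Q I "\<lambda>J. card (J \<inter> T)" "Suc (card T)"] by (metis less_imp_le)
  have iP: "integral_ideal P" using P by (simp add: Q_def)
  \<comment> \<open>Maximality: for \<open>a\<close> outside \<open>P\<close>, the ideal generated
    by \<open>P\<close> and \<open>a\<close> contains 1.\<close>
  have big: "\<exists>q c. q \<in> P \<and> algebraic_int c \<and> 1 = q + c * a" if a: "algebraic_int a" "a \<notin> P" for a
  proof -
    define J where "J = {q + c * a | q c. q \<in> P \<and> algebraic_int c}"
    have J: "q + c * a \<in> J" if "q \<in> P" "algebraic_int c" for q c unfolding J_def using that by blast
    have PJ: "P \<subseteq> J" using J[of _ 0] by auto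
    have "a \<in> J" using J[of 0 1] integral_idealD(2)[OF iP] by simp
    have "integral_ideal J"
    proof (rule integral_idealI)
      show "algebraic_int x" if "x \<in> J" for x
        using that integral_idealD(1)[OF iP] a unfolding J_def
        by (auto intro!: algebraic_int_add algebraic_int_mult)
      show "0 \<in> J" using PJ integral_idealD(2)[OF iP] by blast
      show "x + y \<in> J" if xy: "x \<in> J" "y \<in> J" for x y
      proof -
        obtain q c q' c' where *: "q \<in> P" "q' \<in> P" "algebraic_int c" "algebraic_int c'" "x = q + c * a" "y = q' + c' * a"
          using xy unfolding J_def by blast
        have "x + y = (q + q') + (c + c') * a" using * by (simp add: algebra_simps)
        then show ?thesis using * by (metis J integral_idealD(3)[OF iP] algebraic_int_add)
      qed
      show "d * x \<in> J" if xd: "x \<in> J" "algebraic_int d" for x d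
      proof -
        obtain q c where *: "q \<in> P" "algebraic_int c" "x = q + c * a" using xd unfolding J_def by blast
        have "d * x = d * q + (d * c) * a" using * by (simp add: algebra_simps)
        then show ?thesis using * xd(2) by (metis J integral_idealD(4)[OF iP] algebraic_int_mult)
      qed
    qed
    moreover have "\<not> Q J"
    proof
      assume "Q J"
      \<comment> \<open>The representative \<open>t\<close> of \<open>a\<close> modulo
        \<open>n\<close> lies in \<open>J\<close> but not in \<open>P\<close>, so the count would
        grow.\<close>
      obtain t where t: "t \<in> T" "algebraic_int ((a - t) / n)" using T(2) a by blast
      have "(a - t) / n * n \<in> P" using integral_idealD(4)[OF iP _ t(2)] n P(1) unfolding Q_def by blast
      then have d: "a - t \<in> P" using n by simp
      then have "- (a - t) \<in> J" using PJ integral_ideal_minus[OF \<open>integral_ideal J\<close>] by blast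
      from integral_idealD(3)[OF \<open>integral_ideal J\<close> \<open>a \<in> J\<close> this] have "t \<in> J" by simp
      moreover have "t \<notin> P"
      proof
        assume "t \<in> P"
        then have "(a - t) + t \<in> P" using integral_idealD(3)[OF iP d] by blast
        then show False using a by simp
      qed
      ultimately have "P \<inter> T \<subset> J \<inter> T" using t PJ by blast
      then have "card (P \<inter> T) < card (J \<inter> T)" using T(1) by (intro psubset_card_mono) auto
      then show False using P(2)[OF \<open>Q J\<close>] by simp
    qed
    moreover have "I \<subseteq> J" using PJ P(1) by (auto simp: Q_def)
    ultimately have "1 \<in> J" unfolding Q_def by blast
    then show ?thesis unfolding J_def by blast
  qed
  have "a \<in> P \<or> b \<in> P" if ab: "algebraic_int a" "algebraic_int b" "a * b \<in> P" for a b
  proof (rule ccontr)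
    assume "\<not> (a \<in> P \<or> b \<in> P)"
    then obtain q c where qc: "q \<in> P" "algebraic_int c" "1 = q + c * a" using big ab by blast
    have "b = (q + c * a) * b" using qc(3) by simp
    then have "b = b * q + c * (a * b)" by (simp add: algebra_simps)
    moreover have "b * q \<in> P" "c * (a * b) \<in> P" using integral_idealD(4)[OF iP] qc ab by blast+
    ultimately have "b \<in> P" using integral_idealD(3)[OF iP] by metis
    then show False using \<open>\<not> (a \<in> P \<or> b \<in> P)\<close> by blast
  qed
  then have "primeideal P O_ring" using P(1) by (simp add: primeideal_O_ring_iff Q_def)
  then show ?thesis using P(1) by (auto simp: Q_def)
qed

end

locale integer_prime = number_field_type K for K :: "'k::field_char_0 itself" +
  fixes P :: "'k set"
  assumes primeideal: "primeideal P O_ring" and nonzero: "P \<noteq> {0}"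
begin

lemma P_int: "x \<in> P \<Longrightarrow> algebraic_int x"
  and P_zero: "0 \<in> P"
  and P_add: "x \<in> P \<Longrightarrow> y \<in> P \<Longrightarrow> x + y \<in> P"
  and P_mult: "x \<in> P \<Longrightarrow> algebraic_int a \<Longrightarrow> a * x \<in> P"
  and P_one: "1 \<notin> P"
  and P_prime: "algebraic_int a \<Longrightarrow> algebraic_int b \<Longrightarrow> a * b \<in> P \<Longrightarrow> a \<in> P \<or> b \<in> P"
  using primeideal[unfolded primeideal_O_ring_iff integral_ideal_def] by blast+

lemma P_mult': "x \<in> P \<Longrightarrow> algebraic_int a \<Longrightarrow> x * a \<in> P"
  using P_mult[of x a] by (simp add: mult.commute[of x a])

lemma P_prime_power: "algebraic_int a \<Longrightarrow> a \<notin> P \<Longrightarrow> a ^ n \<notin> P"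
  by (induction n) (use P_one P_prime algebraic_int_power in auto)

lemma exists_P: "\<exists>a\<in>P. a \<noteq> 0"
  using nonzero P_zero by blast

text \<open>Two powers of \<open>b\<close> agree modulo a nonzero \<open>a\<close> in
  \<open>P\<close>, and the common factor \<open>b ^ i\<close> is cancelled by primality. In
  particular \<open>b\<close> is invertible modulo \<open>P\<close>.\<close>

lemma unit_mod_P:
  assumes b: "algebraic_int b" "b \<notin> P"
  shows "\<exists>k>0. 1 - b ^ k \<in> P"
proof -
  obtain a where a: "a \<in> P" "a \<noteq> 0" using exists_P by blast
  obtain i k where ik: "0 < k" "algebraic_int (b ^ i * (1 - b ^ k) / a)"
    using power_pigeonhole[OF P_int[OF a(1)] a(2) b(1)] by blast
  have "b ^ i * (1 - b ^ k) / a * a \<in> P" by (rule P_mult[OF a(1) ik(2)])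
  then have "b ^ i * (1 - b ^ k) \<in> P" using a by simp
  moreover have "algebraic_int (1 - b ^ k)" by (intro algebraic_int_diff algebraic_int_power b algebraic_int_1)
  ultimately have "1 - b ^ k \<in> P"
    using P_prime[OF algebraic_int_power[OF b(1)]] P_prime_power[OF b] by blast
  then show ?thesis using ik(1) by blast
qed

text \<open>The localization of \<open>O\<close> at \<open>P\<close>, as a subset of
  \<open>K\<close>.\<close>

definition local_ring :: "'k set" where
  "local_ring = {x. \<exists>s. algebraic_int s \<and> s \<notin> P \<and> algebraic_int (s * x)}"

text \<open>An inverse of a uniformizer: an element \<open>y\<close> of \<open>a\<^sup>-\<^sup>1O\<close>, \<open>a \<in> P\<close>, outside the local ring
  and with the largest possible ideal of denominators.\<close>

lemma exists_inverse_uniformizer: "\<exists>y. y \<notin> local_ring \<and> (\<forall>p\<in>P. algebraic_int (y * p))"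
proof -
  obtain a where a: "a \<in> P" "a \<noteq> 0" using exists_P by blast
  obtain T where T: "finite T" "\<And>b. algebraic_int b \<Longrightarrow> \<exists>t\<in>T. algebraic_int ((b - t) / a)" "\<And>t. t \<in> T \<Longrightarrow> algebraic_int t"
    using finite_index[OF P_int[OF a(1)] a(2)] by blast
  define Q where "Q y \<longleftrightarrow> algebraic_int (a * y) \<and> y \<notin> local_ring" for y
  \<comment> \<open>As \<open>a\<close> is a denominator of every candidate, the size of an ideal of
    denominators is measured by the representatives modulo \<open>a\<close> that it
    contains.\<close>
  define D where "D y = {t \<in> T. algebraic_int (t * y)}" for y
  have "1 / a \<notin> local_ring"
  proof
    assume "1 / a \<in> local_ring"
    then obtain s where s: "algebraic_int s" "s \<notin> P" "algebraic_int (s * (1 / a))" by (auto simp: local_ring_def)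
    have "s * (1 / a) * a \<in> P" by (rule P_mult[OF a(1) s(3)])
    then show False using s a by simp
  qed
  then have "Q (1 / a)" using a by (simp add: Q_def)
  moreover have "\<forall>y. Q y \<longrightarrow> card (D y) < Suc (card T)"
    using T(1) by (auto simp: D_def intro!: le_imp_less_Suc card_mono)
  ultimately obtain y where y: "Q y" "\<And>z. Q z \<Longrightarrow> card (D z) \<le> card (D y)"
    using ex_has_greatest_nat[of Q "1 / a" "\<lambda>y. card (D y)" "Suc (card T)"] by (metis less_imp_le)
  have "algebraic_int (y * p)" if p: "p \<in> P" for p
  proof -
    note pi = P_int[OF p]
    \<comment> \<open>A power of \<open>p\<close> brings \<open>y\<close> into the local ring:
      \<open>p ^ m * (1 - p ^ k)\<close> is divisible by \<open>a\<close>, and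
      \<open>1 - p ^ k\<close> is outside \<open>P\<close>.\<close>
    obtain m k where mk: "0 < k" "algebraic_int (p ^ m * (1 - p ^ k) / a)"
      using power_pigeonhole[OF P_int[OF a(1)] a(2) pi] by blast
    have nP: "1 - p ^ k \<notin> P"
    proof
      assume *: "1 - p ^ k \<in> P"
      have "p ^ k \<in> P" using mk(1) p pi by (cases k) (auto intro!: P_mult' algebraic_int_power)
      from P_add[OF * this] show False using P_one by simp
    qed
    moreover have "algebraic_int (p ^ m * (1 - p ^ k) / a * (a * y))"
      using y(1) by (intro algebraic_int_mult[OF mk(2)]) (auto simp: Q_def)
    moreover have "p ^ m * (1 - p ^ k) / a * (a * y) = (1 - p ^ k) * (p ^ m * y)" using a by simp
    ultimately have "algebraic_int ((1 - p ^ k) * (p ^ m * y))" by metis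
    moreover have "algebraic_int (1 - p ^ k)" by (intro algebraic_int_diff algebraic_int_power pi algebraic_int_1)
    ultimately have ex: "p ^ m * y \<in> local_ring" unfolding local_ring_def using nP by blast
    define j where "j = (LEAST j. p ^ j * y \<in> local_ring)"
    have j: "p ^ j * y \<in> local_ring" unfolding j_def by (rule LeastI) (rule ex)
    have "j \<noteq> 0"
    proof
      assume "j = 0"
      then show False using j y(1) by (simp add: Q_def)
    qed
    then obtain i where i: "j = Suc i" by (cases j) auto
    then have ni: "p ^ i * y \<notin> local_ring" using not_less_Least[of i "\<lambda>j. p ^ j * y \<in> local_ring"] j_def by auto
    obtain s where s: "algebraic_int s" "s \<notin> P" "algebraic_int (s * (p ^ j * y))" using j by (auto simp: local_ring_def)
    \<comment> \<open>One power before the local ring is reached, and with the denominator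
      \<open>s\<close> of \<open>p ^ j * y\<close> cleared, \<open>z\<close> is still a candidate,
      but now \<open>p * z\<close> is integral.\<close>
    define z where "z = s * p ^ i * y"
    have "z \<notin> local_ring"
    proof
      assume "z \<in> local_ring"
      then obtain s' where s': "algebraic_int s'" "s' \<notin> P" "algebraic_int (s' * z)" by (auto simp: local_ring_def)
      then have "s' * s \<notin> P" "algebraic_int (s' * s)" "algebraic_int (s' * s * (p ^ i * y))"
        using s P_prime algebraic_int_mult by (blast, blast, simp add: z_def mult.assoc)
      then show False using ni unfolding local_ring_def by blast
    qed
    moreover have "algebraic_int (a * y)" using y(1) by (simp add: Q_def)
    then have "algebraic_int (s * p ^ i * (a * y))"
      by (rule algebraic_int_mult[OF algebraic_int_mult[OF s(1) algebraic_int_power[OF pi]]])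
    then have "algebraic_int (a * z)" by (simp add: z_def algebra_simps)
    ultimately have "Q z" by (simp add: Q_def)
    moreover have sub: "D y \<subseteq> D z"
    proof
      fix t assume t: "t \<in> D y"
      have "algebraic_int (t * y)" using t by (simp add: D_def)
      then have "algebraic_int (s * p ^ i * (t * y))"
        by (rule algebraic_int_mult[OF algebraic_int_mult[OF s(1) algebraic_int_power[OF pi]]])
      then show "t \<in> D z" using t by (simp add: D_def z_def algebra_simps)
    qed
    \<comment> \<open>By maximality \<open>z\<close> has no new denominators among the
      representatives. As \<open>p\<close> is a denominator of \<open>z\<close>, so is its
      representative \<open>t\<close>; hence \<open>t\<close> is a denominator of \<open>y\<close>,
      and therefore so is \<open>p\<close>.\<close>
    ultimately have eq: "D y = D z" using y(2)[of z] T(1) by (intro card_seteq) (auto simp: D_def)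
    obtain t where t: "t \<in> T" "algebraic_int ((p - t) / a)" using T(2)[OF pi] by blast
    have *: "algebraic_int ((p - t) / a * (a * w))" if "algebraic_int (a * w)" for w
      by (rule algebraic_int_mult[OF t(2) that])
    have "p * z = s * (p ^ j * y)" by (simp add: z_def i)
    then have "algebraic_int (p * z)" using s(3) by simp
    then have "algebraic_int (p * z - (p - t) / a * (a * z))"
      using \<open>Q z\<close> by (intro algebraic_int_diff *) (simp_all add: Q_def)
    moreover have "(p - t) / a * (a * z) = (p - t) * z" using a by simp
    then have "p * z - (p - t) / a * (a * z) = t * z" by (simp add: left_diff_distrib)
    ultimately have "algebraic_int (t * z)" by metis
    then have "t \<in> D y" using t(1) eq by (simp add: D_def)
    then have "algebraic_int (t * y + (p - t) / a * (a * y))"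
      using y(1) by (intro algebraic_int_add *) (simp_all add: Q_def D_def)
    moreover have "(p - t) / a * (a * y) = (p - t) * y" using a by simp
    then have "t * y + (p - t) / a * (a * y) = y * p" by (simp add: algebra_simps)
    ultimately show ?thesis by metis
  qed
  then show ?thesis using y(1) by (auto simp: Q_def)
qed

text \<open>Locally at \<open>P\<close> a generator of the inverse of \<open>P\<close>. The
  valuation at \<open>P\<close> is read off from multiplication by \<open>\<gamma>\<close>, without
  factorization of ideals.\<close>

definition \<gamma> :: 'k where
  "\<gamma> = (SOME y. y \<notin> local_ring \<and> (\<forall>p\<in>P. algebraic_int (y * p)))"

lemma \<gamma>_not_local: "\<gamma> \<notin> local_ring" and \<gamma>_P: "p \<in> P \<Longrightarrow> algebraic_int (\<gamma> * p)"
  using someI_ex[OF exists_inverse_uniformizer] unfolding \<gamma>_def by auto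

lemma \<gamma>_not_int: "\<not> algebraic_int \<gamma>"
  using \<gamma>_not_local P_one by (auto simp: local_ring_def dest: spec[of _ 1])

text \<open>Otherwise multiplication by \<open>\<gamma>\<close> would preserve \<open>P\<close>;
  then all \<open>a * \<gamma> ^ n\<close> would be integral, and so would \<open>\<gamma>\<close>
  itself.\<close>

lemma exists_uniformizer: "\<exists>p\<in>P. \<gamma> * p \<notin> P"
proof (rule ccontr)
  assume "\<not> ?thesis"
  then have *: "\<gamma> * p \<in> P" if "p \<in> P" for p using that by blast
  obtain a where a: "a \<in> P" "a \<noteq> 0" using exists_P by blast
  have "a * \<gamma> ^ n \<in> P" for n
  proof (induction n)
    case (Suc n)
    then show ?case using *[of "a * \<gamma> ^ n"] by (simp add: algebra_simps)
  qed (use a in simp)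
  then have "algebraic_int \<gamma>" using integrally_closed[OF P_int[OF a(1)] a(2)] P_int by blast
  then show False using \<gamma>_not_int by simp
qed

text \<open>The first exponent at which \<open>\<gamma> ^ i * a\<close> fails to be integral exists
  because \<open>\<gamma>\<close> is not integral. Integrality does not return after it: with a
  uniformizer \<open>p\<close>, it would put
  \<open>(\<gamma> * p) ^ Suc k * (\<gamma> ^ n * a)\<close> into \<open>P\<close> although neither
  factor is in \<open>P\<close>.\<close>

lemma order_exists:
  assumes a: "algebraic_int a" "a \<noteq> 0"
  shows "\<exists>n. (\<forall>i. algebraic_int (\<gamma> ^ i * a) \<longleftrightarrow> i \<le> n) \<and> \<gamma> ^ n * a \<notin> P"
proof -
  obtain p where p: "p \<in> P" "\<gamma> * p \<notin> P" using exists_uniformizer by blast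
  have u: "algebraic_int (\<gamma> * p)" by (rule \<gamma>_P[OF p(1)])
  have "\<exists>i. \<not> algebraic_int (\<gamma> ^ i * a)"
    using integrally_closed[OF a, of \<gamma>] \<gamma>_not_int by (auto simp: mult.commute)
  define m where "m = (LEAST i. \<not> algebraic_int (\<gamma> ^ i * a))"
  have m: "\<not> algebraic_int (\<gamma> ^ m * a)" unfolding m_def using \<open>\<exists>i. _\<close> by (rule LeastI_ex)
  have lt: "algebraic_int (\<gamma> ^ i * a)" if "i < m" for i using not_less_Least that m_def by blast
  have "m \<noteq> 0" using m a by (auto intro: ccontr)
  then obtain n where n: "m = Suc n" by (cases m) auto
  have nP: "\<gamma> ^ n * a \<notin> P"
  proof
    assume "\<gamma> ^ n * a \<in> P"
    from \<gamma>_P[OF this] show False using m n by (simp add: mult.assoc)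
  qed
  have "\<not> algebraic_int (\<gamma> ^ i * a)" if "n < i" for i
  proof
    assume i: "algebraic_int (\<gamma> ^ i * a)"
    obtain k where k: "i = n + Suc k" using \<open>n < i\<close> less_imp_Suc_add by fastforce
    have "p ^ Suc k * (\<gamma> ^ i * a) \<in> P"
      using p(1) i P_int[OF p(1)] by (auto simp: mult.assoc intro!: P_mult' algebraic_int_mult algebraic_int_power)
    also have "p ^ Suc k * (\<gamma> ^ i * a) = (\<gamma> * p) ^ Suc k * (\<gamma> ^ n * a)"
      by (simp add: k power_add power_mult_distrib algebra_simps)
    finally show False
      using P_prime[of "(\<gamma> * p) ^ Suc k" "\<gamma> ^ n * a"] nP P_prime_power[OF u p(2)] lt[of n] n algebraic_int_power[OF u]
      by blast
  qed
  then have "\<forall>i. algebraic_int (\<gamma> ^ i * a) \<longleftrightarrow> i \<le> n" using lt n by (metis less_Suc_eq_le not_less)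
  then show ?thesis using nP by blast
qed

definition ord :: "'k \<Rightarrow> nat" where
  "ord a = (SOME n. (\<forall>i. algebraic_int (\<gamma> ^ i * a) \<longleftrightarrow> i \<le> n) \<and> \<gamma> ^ n * a \<notin> P)"

lemma ord:
  assumes "algebraic_int a" "a \<noteq> 0"
  shows "algebraic_int (\<gamma> ^ i * a) \<longleftrightarrow> i \<le> ord a" and "\<gamma> ^ ord a * a \<notin> P"
proof -
  have "(\<forall>i. algebraic_int (\<gamma> ^ i * a) \<longleftrightarrow> i \<le> ord a) \<and> \<gamma> ^ ord a * a \<notin> P"
    unfolding ord_def by (rule someI_ex[OF order_exists[OF assms]])
  then show "algebraic_int (\<gamma> ^ i * a) \<longleftrightarrow> i \<le> ord a" and "\<gamma> ^ ord a * a \<notin> P" by blast+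
qed

lemma ord_unique:
  assumes a: "algebraic_int a" "a \<noteq> 0" and n: "algebraic_int (\<gamma> ^ n * a)" "\<gamma> ^ n * a \<notin> P"
  shows "ord a = n"
proof (rule antisym)
  show "n \<le> ord a" using ord[OF a] n by blast
  show "ord a \<le> n"
  proof (rule ccontr)
    assume "\<not> ord a \<le> n"
    then have i: "algebraic_int (\<gamma> ^ Suc n * a)" using ord(1)[OF a, of "Suc n"] by (simp del: power_Suc)
    obtain p where p: "p \<in> P" "\<gamma> * p \<notin> P" using exists_uniformizer by blast
    have "(\<gamma> ^ Suc n * a) * p \<in> P" by (rule P_mult[OF p(1) i])
    then have "(\<gamma> * p) * (\<gamma> ^ n * a) \<in> P" by (simp add: algebra_simps)
    then show False using P_prime[OF \<gamma>_P[OF p(1)] n(1)] p n by blast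
  qed
qed

text \<open>Primality of \<open>P\<close>, applied to \<open>\<gamma> ^ ord a * a\<close> and
  \<open>\<gamma> ^ ord b * b\<close>.\<close>

lemma ord_mult:
  assumes a: "algebraic_int a" "a \<noteq> 0" and b: "algebraic_int b" "b \<noteq> 0"
  shows "ord (a * b) = ord a + ord b"
proof (rule ord_unique)
  have eq: "\<gamma> ^ (ord a + ord b) * (a * b) = (\<gamma> ^ ord a * a) * (\<gamma> ^ ord b * b)"
    by (simp add: power_add algebra_simps)
  have "algebraic_int (\<gamma> ^ ord a * a)" "algebraic_int (\<gamma> ^ ord b * b)" using ord a b by auto
  then show "algebraic_int (\<gamma> ^ (ord a + ord b) * (a * b))" "\<gamma> ^ (ord a + ord b) * (a * b) \<notin> P"
    unfolding eq using P_prime ord(2)[OF a] ord(2)[OF b] by (auto intro: algebraic_int_mult)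
qed (use assms algebraic_int_mult in auto)

lemma ord_add:
  assumes a: "algebraic_int a" "a \<noteq> 0" and b: "algebraic_int b" "b \<noteq> 0" and "a + b \<noteq> 0"
  shows "min (ord a) (ord b) \<le> ord (a + b)"
proof -
  have "algebraic_int (\<gamma> ^ min (ord a) (ord b) * a + \<gamma> ^ min (ord a) (ord b) * b)"
    using ord(1)[OF a] ord(1)[OF b] by (intro algebraic_int_add) auto
  then show ?thesis
    using ord(1)[OF algebraic_int_add[OF a(1) b(1)] assms(5)] by (simp add: distrib_left)
qed

lemma ord_0_iff:
  assumes a: "algebraic_int a" "a \<noteq> 0"
  shows "ord a = 0 \<longleftrightarrow> a \<notin> P"
  using ord(2)[OF a] ord_unique[OF a, of 0] a by auto

text \<open>This connects \<open>\<gamma>\<close> with the ideal powers in \<open>int_ord\<close>.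
  In the inductive step \<open>\<gamma> * p\<close> is a unit modulo \<open>P\<close>, so some
  \<open>1 - (\<gamma> * p) ^ k\<close> lies in \<open>P\<close>, and \<open>a\<close> splits into
  two products of an element of \<open>P\<close> with an element of the previous power.\<close>

lemma ideal_power: "(ideal_prod O_ring P ^^ n) (carrier O_ring) = {a. algebraic_int a \<and> algebraic_int (\<gamma> ^ n * a)}"
proof (induction n)
  case (Suc n)
  let ?Q = "{a. algebraic_int a \<and> algebraic_int (\<gamma> ^ n * a)}"
  have "ideal_prod O_ring P ?Q = {a. algebraic_int a \<and> algebraic_int (\<gamma> ^ Suc n * a)}"
  proof (intro equalityI subsetI)
    fix a assume "a \<in> ideal_prod O_ring P ?Q"
    then show "a \<in> {a. algebraic_int a \<and> algebraic_int (\<gamma> ^ Suc n * a)}"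
    proof (induction rule: ideal_prod.induct)
      case (prod i j)
      then have "algebraic_int ((\<gamma> * i) * (\<gamma> ^ n * j))" by (intro algebraic_int_mult[OF \<gamma>_P]) simp_all
      moreover have "(\<gamma> * i) * (\<gamma> ^ n * j) = \<gamma> ^ Suc n * (i * j)" by simp
      ultimately have "algebraic_int (\<gamma> ^ Suc n * (i * j))" by metis
      then show ?case using algebraic_int_mult[OF P_int[OF prod(1)], of j] prod(2) by simp
    next
      case (sum s t)
      then show ?case using algebraic_int_add[of s t] algebraic_int_add[of "\<gamma> ^ Suc n * s" "\<gamma> ^ Suc n * t"]
        by (simp add: distrib_left)
    qed
  next
    fix a assume a: "a \<in> {a. algebraic_int a \<and> algebraic_int (\<gamma> ^ Suc n * a)}"
    \<comment> \<open>Integrality at the exponent \<open>Suc n\<close> descends, since by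
      \<open>ord\<close> the good exponents form an initial segment.\<close>
    have lower: "algebraic_int (\<gamma> ^ i * a)" if "i \<le> Suc n" for i
      using ord(1)[of a "Suc n"] ord(1)[of a i] a that by (cases "a = 0") (simp_all del: power_Suc)
    obtain p where p: "p \<in> P" "\<gamma> * p \<notin> P" using exists_uniformizer by blast
    obtain k where k: "0 < k" "1 - (\<gamma> * p) ^ k \<in> P" using unit_mod_P[OF \<gamma>_P[OF p(1)] p(2)] by blast
    define c where "c = (\<gamma> * p) ^ (k - 1)"
    have c: "algebraic_int c" unfolding c_def by (intro algebraic_int_power \<gamma>_P p)
    have ck: "c * (\<gamma> * p) = (\<gamma> * p) ^ k" unfolding c_def by (rule power_minus_mult[OF k(1)])
    have "a = p * (c * (\<gamma> * a)) + (1 - (\<gamma> * p) ^ k) * a"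
      unfolding ck[symmetric] by (simp add: algebra_simps)
    moreover have "\<gamma> ^ n * (c * (\<gamma> * a)) = c * (\<gamma> ^ Suc n * a)" by simp
    then have "algebraic_int (\<gamma> ^ n * (c * (\<gamma> * a)))"
      using algebraic_int_mult[OF c, of "\<gamma> ^ Suc n * a"] a by (metis mem_Collect_eq)
    then have "c * (\<gamma> * a) \<in> ?Q" using algebraic_int_mult[OF c, of "\<gamma> * a"] lower[of 1] by simp
    moreover have "a \<in> ?Q" using a lower by auto
    ultimately show "a \<in> ideal_prod O_ring P ?Q"
      using ideal_prod.sum[OF ideal_prod.prod[OF p(1), of "c * (\<gamma> * a)" ?Q O_ring] ideal_prod.prod[OF k(2), of a ?Q O_ring]]
      unfolding mult_O_ring add_O_ring by metis
  qed
  then show ?case using Suc by simp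
qed simp

lemma int_ord_eq:
  assumes a: "algebraic_int a" "a \<noteq> 0"
  shows "int_ord P a = ord a"
  unfolding int_ord_def ideal_power using a ord(1)[OF a]
  by (intro Greatest_equality) auto

lemma fraction: "\<exists>a b. algebraic_int a \<and> algebraic_int b \<and> b \<noteq> 0 \<and> (x::'k) = a / b"
proof -
  obtain n where "n > 0" "algebraic_int (of_nat n * x)" using exists_nat_mult_algebraic_int by blast
  then show ?thesis by (intro exI[of _ "of_nat n * x"] exI[of _ "of_nat n"]) auto
qed

text \<open>Additivity of \<open>ord\<close> makes the value independent of the chosen fraction, so
  the definite description is met by exactly one number.\<close>

lemma prime_ord_divide:
  assumes a: "algebraic_int a" "a \<noteq> 0" and b: "algebraic_int b" "b \<noteq> 0"
  shows "prime_ord P (a / b) = int (ord a) - int (ord b)"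
  unfolding prime_ord_def
proof (rule the_equality)
  show "\<exists>c\<in>carrier O_ring - {0}. \<exists>d\<in>carrier O_ring - {0}.
      a / b = c / d \<and> int (ord a) - int (ord b) = int (int_ord P c) - int (int_ord P d)"
    by (rule bexI[of _ a], rule bexI[of _ b]) (use a b int_ord_eq in simp_all)
next
  fix z
  assume "\<exists>c\<in>carrier O_ring - {0}. \<exists>d\<in>carrier O_ring - {0}.
      a / b = c / d \<and> z = int (int_ord P c) - int (int_ord P d)"
  then obtain c d where cd: "algebraic_int c" "c \<noteq> 0" "algebraic_int d" "d \<noteq> 0" "a / b = c / d"
      "z = int (ord c) - int (ord d)" using int_ord_eq by auto
  then have "a * d = c * b" using b by (simp add: field_simps)
  then have "ord a + ord d = ord c + ord b" using ord_mult a b cd by metis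
  then show "z = int (ord a) - int (ord b)" using cd by simp
qed

lemma prime_abs_divide:
  assumes "algebraic_int a" "a \<noteq> 0" "algebraic_int b" "b \<noteq> 0"
  shows "prime_abs P (a / b) = exp (real (ord b) - real (ord a))"
  using assms by (simp add: prime_abs_def prime_ord_divide)

lemma prime_abs_int:
  assumes "algebraic_int a" "a \<noteq> 0"
  shows "prime_abs P a = exp (- real (ord a))"
proof -
  have "ord 1 = 0" using ord_0_iff[OF algebraic_int_1 one_neq_zero] P_one by blast
  then show ?thesis using prime_abs_divide[OF assms algebraic_int_1 one_neq_zero] by simp
qed

lemma prime_abs_nonneg: "0 \<le> prime_abs P x" and prime_abs_0: "prime_abs P 0 = 0"
  and prime_abs_eq_0: "prime_abs P x = 0 \<longleftrightarrow> x = 0"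
  by (simp_all add: prime_abs_def)

text \<open>Over a common denominator the inequality is \<open>ord_add\<close> for the
  numerators.\<close>

lemma prime_abs_add: "prime_abs P (x + y) \<le> max (prime_abs P x) (prime_abs P y)"
proof (cases "x = 0 \<or> y = 0 \<or> x + y = 0")
  case True
  then consider "x = 0" | "y = 0" | "x + y = 0" by blast
  then show ?thesis
  proof cases
    case 3
    show ?thesis unfolding 3 prime_abs_0 using prime_abs_nonneg[of x] by linarith
  qed simp_all
next
  case False
  obtain a b where 1: "algebraic_int a" "algebraic_int b" "b \<noteq> 0" "x = a / b" using fraction[of x] by blast
  obtain c d where 2: "algebraic_int c" "algebraic_int d" "d \<noteq> 0" "y = c / d" using fraction[of y] by blast
  define a' c' e where "a' = a * d" and "c' = c * b" and "e = b * d"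
  have i: "algebraic_int a'" "algebraic_int c'" "algebraic_int e"
    unfolding a'_def c'_def e_def
    by (rule algebraic_int_mult[OF 1(1) 2(2)], rule algebraic_int_mult[OF 2(1) 1(2)], rule algebraic_int_mult[OF 1(2) 2(2)])
  have eq1: "x = a' / e" "y = c' / e"
    unfolding a'_def c'_def e_def using 1 2 by simp_all
  then have eq: "x = a' / e" "y = c' / e" "x + y = (a' + c') / e" by (simp_all add: add_divide_distrib)
  have nz: "a' \<noteq> 0" "c' \<noteq> 0" "a' + c' \<noteq> 0" "e \<noteq> 0"
    using False eq 1 2 by (metis div_0, metis div_0, metis div_0, simp add: e_def)
  have "min (ord a') (ord c') \<le> ord (a' + c')" by (rule ord_add[OF i(1) nz(1) i(2) nz(2) nz(3)])
  then have "ord a' \<le> ord (a' + c') \<or> ord c' \<le> ord (a' + c')" by linarith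
  then have "prime_abs P ((a' + c') / e) \<le> prime_abs P (a' / e) \<or> prime_abs P ((a' + c') / e) \<le> prime_abs P (c' / e)"
    using prime_abs_divide[OF algebraic_int_add[OF i(1,2)] nz(3) i(3) nz(4)]
      prime_abs_divide[OF i(1) nz(1) i(3) nz(4)] prime_abs_divide[OF i(2) nz(2) i(3) nz(4)] by simp
  then show ?thesis unfolding eq(3)[symmetric] eq1[symmetric] by linarith
qed

lemma prime_abs_mult: "prime_abs P (x * y) = prime_abs P x * prime_abs P y"
proof (cases "x = 0 \<or> y = 0")
  case True
  then show ?thesis
  proof
    assume "x = 0"
    then show ?thesis by (simp add: prime_abs_0)
  next
    assume "y = 0"
    then show ?thesis by (simp add: prime_abs_0)
  qed
next
  case False
  obtain a b where 1: "algebraic_int a" "algebraic_int b" "b \<noteq> 0" "x = a / b" using fraction[of x] by blast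
  obtain c d where 2: "algebraic_int c" "algebraic_int d" "d \<noteq> 0" "y = c / d" using fraction[of y] by blast
  have nz: "a \<noteq> 0" "c \<noteq> 0" using False 1 2 by auto
  have "x * y = (a * c) / (b * d)" using 1 2 by simp
  also have "prime_abs P \<dots> = exp (real (ord (b * d)) - real (ord (a * c)))"
    by (rule prime_abs_divide) (use 1 2 nz in \<open>simp_all add: algebraic_int_mult\<close>)
  also have "\<dots> = exp (real (ord b) - real (ord a)) * exp (real (ord d) - real (ord c))"
    using 1 2 nz by (simp add: ord_mult flip: exp_add)
  finally show ?thesis using 1 2 nz by (simp add: prime_abs_divide)
qed

sublocale abs_value "prime_abs P"
proof
  show "prime_abs P (x + y) \<le> prime_abs P x + prime_abs P y" for x y
    using prime_abs_add[of x y] prime_abs_nonneg[of x] prime_abs_nonneg[of y] by linarith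
qed (fact prime_abs_nonneg prime_abs_eq_0 prime_abs_mult)+

lemma prime_abs_int_le_1: "algebraic_int a \<Longrightarrow> prime_abs P a \<le> 1"
  by (cases "a = 0") (auto simp: prime_abs_int)

lemma prime_abs_lt_1_iff: "algebraic_int a \<Longrightarrow> prime_abs P a < 1 \<longleftrightarrow> a \<in> P"
  using ord_0_iff[of a] P_zero by (cases "a = 0") (auto simp: prime_abs_int)

text \<open>The valuation ring is the localization of \<open>O\<close> at \<open>P\<close>: for
  \<open>x = a / b\<close> the element \<open>\<gamma> ^ ord b * b\<close> is integral, lies outside
  \<open>P\<close> and multiplies \<open>x\<close> into \<open>O\<close>.\<close>

lemma prime_abs_le_1E:
  assumes "prime_abs P x \<le> 1"
  shows "\<exists>s. algebraic_int s \<and> prime_abs P s = 1 \<and> algebraic_int (s * x)"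
proof (cases "x = 0")
  case True
  then show ?thesis by (intro exI[of _ 1]) auto
next
  case False
  obtain a b where *: "algebraic_int a" "algebraic_int b" "b \<noteq> 0" "x = a / b" using fraction by metis
  with False have "a \<noteq> 0" by auto
  then have le: "ord b \<le> ord a" using assms * by (simp add: prime_abs_divide)
  define s where "s = \<gamma> ^ ord b * b"
  have s: "algebraic_int s" "s \<notin> P" unfolding s_def using ord[OF *(2,3)] by auto
  moreover have "s * x = \<gamma> ^ ord b * a" using * by (simp add: s_def)
  then have "algebraic_int (s * x)" using ord(1)[OF *(1) \<open>a \<noteq> 0\<close>] le by simp
  moreover have "prime_abs P s = 1"
    using prime_abs_lt_1_iff[OF s(1)] prime_abs_int_le_1[OF s(1)] s(2) by linarith
  ultimately show ?thesis by blast
qed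

text \<open>Discreteness of the value group; it is what makes a maximum over a fractional ideal
  attained later.\<close>

lemma prime_abs_value: "x \<noteq> 0 \<Longrightarrow> \<exists>n::int. prime_abs P x = exp (of_int n)"
  by (auto simp: prime_abs_def intro: exI[of _ "- prime_ord P x"])

end

section \<open>Finite places: approximation by integers\<close>

context number_field_type
begin

lemma finite_placeE:
  assumes "v \<in> (finite_places :: 'k place set)"
  obtains P where "integer_prime P" "v = prime_abs P"
proof -
  obtain P where P: "primeideal P O_ring" "P \<noteq> {0}" "v = prime_abs P"
    using assms unfolding finite_places_def by blast
  have "integer_prime P" by (intro integer_prime.intro number_field_type_axioms integer_prime_axioms.intro P)
  then show ?thesis using that P(3) by blast
qed

context
  fixes v :: "'k place"
  assumes v: "v \<in> finite_places"
begin

lemma finite_place_abs_value: "abs_value v"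
proof -
  obtain P where "integer_prime P" "v = prime_abs P" using finite_placeE[OF v] .
  then interpret integer_prime K P by simp
  show ?thesis unfolding \<open>v = _\<close> by (rule abs_value_axioms)
qed

lemma finite_place_ultrametric: "v (x + y) \<le> max (v x) (v y)"
  using finite_placeE[OF v] integer_prime.prime_abs_add by metis

lemma finite_place_int_le_1: "algebraic_int a \<Longrightarrow> v a \<le> 1"
  using finite_placeE[OF v] integer_prime.prime_abs_int_le_1 by metis

lemma finite_place_le_1E: "v x \<le> 1 \<Longrightarrow> \<exists>s. algebraic_int s \<and> v s = 1 \<and> algebraic_int (s * x)"
  using finite_placeE[OF v] integer_prime.prime_abs_le_1E by metis

lemma finite_place_value: "x \<noteq> 0 \<Longrightarrow> \<exists>n::int. v x = exp (of_int n)"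
  using finite_placeE[OF v] integer_prime.prime_abs_value by metis

lemma finite_place_lt_1_exists: "\<exists>a. algebraic_int a \<and> a \<noteq> 0 \<and> v a < 1"
proof -
  obtain P where P: "integer_prime P" "v = prime_abs P" using finite_placeE[OF v] .
  then interpret integer_prime K P by simp
  show ?thesis using exists_P P_int prime_abs_lt_1_iff P(2) by blast
qed

text \<open>A prime ideal is recovered from its absolute value as the set of integers with value
  below 1.\<close>

lemma finite_place_determined:
  assumes w: "w \<in> finite_places" and eq: "\<And>a. algebraic_int a \<Longrightarrow> v a < 1 \<longleftrightarrow> w a < 1"
  shows "v = w"
proof -
  obtain P where P: "integer_prime P" "v = prime_abs P" using finite_placeE[OF v] .
  obtain Q where Q: "integer_prime Q" "w = prime_abs Q" using finite_placeE[OF w] .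
  have "a \<in> P \<longleftrightarrow> a \<in> Q" for a
    using eq[of a] P Q integer_prime.prime_abs_lt_1_iff integer_prime.P_int by metis
  then have "P = Q" by blast
  then show ?thesis using P Q by simp
qed

lemma finite_place_ultrametric_diff: "v (x - y) \<le> max (v x) (v y)"
  using finite_place_ultrametric[of x "- y"] abs_value.minus[OF finite_place_abs_value, of y] by simp

text \<open>Pigeonhole modulo a power of \<open>a\<close> that is smaller than
  \<open>\<epsilon>\<close> at \<open>v\<close>; the factor \<open>b ^ i\<close> has absolute value
  1 there and drops out.\<close>

lemma finite_place_unit_power:
  assumes b: "algebraic_int b" "v b = 1" and \<epsilon>: "0 < \<epsilon>"
  shows "\<exists>k>0. v (1 - b ^ k) < \<epsilon>"
proof -
  interpret abs_value v by (rule finite_place_abs_value)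
  obtain a where a: "algebraic_int a" "a \<noteq> 0" "v a < 1" using finite_place_lt_1_exists by blast
  obtain n where n: "v a ^ n < \<epsilon>" using real_arch_pow_inv[OF \<epsilon> a(3)] by blast
  obtain i k where ik: "0 < k" "algebraic_int (b ^ i * (1 - b ^ k) / a ^ n)"
    using power_pigeonhole[OF algebraic_int_power[OF a(1)] _ b(1), of n] a(2) by auto
  have "v (b ^ i * (1 - b ^ k) / a ^ n) \<le> 1" by (rule finite_place_int_le_1[OF ik(2)])
  then have "v (1 - b ^ k) \<le> v a ^ n"
    using a(2) b(2) pos_iff[of a] by (simp add: divide mult power)
  then show ?thesis using n ik(1) by (intro exI[of _ k]) simp
qed

text \<open>With \<open>s * x\<close> integral and \<open>v s = 1\<close>, the power
  \<open>s ^ (k - 1)\<close> is an integral approximate inverse of \<open>s\<close>.\<close>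

lemma finite_place_integers_dense:
  assumes x: "v x \<le> 1" and \<epsilon>: "0 < \<epsilon>"
  shows "\<exists>a. algebraic_int a \<and> v (x - a) < \<epsilon>"
proof -
  interpret abs_value v by (rule finite_place_abs_value)
  obtain s where s: "algebraic_int s" "v s = 1" "algebraic_int (s * x)" using finite_place_le_1E[OF x] by blast
  obtain k where k: "k > 0" "v (1 - s ^ k) < \<epsilon>" using finite_place_unit_power[OF s(1,2) \<epsilon>] by blast
  define a where "a = s ^ (k - 1) * (s * x)"
  have "s ^ (k - 1) * s = s ^ k" by (rule power_minus_mult[OF k(1)])
  then have "x - a = x * (1 - s ^ k)" unfolding a_def by (simp add: algebra_simps)
  then have "v (x - a) = v x * v (1 - s ^ k)" by (simp add: mult)
  also have "\<dots> \<le> 1 * v (1 - s ^ k)" by (intro mult_right_mono x) simp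
  finally have "v (x - a) < \<epsilon>" using k(2) by simp
  moreover have "algebraic_int a" unfolding a_def by (intro algebraic_int_mult[OF _ s(3)] algebraic_int_power s)
  ultimately show ?thesis by blast
qed

text \<open>Two different natural numbers are congruent modulo an integer that is below 1 at
  \<open>v\<close>.\<close>

lemma finite_place_nat_lt_1: "\<exists>p>0. v (of_nat p) < 1"
proof -
  interpret abs_value v by (rule finite_place_abs_value)
  obtain a where a: "algebraic_int a" "a \<noteq> 0" "v a < 1" using finite_place_lt_1_exists by blast
  obtain i j where ij: "i < j" "algebraic_int ((of_nat i - of_nat j) / a)"
    using integer_sequence_pigeonhole[OF a(1,2), of of_nat] by auto
  have "v (of_nat i - of_nat j) = v ((of_nat i - of_nat j) / a) * v a" using a by (simp add: divide)
  also have "\<dots> \<le> 1 * v a" by (intro mult_right_mono finite_place_int_le_1 ij) simp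
  finally have "v (of_nat i - of_nat j) < 1" using a by simp
  then show ?thesis
    using ij by (intro exI[of _ "j - i"]) (simp add: of_nat_diff diff_commute[of "of_nat j"])
qed

end

text \<open>A place with \<open>v a < 1\<close> is determined by the representatives modulo
  \<open>a\<close> on which it is below 1, so these places inject into the subsets of
  \<open>T\<close>.\<close>

lemma finite_places_above: 
  assumes a: "algebraic_int a" "a \<noteq> (0::'k)"
  shows "finite {v \<in> finite_places. v a < 1}"
proof -
  obtain T where T: "finite T" "\<And>b. algebraic_int b \<Longrightarrow> \<exists>t\<in>T. algebraic_int ((b - t) / a)" "\<And>t. t \<in> T \<Longrightarrow> algebraic_int t"
    using finite_index[OF a] by blast
  have eq: "v b < 1 \<longleftrightarrow> v t < 1" if "v \<in> finite_places" "v a < 1" "algebraic_int ((b - t) / a)" for v b t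
  proof -
    interpret abs_value v by (rule finite_place_abs_value[OF that(1)])
    have "v (b - t) = v ((b - t) / a) * v a" using a by (simp add: divide)
    also have "\<dots> \<le> 1 * v a" by (intro mult_right_mono finite_place_int_le_1 that) simp
    finally have "v (b - t) < 1" using that by simp
    then show ?thesis
      using finite_place_ultrametric[OF that(1), of "b - t" t] finite_place_ultrametric_diff[OF that(1), of b "b - t"]
      by auto
  qed
  have "inj_on (\<lambda>v. {t \<in> T. v t < 1}) {v \<in> finite_places. v a < 1}"
  proof (rule inj_onI)
    fix v w assume v: "v \<in> {v \<in> finite_places. v a < 1}" and w: "w \<in> {v \<in> finite_places. v a < 1}"
      and vw: "{t \<in> T. v t < 1} = {t \<in> T. w t < 1}"
    show "v = w"
    proof (rule finite_place_determined)
      fix b :: 'k assume "algebraic_int b"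
      then obtain t where t: "t \<in> T" "algebraic_int ((b - t) / a)" using T by blast
      then have "v t < 1 \<longleftrightarrow> w t < 1" using vw by blast
      then show "v b < 1 \<longleftrightarrow> w b < 1" using eq[of v b t] eq[of w b t] v w t by blast
    qed (use v w in auto)
  qed
  then show ?thesis by (rule inj_on_finite[of _ _ "Pow T"]) (use T(1) in auto)
qed

text \<open>If the denominators of \<open>x\<close> formed a proper ideal, a prime ideal would
  contain it; but at the place of that prime \<open>x\<close> has a denominator of absolute value
  1.\<close>

lemma algebraic_int_iff_finite_places: "algebraic_int x \<longleftrightarrow> (\<forall>v\<in>finite_places. v (x::'k) \<le> 1)"
proof
  assume x: "\<forall>v\<in>finite_places. v x \<le> 1"
  define I where "I = {s. algebraic_int s \<and> algebraic_int (s * x)}"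
  have I: "integral_ideal I"
    by (rule integral_idealI)
      (auto simp: I_def distrib_right mult.assoc intro: algebraic_int_add algebraic_int_mult)
  obtain n where n: "n > 0" "algebraic_int (of_nat n * x)" using exists_nat_mult_algebraic_int by blast
  then have "of_nat n \<in> I" "of_nat n \<noteq> (0::'k)" by (auto simp: I_def)
  have "1 \<in> I"
  proof (rule ccontr)
    assume "1 \<notin> I"
    then obtain P where P: "primeideal P O_ring" "I \<subseteq> P"
      using exists_prime_above[OF I \<open>of_nat n \<in> I\<close> \<open>of_nat n \<noteq> 0\<close>] by blast
    then have "P \<noteq> {0}" using \<open>of_nat n \<in> I\<close> \<open>of_nat n \<noteq> (0::'k)\<close> by blast
    then interpret integer_prime K P
      by (intro integer_prime.intro number_field_type_axioms integer_prime_axioms.intro P)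
    have v: "prime_abs P \<in> finite_places" unfolding finite_places_def using primeideal nonzero by blast
    then obtain s where s: "algebraic_int s" "prime_abs P s = 1" "algebraic_int (s * x)"
      using finite_place_le_1E x by blast
    then have "s \<in> P" using P(2) by (auto simp: I_def)
    then show False using prime_abs_lt_1_iff[OF s(1)] s(2) by simp
  qed
  then show "algebraic_int x" by (simp add: I_def)
qed (use finite_place_int_le_1 in blast)

text \<open>A product of elements that are units at \<open>v\<close> and below 1 at one
  \<open>w\<close> each is raised to a power \<open>n\<close>, to become small on
  \<open>S - {v}\<close>, and then to a power \<open>k\<close> that brings it close to 1 at
  \<open>v\<close>.\<close>

lemma finite_places_isolate:
  assumes S: "finite S" "S \<subseteq> finite_places" and v: "v \<in> finite_places" and \<epsilon>: "0 < \<epsilon>"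
  shows "\<exists>e::'k. algebraic_int e \<and> v (1 - e) < \<epsilon> \<and> (\<forall>w\<in>S - {v}. w e < \<epsilon>)"
proof -
  interpret v: abs_value v by (rule finite_place_abs_value[OF v])
  have "\<exists>y::'k. algebraic_int y \<and> v y = 1 \<and> w y < 1" if w: "w \<in> finite_places" "w \<noteq> v" for w
  proof -
    obtain a where a: "algebraic_int a" "v a < 1 \<longleftrightarrow> \<not> w a < 1"
      using finite_place_determined[OF v w(1)] w(2) by blast
    show ?thesis
    proof (cases "w a < 1")
      case True
      then have "v a = 1" using a finite_place_int_le_1[OF v a(1)] by simp
      then show ?thesis using True a by blast
    next
      case False
      then have "w a = 1" "v a < 1" using a finite_place_int_le_1[OF w(1) a(1)] by auto
      \<comment> \<open>Here \<open>a\<close> separates the two places the wrong way round;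
        \<open>1 - a ^ k\<close> is below 1 at \<open>w\<close> and, by the ultrametric inequality,
        a unit at \<open>v\<close>.\<close>
      then obtain k where k: "k > 0" "w (1 - a ^ k) < 1" using finite_place_unit_power[OF w(1) a(1), of 1] by auto
      have i: "algebraic_int (1 - a ^ k)" by (intro algebraic_int_diff algebraic_int_power a algebraic_int_1)
      have "v a ^ k < 1" using k(1) \<open>v a < 1\<close> by (simp add: power_less_one_iff)
      moreover have "v ((1 - a ^ k) + a ^ k) \<le> max (v (1 - a ^ k)) (v (a ^ k))" by (rule finite_place_ultrametric[OF v])
      ultimately have "v (1 - a ^ k) = 1" using finite_place_int_le_1[OF v i] by (simp add: v.power)
      then show ?thesis using k i by blast
    qed
  qed
  then obtain y where y: "\<And>w. w \<in> finite_places \<Longrightarrow> w \<noteq> v \<Longrightarrow> algebraic_int (y w :: 'k) \<and> v (y w) = 1 \<and> w (y w) < 1"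
    by metis
  define z where "z = (\<Prod>w\<in>S - {v}. y w)"
  have zi: "algebraic_int z" unfolding z_def using y S by (intro algebraic_int_prod) auto
  have vprod: "u (prod f A) = (\<Prod>i\<in>A. u (f i))" if "abs_value u" for u :: "'k place" and f :: "'k place \<Rightarrow> 'k" and A
    by (induction A rule: infinite_finite_induct)
      (auto simp: abs_value.mult[OF that] abs_value.one[OF that])
  have vz: "v z = 1" unfolding z_def vprod[OF v.abs_value_axioms] using y S by (intro prod.neutral) auto
  have wz: "w z < 1" if w: "w \<in> S - {v}" for w
  proof -
    have wf: "w \<in> finite_places" using w S by auto
    interpret w: abs_value w by (rule finite_place_abs_value[OF wf])
    have "w z = w (y w) * (\<Prod>u\<in>S - {v} - {w}. w (y u))"
      unfolding z_def vprod[OF w.abs_value_axioms] using S w by (intro prod.remove) auto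
    also have "\<dots> \<le> w (y w) * 1"
      using y S w finite_place_int_le_1[OF wf] by (intro mult_left_mono prod_le_1) auto
    finally show ?thesis using y[OF wf] w by auto
  qed
  have "\<forall>\<^sub>F n in sequentially. w z ^ n < \<epsilon>" if w: "w \<in> S - {v}" for w
  proof -
    have "0 \<le> w z" using w S finite_place_abs_value by (auto intro: abs_value.nonneg)
    then have "(\<lambda>n. w z ^ n) \<longlonglongrightarrow> 0" using wz[OF w] by (intro LIMSEQ_realpow_zero) auto
    then show ?thesis using \<epsilon> by (rule order_tendstoD(2))
  qed
  then have "\<forall>\<^sub>F n in sequentially. \<forall>w\<in>S - {v}. w z ^ n < \<epsilon>"
    using S(1) by (intro eventually_ball_finite) auto
  then obtain n where n: "\<forall>w\<in>S - {v}. w z ^ n < \<epsilon>" by (auto simp: eventually_sequentially)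
  obtain k where k: "k > 0" "v (1 - (z ^ n) ^ k) < \<epsilon>"
    using finite_place_unit_power[OF v algebraic_int_power[OF zi] _ \<epsilon>, of n] vz by (auto simp: v.power)
  have "w ((z ^ n) ^ k) < \<epsilon>" if w: "w \<in> S - {v}" for w
  proof -
    have wf: "w \<in> finite_places" using w S by auto
    interpret w: abs_value w by (rule finite_place_abs_value[OF wf])
    have "(w z ^ n) ^ k \<le> (w z ^ n) ^ 1" using k(1) wz[OF w] by (intro power_decreasing) (auto intro: power_le_one)
    then have "(w z ^ n) ^ k < \<epsilon>" using bspec[OF n w] by simp
    then show ?thesis by (simp add: w.power)
  qed
  moreover have "algebraic_int ((z ^ n) ^ k)" by (intro algebraic_int_power zi)
  ultimately show ?thesis using k(2) by blast
qed

text \<open>The ultrametric inequality keeps a sum below the bound for its terms, and the integral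
  factors \<open>y w\<close> do not enlarge them; so the isolating elements are used with the same
  \<open>\<epsilon>\<close>.\<close>

lemma chinese_remainder:
  assumes S: "finite S" "S \<subseteq> finite_places" and y: "\<And>v. v \<in> S \<Longrightarrow> algebraic_int (y v :: 'k)" and \<epsilon>: "0 < \<epsilon>"
  shows "\<exists>a. algebraic_int a \<and> (\<forall>v\<in>S. v (a - y v) < \<epsilon>)"
proof -
  obtain e where e: "\<And>v. v \<in> S \<Longrightarrow> algebraic_int (e v :: 'k) \<and> v (1 - e v) < \<epsilon> \<and> (\<forall>w\<in>S - {v}. w (e v) < \<epsilon>)"
    using finite_places_isolate[OF S _ \<epsilon>] S(2) by (metis subsetD)
  define a where "a = (\<Sum>v\<in>S. y v * e v)"
  have "v (a - y v) < \<epsilon>" if v: "v \<in> S" for v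
  proof -
    have vf: "v \<in> finite_places" using v S by auto
    interpret abs_value v by (rule finite_place_abs_value[OF vf])
    have sm: "v (sum f A) < \<epsilon>" if "finite A" "\<And>i. i \<in> A \<Longrightarrow> v (f i) < \<epsilon>" for f :: "'k place \<Rightarrow> 'k" and A
      using that
    proof (induction A rule: finite_induct)
      case (insert i A)
      have "v (f i) < \<epsilon>" "v (sum f A) < \<epsilon>" using insert by simp_all
      then show ?case using finite_place_ultrametric[OF vf, of "f i" "sum f A"] insert.hyps by simp
    qed (simp add: \<epsilon>)
    have "a - y v = (\<Sum>w\<in>S. y w * (if w = v then e w - 1 else e w))"
      unfolding a_def by (simp add: sum.remove[OF S(1) v] algebra_simps)
    also have "v \<dots> < \<epsilon>"
    proof (rule sm[OF S(1)])
      fix w assume w: "w \<in> S"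
      have "v (if w = v then e w - 1 else e w) < \<epsilon>"
        using e[OF v] e[OF w] v diff_commute[of 1 "e v"] by auto
      moreover have "v (y w) \<le> 1" by (rule finite_place_int_le_1[OF vf y[OF w]])
      then have "v (y w) * v (if w = v then e w - 1 else e w) \<le> 1 * v (if w = v then e w - 1 else e w)"
        by (intro mult_right_mono) simp_all
      ultimately show "v (y w * (if w = v then e w - 1 else e w)) < \<epsilon>" unfolding mult by linarith
    qed
    finally show ?thesis .
  qed
  moreover have "algebraic_int a" unfolding a_def using e y by (intro algebraic_int_sum algebraic_int_mult) auto
  ultimately show ?thesis by blast
qed

text \<open>A sequence that is cofinal for divisibility and tends to zero at every finite place.\<close>

definition superfact :: "nat \<Rightarrow> nat" where
  "superfact m = fact m ^ m"

lemma superfact_pos: "superfact m > 0"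
  by (simp add: superfact_def)

lemma superfact_dvd: "m \<le> n \<Longrightarrow> superfact m dvd superfact n"
  unfolding superfact_def by (meson dvd_power_same dvd_trans fact_dvd le_imp_power_dvd)

lemma dvd_superfact: "0 < n \<Longrightarrow> n \<le> m \<Longrightarrow> n dvd superfact m"
  unfolding superfact_def by (metis dvd_fact dvd_power dvd_trans le_zero_eq not_gr_zero Suc_leI One_nat_def)

lemma superfact_tendsto_0:
  assumes v: "v \<in> finite_places"
  shows "(\<lambda>m. v (of_nat (superfact m) :: 'k)) \<longlonglongrightarrow> 0"
proof -
  interpret abs_value v by (rule finite_place_abs_value[OF v])
  obtain p where p: "p > 0" "v (of_nat p) < 1" using finite_place_nat_lt_1[OF v] by blast
  have "\<forall>\<^sub>F m in sequentially. norm (v (of_nat (superfact m))) \<le> v (of_nat p) ^ m"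
    using eventually_ge_at_top[of p]
  proof eventually_elim
    case (elim m)
    \<comment> \<open>From \<open>m = p\<close> on the factorial is divisible by \<open>p\<close>,
      and the exponent \<open>m\<close> in \<open>superfact\<close> turns this into the bound by the
      \<open>m\<close>-th power of \<open>v p\<close>.\<close>
    then have "p dvd fact m" using p by (simp add: dvd_fact)
    then obtain q where q: "fact m = p * q" by auto
    have "v (of_nat (fact m)) = v (of_nat p) * v (of_nat q)" unfolding q by (simp add: mult)
    also have "\<dots> \<le> v (of_nat p) * 1" by (intro mult_left_mono finite_place_int_le_1[OF v]) simp_all
    finally have "v (of_nat (fact m)) ^ m \<le> v (of_nat p) ^ m" by (intro power_mono) simp_all
    then show ?case unfolding superfact_def of_nat_power power by simp
  qed
  moreover have "(\<lambda>m. v (of_nat p) ^ m) \<longlonglongrightarrow> 0" using p by (intro LIMSEQ_realpow_zero) auto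
  ultimately show ?thesis by (rule Lim_null_comparison)
qed

end

section \<open>Completions\<close>

context abs_value
begin

abbreviation CR :: "(nat \<Rightarrow> 'k) ring" where "CR \<equiv> Cauchy_ring v"

abbreviation KK :: "'k completion ring" where "KK \<equiv> completion v"

lemma Cauchy_ring_simps [simp]:
  "s \<otimes>\<^bsub>CR\<^esub> t = (\<lambda>n. s n * t n)" "s \<oplus>\<^bsub>CR\<^esub> t = (\<lambda>n. s n + t n)"
  "\<one>\<^bsub>CR\<^esub> = (\<lambda>n. 1)" "\<zero>\<^bsub>CR\<^esub> = (\<lambda>n. 0)"
  by (simp_all add: Cauchy_ring_def)

lemma Cauchy_ring_carrier:
  "s \<in> carrier CR \<longleftrightarrow> (\<forall>e>0. \<exists>N. \<forall>m\<ge>N. \<forall>n\<ge>N. v (s m - s n) < e)"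
  by (simp add: Cauchy_ring_def)

lemma Cauchy_ringD:
  assumes "s \<in> carrier CR" "0 < e"
  obtains N where "\<And>m n. N \<le> m \<Longrightarrow> N \<le> n \<Longrightarrow> v (s m - s n) < e"
  using assms unfolding Cauchy_ring_carrier by blast

lemma Cauchy_const: "(\<lambda>n. x) \<in> carrier CR"
  by (simp add: Cauchy_ring_carrier)

lemma Cauchy_add:
  assumes s: "s \<in> carrier CR" and t: "t \<in> carrier CR"
  shows "(\<lambda>n. s n + t n) \<in> carrier CR"
  unfolding Cauchy_ring_carrier
proof (intro allI impI)
  fix e :: real assume "0 < e"
  then have e: "0 < e / 2" by simp
  obtain N where N: "\<And>m n. N \<le> m \<Longrightarrow> N \<le> n \<Longrightarrow> v (s m - s n) < e / 2" using Cauchy_ringD[OF s e] by metis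
  obtain M where M: "\<And>m n. M \<le> m \<Longrightarrow> M \<le> n \<Longrightarrow> v (t m - t n) < e / 2" using Cauchy_ringD[OF t e] by metis
  have "v (s m + t m - (s n + t n)) < e" if "max N M \<le> m" "max N M \<le> n" for m n
    using N[of m n] M[of m n] that triangle[of "s m - s n" "t m - t n"] by (simp add: algebra_simps)
  then show "\<exists>N. \<forall>m\<ge>N. \<forall>n\<ge>N. v (s m + t m - (s n + t n)) < e" by blast
qed

lemma Cauchy_minus: "s \<in> carrier CR \<Longrightarrow> (\<lambda>n. - s n) \<in> carrier CR"
  unfolding Cauchy_ring_carrier by (simp add: diff_commute[of "- _"] algebra_simps) (metis diff_commute)

lemma Cauchy_bounded:
  assumes "s \<in> carrier CR"
  shows "\<exists>B>0. \<forall>n. v (s n) \<le> B"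
proof -
  obtain N where N: "\<And>m n. N \<le> m \<Longrightarrow> N \<le> n \<Longrightarrow> v (s m - s n) < 1" using Cauchy_ringD[OF assms, of 1] by auto
  define B where "B = (\<Sum>i\<le>N. v (s i)) + 1"
  have "v (s n) \<le> B" for n
  proof (cases "n \<le> N")
    case True
    have "v (s n) \<le> (\<Sum>i\<le>N. v (s i))" using True by (intro member_le_sum) auto
    then show ?thesis by (simp add: B_def)
  next
    case False
    have "v (s N) \<le> (\<Sum>i\<le>N. v (s i))" by (intro member_le_sum) auto
    moreover have "v (s n) \<le> v (s n - s N) + v (s N)" using triangle[of "s n - s N" "s N"] by simp
    ultimately show ?thesis using N[of n N] False by (simp add: B_def)
  qed
  moreover have "B > 0" unfolding B_def by (simp add: add_nonneg_pos sum_nonneg)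
  ultimately show ?thesis by blast
qed

lemma Cauchy_mult:
  assumes s: "s \<in> carrier CR" and t: "t \<in> carrier CR"
  shows "(\<lambda>n. s n * t n) \<in> carrier CR"
  unfolding Cauchy_ring_carrier
proof (intro allI impI)
  fix e :: real assume "0 < e"
  obtain A B where A: "A > 0" "\<And>n. v (s n) \<le> A" and B: "B > 0" "\<And>n. v (t n) \<le> B"
    using Cauchy_bounded s t by metis
  have e: "0 < e / (2 * B)" "0 < e / (2 * A)" using A B \<open>0 < e\<close> by simp_all
  obtain N where N: "\<And>m n. N \<le> m \<Longrightarrow> N \<le> n \<Longrightarrow> v (s m - s n) < e / (2 * B)" using Cauchy_ringD[OF s e(1)] by metis
  obtain M where M: "\<And>m n. M \<le> m \<Longrightarrow> M \<le> n \<Longrightarrow> v (t m - t n) < e / (2 * A)" using Cauchy_ringD[OF t e(2)] by metis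
  have "v (s m * t m - s n * t n) < e" if mn: "max N M \<le> m" "max N M \<le> n" for m n
  proof -
    have "s m * t m - s n * t n = (s m - s n) * t m + s n * (t m - t n)" by (simp add: algebra_simps)
    then have "v (s m * t m - s n * t n) \<le> v (s m - s n) * v (t m) + v (s n) * v (t m - t n)"
      using triangle[of "(s m - s n) * t m" "s n * (t m - t n)"] by (simp add: mult)
    also have "v (s m - s n) * v (t m) \<le> v (s m - s n) * B" by (intro mult_left_mono B) simp
    also have "v (s m - s n) * B < e / (2 * B) * B" using N[of m n] mn B by (intro mult_strict_right_mono) simp_all
    also have "v (s n) * v (t m - t n) \<le> A * v (t m - t n)" by (intro mult_right_mono A) simp
    also have "A * v (t m - t n) < A * (e / (2 * A))" using M[of m n] mn A by (intro mult_strict_left_mono) simp_all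
    finally show ?thesis using A B by (simp add: add_strict_mono)
  qed
  then show "\<exists>N. \<forall>m\<ge>N. \<forall>n\<ge>N. v (s m * t m - s n * t n) < e" by blast
qed

lemma cring_Cauchy_ring: "cring CR"
proof (intro cringI abelian_groupI comm_monoidI)
  fix s assume "s \<in> carrier CR"
  then show "\<exists>t\<in>carrier CR. t \<oplus>\<^bsub>CR\<^esub> s = \<zero>\<^bsub>CR\<^esub>"
    by (intro bexI[of _ "\<lambda>n. - s n"] Cauchy_minus) simp_all
qed (simp_all add: Cauchy_add Cauchy_mult Cauchy_const algebra_simps)

lemma null_ideal_iff: "s \<in> null_ideal v \<longleftrightarrow> s \<in> carrier CR \<and> (\<lambda>n. v (s n)) \<longlonglongrightarrow> 0"
  by (auto simp: null_ideal_def)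

lemma Cauchy_minus_eq: "s \<in> carrier CR \<Longrightarrow> \<ominus>\<^bsub>CR\<^esub> s = (\<lambda>n. - s n)"
proof -
  assume s: "s \<in> carrier CR"
  interpret cring CR by (rule cring_Cauchy_ring)
  show "\<ominus>\<^bsub>CR\<^esub> s = (\<lambda>n. - s n)" by (rule minus_equality[OF _ s Cauchy_minus[OF s]]) simp
qed

lemma ideal_null_ideal: "ideal (null_ideal v) CR"
proof -
  interpret cring CR by (rule cring_Cauchy_ring)
  have m: "(\<lambda>n. v (t n * s n)) \<longlonglongrightarrow> 0" if s: "(\<lambda>n. v (s n)) \<longlonglongrightarrow> 0" and t: "t \<in> carrier CR" for s t
  proof -
    obtain B where B: "B > 0" "\<And>n. v (t n) \<le> B" using Cauchy_bounded t by metis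
    have "(\<lambda>n. B * v (s n)) \<longlonglongrightarrow> 0" using tendsto_mult_right_zero[OF s] .
    moreover have "\<forall>\<^sub>F n in sequentially. norm (v (t n * s n)) \<le> B * v (s n)"
      by (intro always_eventually allI) (simp add: mult mult_right_mono B)
    ultimately show ?thesis by (rule Lim_null_comparison[rotated])
  qed
  show ?thesis
  proof (rule idealI)
    show "ring CR" by (rule ring_axioms)
    show "subgroup (null_ideal v) (add_monoid CR)"
    proof (rule add.subgroupI)
      show "null_ideal v \<noteq> {}" using Cauchy_const[of 0] null_ideal_iff[of "\<lambda>n. 0"] by auto
      fix s t assume s: "s \<in> null_ideal v"
      then show "\<ominus>\<^bsub>CR\<^esub> s \<in> null_ideal v" by (simp add: null_ideal_iff Cauchy_minus_eq Cauchy_minus)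
      assume t: "t \<in> null_ideal v"
      have "(\<lambda>n. v (s n) + v (t n)) \<longlonglongrightarrow> 0 + 0" using s t by (intro tendsto_add) (simp_all add: null_ideal_iff)
      then have "(\<lambda>n. v (s n + t n)) \<longlonglongrightarrow> 0"
        by (intro Lim_null_comparison[of "\<lambda>n. v (s n + t n)" "\<lambda>n. v (s n) + v (t n)"] always_eventually allI) (simp_all add: triangle)
      then show "s \<oplus>\<^bsub>CR\<^esub> t \<in> null_ideal v" using s t by (simp add: null_ideal_iff Cauchy_add)
    qed (auto simp: null_ideal_iff)
    fix s t assume "s \<in> null_ideal v" "t \<in> carrier CR"
    then show "t \<otimes>\<^bsub>CR\<^esub> s \<in> null_ideal v" "s \<otimes>\<^bsub>CR\<^esub> t \<in> null_ideal v"
      using m[of s t] by (simp_all add: null_ideal_iff Cauchy_mult mult.commute)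
  qed
qed

lemma cring_completion: "cring KK"
  unfolding completion_def by (rule ideal.quotient_is_cring[OF ideal_null_ideal cring_Cauchy_ring])

definition cls :: "(nat \<Rightarrow> 'k) \<Rightarrow> 'k completion" where
  "cls s = null_ideal v +>\<^bsub>CR\<^esub> s"

lemma carrier_completion: "carrier KK = cls ` carrier CR"
  unfolding completion_def FactRing_def A_RCOSETS_def' cls_def by auto

lemma cls_in: "s \<in> carrier CR \<Longrightarrow> cls s \<in> carrier KK"
  by (simp add: carrier_completion)

lemma completionE:
  "\<xi> \<in> carrier KK \<Longrightarrow> (\<And>s. s \<in> carrier CR \<Longrightarrow> \<xi> = cls s \<Longrightarrow> Q) \<Longrightarrow> Q"
  by (auto simp: carrier_completion)

lemma cls_add: "s \<in> carrier CR \<Longrightarrow> t \<in> carrier CR \<Longrightarrow> cls s \<oplus>\<^bsub>KK\<^esub> cls t = cls (\<lambda>n. s n + t n)"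
proof -
  assume st: "s \<in> carrier CR" "t \<in> carrier CR"
  interpret ideal "null_ideal v" CR by (rule ideal_null_ideal)
  interpret abelian_subgroup "null_ideal v" CR by (rule abelian_subgroupI3[OF is_additive_subgroup is_abelian_group])
  show ?thesis
    using st a_rcos_sum[OF st] by (simp add: completion_def FactRing_def cls_def)
qed

lemma cls_mult: "s \<in> carrier CR \<Longrightarrow> t \<in> carrier CR \<Longrightarrow> cls s \<otimes>\<^bsub>KK\<^esub> cls t = cls (\<lambda>n. s n * t n)"
  using ideal.rcoset_mult_add[OF ideal_null_ideal, of s t] by (simp add: completion_def FactRing_def cls_def)

lemma cls_one: "\<one>\<^bsub>KK\<^esub> = cls (\<lambda>n. 1)"
  by (simp add: completion_def FactRing_def cls_def)

lemma mem_cls_iff: "s \<in> carrier CR \<Longrightarrow> t \<in> cls s \<longleftrightarrow> t \<in> carrier CR \<and> (\<lambda>n. v (t n - s n)) \<longlonglongrightarrow> 0"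
proof -
  assume s: "s \<in> carrier CR"
  show ?thesis
  proof
    assume "t \<in> cls s"
    then obtain u where u: "u \<in> null_ideal v" "t = (\<lambda>n. u n + s n)"
      unfolding cls_def a_r_coset_def' by auto
    then show "t \<in> carrier CR \<and> (\<lambda>n. v (t n - s n)) \<longlonglongrightarrow> 0"
      using s by (simp add: null_ideal_iff Cauchy_add)
  next
    assume t: "t \<in> carrier CR \<and> (\<lambda>n. v (t n - s n)) \<longlonglongrightarrow> 0"
    then have "(\<lambda>n. t n - s n) \<in> null_ideal v"
      using Cauchy_add[OF _ Cauchy_minus[OF s], of t] by (simp add: null_ideal_iff)
    moreover have "t = (\<lambda>n. t n - s n) \<oplus>\<^bsub>CR\<^esub> s" by simp
    ultimately show "t \<in> cls s" unfolding cls_def a_r_coset_def' by blast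
  qed
qed

lemma cls_zero: "\<zero>\<^bsub>KK\<^esub> = cls (\<lambda>n. 0)"
proof -
  have "null_ideal v = cls (\<lambda>n. 0)" using mem_cls_iff[OF Cauchy_const[of 0]] null_ideal_iff by auto
  then show ?thesis by (simp add: completion_def FactRing_def)
qed

lemma cls_minus: "s \<in> carrier CR \<Longrightarrow> \<ominus>\<^bsub>KK\<^esub> cls s = cls (\<lambda>n. - s n)"
proof -
  assume s: "s \<in> carrier CR"
  interpret cring KK by (rule cring_completion)
  show ?thesis
    using cls_add[OF Cauchy_minus[OF s] s]
    by (intro minus_equality cls_in s Cauchy_minus) (simp add: cls_zero)
qed

lemma cls_diff: "s \<in> carrier CR \<Longrightarrow> t \<in> carrier CR \<Longrightarrow> cls s \<ominus>\<^bsub>KK\<^esub> cls t = cls (\<lambda>n. s n - t n)"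
  using cls_add[OF _ Cauchy_minus, of s t] by (simp add: a_minus_def cls_minus)

lemma Cauchy_diff: "s \<in> carrier CR \<Longrightarrow> t \<in> carrier CR \<Longrightarrow> (\<lambda>n. s n - t n) \<in> carrier CR"
  using Cauchy_add[OF _ Cauchy_minus, of s t] by simp

lemma embed_eq: "embed v x = cls (\<lambda>n. x)"
  by (simp add: embed_def cls_def)

lemma Cauchy_convergent_norm: "s \<in> carrier CR \<Longrightarrow> convergent (\<lambda>n. v (s n))"
proof (rule real_Cauchy_convergent)
  assume s: "s \<in> carrier CR"
  show "Cauchy (\<lambda>n. v (s n))"
  proof (rule metric_CauchyI)
    fix e :: real assume "0 < e"
    obtain N where N: "\<And>m n. N \<le> m \<Longrightarrow> N \<le> n \<Longrightarrow> v (s m - s n) < e" using Cauchy_ringD[OF s \<open>0 < e\<close>] by metis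
    show "\<exists>M. \<forall>m\<ge>M. \<forall>n\<ge>M. dist (v (s m)) (v (s n)) < e"
      using N abs_diff by (metis dist_real_def le_less_trans)
  qed
qed

lemma norm_limit_cong:
  assumes "(\<lambda>n. v (t n - s n)) \<longlonglongrightarrow> 0" "(\<lambda>n. v (s n)) \<longlonglongrightarrow> r"
  shows "(\<lambda>n. v (t n)) \<longlonglongrightarrow> r"
proof -
  have "(\<lambda>n. v (t n) - v (s n)) \<longlonglongrightarrow> 0"
    using assms(1) by (rule Lim_null_comparison[rotated]) (simp add: abs_diff)
  from tendsto_add[OF this assms(2)] show ?thesis by simp
qed

text \<open>The distance is a definite description over representatives. Changing both
  representatives by null sequences does not affect the limit, so exactly one number meets the
  description.\<close>

lemma completion_dist_cls:
  assumes s: "s \<in> carrier CR" and t: "t \<in> carrier CR"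
  shows "(\<lambda>n. v (s n - t n)) \<longlonglongrightarrow> completion_dist v (cls s) (cls t)"
proof -
  obtain r where r: "(\<lambda>n. v (s n - t n)) \<longlonglongrightarrow> r"
    using Cauchy_convergent_norm[OF Cauchy_diff[OF s t]] by (auto simp: convergent_def)
  have "(THE r. \<exists>s'\<in>cls s. \<exists>t'\<in>cls t. (\<lambda>n. v (s' n - t' n)) \<longlonglongrightarrow> r) = r"
  proof (rule the_equality)
    show "\<exists>s'\<in>cls s. \<exists>t'\<in>cls t. (\<lambda>n. v (s' n - t' n)) \<longlonglongrightarrow> r"
      using s t r by (intro bexI[of _ s] bexI[of _ t]) (auto simp: mem_cls_iff)
    fix r' assume "\<exists>s'\<in>cls s. \<exists>t'\<in>cls t. (\<lambda>n. v (s' n - t' n)) \<longlonglongrightarrow> r'"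
    then obtain s' t' where *: "s' \<in> cls s" "t' \<in> cls t" "(\<lambda>n. v (s' n - t' n)) \<longlonglongrightarrow> r'" by blast
    have "(\<lambda>n. v (s' n - s n) + v (t' n - t n)) \<longlonglongrightarrow> 0 + 0"
      using * s t by (intro tendsto_add) (auto simp: mem_cls_iff)
    then have "(\<lambda>n. v ((s' n - t' n) - (s n - t n))) \<longlonglongrightarrow> 0"
      by (intro Lim_null_comparison[of "\<lambda>n. v ((s' n - t' n) - (s n - t n))" "\<lambda>n. v (s' n - s n) + v (t' n - t n)"] always_eventually allI)
        (use triangle_diff[of "s' _ - s _" "t' _ - t _"] in \<open>simp_all add: algebra_simps\<close>)
    from norm_limit_cong[OF this r] show "r' = r" using *(3) LIMSEQ_unique by blast
  qed
  then show ?thesis using r s t by (simp add: completion_dist_def cls_in)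
qed

text \<open>The continuous extension of \<open>v\<close> to the completion.\<close>

definition cnorm :: "'k completion \<Rightarrow> real" where
  "cnorm \<xi> = completion_dist v \<xi> \<zero>\<^bsub>KK\<^esub>"

lemma cnorm_cls: "s \<in> carrier CR \<Longrightarrow> (\<lambda>n. v (s n)) \<longlonglongrightarrow> cnorm (cls s)"
  using completion_dist_cls[OF _ Cauchy_const, of s 0] by (simp add: cnorm_def cls_zero)

lemma cnorm_unique: "s \<in> carrier CR \<Longrightarrow> (\<lambda>n. v (s n)) \<longlonglongrightarrow> r \<Longrightarrow> cnorm (cls s) = r"
  using cnorm_cls LIMSEQ_unique by blast

lemma cnorm_embed [simp]: "cnorm (embed v x) = v x"
  unfolding embed_eq by (rule cnorm_unique) (auto simp: Cauchy_const)

lemma completion_dist_eq: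
  "\<xi> \<in> carrier KK \<Longrightarrow> \<eta> \<in> carrier KK \<Longrightarrow> completion_dist v \<xi> \<eta> = cnorm (\<xi> \<ominus>\<^bsub>KK\<^esub> \<eta>)"
proof (elim completionE)
  fix s t assume *: "s \<in> carrier CR" "\<xi> = cls s" "t \<in> carrier CR" "\<eta> = cls t"
  show "completion_dist v \<xi> \<eta> = cnorm (\<xi> \<ominus>\<^bsub>KK\<^esub> \<eta>)"
    using cnorm_unique[OF Cauchy_diff[OF *(1,3)] completion_dist_cls[OF *(1,3)]] by (simp add: * cls_diff)
qed

lemma cnorm_nonneg: "\<xi> \<in> carrier KK \<Longrightarrow> 0 \<le> cnorm \<xi>"
  by (auto elim!: completionE intro!: LIMSEQ_le_const[OF cnorm_cls])

lemma cls_eqI: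
  assumes s: "s \<in> carrier CR" and t: "t \<in> carrier CR" and "(\<lambda>n. v (s n - t n)) \<longlonglongrightarrow> 0"
  shows "cls s = cls t"
proof -
  interpret ideal "null_ideal v" CR by (rule ideal_null_ideal)
  interpret abelian_subgroup "null_ideal v" CR by (rule abelian_subgroupI3[OF is_additive_subgroup is_abelian_group])
  have "s \<in> cls t" using assms by (simp add: mem_cls_iff)
  then show ?thesis using a_repr_independence[OF _ t a_subgroup] unfolding cls_def by metis
qed

lemma cnorm_eq_0: "\<xi> \<in> carrier KK \<Longrightarrow> cnorm \<xi> = 0 \<longleftrightarrow> \<xi> = \<zero>\<^bsub>KK\<^esub>"
proof (elim completionE)
  fix s assume s: "s \<in> carrier CR" and \<xi>: "\<xi> = cls s"
  show ?thesis
  proof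
    assume "cnorm \<xi> = 0"
    then show "\<xi> = \<zero>\<^bsub>KK\<^esub>" unfolding \<xi> cls_zero
      using cnorm_cls[OF s] by (intro cls_eqI s Cauchy_const) simp
  next
    assume "\<xi> = \<zero>\<^bsub>KK\<^esub>"
    then have "\<xi> = embed v 0" by (simp add: cls_zero embed_eq)
    then show "cnorm \<xi> = 0" using cnorm_embed[of 0] by simp
  qed
qed

lemma cnorm_mult: "\<xi> \<in> carrier KK \<Longrightarrow> \<eta> \<in> carrier KK \<Longrightarrow> cnorm (\<xi> \<otimes>\<^bsub>KK\<^esub> \<eta>) = cnorm \<xi> * cnorm \<eta>"
proof (elim completionE)
  fix s t assume *: "s \<in> carrier CR" "\<xi> = cls s" "t \<in> carrier CR" "\<eta> = cls t"
  have "(\<lambda>n. v (s n * t n)) \<longlonglongrightarrow> cnorm \<xi> * cnorm \<eta>"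
    unfolding mult * by (intro tendsto_mult cnorm_cls *)
  then show ?thesis using cnorm_unique[OF Cauchy_mult[OF *(1,3)]] by (simp add: * cls_mult)
qed

lemma cnorm_triangle: "\<xi> \<in> carrier KK \<Longrightarrow> \<eta> \<in> carrier KK \<Longrightarrow> cnorm (\<xi> \<oplus>\<^bsub>KK\<^esub> \<eta>) \<le> cnorm \<xi> + cnorm \<eta>"
proof (elim completionE)
  fix s t assume *: "s \<in> carrier CR" "\<xi> = cls s" "t \<in> carrier CR" "\<eta> = cls t"
  have "cnorm (cls (\<lambda>n. s n + t n)) \<le> cnorm \<xi> + cnorm \<eta>"
    unfolding * by (rule LIMSEQ_le[OF cnorm_cls[OF Cauchy_add[OF *(1,3)]] tendsto_add[OF cnorm_cls[OF *(1)] cnorm_cls[OF *(3)]]])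
      (auto intro: triangle)
  then show ?thesis by (simp add: * cls_add)
qed

lemma cnorm_ultrametric:
  assumes "\<And>x y. v (x + y) \<le> max (v x) (v y)"
  shows "\<xi> \<in> carrier KK \<Longrightarrow> \<eta> \<in> carrier KK \<Longrightarrow> cnorm (\<xi> \<oplus>\<^bsub>KK\<^esub> \<eta>) \<le> max (cnorm \<xi>) (cnorm \<eta>)"
proof (elim completionE)
  fix s t assume *: "s \<in> carrier CR" "\<xi> = cls s" "t \<in> carrier CR" "\<eta> = cls t"
  have "cnorm (cls (\<lambda>n. s n + t n)) \<le> max (cnorm \<xi>) (cnorm \<eta>)"
    unfolding * by (rule LIMSEQ_le[OF cnorm_cls[OF Cauchy_add[OF *(1,3)]] tendsto_max[OF cnorm_cls[OF *(1)] cnorm_cls[OF *(3)]]])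
      (auto intro: assms)
  then show ?thesis by (simp add: * cls_add)
qed

lemma cnorm_minus: "\<xi> \<in> carrier KK \<Longrightarrow> cnorm (\<ominus>\<^bsub>KK\<^esub> \<xi>) = cnorm \<xi>"
proof (elim completionE)
  fix s assume *: "s \<in> carrier CR" "\<xi> = cls s"
  show ?thesis unfolding * cls_minus[OF *(1)]
    using cnorm_cls[OF *(1)] by (intro cnorm_unique Cauchy_minus *) simp
qed

lemma embed_in [simp]: "embed v x \<in> carrier KK"
  by (simp add: embed_eq cls_in Cauchy_const)

lemma embed_hom: 
  "embed v (x + y) = embed v x \<oplus>\<^bsub>KK\<^esub> embed v y" "embed v (x * y) = embed v x \<otimes>\<^bsub>KK\<^esub> embed v y"
  "embed v 1 = \<one>\<^bsub>KK\<^esub>" "embed v 0 = \<zero>\<^bsub>KK\<^esub>" "embed v (x - y) = embed v x \<ominus>\<^bsub>KK\<^esub> embed v y"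
  by (simp_all add: embed_eq cls_add cls_mult cls_one cls_zero cls_diff Cauchy_const)

text \<open>Turns a bound on the tail of a Cauchy sequence into a bound on its class.\<close>

lemma cnorm_diff_embed_le:
  assumes s: "s \<in> carrier CR" and "\<And>n. N \<le> n \<Longrightarrow> v (s n - a) \<le> r"
  shows "cnorm (cls s \<ominus>\<^bsub>KK\<^esub> embed v a) \<le> r"
  unfolding embed_eq cls_diff[OF s Cauchy_const]
  by (rule LIMSEQ_le_const2[OF cnorm_cls[OF Cauchy_diff[OF s Cauchy_const]]]) (use assms in auto)

lemma completion_dense:
  assumes \<xi>: "\<xi> \<in> carrier KK" and e: "0 < e"
  shows "\<exists>x. cnorm (\<xi> \<ominus>\<^bsub>KK\<^esub> embed v x) < e"
proof -
  obtain s where s: "s \<in> carrier CR" "\<xi> = cls s" using \<xi> by (rule completionE)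
  have "0 < e / 2" using e by simp
  obtain N where N: "\<And>m n. N \<le> m \<Longrightarrow> N \<le> n \<Longrightarrow> v (s m - s n) < e / 2" using Cauchy_ringD[OF s(1) \<open>0 < e / 2\<close>] by metis
  have "cnorm (cls s \<ominus>\<^bsub>KK\<^esub> embed v (s N)) \<le> e / 2"
    using N[of _ N] by (intro cnorm_diff_embed_le[OF s(1), of N]) (simp add: less_imp_le)
  then show ?thesis using e s by (intro exI[of _ "s N"]) simp
qed

text \<open>The terms of \<open>s\<close> eventually exceed half the norm, so the termwise inverse
  is Cauchy; zero terms at the beginning are harmless, as \<open>inverse 0 = 0\<close> and only the
  tail matters.\<close>

lemma completion_inverse:
  assumes \<xi>: "\<xi> \<in> carrier KK" "\<xi> \<noteq> \<zero>\<^bsub>KK\<^esub>"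
  shows "\<exists>\<eta>\<in>carrier KK. \<xi> \<otimes>\<^bsub>KK\<^esub> \<eta> = \<one>\<^bsub>KK\<^esub>"
proof -
  obtain s where s: "s \<in> carrier CR" "\<xi> = cls s" using \<xi>(1) by (rule completionE)
  define c where "c = cnorm \<xi> / 2"
  have c: "0 < c" "c < cnorm \<xi>" using cnorm_nonneg[OF \<xi>(1)] cnorm_eq_0[OF \<xi>(1)] \<xi>(2) by (auto simp: c_def)
  have "\<forall>\<^sub>F n in sequentially. c < v (s n)"
    using order_tendstoD(1)[OF cnorm_cls[OF s(1)]] c(2) s(2) by simp
  then obtain N0 where N0: "\<And>n. N0 \<le> n \<Longrightarrow> c < v (s n)" by (auto simp: eventually_sequentially)
  define t where "t n = inverse (s n)" for n
  have t: "t \<in> carrier CR"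
    unfolding Cauchy_ring_carrier
  proof (intro allI impI)
    fix e :: real assume "0 < e"
    then have e: "0 < e * (c * c)" using c by simp
    obtain N where N: "\<And>m n. N \<le> m \<Longrightarrow> N \<le> n \<Longrightarrow> v (s m - s n) < e * (c * c)" using Cauchy_ringD[OF s(1) e] by metis
    have "v (t m - t n) < e" if mn: "max N N0 \<le> m" "max N N0 \<le> n" for m n
    proof -
      have g: "c < v (s m)" "c < v (s n)" using N0 mn by auto
      then have nz: "s m \<noteq> 0" "s n \<noteq> 0" using c by auto
      then have "t m - t n = (s n - s m) / (s m * s n)" by (simp add: t_def field_simps)
      then have "v (t m - t n) = v (s n - s m) / (v (s m) * v (s n))" by (simp add: divide mult)
      also have "\<dots> \<le> v (s n - s m) / (c * c)"
        using g c by (intro divide_left_mono mult_mono mult_pos_pos) auto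
      also have "\<dots> < e" using N[of n m] mn c by (simp add: divide_less_eq)
      finally show ?thesis .
    qed
    then show "\<exists>N. \<forall>m\<ge>N. \<forall>n\<ge>N. v (t m - t n) < e" by blast
  qed
  have "\<forall>\<^sub>F n in sequentially. v (s n * t n - 1) = 0"
    using eventually_ge_at_top[of N0]
  proof eventually_elim
    case (elim n)
    then have "s n \<noteq> 0" using N0[of n] c by auto
    then show ?case by (simp add: t_def)
  qed
  then have "(\<lambda>n. v (s n * t n - 1)) \<longlonglongrightarrow> 0" by (rule tendsto_eventually)
  then have "cls (\<lambda>n. s n * t n) = cls (\<lambda>n. 1)" by (intro cls_eqI Cauchy_mult Cauchy_const s t)
  then show ?thesis using s t by (intro bexI[of _ "cls t"]) (simp_all add: cls_mult cls_one cls_in)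
qed

lemma Metric_space_completion: "Metric_space (carrier KK) (completion_dist v)"
proof
  interpret KK: cring KK by (rule cring_completion)
  show nn: "0 \<le> completion_dist v \<xi> \<eta>" for \<xi> \<eta>
  proof (cases "\<xi> \<in> carrier KK \<and> \<eta> \<in> carrier KK")
    case True
    then show ?thesis by (simp add: completion_dist_eq cnorm_nonneg)
  qed (auto simp: completion_dist_def)
  show "completion_dist v \<xi> \<eta> = completion_dist v \<eta> \<xi>" for \<xi> \<eta>
  proof (cases "\<xi> \<in> carrier KK \<and> \<eta> \<in> carrier KK")
    case True
    then have "\<eta> \<ominus>\<^bsub>KK\<^esub> \<xi> = \<ominus>\<^bsub>KK\<^esub> (\<xi> \<ominus>\<^bsub>KK\<^esub> \<eta>)"
      by (simp add: KK.minus_add a_minus_def KK.minus_minus KK.a_comm)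
    then show ?thesis using True by (simp add: completion_dist_eq cnorm_minus)
  qed (auto simp: completion_dist_def)
  fix \<xi> \<eta> \<zeta> assume XY: "\<xi> \<in> carrier KK" "\<eta> \<in> carrier KK"
  then show "completion_dist v \<xi> \<eta> = 0 \<longleftrightarrow> \<xi> = \<eta>"
    by (simp add: completion_dist_eq cnorm_eq_0 KK.r_right_minus_eq)
  assume Zc: "\<zeta> \<in> carrier KK"
  have "\<xi> \<ominus>\<^bsub>KK\<^esub> \<zeta> = (\<xi> \<ominus>\<^bsub>KK\<^esub> \<eta>) \<oplus>\<^bsub>KK\<^esub> (\<eta> \<ominus>\<^bsub>KK\<^esub> \<zeta>)"
    using XY Zc by (simp add: a_minus_def KK.a_assoc KK.l_neg KK.r_neg2 KK.r_neg1)
  then show "completion_dist v \<xi> \<zeta> \<le> completion_dist v \<xi> \<eta> + completion_dist v \<eta> \<zeta>"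
    using XY Zc cnorm_triangle[of "\<xi> \<ominus>\<^bsub>KK\<^esub> \<eta>" "\<eta> \<ominus>\<^bsub>KK\<^esub> \<zeta>"] by (simp add: completion_dist_eq)
qed

sublocale M: Metric_space "carrier KK" "completion_dist v"
  by (rule Metric_space_completion)

lemma completion_topology_eq: "completion_topology v = M.mtopology"
  by (simp add: completion_topology_def)

end

context number_field_type
begin

text \<open>The ultrametric inequality keeps limits of integers in the unit ball. Conversely,
  elements of the ball are approximated by elements of \<open>K\<close> that again have absolute
  value at most 1, and these by integers.\<close>

lemma carrier_local_integers:
  assumes v: "v \<in> (finite_places :: 'k place set)"
  shows "carrier (local_integers v) = {\<xi> \<in> carrier (completion v). abs_value.cnorm v \<xi> \<le> 1}"
proof -
  interpret abs_value v by (rule finite_place_abs_value[OF v])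
  interpret KK: cring KK by (rule cring_completion)
  have ultra: "cnorm (\<xi> \<oplus>\<^bsub>KK\<^esub> \<eta>) \<le> max (cnorm \<xi>) (cnorm \<eta>)" if "\<xi> \<in> carrier KK" "\<eta> \<in> carrier KK" for \<xi> \<eta>
    by (rule cnorm_ultrametric[OF finite_place_ultrametric[OF v] that])
  have "\<xi> \<in> M.mtopology closure_of (embed v ` carrier O_ring) \<longleftrightarrow> cnorm \<xi> \<le> 1" if \<xi>: "\<xi> \<in> carrier KK" for \<xi>
  proof
    assume "\<xi> \<in> M.mtopology closure_of (embed v ` carrier O_ring)"
    then have "\<forall>r>0. \<exists>y\<in>embed v ` carrier O_ring. y \<in> M.mball \<xi> r"
      unfolding M.metric_closure_of by blast
    from this[rule_format, of 1] obtain a where a: "algebraic_int a" "completion_dist v \<xi> (embed v a) < 1" by auto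
    then have "cnorm (\<xi> \<ominus>\<^bsub>KK\<^esub> embed v a) < 1" using \<xi> by (simp add: completion_dist_eq)
    moreover have "\<xi> = (\<xi> \<ominus>\<^bsub>KK\<^esub> embed v a) \<oplus>\<^bsub>KK\<^esub> embed v a"
      using \<xi> by (simp add: a_minus_def KK.a_assoc KK.l_neg)
    then have "cnorm \<xi> \<le> max (cnorm (\<xi> \<ominus>\<^bsub>KK\<^esub> embed v a)) (cnorm (embed v a))"
      using ultra[of "\<xi> \<ominus>\<^bsub>KK\<^esub> embed v a" "embed v a"] \<xi> by simp
    moreover have "v a \<le> 1" by (rule finite_place_int_le_1[OF v a(1)])
    ultimately show "cnorm \<xi> \<le> 1" by simp
  next
    assume norm1: "cnorm \<xi> \<le> 1"
    have "\<exists>y\<in>embed v ` carrier O_ring. y \<in> M.mball \<xi> r" if r: "r > 0" for r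
    proof -
      \<comment> \<open>The bound \<open>r / 2\<close> serves the distance, the bound 1 ensures
        \<open>v x \<le> 1\<close>.\<close>
      obtain x where x: "cnorm (\<xi> \<ominus>\<^bsub>KK\<^esub> embed v x) < min (r / 2) 1"
        using completion_dense[OF \<xi>, of "min (r / 2) 1"] r by auto
      have "embed v x = \<xi> \<oplus>\<^bsub>KK\<^esub> \<ominus>\<^bsub>KK\<^esub> (\<xi> \<ominus>\<^bsub>KK\<^esub> embed v x)"
        using \<xi> by (simp add: a_minus_def KK.minus_add KK.minus_minus KK.r_neg2)
      then have "cnorm (embed v x) \<le> max (cnorm \<xi>) (cnorm (\<ominus>\<^bsub>KK\<^esub> (\<xi> \<ominus>\<^bsub>KK\<^esub> embed v x)))"
        using ultra[of \<xi> "\<ominus>\<^bsub>KK\<^esub> (\<xi> \<ominus>\<^bsub>KK\<^esub> embed v x)"] \<xi> by simp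
      then have "v x \<le> max (cnorm \<xi>) (cnorm (\<xi> \<ominus>\<^bsub>KK\<^esub> embed v x))" using \<xi> by (simp add: cnorm_minus)
      then have "v x \<le> 1" using x norm1 by linarith
      then obtain a where a: "algebraic_int a" "v (x - a) < r / 2"
        using finite_place_integers_dense[OF v, of x "r / 2"] r by auto
      have "\<xi> \<ominus>\<^bsub>KK\<^esub> embed v a = (\<xi> \<ominus>\<^bsub>KK\<^esub> embed v x) \<oplus>\<^bsub>KK\<^esub> embed v (x - a)"
        using \<xi> by (simp add: embed_hom a_minus_def KK.a_assoc KK.r_neg1)
      then have "cnorm (\<xi> \<ominus>\<^bsub>KK\<^esub> embed v a) \<le> cnorm (\<xi> \<ominus>\<^bsub>KK\<^esub> embed v x) + v (x - a)"
        using cnorm_triangle[of "\<xi> \<ominus>\<^bsub>KK\<^esub> embed v x" "embed v (x - a)"] \<xi> by simp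
      then have "completion_dist v \<xi> (embed v a) < r" using x a \<xi> by (simp add: completion_dist_eq)
      then show ?thesis using a \<xi> by auto
    qed
    then show "\<xi> \<in> M.mtopology closure_of (embed v ` carrier O_ring)"
      unfolding M.metric_closure_of using \<xi> by blast
  qed
  moreover have "M.mtopology closure_of S \<subseteq> carrier KK" for S
    using closure_of_subset_topspace[of M.mtopology S] by simp
  ultimately show ?thesis
    unfolding local_integers_def completion_topology_eq by auto
qed

end

section \<open>Finite adeles\<close>

lemma cring_product_ring:
  assumes "\<And>i. i \<in> I \<Longrightarrow> cring (R i)"
  shows "cring (product_ring I R)"
proof -
  note c = assms[THEN cring.cring_simprules(1)] assms[THEN cring.cring_simprules(2)]
    assms[THEN cring.cring_simprules(5)] assms[THEN cring.cring_simprules(6)]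
  show ?thesis
  proof (intro cringI abelian_groupI comm_monoidI)
    fix x assume x: "x \<in> carrier (product_ring I R)"
    show "\<exists>y\<in>carrier (product_ring I R). y \<oplus>\<^bsub>product_ring I R\<^esub> x = \<zero>\<^bsub>product_ring I R\<^esub>"
    proof
      show "(\<lambda>i\<in>I. \<ominus>\<^bsub>R i\<^esub> x i) \<in> carrier (product_ring I R)"
        using x assms by (auto simp: product_ring_def PiE_iff intro!: cring.cring_simprules(3))
      show "(\<lambda>i\<in>I. \<ominus>\<^bsub>R i\<^esub> x i) \<oplus>\<^bsub>product_ring I R\<^esub> x = \<zero>\<^bsub>product_ring I R\<^esub>"
        using x assms by (auto simp: product_ring_def PiE_iff intro!: restrict_ext cring.cring_simprules(9))
    qed
  next
    fix x y assume "x \<in> carrier (product_ring I R)" "y \<in> carrier (product_ring I R)"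
    then show "x \<oplus>\<^bsub>product_ring I R\<^esub> y = y \<oplus>\<^bsub>product_ring I R\<^esub> x"
      "x \<otimes>\<^bsub>product_ring I R\<^esub> y = y \<otimes>\<^bsub>product_ring I R\<^esub> x"
      by (auto simp: product_ring_def PiE_iff intro!: restrict_ext
          cring.cring_simprules(10)[OF assms] cring.cring_simprules(14)[OF assms])
  qed (auto simp: product_ring_def PiE_iff c assms[THEN cring.cring_simprules(7)]
       assms[THEN cring.cring_simprules(11)] assms[THEN cring.cring_simprules(12)]
       assms[THEN cring.cring_simprules(8)] assms[THEN cring.cring_simprules(13)] extensional_def fun_eq_iff)
qed

lemma frag_extend_fun_diff: "frag_extend (\<lambda>p. F p - G p) c = frag_extend F c - frag_extend G c"
  using subset_UNIV by (induction c rule: frag_induction) (auto simp: frag_extend_diff)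

lemma K_ring_simps [simp]:
  "x \<otimes>\<^bsub>K_ring\<^esub> y = x * y" "x \<oplus>\<^bsub>K_ring\<^esub> y = x + y" "\<one>\<^bsub>K_ring\<^esub> = (1::'a::field_char_0)" "\<zero>\<^bsub>K_ring\<^esub> = (0::'a)"
  "carrier K_ring = (UNIV :: 'a set)"
  by (simp_all add: ring_of_type_algebra_def)

locale free_pair = A: cring A + B: cring B for A :: "('a, 'm) ring_scheme" and B :: "('b, 'n) ring_scheme"
begin

abbreviation FP :: "('a \<times> 'b \<Rightarrow>\<^sub>0 int) ring" where "FP \<equiv> free_pair_ring A B"

lemma FP_simps [simp]:
  "c \<in> carrier FP \<longleftrightarrow> Poly_Mapping.keys c \<subseteq> carrier A \<times> carrier B"
  "\<one>\<^bsub>FP\<^esub> = frag_of (\<one>\<^bsub>A\<^esub>, \<one>\<^bsub>B\<^esub>)" "\<zero>\<^bsub>FP\<^esub> = 0" "c \<oplus>\<^bsub>FP\<^esub> d = c + d"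
  by (simp_all add: free_pair_ring_def)

lemma FP_mult:
  "c \<otimes>\<^bsub>FP\<^esub> d = frag_extend (\<lambda>p. frag_extend (\<lambda>q. frag_of (fst p \<otimes>\<^bsub>A\<^esub> fst q, snd p \<otimes>\<^bsub>B\<^esub> snd q)) d) c"
  by (simp add: free_pair_ring_def case_prod_unfold)

lemma FP_mult_of [simp]:
  "frag_of p \<otimes>\<^bsub>FP\<^esub> frag_of q = frag_of (fst p \<otimes>\<^bsub>A\<^esub> fst q, snd p \<otimes>\<^bsub>B\<^esub> snd q)"
  by (simp add: FP_mult)

lemma FP_mult_zero [simp]: "0 \<otimes>\<^bsub>FP\<^esub> d = 0" "c \<otimes>\<^bsub>FP\<^esub> 0 = 0"
  by (simp_all add: FP_mult frag_extend_eq_0)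

lemma FP_mult_diff:
  "(c - c') \<otimes>\<^bsub>FP\<^esub> d = c \<otimes>\<^bsub>FP\<^esub> d - c' \<otimes>\<^bsub>FP\<^esub> d"
  "c \<otimes>\<^bsub>FP\<^esub> (d - d') = c \<otimes>\<^bsub>FP\<^esub> d - c \<otimes>\<^bsub>FP\<^esub> d'"
  by (simp_all add: FP_mult frag_extend_diff frag_extend_fun_diff)

lemma FP_mult_add: "(c + c') \<otimes>\<^bsub>FP\<^esub> d = c \<otimes>\<^bsub>FP\<^esub> d + c' \<otimes>\<^bsub>FP\<^esub> d"
  by (simp add: FP_mult frag_extend_add)

lemma FP_mult_closed: "c \<in> carrier FP \<Longrightarrow> d \<in> carrier FP \<Longrightarrow> c \<otimes>\<^bsub>FP\<^esub> d \<in> carrier FP"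
  unfolding FP_simps FP_mult
  by (rule order_trans[OF keys_frag_extend], rule UN_least,
      rule order_trans[OF keys_frag_extend], rule UN_least) (auto 4 4 simp: keys_frag_of dest: subsetD)

lemma FP_mult_comm:
  assumes "c \<in> carrier FP" "d \<in> carrier FP"
  shows "c \<otimes>\<^bsub>FP\<^esub> d = d \<otimes>\<^bsub>FP\<^esub> c"
  using assms(1)[unfolded FP_simps]
proof (induction c rule: frag_induction)
  case (one p)
  show ?case using assms(2)[unfolded FP_simps]
    by (induction d rule: frag_induction) (use one in \<open>auto simp: FP_mult_diff A.m_comm B.m_comm\<close>)
qed (auto simp: FP_mult_diff)

lemma FP_mult_assoc:
  assumes "c \<in> carrier FP" "d \<in> carrier FP" "e \<in> carrier FP"
  shows "(c \<otimes>\<^bsub>FP\<^esub> d) \<otimes>\<^bsub>FP\<^esub> e = c \<otimes>\<^bsub>FP\<^esub> (d \<otimes>\<^bsub>FP\<^esub> e)"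
  using assms(1)[unfolded FP_simps]
proof (induction c rule: frag_induction)
  case (one p)
  show ?case using assms(2)[unfolded FP_simps]
  proof (induction d rule: frag_induction)
    case (one q)
    show ?case using assms(3)[unfolded FP_simps]
      by (induction e rule: frag_induction)
        (use one \<open>p \<in> carrier A \<times> carrier B\<close> in \<open>auto simp: FP_mult_diff A.m_assoc B.m_assoc\<close>)
  qed (auto simp: FP_mult_diff)
qed (auto simp: FP_mult_diff)

lemma cring_FP: "cring FP"
proof (intro cringI abelian_groupI comm_monoidI)
  fix c d assume c: "c \<in> carrier FP" and d: "d \<in> carrier FP"
  show "c \<oplus>\<^bsub>FP\<^esub> d \<in> carrier FP" using c d keys_add[of c d] by auto
  show "c \<otimes>\<^bsub>FP\<^esub> d \<in> carrier FP" by (rule FP_mult_closed[OF c d])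
  show "c \<otimes>\<^bsub>FP\<^esub> d = d \<otimes>\<^bsub>FP\<^esub> c" by (rule FP_mult_comm[OF c d])
next
  fix c assume c: "c \<in> carrier FP"
  show "\<exists>d\<in>carrier FP. d \<oplus>\<^bsub>FP\<^esub> c = \<zero>\<^bsub>FP\<^esub>" using c by (intro bexI[of _ "- c"]) auto
  show "\<one>\<^bsub>FP\<^esub> \<otimes>\<^bsub>FP\<^esub> c = c"
    using c[unfolded FP_simps(1)] by (induction c rule: frag_induction) (auto simp: FP_mult_diff)
qed (auto simp: keys_frag_of FP_mult_assoc FP_mult_add algebra_simps simp del: FP_simps(1), auto simp: keys_frag_of)

lemma FP_minus: "c \<in> carrier FP \<Longrightarrow> \<ominus>\<^bsub>FP\<^esub> c = - c"
proof -
  assume c: "c \<in> carrier FP"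
  interpret FP: cring FP by (rule cring_FP)
  show ?thesis by (rule FP.minus_equality) (use c in auto)
qed

text \<open>The free abelian group supplies the additive extension; multiplicativity is then checked
  on generators, one variable at a time.\<close>

lemma additive_hom_extends:
  assumes T: "cring T" and f: "\<And>p. p \<in> carrier A \<times> carrier B \<Longrightarrow> f p \<in> carrier T"
    and f_mult: "\<And>a b a' b'. a \<in> carrier A \<Longrightarrow> b \<in> carrier B \<Longrightarrow> a' \<in> carrier A \<Longrightarrow> b' \<in> carrier B \<Longrightarrow>
      f (a \<otimes>\<^bsub>A\<^esub> a', b \<otimes>\<^bsub>B\<^esub> b') = f (a, b) \<otimes>\<^bsub>T\<^esub> f (a', b')"
    and f_one: "f (\<one>\<^bsub>A\<^esub>, \<one>\<^bsub>B\<^esub>) = \<one>\<^bsub>T\<^esub>"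
  obtains h where "h \<in> ring_hom FP T" "\<And>p. p \<in> carrier A \<times> carrier B \<Longrightarrow> h (frag_of p) = f p"
proof -
  interpret T: cring T by (rule T)
  obtain h where h: "h \<in> hom (free_Abelian_group (carrier A \<times> carrier B)) (add_monoid T)"
    "\<And>p. p \<in> carrier A \<times> carrier B \<Longrightarrow> h (frag_of p) = f p"
    using comm_group.free_Abelian_group_universal[OF T.a_comm_group, of f "carrier A \<times> carrier B"] f by auto
  have hc: "h c \<in> carrier T" if "c \<in> carrier FP" for c using h(1) that by (auto simp: hom_def)
  have hadd: "h (c + d) = h c \<oplus>\<^bsub>T\<^esub> h d" if "c \<in> carrier FP" "d \<in> carrier FP" for c d
    using h(1) that by (auto simp: hom_def)
  interpret FP: cring FP by (rule cring_FP)
  have h0: "h 0 = \<zero>\<^bsub>T\<^esub>"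
    using hom_one[OF h(1) group_free_Abelian_group comm_group.axioms(2)[OF T.a_comm_group]] by simp
  have hdiff: "h (c - d) = h c \<ominus>\<^bsub>T\<^esub> h d" if "c \<in> carrier FP" "d \<in> carrier FP" for c d
  proof -
    have cd: "c - d \<in> carrier FP" using that keys_diff[of c d] by auto
    have "h c = h (c - d) \<oplus>\<^bsub>T\<^esub> h d" using hadd[OF cd that(2)] by simp
    then show ?thesis using hc[OF cd] hc[OF that(2)] by (simp add: a_minus_def T.a_assoc T.r_neg)
  qed
  have hmult_of: "h (frag_of p \<otimes>\<^bsub>FP\<^esub> d) = h (frag_of p) \<otimes>\<^bsub>T\<^esub> h d"
    if p: "p \<in> carrier A \<times> carrier B" and d: "d \<in> carrier FP" for p d
  proof -
    have pc: "frag_of p \<in> carrier FP" using p by (simp add: keys_frag_of)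
    have "d \<in> carrier FP \<and> h (frag_of p \<otimes>\<^bsub>FP\<^esub> d) = h (frag_of p) \<otimes>\<^bsub>T\<^esub> h d"
      using d[unfolded FP_simps(1)]
    proof (induction d rule: frag_induction)
      case zero
      show ?case using h0 hc[OF pc] by simp
    next
      case (one q)
      show ?case using p one by (auto simp: keys_frag_of h(2) f_mult)
    next
      case (diff c c')
      then have *: "c \<in> carrier FP" "c' \<in> carrier FP" by blast+
      have "h (frag_of p \<otimes>\<^bsub>FP\<^esub> (c - c')) = h (frag_of p) \<otimes>\<^bsub>T\<^esub> h c \<ominus>\<^bsub>T\<^esub> h (frag_of p) \<otimes>\<^bsub>T\<^esub> h c'"
        unfolding FP_mult_diff using diff hdiff[OF FP_mult_closed[OF pc *(1)] FP_mult_closed[OF pc *(2)]] by metis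
      also have "\<dots> = h (frag_of p) \<otimes>\<^bsub>T\<^esub> h (c - c')"
        unfolding hdiff[OF *] using hc[OF *(1)] hc[OF *(2)] hc[OF pc] by (simp add: a_minus_def T.r_distr T.r_minus)
      finally show ?case using * keys_diff[of c c'] by auto
    qed
    then show ?thesis ..
  qed
  have hmult: "h (c \<otimes>\<^bsub>FP\<^esub> d) = h c \<otimes>\<^bsub>T\<^esub> h d"
    if c: "c \<in> carrier FP" and d: "d \<in> carrier FP" for c d
  proof -
    have "c \<in> carrier FP \<and> h (c \<otimes>\<^bsub>FP\<^esub> d) = h c \<otimes>\<^bsub>T\<^esub> h d"
      using c[unfolded FP_simps(1)]
    proof (induction c rule: frag_induction)
      case zero
      show ?case using h0 hc[OF d] by simp
    next
      case (one q)
      show ?case using hmult_of[OF one d] one by (simp add: keys_frag_of)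
    next
      case (diff c c')
      then have *: "c \<in> carrier FP" "c' \<in> carrier FP" by blast+
      have "h ((c - c') \<otimes>\<^bsub>FP\<^esub> d) = h c \<otimes>\<^bsub>T\<^esub> h d \<ominus>\<^bsub>T\<^esub> h c' \<otimes>\<^bsub>T\<^esub> h d"
        unfolding FP_mult_diff using diff hdiff[OF FP_mult_closed[OF *(1) d] FP_mult_closed[OF *(2) d]] by metis
      also have "\<dots> = h (c - c') \<otimes>\<^bsub>T\<^esub> h d"
        unfolding hdiff[OF *] using hc[OF *(1)] hc[OF *(2)] hc[OF d] by (simp add: a_minus_def T.l_distr T.l_minus)
      finally show ?case using * keys_diff[of c c'] by auto
    qed
    then show ?thesis ..
  qed
  have "h \<in> ring_hom FP T"
    by (rule ring_hom_memI) (use hc hmult hadd h(2) f_one in auto)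
  then show ?thesis using that h(2) by blast
qed

end

section \<open>The tensor product as a ring of families of local elements\<close>

context number_field_type
begin

text \<open>The unrestricted product of the completions at the finite places: an ambient ring in
  which finite adeles are handled by components.\<close>

abbreviation PK :: "('k place \<Rightarrow> 'k completion) ring" where
  "PK \<equiv> product_ring finite_places completion"

abbreviation PK_mult (infixl "*\<^sub>p" 70) where "x *\<^sub>p y \<equiv> x \<otimes>\<^bsub>PK\<^esub> y"
abbreviation PK_add (infixl "+\<^sub>p" 65) where "x +\<^sub>p y \<equiv> x \<oplus>\<^bsub>PK\<^esub> y"
abbreviation PK_one ("\<one>\<^sub>p") where "\<one>\<^sub>p \<equiv> \<one>\<^bsub>PK\<^esub>"
abbreviation PK_zero ("\<zero>\<^sub>p") where "\<zero>\<^sub>p \<equiv> \<zero>\<^bsub>PK\<^esub>"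

lemma cring_completion_finite: "v \<in> finite_places \<Longrightarrow> cring (completion (v :: 'k place))"
  by (rule abs_value.cring_completion[OF finite_place_abs_value])

lemma cring_PK: "cring PK"
  by (rule cring_product_ring[OF cring_completion_finite])

lemma subring_local_integers:
  assumes v: "v \<in> (finite_places :: 'k place set)"
  shows "subring (carrier (local_integers v)) (completion v)"
proof -
  interpret abs_value v by (rule finite_place_abs_value[OF v])
  interpret KK: cring KK by (rule cring_completion)
  have ultra: "cnorm (\<xi> \<oplus>\<^bsub>KK\<^esub> \<eta>) \<le> max (cnorm \<xi>) (cnorm \<eta>)" if "\<xi> \<in> carrier KK" "\<eta> \<in> carrier KK" for \<xi> \<eta>
    by (rule cnorm_ultrametric[OF finite_place_ultrametric[OF v] that])
  show ?thesis
    unfolding carrier_local_integers[OF v]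
  proof (rule KK.subringI)
    show "\<one>\<^bsub>KK\<^esub> \<in> {\<xi> \<in> carrier KK. cnorm \<xi> \<le> 1}" using cnorm_embed[of 1] by (simp add: embed_hom)
    fix \<xi> \<eta> assume xe: "\<xi> \<in> {\<xi> \<in> carrier KK. cnorm \<xi> \<le> 1}" "\<eta> \<in> {\<xi> \<in> carrier KK. cnorm \<xi> \<le> 1}"
    show "\<xi> \<otimes>\<^bsub>KK\<^esub> \<eta> \<in> {\<xi> \<in> carrier KK. cnorm \<xi> \<le> 1}"
      using xe by (simp add: cnorm_mult mult_le_one cnorm_nonneg)
    show "\<xi> \<oplus>\<^bsub>KK\<^esub> \<eta> \<in> {\<xi> \<in> carrier KK. cnorm \<xi> \<le> 1}"
      using xe ultra[of \<xi> \<eta>] by auto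
  qed (auto simp: cnorm_minus)
qed

lemma local_integers_simps [simp]:
  "x \<otimes>\<^bsub>local_integers v\<^esub> y = x \<otimes>\<^bsub>completion v\<^esub> y" "x \<oplus>\<^bsub>local_integers v\<^esub> y = x \<oplus>\<^bsub>completion v\<^esub> y"
  "\<one>\<^bsub>local_integers v\<^esub> = \<one>\<^bsub>completion v\<^esub>" "\<zero>\<^bsub>local_integers v\<^esub> = \<zero>\<^bsub>completion v\<^esub>"
  by (simp_all add: local_integers_def)

lemma cring_local_integers:
  assumes v: "v \<in> (finite_places :: 'k place set)"
  shows "cring (local_integers v)"
proof -
  interpret KK: cring "completion v" by (rule cring_completion_finite[OF v])
  have "cring (completion v\<lparr>carrier := carrier (local_integers v)\<rparr>)"
    using KK.subcring_iff[OF subringE(1)[OF subring_local_integers[OF v]]]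
      KK.subcringI'[OF subring_local_integers[OF v]] by simp
  then show ?thesis by (simp add: local_integers_def)
qed

lemma cring_O_hat: "cring (O_hat :: ('k place \<Rightarrow> 'k completion) ring)"
  unfolding O_hat_def by (rule cring_product_ring[OF cring_local_integers])

lemma carrier_O_hat: "carrier O_hat = {x \<in> carrier PK. \<forall>v\<in>finite_places. abs_value.cnorm v (x v) \<le> 1}"
  by (simp add: O_hat_def product_ring_def set_eq_iff PiE_iff carrier_local_integers) blast

lemma O_hat_simps [simp]:
  "x \<otimes>\<^bsub>O_hat\<^esub> y = x *\<^sub>p y" "x \<oplus>\<^bsub>O_hat\<^esub> y = x +\<^sub>p y"
  "\<one>\<^bsub>O_hat\<^esub> = \<one>\<^sub>p" "\<zero>\<^bsub>O_hat\<^esub> = \<zero>\<^sub>p"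
  by (simp_all add: O_hat_def product_ring_def)

lemma diag_fin_hom:
  "diag_fin (x * y) = diag_fin x *\<^sub>p diag_fin y" "diag_fin (x + y) = diag_fin x +\<^sub>p diag_fin y"
  "diag_fin 1 = \<one>\<^sub>p" "diag_fin 0 = \<zero>\<^sub>p" "diag_fin x \<in> carrier PK"
  using abs_value.embed_hom[OF finite_place_abs_value] abs_value.embed_in[OF finite_place_abs_value]
  by (auto simp: diag_fin_def product_ring_def intro!: restrict_ext)

lemma diag_fin_O_hat: "algebraic_int (x::'k) \<Longrightarrow> diag_fin x \<in> carrier O_hat"
  using diag_fin_hom(5)[of x] finite_place_int_le_1
  by (auto simp: carrier_O_hat diag_fin_def abs_value.cnorm_embed[OF finite_place_abs_value])

abbreviation FP where "FP \<equiv> free_pair_ring (K_ring :: 'k ring) (O_hat :: ('k place \<Rightarrow> 'k completion) ring)"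

abbreviation TI where "TI \<equiv> tensor_ideal O_ring (\<lambda>a. a) diag_fin (K_ring :: 'k ring) O_hat"

lemma free_pair: "free_pair (K_ring :: 'k ring) (O_hat :: ('k place \<Rightarrow> 'k completion) ring)"
  using cring_O_hat cring_from_type_algebra by (simp add: free_pair_def)

sublocale FP: free_pair "K_ring :: 'k ring" "O_hat :: ('k place \<Rightarrow> 'k completion) ring"
  by (rule free_pair)

sublocale FPc: cring FP by (rule FP.cring_FP)

lemma ideal_TI: "ideal TI FP"
  and TI_rel_left: "b \<in> carrier O_hat \<Longrightarrow> frag_of (a + a', b) - frag_of (a, b) - frag_of (a', b) \<in> TI"
  and TI_rel_right: "b \<in> carrier O_hat \<Longrightarrow> b' \<in> carrier O_hat \<Longrightarrow>
    frag_of (a, b +\<^sub>p b') - frag_of (a, b) - frag_of (a, b') \<in> TI"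
  and TI_rel_mid: "algebraic_int s \<Longrightarrow> b \<in> carrier O_hat \<Longrightarrow>
    frag_of (s * a, b) - frag_of (a, diag_fin s *\<^sub>p b) \<in> TI"
proof -
  have sub: "tensor_relations O_ring (\<lambda>a. a) diag_fin (K_ring :: 'k ring) O_hat \<subseteq> carrier FP"
  proof
    fix c assume "c \<in> tensor_relations O_ring (\<lambda>a. a) diag_fin (K_ring :: 'k ring) O_hat"
    then consider (1) a a' b where "c = frag_of (a \<oplus>\<^bsub>K_ring\<^esub> a', b) - frag_of (a, b) - frag_of (a', b)" "b \<in> carrier O_hat"
      | (2) a b b' where "c = frag_of (a, b \<oplus>\<^bsub>O_hat\<^esub> b') - frag_of (a, b) - frag_of (a, b')" "b \<in> carrier O_hat" "b' \<in> carrier O_hat"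
      | (3) s a b where "c = frag_of (s \<otimes>\<^bsub>K_ring\<^esub> a, b) - frag_of (a, diag_fin s \<otimes>\<^bsub>O_hat\<^esub> b)" "algebraic_int s" "b \<in> carrier O_hat"
      unfolding tensor_relations_def by auto
    then show "c \<in> carrier FP"
    proof cases
      case 1
      then have "frag_of (a \<oplus>\<^bsub>K_ring\<^esub> a', b) \<in> carrier FP" "frag_of (a, b) \<in> carrier FP" "frag_of (a', b) \<in> carrier FP"
        by (simp_all add: keys_frag_of)
      then show ?thesis unfolding 1 FP.FP_simps by (meson keys_diff order_trans Un_least)
    next
      case 2
      then have "frag_of (a, b \<oplus>\<^bsub>O_hat\<^esub> b') \<in> carrier FP" "frag_of (a, b) \<in> carrier FP" "frag_of (a, b') \<in> carrier FP"
        using FP.B.a_closed[of b b'] by (simp_all add: keys_frag_of)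
      then show ?thesis unfolding 2 FP.FP_simps by (meson keys_diff order_trans Un_least)
    next
      case 3
      then have "frag_of (s \<otimes>\<^bsub>K_ring\<^esub> a, b) \<in> carrier FP" "frag_of (a, diag_fin s \<otimes>\<^bsub>O_hat\<^esub> b) \<in> carrier FP"
        using FP.B.m_closed[OF diag_fin_O_hat, of s b] by (simp_all add: keys_frag_of)
      then show ?thesis unfolding 3 FP.FP_simps by (meson keys_diff order_trans Un_least)
    qed
  qed
  show "ideal TI FP" unfolding tensor_ideal_def by (rule FPc.genideal_ideal[OF sub])
  have *: "c \<in> TI" if "c \<in> tensor_relations O_ring (\<lambda>a. a) diag_fin (K_ring :: 'k ring) O_hat" for c
    using FPc.genideal_self[OF sub] that unfolding tensor_ideal_def by blast
  show "frag_of (a + a', b) - frag_of (a, b) - frag_of (a', b) \<in> TI" if "b \<in> carrier O_hat"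
  proof (rule *)
    show "frag_of (a + a', b) - frag_of (a, b) - frag_of (a', b) \<in> tensor_relations O_ring (\<lambda>a. a) diag_fin K_ring O_hat"
      unfolding tensor_relations_def using that by (intro UnI1 CollectI exI[of _ a] exI[of _ a'] exI[of _ b]) simp
  qed
  show "frag_of (a, b +\<^sub>p b') - frag_of (a, b) - frag_of (a, b') \<in> TI" if "b \<in> carrier O_hat" "b' \<in> carrier O_hat"
  proof (rule *)
    show "frag_of (a, b +\<^sub>p b') - frag_of (a, b) - frag_of (a, b') \<in> tensor_relations O_ring (\<lambda>a. a) diag_fin K_ring O_hat"
      unfolding tensor_relations_def using that
      by (intro UnI1[OF UnI2] CollectI exI[of _ a] exI[of _ b] exI[of _ b']) simp
  qed
  show "frag_of (s * a, b) - frag_of (a, diag_fin s *\<^sub>p b) \<in> TI" if "algebraic_int s" "b \<in> carrier O_hat"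
  proof (rule *)
    show "frag_of (s * a, b) - frag_of (a, diag_fin s *\<^sub>p b) \<in> tensor_relations O_ring (\<lambda>a. a) diag_fin K_ring O_hat"
      unfolding tensor_relations_def using that
      by (intro UnI2 CollectI exI[of _ s] exI[of _ a] exI[of _ b]) simp
  qed
qed

lemma TI_closed:
  "0 \<in> TI" "c \<in> TI \<Longrightarrow> d \<in> TI \<Longrightarrow> c + d \<in> TI" "c \<in> TI \<Longrightarrow> - c \<in> TI" "c \<in> TI \<Longrightarrow> d \<in> TI \<Longrightarrow> c - d \<in> TI"
proof -
  interpret I: ideal TI FP by (rule ideal_TI)
  have sub: "c \<in> carrier FP" if "c \<in> TI" for c using I.a_subset that by blast
  show "0 \<in> TI" using additive_subgroup.zero_closed[OF I.is_additive_subgroup] by simp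
  show a: "c + d \<in> TI" if "c \<in> TI" "d \<in> TI" for c d
    using additive_subgroup.a_closed[OF I.is_additive_subgroup that] by simp
  show m: "- c \<in> TI" if "c \<in> TI" for c
    using additive_subgroup.a_inv_closed[OF I.is_additive_subgroup that] FP.FP_minus[OF sub[OF that]] by simp
  show "c - d \<in> TI" if "c \<in> TI" "d \<in> TI" using a[OF that(1) m[OF that(2)]] by simp
qed

lemma TI_frag_of_zero: "frag_of (a, \<zero>\<^sub>p) \<in> TI"
proof -
  have z: "\<zero>\<^sub>p \<in> carrier O_hat" using FP.B.zero_closed by simp
  interpret PK: cring PK by (rule cring_PK)
  have "- frag_of (a, \<zero>\<^sub>p) \<in> TI" using TI_rel_right[OF z z, of a] by simp
  from TI_closed(3)[OF this] show ?thesis by simp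
qed

lemma frag_of_scale:
  assumes N: "N > 0" and y: "y \<in> carrier O_hat"
  shows "frag_of (1 / of_nat M, y) - frag_of (1 / of_nat (M * N), diag_fin (of_nat N) *\<^sub>p y) \<in> TI"
proof -
  have "of_nat N * (1 / of_nat (M * N)) = (1 / of_nat M :: 'k)" using N by simp
  then show ?thesis using TI_rel_mid[OF algebraic_int_of_nat y, of N "1 / of_nat (M * N)"] by simp
qed

text \<open>A denominator can be isolated in the first entry, the rest moving into
  \<open>O_hat\<close>; so every element of the tensor product is a pure tensor with first entry
  \<open>1 / N\<close>. For a difference, both tensors are first rewritten over
  \<open>N * N'\<close>.\<close>

lemma free_pair_reduce:
  assumes "c \<in> carrier FP"
  shows "\<exists>N>0. \<exists>y\<in>carrier O_hat. c - frag_of (1 / of_nat N, y) \<in> TI"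
  using assms[unfolded FP.FP_simps(1)]
proof (induction c rule: frag_induction)
  case zero
  show ?case
    using TI_closed(3)[OF TI_frag_of_zero[of "1 / of_nat 1"]] FP.B.zero_closed
    by (intro exI[of _ 1] conjI bexI[of _ "\<zero>\<^sub>p"]) simp_all
next
  case (one p)
  obtain a b where p: "p = (a, b)" by (cases p)
  have b: "b \<in> carrier O_hat" using one p by simp
  obtain N where N: "N > 0" "algebraic_int (of_nat N * a)" using exists_nat_mult_algebraic_int by blast
  have "of_nat N * a * (1 / of_nat N) = a" using N by simp
  then have "frag_of (a, b) - frag_of (1 / of_nat N, diag_fin (of_nat N * a) *\<^sub>p b) \<in> TI"
    using TI_rel_mid[OF N(2) b, of "1 / of_nat N"] by simp
  moreover have "diag_fin (of_nat N * a) *\<^sub>p b \<in> carrier O_hat"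
    using FP.B.m_closed[OF diag_fin_O_hat[OF N(2)] b] by simp
  ultimately show ?case unfolding p using N(1) by blast
next
  case (diff c c')
  then obtain N y N' y' where *: "N > 0" "y \<in> carrier O_hat" "c - frag_of (1 / of_nat N, y) \<in> TI"
    "N' > 0" "y' \<in> carrier O_hat" "c' - frag_of (1 / of_nat N', y') \<in> TI" by blast
  define z where "z = diag_fin (of_nat N') *\<^sub>p y"
  define z' where "z' = diag_fin (of_nat N) *\<^sub>p y'"
  have zc: "z \<in> carrier O_hat" "z' \<in> carrier O_hat"
    using FP.B.m_closed[OF diag_fin_O_hat *(2), of "of_nat N'"] FP.B.m_closed[OF diag_fin_O_hat *(5), of "of_nat N"]
    by (simp_all add: z_def z'_def)
  let ?w = "1 / of_nat (N * N') :: 'k"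
  have 1: "frag_of (1 / of_nat N, y) - frag_of (?w, z) \<in> TI"
    unfolding z_def by (rule frag_of_scale[OF *(4,2)])
  have 2: "frag_of (1 / of_nat N', y') - frag_of (?w, z') \<in> TI"
    using frag_of_scale[OF *(1,5), of N'] by (simp add: z'_def mult.commute)
  define u where "u = z \<ominus>\<^bsub>O_hat\<^esub> z'"
  have u: "u \<in> carrier O_hat" "u +\<^sub>p z' = z"
    using FP.B.minus_closed[OF zc] zc FP.B.a_assoc[of z "\<ominus>\<^bsub>O_hat\<^esub> z'" z'] FP.B.l_neg[OF zc(2)] FP.B.r_zero[OF zc(1)]
    by (simp_all add: u_def a_minus_def)
  have 3: "frag_of (?w, z) - frag_of (?w, u) - frag_of (?w, z') \<in> TI"
    using TI_rel_right[OF u(1) zc(2), of ?w] u(2) by simp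
  have "(c - c') - frag_of (?w, u) = (c - frag_of (1 / of_nat N, y)) - (c' - frag_of (1 / of_nat N', y'))
      + (frag_of (1 / of_nat N, y) - frag_of (?w, z)) - (frag_of (1 / of_nat N', y') - frag_of (?w, z'))
      + (frag_of (?w, z) - frag_of (?w, u) - frag_of (?w, z'))" by simp
  also have "\<dots> \<in> TI"
    by (rule TI_closed(2)[OF TI_closed(4)[OF TI_closed(2)[OF TI_closed(4)[OF *(3,6)] 1] 2] 3])
  finally show ?case using *(1,4) u(1) by (intro exI[of _ "N * N'"]) auto
qed

text \<open>The map sends the tensor of \<open>a\<close> and \<open>b\<close> to
  \<open>diag_fin a\<close> times \<open>b\<close>. It is injective because an element of its kernel
  is a tensor of \<open>1 / N\<close> and some \<open>y\<close>, and \<open>y / N = 0\<close> in the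
  product forces \<open>y = 0\<close>. All properties are collected in one existence statement
  because the map is fixed by choice afterwards.\<close>

lemma exists_adele_map:
  "\<exists>\<Psi>. \<Psi> \<in> ring_hom finite_adeles PK \<and> inj_on \<Psi> (carrier finite_adeles) \<and>
     (\<forall>a. \<forall>b\<in>carrier O_hat. fin_tensor a b \<in> carrier finite_adeles \<and> \<Psi> (fin_tensor a b) = diag_fin a *\<^sub>p b) \<and>
     (\<forall>x\<in>carrier (finite_adeles :: 'k fin_adele ring). \<exists>N>0. \<exists>b\<in>carrier O_hat. x = fin_tensor (1 / of_nat N) b) \<and>
     cring (finite_adeles :: 'k fin_adele ring)"
proof -
  interpret PK: cring PK by (rule cring_PK)
  have sub: "b \<in> carrier PK" if "b \<in> carrier O_hat" for b using that by (simp add: carrier_O_hat)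
  define f where "f p = diag_fin (fst p) *\<^sub>p snd p" for p :: "'k \<times> ('k place \<Rightarrow> 'k completion)"
  have fc: "f p \<in> carrier PK" if "p \<in> carrier K_ring \<times> carrier O_hat" for p
    unfolding f_def using that sub by (intro PK.m_closed diag_fin_hom) auto
  obtain h where h: "h \<in> ring_hom FP PK" "\<And>p. p \<in> carrier K_ring \<times> carrier O_hat \<Longrightarrow> h (frag_of p) = f p"
  proof (rule FP.additive_hom_extends[OF cring_PK fc])
    fix a a' :: 'k and b b' :: "'k place \<Rightarrow> 'k completion" assume b: "b \<in> carrier O_hat" "b' \<in> carrier O_hat"
    show "f (a \<otimes>\<^bsub>K_ring\<^esub> a', b \<otimes>\<^bsub>O_hat\<^esub> b') = f (a, b) *\<^sub>p f (a', b')"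
      using sub[OF b(1)] sub[OF b(2)] by (simp add: f_def diag_fin_hom PK.m_ac)
  next
    show "f (\<one>\<^bsub>K_ring\<^esub>, \<one>\<^bsub>O_hat\<^esub>) = \<one>\<^sub>p" by (simp add: f_def diag_fin_hom)
  qed auto
  interpret h: ring_hom_ring FP PK h
    by (rule ring_hom_ringI2[OF FPc.ring_axioms PK.ring_axioms h(1)])
  have hf: "h (frag_of (a, b)) = diag_fin a *\<^sub>p b" if "b \<in> carrier O_hat" for a b
    using h(2)[of "(a, b)"] that by (simp add: f_def)
  have fin: "frag_of (a, b) \<in> carrier FP" if "b \<in> carrier O_hat" for a b using that by (simp add: keys_frag_of)
  have hdiff: "h (c - d) = h c \<ominus>\<^bsub>PK\<^esub> h d" if "c \<in> carrier FP" "d \<in> carrier FP" for c d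
  proof -
    have "c - d = c \<oplus>\<^bsub>FP\<^esub> \<ominus>\<^bsub>FP\<^esub> d" using FP.FP_minus[OF that(2)] by simp
    moreover have "h (c \<oplus>\<^bsub>FP\<^esub> \<ominus>\<^bsub>FP\<^esub> d) = h c +\<^sub>p \<ominus>\<^bsub>PK\<^esub> h d"
      using h.hom_add[OF that(1) FPc.a_inv_closed[OF that(2)]] h.hom_a_inv[OF that(2)] by metis
    ultimately show ?thesis unfolding a_minus_def by metis
  qed
  have ker: "a_kernel FP PK h = TI"
  proof
    \<comment> \<open>The generating relations vanish under \<open>h\<close>: it is additive in both
      entries, and integers may be moved between the entries.\<close>
    have "tensor_relations O_ring (\<lambda>a. a) diag_fin (K_ring :: 'k ring) O_hat \<subseteq> a_kernel FP PK h"
    proof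
      fix c assume "c \<in> tensor_relations O_ring (\<lambda>a. a) diag_fin (K_ring :: 'k ring) O_hat"
      then consider (1) a a' b where "c = frag_of (a + a', b) - frag_of (a, b) - frag_of (a', b)" "b \<in> carrier O_hat"
        | (2) a b b' where "c = frag_of (a, b +\<^sub>p b') - frag_of (a, b) - frag_of (a, b')" "b \<in> carrier O_hat" "b' \<in> carrier O_hat"
        | (3) s a b where "c = frag_of (s * a, b) - frag_of (a, diag_fin s *\<^sub>p b)" "algebraic_int s" "b \<in> carrier O_hat"
        unfolding tensor_relations_def by auto
      then have "c \<in> carrier FP \<and> h c = \<zero>\<^sub>p"
      proof cases
        case 1
        have d: "frag_of (a + a', b) - frag_of (a, b) \<in> carrier FP"
          using keys_diff[of "frag_of (a + a', b)" "frag_of (a, b)"] 1(2) by (auto simp: keys_frag_of)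
        then have "c \<in> carrier FP" unfolding 1 using keys_diff[of "frag_of (a + a', b) - frag_of (a, b)" "frag_of (a', b)"] 1(2) by (auto simp: keys_frag_of)
        moreover have "h c = h (frag_of (a + a', b)) \<ominus>\<^bsub>PK\<^esub> h (frag_of (a, b)) \<ominus>\<^bsub>PK\<^esub> h (frag_of (a', b))"
          unfolding 1(1) hdiff[OF d fin[OF 1(2)]] hdiff[OF fin[OF 1(2)] fin[OF 1(2)]] ..
        ultimately show ?thesis using sub[OF 1(2)]
          by (simp add: hf[OF 1(2)] diag_fin_hom PK.l_distr a_minus_def PK.a_ac PK.r_neg PK.r_neg1 PK.r_neg2)
      next
        case 2
        have b3: "b +\<^sub>p b' \<in> carrier O_hat" using FP.B.a_closed[OF 2(2,3)] by simp
        have d: "frag_of (a, b +\<^sub>p b') - frag_of (a, b) \<in> carrier FP"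
          using keys_diff[of "frag_of (a, b +\<^sub>p b')" "frag_of (a, b)"] 2(2) b3 by (auto simp: keys_frag_of)
        then have "c \<in> carrier FP" unfolding 2 using keys_diff[of "frag_of (a, b +\<^sub>p b') - frag_of (a, b)" "frag_of (a, b')"] 2(3) by (auto simp: keys_frag_of)
        moreover have "h c = h (frag_of (a, b +\<^sub>p b')) \<ominus>\<^bsub>PK\<^esub> h (frag_of (a, b)) \<ominus>\<^bsub>PK\<^esub> h (frag_of (a, b'))"
          unfolding 2(1) hdiff[OF d fin[OF 2(3)]] hdiff[OF fin[OF b3] fin[OF 2(2)]] ..
        moreover have "h (frag_of (a, b +\<^sub>p b')) = h (frag_of (a, b)) +\<^sub>p h (frag_of (a, b'))"
          using sub[OF 2(2)] sub[OF 2(3)] unfolding hf[OF 2(2)] hf[OF 2(3)] hf[OF b3]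
          by (simp add: PK.r_distr diag_fin_hom)
        ultimately show ?thesis using h.hom_closed[OF fin[OF 2(2)]] h.hom_closed[OF fin[OF 2(3)]]
          by (simp add: a_minus_def PK.a_ac PK.r_neg PK.r_neg1 PK.r_neg2)
      next
        case 3
        have b3: "diag_fin s *\<^sub>p b \<in> carrier O_hat" using FP.B.m_closed[OF diag_fin_O_hat[OF 3(2)] 3(3)] by simp
        have "c \<in> carrier FP" unfolding 3
          using keys_diff[of "frag_of (s * a, b)" "frag_of (a, diag_fin s *\<^sub>p b)"] 3(3) b3 by (auto simp: keys_frag_of)
        moreover have "h c = \<zero>\<^sub>p"
          unfolding 3(1) hdiff[OF fin[OF 3(3)] fin[OF b3]] hf[OF 3(3)] hf[OF b3] using sub[OF 3(3)]
          by (simp add: diag_fin_hom PK.m_ac PK.r_neg a_minus_def)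
        ultimately show ?thesis ..
      qed
      then show "c \<in> a_kernel FP PK h" unfolding a_kernel_def' by blast
    qed
    then show "TI \<subseteq> a_kernel FP PK h"
      unfolding tensor_ideal_def by (rule FPc.genideal_minimal[OF h.kernel_is_ideal])
    then have TI0: "h c = \<zero>\<^sub>p" "c \<in> carrier FP" if "c \<in> TI" for c using that unfolding a_kernel_def' by blast+
    show "a_kernel FP PK h \<subseteq> TI"
    proof
      fix c assume "c \<in> a_kernel FP PK h"
      then have c: "c \<in> carrier FP" "h c = \<zero>\<^sub>p" unfolding a_kernel_def' by blast+
      obtain N y where y: "N > 0" "y \<in> carrier O_hat" "c - frag_of (1 / of_nat N, y) \<in> TI"
        using free_pair_reduce[OF c(1)] by blast
      have hy: "diag_fin (1 / of_nat N) *\<^sub>p y = \<zero>\<^sub>p"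
        using TI0(1)[OF y(3)] hdiff[OF c(1) fin[OF y(2)]] c(2) sub[OF y(2)]
        by (simp add: hf[OF y(2)] a_minus_def diag_fin_hom)
      have "y = diag_fin (of_nat N * (1 / of_nat N)) *\<^sub>p y"
        using y sub[OF y(2)] by (simp add: diag_fin_hom)
      also have "\<dots> = \<zero>\<^sub>p"
        unfolding diag_fin_hom(1) using sub[OF y(2)] hy by (simp add: PK.m_assoc diag_fin_hom)
      finally have "frag_of (1 / of_nat N, y) \<in> TI" using TI_frag_of_zero by simp
      from TI_closed(2)[OF y(3) this] show "c \<in> TI" by simp
    qed
  qed
  \<comment> \<open>The isomorphism theorem: each coset of the kernel has a single image under
    \<open>h\<close>.\<close>
  let ?\<Psi> = "\<lambda>E. the_elem (h ` E)"
  have AF: "finite_adeles = FP Quot a_kernel FP PK h"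
    unfolding finite_adeles_def tensor_ring_def ker ..
  have iso: "?\<Psi> \<in> ring_iso finite_adeles (PK\<lparr>carrier := h ` carrier FP\<rparr>)"
    unfolding AF by (rule h.FactRing_iso_set_aux)
  have img: "h ` carrier FP \<subseteq> carrier PK" using h.hom_closed by blast
  have "?\<Psi> \<in> ring_hom finite_adeles PK"
    using iso by (auto simp: ring_iso_def Ring.ring_hom_def Pi_iff intro: subsetD[OF img])
  moreover have "inj_on ?\<Psi> (carrier finite_adeles)"
    using iso by (simp add: ring_iso_def bij_betw_def)
  moreover have ft: "fin_tensor a b = a_kernel FP PK h +>\<^bsub>FP\<^esub> frag_of (a, b)" for a b
    unfolding fin_tensor_def pure_tensor_def ker ..
  then have "fin_tensor a b \<in> carrier finite_adeles \<and> ?\<Psi> (fin_tensor a b) = diag_fin a *\<^sub>p b" if "b \<in> carrier O_hat" for a b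
    using h.the_elem_simp[OF fin[OF that]] hf[OF that] fin[OF that]
    by (auto simp: AF FactRing_def A_RCOSETS_def')
  moreover have "\<exists>N>0. \<exists>b\<in>carrier O_hat. x = fin_tensor (1 / of_nat N) b" if x: "x \<in> carrier finite_adeles" for x :: "'k fin_adele"
  proof -
    obtain c where c: "c \<in> carrier FP" "x = a_kernel FP PK h +>\<^bsub>FP\<^esub> c"
      using x by (auto simp: AF FactRing_def A_RCOSETS_def')
    obtain N y where y: "N > 0" "y \<in> carrier O_hat" "c - frag_of (1 / of_nat N, y) \<in> TI"
      using free_pair_reduce[OF c(1)] by blast
    interpret I: ideal TI FP by (rule ideal_TI)
    interpret I: abelian_subgroup TI FP by (rule abelian_subgroupI3[OF I.is_additive_subgroup FPc.is_abelian_group])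
    have "c = (c - frag_of (1 / of_nat N, y)) \<oplus>\<^bsub>FP\<^esub> frag_of (1 / of_nat N, y)" by simp
    then have "c \<in> TI +>\<^bsub>FP\<^esub> frag_of (1 / of_nat N, y)" using y(3) unfolding a_r_coset_def' by blast
    then have "TI +>\<^bsub>FP\<^esub> frag_of (1 / of_nat N, y) = TI +>\<^bsub>FP\<^esub> c"
      by (rule FPc.a_repr_independence[OF _ fin[OF y(2)] I.a_subgroup])
    then have "x = fin_tensor (1 / of_nat N) y" unfolding c(2) ft ker by simp
    then show ?thesis using y by blast
  qed
  moreover have "cring (finite_adeles :: 'k fin_adele ring)"
    unfolding AF by (rule ideal.quotient_is_cring[OF h.kernel_is_ideal FP.cring_FP])
  ultimately show ?thesis by blast
qed

definition adele_map :: "'k fin_adele \<Rightarrow> 'k place \<Rightarrow> 'k completion" where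
  "adele_map = (SOME \<Psi>. \<Psi> \<in> ring_hom finite_adeles PK \<and> inj_on \<Psi> (carrier finite_adeles) \<and>
     (\<forall>a. \<forall>b\<in>carrier O_hat. fin_tensor a b \<in> carrier finite_adeles \<and> \<Psi> (fin_tensor a b) = diag_fin a *\<^sub>p b) \<and>
     (\<forall>x\<in>carrier (finite_adeles :: 'k fin_adele ring). \<exists>N>0. \<exists>b\<in>carrier O_hat. x = fin_tensor (1 / of_nat N) b) \<and>
     cring (finite_adeles :: 'k fin_adele ring))"

abbreviation AF :: "'k fin_adele ring" where "AF \<equiv> finite_adeles"

abbreviation AF_mult (infixl "*\<^sub>f" 70) where "x *\<^sub>f y \<equiv> x \<otimes>\<^bsub>AF\<^esub> y"
abbreviation AF_add (infixl "+\<^sub>f" 65) where "x +\<^sub>f y \<equiv> x \<oplus>\<^bsub>AF\<^esub> y"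
abbreviation AF_diff (infixl "-\<^sub>f" 65) where "x -\<^sub>f y \<equiv> x \<ominus>\<^bsub>AF\<^esub> y"
abbreviation AF_inv ("inv\<^sub>f _" [81] 80) where "inv\<^sub>f x \<equiv> inv\<^bsub>AF\<^esub> x"
abbreviation AF_one ("\<one>\<^sub>f") where "\<one>\<^sub>f \<equiv> \<one>\<^bsub>AF\<^esub>"
abbreviation AF_zero ("\<zero>\<^sub>f") where "\<zero>\<^sub>f \<equiv> \<zero>\<^bsub>AF\<^esub>"

lemma adele_map_hom: "adele_map \<in> ring_hom AF PK"
  and adele_map_inj: "inj_on adele_map (carrier AF)"
  and fin_tensor_in: "b \<in> carrier O_hat \<Longrightarrow> fin_tensor a b \<in> carrier AF"
  and adele_map_tensor: "b \<in> carrier O_hat \<Longrightarrow> adele_map (fin_tensor a b) = diag_fin a *\<^sub>p b"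
  and adele_eq_tensor: "x \<in> carrier AF \<Longrightarrow> \<exists>N>0. \<exists>b\<in>carrier O_hat. x = fin_tensor (1 / of_nat N) b"
  and cring_AF: "cring AF"
  using someI_ex[OF exists_adele_map, folded adele_map_def] by blast+

sublocale AF: cring AF by (rule cring_AF)

sublocale PK: cring PK by (rule cring_PK)

lemma adele_map_simps [simp]:
  "x \<in> carrier AF \<Longrightarrow> adele_map x \<in> carrier PK"
  "x \<in> carrier AF \<Longrightarrow> y \<in> carrier AF \<Longrightarrow> adele_map (x *\<^sub>f y) = adele_map x *\<^sub>p adele_map y"
  "x \<in> carrier AF \<Longrightarrow> y \<in> carrier AF \<Longrightarrow> adele_map (x +\<^sub>f y) = adele_map x +\<^sub>p adele_map y"
  "adele_map \<one>\<^sub>f = \<one>\<^sub>p"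
  using adele_map_hom by (auto simp: Ring.ring_hom_def)

text \<open>The diagonal embedding of \<open>K\<close> into the finite adeles.\<close>

definition jf :: "'k \<Rightarrow> 'k fin_adele" where
  "jf x = fin_tensor x \<one>\<^bsub>O_hat\<^esub>"

lemma adele_map_jf: "adele_map (jf x) = diag_fin x"
  using adele_map_tensor[OF FP.B.one_closed, of x] by (simp add: jf_def diag_fin_hom)

lemma jf_in [simp]: "jf x \<in> carrier AF"
  unfolding jf_def by (rule fin_tensor_in[OF FP.B.one_closed])

lemma adele_eqI: "x \<in> carrier AF \<Longrightarrow> y \<in> carrier AF \<Longrightarrow> adele_map x = adele_map y \<Longrightarrow> x = y"
  using adele_map_inj by (auto simp: inj_on_def)

lemma jf_hom: "jf (x * y) = jf x *\<^sub>f jf y" "jf (x + y) = jf x +\<^sub>f jf y" "jf 1 = \<one>\<^sub>f"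
  by (rule adele_eqI; simp add: adele_map_jf diag_fin_hom)+

lemma jf_zero: "jf 0 = \<zero>\<^sub>f"
proof -
  have "jf 0 +\<^sub>f jf 0 = jf 0" using jf_hom(2)[of 0 0] by simp
  then show ?thesis using AF.add.l_cancel_one[of "jf 0" "jf 0"] by simp
qed

lemma jf_minus: "jf (- x) = \<ominus>\<^bsub>AF\<^esub> jf x"
  using jf_hom(2)[of "- x" x] by (intro AF.minus_equality[symmetric]) (simp_all add: jf_zero)

lemma jf_diff: "jf (x - y) = jf x -\<^sub>f jf y"
  using jf_hom(2)[of x "- y"] by (simp add: jf_minus a_minus_def)

definition fnorm :: "'k place \<Rightarrow> 'k fin_adele \<Rightarrow> real" where
  "fnorm v x = abs_value.cnorm v (adele_map x v)"

lemma adele_map_component: "v \<in> finite_places \<Longrightarrow> x \<in> carrier AF \<Longrightarrow> adele_map x v \<in> carrier (completion v)"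
  using adele_map_simps(1)[of x] by (auto simp: product_ring_def)

lemma fnorm_simps:
  assumes v: "v \<in> finite_places" and x: "x \<in> carrier AF"
  shows "0 \<le> fnorm v x" "y \<in> carrier AF \<Longrightarrow> fnorm v (x *\<^sub>f y) = fnorm v x * fnorm v y"
    "y \<in> carrier AF \<Longrightarrow> fnorm v (x +\<^sub>f y) \<le> max (fnorm v x) (fnorm v y)"
    "fnorm v (jf k) = v k"
proof -
  interpret abs_value v by (rule finite_place_abs_value[OF v])
  note c = adele_map_component[OF v]
  show "0 \<le> fnorm v x" unfolding fnorm_def by (rule cnorm_nonneg[OF c[OF x]])
  show "fnorm v (jf k) = v k" using v by (simp add: fnorm_def adele_map_jf diag_fin_def)
  assume y: "y \<in> carrier AF"
  show "fnorm v (x *\<^sub>f y) = fnorm v x * fnorm v y"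
    using x y v cnorm_mult[OF c[OF x] c[OF y]] by (simp add: fnorm_def product_ring_def)
  show "fnorm v (x +\<^sub>f y) \<le> max (fnorm v x) (fnorm v y)"
    using x y v cnorm_ultrametric[OF finite_place_ultrametric[OF v] c[OF x] c[OF y]] by (simp add: fnorm_def product_ring_def)
qed

lemma fnorm_jf: "v \<in> finite_places \<Longrightarrow> fnorm v (jf k) = v k"
  by (rule fnorm_simps(4)[OF _ AF.one_closed])

lemma fnorm_one: "v \<in> finite_places \<Longrightarrow> fnorm v \<one>\<^sub>f = 1"
  using fnorm_jf[of v 1] by (simp add: jf_hom abs_value.one[OF finite_place_abs_value])

lemma fnorm_minus: "v \<in> finite_places \<Longrightarrow> x \<in> carrier AF \<Longrightarrow> fnorm v (\<ominus>\<^bsub>AF\<^esub> x) = fnorm v x"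
proof -
  assume v: "v \<in> finite_places" and x: "x \<in> carrier AF"
  interpret abs_value v by (rule finite_place_abs_value[OF v])
  have "\<ominus>\<^bsub>AF\<^esub> x = jf (-1) *\<^sub>f x" using x by (simp add: jf_minus jf_hom AF.l_minus)
  then show ?thesis using fnorm_simps(2)[OF v jf_in x, of "-1"] fnorm_jf[OF v, of "-1"] by simp
qed

lemma adele_zeroI:
  assumes x: "x \<in> carrier AF" and "\<And>v. v \<in> finite_places \<Longrightarrow> fnorm v x = 0"
  shows "x = \<zero>\<^sub>f"
proof (rule adele_eqI[OF x AF.zero_closed])
  have z: "adele_map \<zero>\<^sub>f = diag_fin 0" using adele_map_jf[of 0] by (simp add: jf_zero)
  show "adele_map x = adele_map \<zero>\<^sub>f"
  proof (rule PiE_ext)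
    show "adele_map x \<in> PiE finite_places (\<lambda>v. carrier (completion v))"
      using adele_map_simps(1)[OF x] by (simp add: product_ring_def)
    show "adele_map \<zero>\<^sub>f \<in> PiE finite_places (\<lambda>v. carrier (completion v))"
      using adele_map_simps(1)[OF AF.zero_closed] by (simp add: product_ring_def)
    fix v :: "'k place" assume v: "v \<in> finite_places"
    interpret abs_value v by (rule finite_place_abs_value[OF v])
    show "adele_map x v = adele_map \<zero>\<^sub>f v"
      using assms(2)[OF v] cnorm_eq_0[OF adele_map_component[OF v x]] v
      by (simp add: z fnorm_def diag_fin_def embed_hom)
  qed
qed

abbreviation OH :: "'k fin_adele set" where "OH \<equiv> O_hat_in_adeles"

text \<open>The means of building adeles with prescribed components; families that are not integral
  are first multiplied by an integer.\<close>

lemma OH_family: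
  assumes "y \<in> carrier O_hat"
  shows "\<exists>x\<in>OH. adele_map x = y"
proof
  interpret PK: cring PK by (rule cring_PK)
  show "fin_tensor 1 y \<in> OH" using assms by (simp add: O_hat_in_adeles_def)
  show "adele_map (fin_tensor 1 y) = y"
    using assms by (simp add: adele_map_tensor diag_fin_hom carrier_O_hat)
qed

lemma OH_iff: "x \<in> OH \<longleftrightarrow> x \<in> carrier AF \<and> (\<forall>v\<in>finite_places. fnorm v x \<le> 1)"
proof
  assume "x \<in> OH"
  then obtain y where y: "y \<in> carrier O_hat" "x = fin_tensor 1 y" by (auto simp: O_hat_in_adeles_def)
  have "adele_map x = y" unfolding y using y(1) by (simp add: adele_map_tensor diag_fin_hom carrier_O_hat)
  then show "x \<in> carrier AF \<and> (\<forall>v\<in>finite_places. fnorm v x \<le> 1)"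
    using y fin_tensor_in[OF y(1)] by (auto simp: carrier_O_hat fnorm_def)
next
  assume x: "x \<in> carrier AF \<and> (\<forall>v\<in>finite_places. fnorm v x \<le> 1)"
  then have "adele_map x \<in> carrier O_hat" by (simp add: carrier_O_hat fnorm_def)
  then obtain z where "z \<in> OH" "adele_map z = adele_map x" using OH_family by blast
  moreover have "z \<in> carrier AF" using \<open>z \<in> OH\<close> by (auto simp: O_hat_in_adeles_def fin_tensor_in)
  ultimately show "x \<in> OH" using adele_eqI x by metis
qed

lemma OH_sub: "x \<in> OH \<Longrightarrow> x \<in> carrier AF"
  by (simp add: OH_iff)

lemma OH_closed:
  "x \<in> OH \<Longrightarrow> y \<in> OH \<Longrightarrow> x +\<^sub>f y \<in> OH" "x \<in> OH \<Longrightarrow> y \<in> OH \<Longrightarrow> x *\<^sub>f y \<in> OH"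
  "x \<in> OH \<Longrightarrow> \<ominus>\<^bsub>AF\<^esub> x \<in> OH" "\<one>\<^sub>f \<in> OH" "\<zero>\<^sub>f \<in> OH"
proof -
  show "x +\<^sub>f y \<in> OH" if "x \<in> OH" "y \<in> OH"
    using that fnorm_simps(3)[of _ x y] by (fastforce simp: OH_iff)
  show "x *\<^sub>f y \<in> OH" if "x \<in> OH" "y \<in> OH"
    using that by (auto simp: OH_iff fnorm_simps mult_le_one)
  show "\<ominus>\<^bsub>AF\<^esub> x \<in> OH" if "x \<in> OH" using that by (simp add: OH_iff fnorm_minus)
  show "\<one>\<^sub>f \<in> OH" by (simp add: OH_iff fnorm_one)
  show "\<zero>\<^sub>f \<in> OH" using fnorm_jf[of _ 0]
    by (simp add: OH_iff jf_zero abs_value.zero[OF finite_place_abs_value])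
qed

lemma jf_OH_iff: "jf k \<in> OH \<longleftrightarrow> algebraic_int k"
  by (simp add: OH_iff fnorm_jf algebraic_int_iff_finite_places)

text \<open>As \<open>x\<close> is a tensor of some \<open>1 / N\<close> with an integral family,
  \<open>N\<close> clears its denominators.\<close>

lemma adele_denominator: "x \<in> carrier AF \<Longrightarrow> \<exists>N>0. jf (of_nat N) *\<^sub>f x \<in> OH"
proof -
  assume x: "x \<in> carrier AF"
  obtain N b where b: "N > 0" "b \<in> carrier O_hat" "x = fin_tensor (1 / of_nat N) b"
    using adele_eq_tensor[OF x] by blast
  have "adele_map (jf (of_nat N) *\<^sub>f x) = diag_fin (of_nat N) *\<^sub>p (diag_fin (1 / of_nat N) *\<^sub>p b)"
    using x b(2) by (simp add: adele_map_jf) (simp add: b(3) adele_map_tensor)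
  also have "\<dots> = diag_fin (of_nat N * (1 / of_nat N)) *\<^sub>p b"
    unfolding diag_fin_hom(1) using b(2) by (simp add: PK.m_assoc diag_fin_hom carrier_O_hat)
  also have "\<dots> = b" using b by (simp add: diag_fin_hom carrier_O_hat)
  finally have "adele_map (jf (of_nat N) *\<^sub>f x) = b" .
  then show ?thesis using b x by (intro exI[of _ N]) (simp add: OH_iff fnorm_def carrier_O_hat)
qed

lemma O_hat_units_iff: "u \<in> O_hat_units \<longleftrightarrow> u \<in> Units AF \<and> u \<in> OH \<and> inv\<^sub>f u \<in> OH"
proof
  assume "u \<in> O_hat_units"
  then obtain y where y: "y \<in> Units O_hat" "u = fin_tensor 1 y" by (auto simp: O_hat_units_def)
  then obtain z where z: "y \<in> carrier O_hat" "z \<in> carrier O_hat" "y \<otimes>\<^bsub>O_hat\<^esub> z = \<one>\<^bsub>O_hat\<^esub>"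
    by (auto simp: Units_def)
  define w where "w = fin_tensor 1 z"
  have am: "adele_map u = y" "adele_map w = z" unfolding w_def y(2) using z
    by (simp_all add: adele_map_tensor diag_fin_hom carrier_O_hat)
  have c: "u \<in> carrier AF" "w \<in> carrier AF" unfolding w_def y(2) using z fin_tensor_in by auto
  have "u *\<^sub>f w = \<one>\<^sub>f" using c z by (intro adele_eqI) (simp_all add: am)
  moreover from this have "w *\<^sub>f u = \<one>\<^sub>f" using c by (simp add: AF.m_comm)
  ultimately have "u \<in> Units AF" "inv\<^sub>f u = w"
    using c AF.comm_inv_char[OF c] unfolding Units_def by blast+
  moreover have "u \<in> OH" "w \<in> OH" using z by (auto simp: O_hat_in_adeles_def w_def y(2))
  ultimately show "u \<in> Units AF \<and> u \<in> OH \<and> inv\<^sub>f u \<in> OH" by simp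
next
  assume u: "u \<in> Units AF \<and> u \<in> OH \<and> inv\<^sub>f u \<in> OH"
  then have c: "u \<in> carrier AF" "inv\<^sub>f u \<in> carrier AF" by auto
  have y: "adele_map u \<in> carrier O_hat" "adele_map (inv\<^sub>f u) \<in> carrier O_hat"
    using u by (auto simp: carrier_O_hat OH_iff fnorm_def)
  have "adele_map u *\<^sub>p adele_map (inv\<^sub>f u) = \<one>\<^sub>p"
    using adele_map_simps(2)[OF c] u by simp
  then have "adele_map u \<in> Units O_hat" using y FP.B.m_comm[OF y] by (auto simp: Units_def)
  moreover have "u = fin_tensor 1 (adele_map u)"
    using y c by (intro adele_eqI) (simp_all add: adele_map_tensor diag_fin_hom fin_tensor_in)
  ultimately show "u \<in> O_hat_units" by (auto simp: O_hat_units_def)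
qed

section \<open>Fractional ideals and approximation in the finite adeles\<close>

lemma Units_AF_in [simp]: "g \<in> Units AF \<Longrightarrow> g \<in> carrier AF"
  by (rule AF.Units_closed)

lemma AF_diff_trans:
  assumes "x \<in> carrier AF" "y \<in> carrier AF" "z \<in> carrier AF"
  shows "x -\<^sub>f z = (x -\<^sub>f y) +\<^sub>f (y -\<^sub>f z)"
  using assms by (simp add: a_minus_def AF.a_assoc AF.l_neg AF.r_neg2 AF.r_neg1)

text \<open>For a finite idele \<open>g\<close> this is \<open>g O_hat\<close>.\<close>

definition GO :: "'k fin_adele \<Rightarrow> 'k fin_adele set" where
  "GO g = {x \<in> carrier AF. \<forall>v\<in>finite_places. fnorm v x \<le> fnorm v g}"

lemma GO_sub: "x \<in> GO g \<Longrightarrow> x \<in> carrier AF"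
  by (simp add: GO_def)

lemma GO_one: "GO \<one>\<^sub>f = OH"
  by (auto simp: GO_def OH_iff fnorm_one)

lemma fnorm_zero: "v \<in> finite_places \<Longrightarrow> fnorm v \<zero>\<^sub>f = 0"
  using fnorm_jf[of v 0] by (simp add: jf_zero abs_value.zero[OF finite_place_abs_value])

lemma GO_zero: "g \<in> carrier AF \<Longrightarrow> \<zero>\<^sub>f \<in> GO g"
  by (simp add: GO_def fnorm_zero fnorm_simps)

lemma GO_self: "g \<in> carrier AF \<Longrightarrow> g \<in> GO g"
  by (simp add: GO_def)

lemma GO_add: "x \<in> GO g \<Longrightarrow> y \<in> GO g \<Longrightarrow> x +\<^sub>f y \<in> GO g"
  using fnorm_simps(3)[of _ x y] by (fastforce simp: GO_def)

lemma GO_minus: "x \<in> GO g \<Longrightarrow> \<ominus>\<^bsub>AF\<^esub> x \<in> GO g"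
  by (simp add: GO_def fnorm_minus)

lemma GO_diff: "x \<in> GO g \<Longrightarrow> y \<in> GO g \<Longrightarrow> x -\<^sub>f y \<in> GO g"
  by (simp add: a_minus_def GO_add GO_minus)

lemma GO_mult: "x \<in> GO g \<Longrightarrow> y \<in> GO h \<Longrightarrow> g \<in> carrier AF \<Longrightarrow> h \<in> carrier AF \<Longrightarrow> x *\<^sub>f y \<in> GO (g *\<^sub>f h)"
  by (auto simp: GO_def fnorm_simps intro!: mult_mono)

lemma GO_mult_int: "algebraic_int a \<Longrightarrow> x \<in> GO g \<Longrightarrow> g \<in> carrier AF \<Longrightarrow> jf a *\<^sub>f x \<in> GO g"
  using GO_mult[of "jf a" "\<one>\<^sub>f" x g] by (simp add: GO_one jf_OH_iff)

lemma fnorm_pos: "g \<in> Units AF \<Longrightarrow> v \<in> finite_places \<Longrightarrow> 0 < fnorm v g"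
proof -
  assume g: "g \<in> Units AF" and v: "v \<in> finite_places"
  have "fnorm v g * fnorm v (inv\<^sub>f g) = 1"
    using fnorm_simps(2)[OF v, of g "inv\<^sub>f g"] g fnorm_one[OF v] by simp
  then show ?thesis using fnorm_simps(1)[OF v, of g] g by (metis AF.Units_closed less_eq_real_def mult_zero_left zero_neq_one)
qed

lemma fnorm_inv: "g \<in> Units AF \<Longrightarrow> v \<in> finite_places \<Longrightarrow> fnorm v (inv\<^sub>f g) = inverse (fnorm v g)"
proof -
  assume g: "g \<in> Units AF" and v: "v \<in> finite_places"
  have "fnorm v g * fnorm v (inv\<^sub>f g) = 1"
    using fnorm_simps(2)[OF v, of g "inv\<^sub>f g"] g fnorm_one[OF v] by simp
  then show ?thesis by (metis inverse_unique)
qed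

lemma O_hat_units_iff_fnorm: "u \<in> O_hat_units \<longleftrightarrow> u \<in> Units AF \<and> (\<forall>v\<in>finite_places. fnorm v u = 1)"
proof
  assume u: "u \<in> O_hat_units"
  then have u': "u \<in> Units AF" "u \<in> OH" "inv\<^sub>f u \<in> OH" by (auto simp: O_hat_units_iff)
  have "fnorm v u = 1" if v: "v \<in> finite_places" for v
  proof -
    have "fnorm v u \<le> 1" "inverse (fnorm v u) \<le> 1" "0 < fnorm v u"
      using u' v fnorm_inv[OF u'(1) v] fnorm_pos[OF u'(1) v] by (auto simp: OH_iff)
    then show ?thesis by (simp add: inverse_le_1_iff)
  qed
  then show "u \<in> Units AF \<and> (\<forall>v\<in>finite_places. fnorm v u = 1)" using u' by blast
next
  assume u: "u \<in> Units AF \<and> (\<forall>v\<in>finite_places. fnorm v u = 1)"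
  then show "u \<in> O_hat_units" by (simp add: O_hat_units_iff OH_iff fnorm_inv)
qed

lemma jf_Units: "k \<noteq> 0 \<Longrightarrow> jf k \<in> Units AF" and jf_inv: "k \<noteq> 0 \<Longrightarrow> inv\<^sub>f jf k = jf (1 / k)"
proof -
  assume k: "k \<noteq> 0"
  have *: "jf k *\<^sub>f jf (1 / k) = \<one>\<^sub>f" "jf (1 / k) *\<^sub>f jf k = \<one>\<^sub>f"
    using k by (simp_all flip: jf_hom)
  then show "jf k \<in> Units AF" using jf_in unfolding Units_def by blast
  show "inv\<^sub>f jf k = jf (1 / k)" by (rule AF.comm_inv_char[OF jf_in jf_in *(1)])
qed

text \<open>At each place \<open>N\<close> can be taken arbitrarily small, along
  \<open>superfact\<close>. This is what makes the adele \<open>w\<close> of a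
  \<open>K\<close>-lattice unique.\<close>

lemma divisible_adele_zero:
  assumes x: "x \<in> carrier AF" and g: "g \<in> carrier AF" and "\<And>N. N > 0 \<Longrightarrow> x \<in> GO (jf (of_nat N) *\<^sub>f g)"
  shows "x = \<zero>\<^sub>f"
proof (rule adele_zeroI[OF x])
  fix v :: "'k place" assume v: "v \<in> finite_places"
  have "(\<lambda>m. v (of_nat (superfact m) :: 'k) * fnorm v g) \<longlonglongrightarrow> 0"
    by (rule tendsto_mult_left_zero[OF superfact_tendsto_0[OF v]])
  moreover have "fnorm v x \<le> v (of_nat (superfact m)) * fnorm v g" for m
    using assms(3)[OF superfact_pos, of m] v g by (simp add: GO_def fnorm_simps fnorm_jf)
  ultimately have "fnorm v x \<le> 0" by (intro LIMSEQ_le_const) auto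
  then show "fnorm v x = 0" using fnorm_simps(1)[OF v x] by simp
qed

text \<open>Up to integer factors, \<open>K \<inter> g O_hat\<close> lies between \<open>O\<close>
  and itself scaled: it contains some \<open>N O\<close> and is contained in some
  \<open>(1/N) O\<close>. The two bounds come from denominators of the inverse of \<open>g\<close>
  and of \<open>g\<close>.\<close>

lemma Units_denominators:
  assumes g: "g \<in> Units AF"
  shows "\<exists>N>0. \<forall>k. algebraic_int k \<longrightarrow> jf (of_nat N * k) \<in> GO g"
    and "\<exists>N>0. \<forall>k. jf k \<in> GO g \<longrightarrow> algebraic_int (of_nat N * k)"
proof -
  have gc: "g \<in> carrier AF" "inv\<^sub>f g \<in> carrier AF" using g by auto
  obtain N where N: "N > 0" "jf (of_nat N) *\<^sub>f inv\<^sub>f g \<in> OH" using adele_denominator[OF gc(2)] by blast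
  have "jf (of_nat N * k) \<in> GO g" if k: "algebraic_int k" for k
  proof -
    have "v (of_nat N * k) \<le> fnorm v g" if v: "v \<in> finite_places" for v
    proof -
      interpret abs_value v by (rule finite_place_abs_value[OF v])
      have "v (of_nat N) * inverse (fnorm v g) \<le> 1"
        using N(2) v gc by (simp add: OH_iff fnorm_simps fnorm_jf fnorm_inv[OF g])
      then have "v (of_nat N) \<le> fnorm v g" using fnorm_pos[OF g v] by (simp add: field_simps)
      moreover have "v (of_nat N) * v k \<le> v (of_nat N) * 1"
        by (intro mult_left_mono finite_place_int_le_1[OF v k]) simp
      ultimately show ?thesis by (simp add: mult)
    qed
    then show ?thesis by (simp add: GO_def fnorm_jf)
  qed
  then show "\<exists>N>0. \<forall>k. algebraic_int k \<longrightarrow> jf (of_nat N * k) \<in> GO g" using N(1) by blast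
  obtain M where M: "M > 0" "jf (of_nat M) *\<^sub>f g \<in> OH" using adele_denominator[OF gc(1)] by blast
  have "algebraic_int (of_nat M * k)" if k: "jf k \<in> GO g" for k
  proof -
    have "v (of_nat M * k) \<le> 1" if v: "v \<in> finite_places" for v
    proof -
      interpret abs_value v by (rule finite_place_abs_value[OF v])
      have "v (of_nat M) * v k \<le> v (of_nat M) * fnorm v g"
        using k v by (intro mult_left_mono) (auto simp: GO_def fnorm_jf)
      also have "\<dots> \<le> 1" using M(2) v gc by (simp add: OH_iff fnorm_simps fnorm_jf)
      finally show ?thesis by (simp add: mult)
    qed
    then show ?thesis by (simp add: algebraic_int_iff_finite_places)
  qed
  then show "\<exists>N>0. \<forall>k. jf k \<in> GO g \<longrightarrow> algebraic_int (of_nat N * k)" using M(1) by blast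
qed

lemma fnorm_diff_jf:
  assumes v: "v \<in> finite_places" and x: "x \<in> carrier AF"
  shows "fnorm v (x -\<^sub>f jf a) = abs_value.cnorm v (adele_map x v \<ominus>\<^bsub>completion v\<^esub> embed v a)"
proof -
  interpret abs_value v by (rule finite_place_abs_value[OF v])
  interpret KK: cring KK by (rule cring_completion)
  have d: "x -\<^sub>f jf a = x +\<^sub>f jf (- a)" by (simp add: a_minus_def jf_minus)
  have "embed v (- a) = \<ominus>\<^bsub>KK\<^esub> embed v a"
    using embed_hom(1)[of "- a" a] by (intro KK.minus_equality[symmetric]) (simp_all add: embed_hom)
  then have "adele_map (x -\<^sub>f jf a) v = adele_map x v \<ominus>\<^bsub>completion v\<^esub> embed v a"
    unfolding d using x v by (simp add: adele_map_jf diag_fin_def product_ring_def a_minus_def)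
  then show ?thesis by (simp add: fnorm_def)
qed

lemma OH_approximation_at:
  assumes v: "v \<in> finite_places" and y: "y \<in> OH" and e: "0 < e"
  shows "\<exists>a. algebraic_int a \<and> fnorm v (y -\<^sub>f jf a) < e"
proof -
  interpret abs_value v by (rule finite_place_abs_value[OF v])
  have yc: "y \<in> carrier AF" using y by (rule OH_sub)
  have "adele_map y v \<in> carrier (local_integers v)"
    unfolding carrier_local_integers[OF v] using adele_map_component[OF v yc] y v by (auto simp: OH_iff fnorm_def)
  then have "adele_map y v \<in> M.mtopology closure_of (embed v ` carrier O_ring)"
    by (simp add: local_integers_def completion_topology_eq)
  then have "\<forall>r>0. \<exists>z\<in>embed v ` carrier O_ring. z \<in> M.mball (adele_map y v) r"
    unfolding M.metric_closure_of by blast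
  from this[rule_format, OF e] obtain a where a: "algebraic_int a" "completion_dist v (adele_map y v) (embed v a) < e"
    by auto
  then have "fnorm v (y -\<^sub>f jf a) < e"
    using adele_map_component[OF v yc] by (simp add: fnorm_diff_jf[OF v yc] completion_dist_eq)
  then show ?thesis using a(1) by blast
qed

text \<open>Strong approximation in the form \<open>A_f = K + g O_hat\<close>. After clearing
  denominators, only the finitely many places where \<open>n\<close> is not a unit impose a
  condition, and the Chinese remainder theorem meets it.\<close>

lemma adele_approximation:
  assumes x: "x \<in> carrier AF" and g: "g \<in> Units AF"
  shows "\<exists>k. x -\<^sub>f jf k \<in> GO g"
proof -
  obtain N where N: "N > 0" "\<And>k. algebraic_int k \<Longrightarrow> jf (of_nat N * k) \<in> GO g"
    using Units_denominators(1)[OF g] by blast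
  obtain M where M: "M > 0" "jf (of_nat M) *\<^sub>f x \<in> OH" using adele_denominator[OF x] by blast
  define y where "y = jf (of_nat M) *\<^sub>f x"
  \<comment> \<open>\<open>M\<close> clears the denominators of \<open>x\<close>, and
    \<open>N\<close> lies in \<open>g O_hat\<close>; so approximating \<open>y = M x\<close> modulo
    \<open>M N\<close> approximates \<open>x\<close> modulo \<open>g O_hat\<close>.\<close>
  define n where "n = (of_nat (M * N) :: 'k)"
  have n: "algebraic_int n" "n \<noteq> 0" using N M unfolding n_def by (simp_all del: of_nat_mult)
  have yc: "y \<in> carrier AF" unfolding y_def using x by simp
  define S where "S = {v \<in> finite_places. v n < 1}"
  have S: "finite S" "S \<subseteq> finite_places" unfolding S_def using finite_places_above[OF n] by auto
  have vpos: "0 < v n" if "v \<in> finite_places" for v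
    using abs_value.pos_iff[OF finite_place_abs_value[OF that]] n by blast
  \<comment> \<open>The precision that is needed: a positive lower bound of \<open>v n\<close> over
    the finite set \<open>S\<close>.\<close>
  have "\<exists>e>0. \<forall>v\<in>S. e \<le> v n"
  proof (cases "S = {}")
    case False
    then show ?thesis using S vpos
      by (intro exI[of _ "Min ((\<lambda>v. v n) ` S)"]) (auto simp: Min_gr_iff)
  qed (auto intro: exI[of _ 1])
  then obtain e where e: "e > 0" "\<And>v. v \<in> S \<Longrightarrow> e \<le> v n" by blast
  have "\<exists>a. algebraic_int a \<and> fnorm v (y -\<^sub>f jf a) < e" if "v \<in> S" for v
    using OH_approximation_at[of v y e] that S(2) M(2) e(1) by (auto simp: y_def)
  then obtain b where b: "\<And>v. v \<in> S \<Longrightarrow> algebraic_int (b v) \<and> fnorm v (y -\<^sub>f jf (b v)) < e" by metis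
  obtain a where a: "algebraic_int a" "\<And>v. v \<in> S \<Longrightarrow> v (a - b v) < e"
    using chinese_remainder[OF S, of b e] b e(1) by blast
  have key: "fnorm v (y -\<^sub>f jf a) \<le> v n" if v: "v \<in> finite_places" for v
  proof (cases "v \<in> S")
    case True
    interpret abs_value v by (rule finite_place_abs_value[OF v])
    have "y -\<^sub>f jf a = (y -\<^sub>f jf (b v)) +\<^sub>f jf (b v - a)"
      unfolding jf_diff by (rule AF_diff_trans[OF yc jf_in jf_in])
    then have "fnorm v (y -\<^sub>f jf a) \<le> max (fnorm v (y -\<^sub>f jf (b v))) (v (b v - a))"
      using fnorm_simps(3)[OF v, of "y -\<^sub>f jf (b v)" "jf (b v - a)"] yc by (simp add: fnorm_jf[OF v])
    then show ?thesis using b[OF True] a(2)[OF True] e(2)[OF True] diff_commute[of "b v" a] by linarith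
  next
    case False
    then have "v n \<ge> 1" using v by (simp add: S_def)
    moreover have "y -\<^sub>f jf a \<in> OH"
      unfolding GO_one[symmetric] using M(2) a(1) by (intro GO_diff) (simp_all add: GO_one jf_OH_iff y_def)
    ultimately show ?thesis using v by (auto simp: OH_iff intro: order_trans)
  qed
  define k where "k = a / of_nat M"
  have "x -\<^sub>f jf k = jf (1 / of_nat M) *\<^sub>f (y -\<^sub>f jf a)"
  proof -
    have "jf (1 / of_nat M) *\<^sub>f y = jf (1 / of_nat M * of_nat M) *\<^sub>f x"
      using x by (simp only: y_def jf_hom AF.m_assoc jf_in)
    also have "\<dots> = x" using M(1) x by (simp add: jf_hom)
    finally have 1: "jf (1 / of_nat M) *\<^sub>f y = x" .
    have 2: "jf (1 / of_nat M) *\<^sub>f jf a = jf k" by (simp add: k_def flip: jf_hom)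
    show ?thesis using yc by (simp add: a_minus_def AF.r_distr AF.r_minus 1 2)
  qed
  moreover have "fnorm v (jf (1 / of_nat M) *\<^sub>f (y -\<^sub>f jf a)) \<le> fnorm v g" if v: "v \<in> finite_places" for v
  proof -
    interpret abs_value v by (rule finite_place_abs_value[OF v])
    have "fnorm v (jf (1 / of_nat M) *\<^sub>f (y -\<^sub>f jf a)) = v (1 / of_nat M) * fnorm v (y -\<^sub>f jf a)"
      using yc by (simp add: fnorm_simps[OF v] fnorm_jf[OF v])
    also have "\<dots> \<le> v (1 / of_nat M) * v n" by (intro mult_left_mono key v) simp
    also have "\<dots> = v (of_nat N)" using M(1) by (simp add: n_def flip: mult)
    also have "\<dots> \<le> fnorm v g" using N(2)[of 1] v by (simp add: GO_def fnorm_jf)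
    finally show ?thesis .
  qed
  ultimately show ?thesis using yc by (intro exI[of _ k]) (simp add: GO_def)
qed

text \<open>The \<open>a N\<close> play the role of residues of \<open>w\<close> modulo
  \<open>N g O_hat\<close>. Along the cofinal sequence \<open>superfact\<close> they are Cauchy at
  every finite place, and \<open>w\<close> is assembled from the limits.\<close>

lemma adele_completeness:
  assumes g: "g \<in> carrier AF" and a1: "\<And>N. N > 0 \<Longrightarrow> jf (a N) \<in> GO g"
    and compat: "\<And>N M. N > 0 \<Longrightarrow> M > 0 \<Longrightarrow> jf (a (N * M) - a N) \<in> GO (jf (of_nat N) *\<^sub>f g)"
  shows "\<exists>w\<in>GO g. \<forall>N>0. w -\<^sub>f jf (a N) \<in> GO (jf (of_nat N) *\<^sub>f g)"
proof -
  define b where "b m = a (superfact m)" for m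
  have step: "v (b m - a N) \<le> v (of_nat N) * fnorm v g"
    if v: "v \<in> finite_places" and "N > 0" "N dvd superfact m" for v N m
  proof -
    obtain M where M: "superfact m = N * M" using \<open>N dvd superfact m\<close> by auto
    then have "M > 0" using superfact_pos[of m] by (auto intro: gr0I)
    then show ?thesis using compat[OF \<open>N > 0\<close>, of M] v g by (simp add: GO_def fnorm_simps fnorm_jf b_def M)
  qed
  have bb: "v (b m) \<le> fnorm v g" if "v \<in> finite_places" for v m
    using a1[OF superfact_pos[of m]] that by (simp add: GO_def b_def fnorm_jf)
  have Cauchy: "b \<in> carrier (Cauchy_ring v)" if v: "v \<in> finite_places" for v
  proof -
    interpret abs_value v by (rule finite_place_abs_value[OF v])
    have lim: "(\<lambda>m. v (of_nat (superfact m)) * fnorm v g) \<longlonglongrightarrow> 0"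
      by (rule tendsto_mult_left_zero[OF superfact_tendsto_0[OF v]])
    show ?thesis unfolding Cauchy_ring_carrier
    proof (intro allI impI)
      fix e :: real assume "0 < e"
      then have "\<forall>\<^sub>F m in sequentially. v (of_nat (superfact m)) * fnorm v g < e / 2"
        using order_tendstoD(2)[OF lim, of "e / 2"] by simp
      then obtain N where N: "v (of_nat (superfact N)) * fnorm v g < e / 2" by (auto simp: eventually_sequentially)
      have *: "v (b m - b N) < e / 2" if "N \<le> m" for m
        using step[OF v superfact_pos superfact_dvd[OF that]] N by (simp add: b_def)
      have "v (b m - b n) < e" if "N \<le> m" "N \<le> n" for m n
        using *[OF that(1)] *[OF that(2)] triangle3[of "b m" "b n" "b N"] diff_commute[of "b n" "b N"] by linarith
      then show "\<exists>N. \<forall>m\<ge>N. \<forall>n\<ge>N. v (b m - b n) < e" by blast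
    qed
  qed
  obtain M where M: "M > 0" "jf (of_nat M) *\<^sub>f g \<in> OH" using adele_denominator[OF g] by blast
  \<comment> \<open>The factor \<open>M\<close> makes the family of limits integral, so that it
    comes from an adele; it is divided out in \<open>w\<close>.\<close>
  define y where "y = (\<lambda>v\<in>finite_places. abs_value.cls v (\<lambda>m. of_nat M * b m))"
  have Cauchy': "(\<lambda>m. of_nat M * b m) \<in> carrier (Cauchy_ring v)" if v: "v \<in> finite_places" for v
    using abs_value.Cauchy_mult[OF finite_place_abs_value[OF v] abs_value.Cauchy_const[OF finite_place_abs_value[OF v]] Cauchy[OF v]] .
  have "y \<in> carrier O_hat"
    unfolding carrier_O_hat
  proof (intro CollectI conjI ballI)
    show "y \<in> carrier PK"
      using abs_value.cls_in[OF finite_place_abs_value Cauchy'] by (auto simp: y_def product_ring_def)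
    fix v :: "'k place" assume v: "v \<in> finite_places"
    interpret abs_value v by (rule finite_place_abs_value[OF v])
    have "v (of_nat M * b m) \<le> 1" for m
    proof -
      have "v (of_nat M) * v (b m) \<le> v (of_nat M) * fnorm v g" by (intro mult_left_mono bb v) simp
      also have "\<dots> \<le> 1" using M(2) v g by (simp add: OH_iff fnorm_simps fnorm_jf)
      finally show ?thesis by (simp add: mult)
    qed
    then show "cnorm (y v) \<le> 1"
      using LIMSEQ_le_const2[OF cnorm_cls[OF Cauchy'[OF v]], of 1] v by (simp add: y_def)
  qed
  then obtain x where x: "x \<in> OH" "adele_map x = y" using OH_family by blast
  have xc: "x \<in> carrier AF" using x by (simp add: OH_sub)
  define w where "w = jf (1 / of_nat M) *\<^sub>f x"
  have wc: "w \<in> carrier AF" using xc by (simp add: w_def)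
  have key: "w -\<^sub>f jf (a N) \<in> GO (jf (of_nat N) *\<^sub>f g)" if N: "N > 0" for N
  proof -
    have "fnorm v (w -\<^sub>f jf (a N)) \<le> v (of_nat N) * fnorm v g" if v: "v \<in> finite_places" for v
    proof -
      interpret abs_value v by (rule finite_place_abs_value[OF v])
      have "cnorm (cls (\<lambda>m. of_nat M * b m) \<ominus>\<^bsub>KK\<^esub> embed v (of_nat M * a N)) \<le> v (of_nat M) * (v (of_nat N) * fnorm v g)"
      proof (rule cnorm_diff_embed_le[OF Cauchy'[OF v], where N = N])
        \<comment> \<open>From the index \<open>N\<close> on, \<open>N\<close> divides
          \<open>superfact m\<close>, so the compatibility bounds the whole tail.\<close>
        fix m assume "N \<le> m"
        then have "v (b m - a N) \<le> v (of_nat N) * fnorm v g" using N dvd_superfact by (intro step[OF v]) auto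
        then have "v (of_nat M) * v (b m - a N) \<le> v (of_nat M) * (v (of_nat N) * fnorm v g)"
          by (rule mult_left_mono) simp
        then show "v (of_nat M * b m - of_nat M * a N) \<le> v (of_nat M) * (v (of_nat N) * fnorm v g)"
          by (simp only: mult right_diff_distrib[symmetric])
      qed
      then have 1: "fnorm v (x -\<^sub>f jf (of_nat M * a N)) \<le> v (of_nat M) * (v (of_nat N) * fnorm v g)"
        using v by (simp add: fnorm_diff_jf[OF v xc] x(2) y_def)
      have "jf (a N) = jf (1 / of_nat M) *\<^sub>f jf (of_nat M * a N)"
        using M(1) by (simp flip: jf_hom)
      then have "w -\<^sub>f jf (a N) = jf (1 / of_nat M) *\<^sub>f (x -\<^sub>f jf (of_nat M * a N))"
        using xc by (simp add: w_def a_minus_def AF.r_distr AF.r_minus)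
      then have "fnorm v (w -\<^sub>f jf (a N)) = v (1 / of_nat M) * fnorm v (x -\<^sub>f jf (of_nat M * a N))"
        using xc by (simp add: fnorm_simps[OF v] fnorm_jf[OF v])
      also have "\<dots> \<le> v (1 / of_nat M) * (v (of_nat M) * (v (of_nat N) * fnorm v g))"
        by (intro mult_left_mono 1) simp
      also have "\<dots> = v (of_nat N) * fnorm v g" using M(1) pos_iff[of "of_nat M"] by (simp add: divide)
      finally show ?thesis .
    qed
    then show ?thesis using g wc by (simp add: GO_def fnorm_simps fnorm_jf)
  qed
  \<comment> \<open>The congruence for \<open>N = 1\<close> puts \<open>w\<close> itself into
    \<open>g O_hat\<close>.\<close>
  have "w = (w -\<^sub>f jf (a 1)) +\<^sub>f jf (a 1)" using wc by (simp add: a_minus_def AF.a_assoc AF.l_neg)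
  moreover have "w -\<^sub>f jf (a 1) \<in> GO g" using key[of 1] g by (simp add: jf_hom)
  moreover have "jf (a 1) \<in> GO g" by (rule a1) simp
  ultimately have "w \<in> GO g" using GO_add by metis
  then show ?thesis using key by blast
qed

text \<open>At each finite place some \<open>xm v\<close> in \<open>I\<close> has the largest
  absolute value, since the values are discrete and bounded by means of the denominator
  \<open>N\<close>. These elements are the components of \<open>g\<close>. As
  \<open>1 \<in> I\<close>, they have absolute value at least 1, so their inverses form an integral
  family and \<open>g\<close> is invertible.\<close>

lemma fractional_ideal_idele:
  fixes I :: "'k set"
  assumes add: "\<And>x y. x \<in> I \<Longrightarrow> y \<in> I \<Longrightarrow> x + y \<in> I"
    and mult: "\<And>x a. x \<in> I \<Longrightarrow> algebraic_int a \<Longrightarrow> a * x \<in> I"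
    and one: "1 \<in> I" and N: "N > 0" "\<And>x. x \<in> I \<Longrightarrow> algebraic_int (of_nat N * x)"
  shows "\<exists>g\<in>Units AF. I = {k. jf k \<in> GO g}"
proof -
  have "\<exists>x\<in>I. \<forall>y\<in>I. v y \<le> v x" if v: "v \<in> finite_places" for v
  proof -
    interpret abs_value v by (rule finite_place_abs_value[OF v])
    have vN: "0 < v (of_nat N)" using N(1) by (simp add: pos_iff)
    define B where "B = nat \<lceil>- ln (v (of_nat N))\<rceil>"
    have bd: "n \<le> B" if "\<exists>x\<in>I. v x = exp (real n)" for n
    proof -
      obtain x where x: "x \<in> I" "v x = exp (real n)" using \<open>\<exists>x\<in>I. v x = exp (real n)\<close> by blast
      have "v (of_nat N) * v x \<le> 1" using finite_place_int_le_1[OF v N(2)[OF x(1)]] by (simp add: abs_value.mult[OF abs_value_axioms])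
      then have "exp (real n) \<le> 1 / v (of_nat N)" using vN x by (simp add: field_simps)
      also have "\<dots> = exp (- ln (v (of_nat N)))" using vN by (simp add: exp_minus divide_inverse)
      finally have "real n \<le> - ln (v (of_nat N))" by simp
      then show ?thesis unfolding B_def by linarith
    qed
    \<comment> \<open>Exponents are natural numbers because 1 is in \<open>I\<close>, so the maximum
      is not below 1.\<close>
    define Q where "Q n \<longleftrightarrow> (\<exists>x\<in>I. v x = exp (real n))" for n :: nat
    have Q0: "Q 0" unfolding Q_def using assms(3) by (intro bexI[of _ 1]) auto
    have QB: "n \<le> B" if "Q n" for n using bd that unfolding Q_def by blast
    define n where "n = Greatest Q"
    have "Q n" unfolding n_def by (rule GreatestI_nat[where P = Q and k = 0 and b = B, OF Q0 QB])
    have n: "m \<le> n" if "\<exists>x\<in>I. v x = exp (real m)" for m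
      unfolding n_def by (rule Greatest_le_nat[where P = Q and b = B, OF _ QB]) (use that in \<open>simp_all add: Q_def\<close>)
    from \<open>Q n\<close> have "\<exists>x\<in>I. v x = exp (real n)" unfolding Q_def .
    then obtain x where x: "x \<in> I" "v x = exp (real n)" by blast
    have "v y \<le> v x" if y: "y \<in> I" for y
    proof (cases "v y \<le> 1")
      case True
      have "1 \<le> exp (real n)" by simp
      then show ?thesis using True x(2) by linarith
    next
      case False
      then have "y \<noteq> 0" by auto
      then obtain i where i: "v y = exp (of_int i)" using finite_place_value[OF v] by blast
      have "i > 0" using False i by (auto simp: not_le)
      then have "v y = exp (real (nat i))" using i by simp
      then have "nat i \<le> n" using n y by blast
      then show ?thesis using x(2) \<open>v y = exp (real (nat i))\<close> by simp
    qed
    then show ?thesis using x(1) by blast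
  qed
  then obtain xm where xm: "\<And>v. v \<in> finite_places \<Longrightarrow> xm v \<in> I \<and> (\<forall>y\<in>I. v y \<le> v (xm v))" by metis
  have xm1: "1 \<le> v (xm v)" if v: "v \<in> finite_places" for v
    using xm[OF v] one abs_value.one[OF finite_place_abs_value[OF v]] by metis
  \<comment> \<open>Any family of elements of \<open>K\<close>, each integral at its own place, is
    the family of components of an integral adele.\<close>
  have fam: "\<exists>x\<in>OH. \<forall>v\<in>finite_places. adele_map x v = embed v (f v)" if f: "\<And>v. v \<in> finite_places \<Longrightarrow> v (f v) \<le> 1" for f
  proof -
    have "(\<lambda>v\<in>finite_places. embed v (f v)) \<in> carrier O_hat"
      using f by (auto simp: carrier_O_hat product_ring_def abs_value.embed_in[OF finite_place_abs_value]
          abs_value.cnorm_embed[OF finite_place_abs_value])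
    from OH_family[OF this] obtain x where "x \<in> OH" "adele_map x = (\<lambda>v\<in>finite_places. embed v (f v))" by blast
    then show ?thesis by (intro bexI[of _ x]) simp_all
  qed
  have "v (of_nat N * xm v) \<le> 1" if v: "v \<in> finite_places" for v
    using xm[OF v] N(2) finite_place_int_le_1[OF v] by blast
  then obtain Y where Y: "Y \<in> OH" "\<And>v. v \<in> finite_places \<Longrightarrow> adele_map Y v = embed v (of_nat N * xm v)" using fam[of "\<lambda>v. of_nat N * xm v"] by blast
  have "v (1 / xm v) \<le> 1" if v: "v \<in> finite_places" for v
  proof -
    interpret abs_value v by (rule finite_place_abs_value[OF v])
    show ?thesis using xm1[OF v] by (simp add: divide)
  qed
  then obtain h where h: "h \<in> OH" "\<And>v. v \<in> finite_places \<Longrightarrow> adele_map h v = embed v (1 / xm v)" using fam[of "\<lambda>v. 1 / xm v"] by blast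
  define g where "g = jf (1 / of_nat N) *\<^sub>f Y"
  have c: "Y \<in> carrier AF" "h \<in> carrier AF" "g \<in> carrier AF" using Y h OH_sub by (auto simp: g_def)
  have comp: "adele_map g v = embed v (xm v)" if v: "v \<in> finite_places" for v
  proof -
    interpret abs_value v by (rule finite_place_abs_value[OF v])
    have "adele_map g v = embed v (1 / of_nat N) \<otimes>\<^bsub>KK\<^esub> embed v (of_nat N * xm v)"
      using v c Y by (simp add: g_def adele_map_jf diag_fin_def product_ring_def)
    then show ?thesis using N(1) by (simp flip: embed_hom)
  qed
  have "adele_map (g *\<^sub>f h) = adele_map \<one>\<^sub>f"
  proof (rule PiE_ext)
    show "adele_map (g *\<^sub>f h) \<in> PiE finite_places (\<lambda>v. carrier (completion v))"
      using adele_map_simps(1)[OF AF.m_closed[OF c(3,2)]] by (simp add: product_ring_def)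
    show "adele_map \<one>\<^sub>f \<in> PiE finite_places (\<lambda>v. carrier (completion v))"
      using adele_map_simps(1)[OF AF.one_closed] by (simp add: product_ring_def)
    fix v :: "'k place" assume v: "v \<in> finite_places"
    interpret abs_value v by (rule finite_place_abs_value[OF v])
    have "xm v \<noteq> 0" using xm1[OF v] by auto
    then have "embed v (xm v) \<otimes>\<^bsub>KK\<^esub> embed v (1 / xm v) = \<one>\<^bsub>KK\<^esub>" by (simp flip: embed_hom)
    then show "adele_map (g *\<^sub>f h) v = adele_map \<one>\<^sub>f v"
      using v c comp[OF v] h(2)[OF v] by (simp add: product_ring_def)
  qed
  then have "g *\<^sub>f h = \<one>\<^sub>f" using c by (intro adele_eqI) auto
  moreover from this have "h *\<^sub>f g = \<one>\<^sub>f" using c by (simp add: AF.m_comm)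
  ultimately have g: "g \<in> Units AF" using c unfolding Units_def by blast
  have ng: "fnorm v g = v (xm v)" if v: "v \<in> finite_places" for v
    using comp[OF v] by (simp add: fnorm_def abs_value.cnorm_embed[OF finite_place_abs_value[OF v]])
  \<comment> \<open>The local bounds suffice: if the integers \<open>b\<close> with
    \<open>b * k \<in> I\<close> formed a proper ideal, it would lie in a prime ideal, but the bound
    at that prime supplies such a \<open>b\<close> outside it.\<close>
  have "k \<in> I" if k: "\<And>v. v \<in> finite_places \<Longrightarrow> v k \<le> v (xm v)" for k
  proof -
    define J where "J = {b. algebraic_int b \<and> b * k \<in> I}"
    have I0: "0 \<in> I" using mult[OF one, of 0] by simp
    have J: "integral_ideal J"
      by (rule integral_idealI) (auto simp: J_def I0 distrib_right mult.assoc intro: algebraic_int_add algebraic_int_mult add mult)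
    obtain n where n: "n > 0" "algebraic_int (of_nat n * k)" using exists_nat_mult_algebraic_int by blast
    then have nJ: "of_nat n \<in> J" "of_nat n \<noteq> (0::'k)" using mult[OF one n(2)] by (auto simp: J_def)
    have "1 \<in> J"
    proof (rule ccontr)
      assume "1 \<notin> J"
      then obtain P where P: "primeideal P O_ring" "J \<subseteq> P"
        using exists_prime_above[OF J nJ] by blast
      then have "P \<noteq> {0}" using nJ by blast
      then interpret P: integer_prime K P
        by (intro integer_prime.intro number_field_type_axioms integer_prime_axioms.intro P)
      have v: "prime_abs P \<in> finite_places" unfolding finite_places_def using P.primeideal P.nonzero by blast
      have nz: "xm (prime_abs P) \<noteq> 0" using xm1[OF v] by auto
      then have "prime_abs P (k / xm (prime_abs P)) \<le> 1"
        using k[OF v] P.pos_iff[of "xm (prime_abs P)"] by (simp add: P.divide)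
      then obtain s where s: "algebraic_int s" "prime_abs P s = 1" "algebraic_int (s * (k / xm (prime_abs P)))"
        using finite_place_le_1E[OF v] by blast
      have "s * (k / xm (prime_abs P)) * xm (prime_abs P) \<in> I" using mult s(3) xm[OF v] by blast
      then have "s \<in> J" using s(1) nz by (simp add: J_def)
      then have "s \<in> P" using P by blast
      then show False using P.prime_abs_lt_1_iff[OF s(1)] s(2) by simp
    qed
    then show ?thesis by (simp add: J_def)
  qed
  moreover have "v k \<le> v (xm v)" if "k \<in> I" "v \<in> finite_places" for k v using xm that by blast
  ultimately have "I = {k. jf k \<in> GO g}" by (auto simp: GO_def fnorm_jf ng)
  then show ?thesis using g by blast
qed

section \<open>The archimedean part and its lattices\<close>

abbreviation IP :: "'k place set" where "IP \<equiv> infinite_places"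

abbreviation KI :: "'k inf_adele ring" where "KI \<equiv> K_inf"

abbreviation KI_mult (infixl "*\<^sub>i" 70) where "x *\<^sub>i y \<equiv> x \<otimes>\<^bsub>KI\<^esub> y"
abbreviation KI_add (infixl "+\<^sub>i" 65) where "x +\<^sub>i y \<equiv> x \<oplus>\<^bsub>KI\<^esub> y"
abbreviation KI_diff (infixl "-\<^sub>i" 65) where "x -\<^sub>i y \<equiv> x \<ominus>\<^bsub>KI\<^esub> y"
abbreviation KI_inv ("inv\<^sub>i _" [81] 80) where "inv\<^sub>i x \<equiv> inv\<^bsub>KI\<^esub> x"
abbreviation KI_one ("\<one>\<^sub>i") where "\<one>\<^sub>i \<equiv> \<one>\<^bsub>KI\<^esub>"
abbreviation KI_zero ("\<zero>\<^sub>i") where "\<zero>\<^sub>i \<equiv> \<zero>\<^bsub>KI\<^esub>"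
abbreviation KI_coset (infixl "+>\<^sub>i" 60) where "L +>\<^sub>i x \<equiv> L +>\<^bsub>KI\<^esub> x"
abbreviation KI_set_add (infixl "<+>\<^sub>i" 60) where "L <+>\<^sub>i M \<equiv> L <+>\<^bsub>KI\<^esub> M"

lemma cring_KI: "cring KI"
  unfolding K_inf_def
  by (rule cring_product_ring[OF abs_value.cring_completion[OF infinite_place_abs_value]])

sublocale KI: cring KI by (rule cring_KI)

lemma Units_KI_in [simp]: "g \<in> Units KI \<Longrightarrow> g \<in> carrier KI"
  by (rule KI.Units_closed)

lemma carrier_KI: "carrier KI = PiE IP (\<lambda>v. carrier (completion v))"
  by (simp add: K_inf_def product_ring_def)

lemma KI_component: "v \<in> IP \<Longrightarrow> x \<in> carrier KI \<Longrightarrow> x v \<in> carrier (completion v)"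
  by (auto simp: carrier_KI)

lemma KI_apply:
  "v \<in> IP \<Longrightarrow> (x *\<^sub>i y) v = x v \<otimes>\<^bsub>completion v\<^esub> y v"
  "v \<in> IP \<Longrightarrow> (x +\<^sub>i y) v = x v \<oplus>\<^bsub>completion v\<^esub> y v"
  "v \<in> IP \<Longrightarrow> \<one>\<^sub>i v = \<one>\<^bsub>completion v\<^esub>" "v \<in> IP \<Longrightarrow> \<zero>\<^sub>i v = \<zero>\<^bsub>completion v\<^esub>"
  by (simp_all add: K_inf_def product_ring_def)

lemma KI_eqI:
  "x \<in> carrier KI \<Longrightarrow> y \<in> carrier KI \<Longrightarrow> (\<And>v. v \<in> IP \<Longrightarrow> x v = y v) \<Longrightarrow> x = y"
  unfolding carrier_KI by (rule PiE_ext)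

abbreviation di :: "'k \<Rightarrow> 'k inf_adele" where "di \<equiv> diag_inf"

lemma di_in [simp]: "di k \<in> carrier KI"
  by (auto simp: carrier_KI diag_inf_def abs_value.embed_in[OF infinite_place_abs_value])

lemma di_apply: "v \<in> IP \<Longrightarrow> di k v = embed v k"
  by (simp add: diag_inf_def)

lemma di_hom:
  "di (x * y) = di x *\<^sub>i di y" "di (x + y) = di x +\<^sub>i di y" "di 1 = \<one>\<^sub>i" "di 0 = \<zero>\<^sub>i"
  by (rule KI_eqI; simp add: KI_apply di_apply abs_value.embed_hom[OF infinite_place_abs_value])+

lemma di_minus: "di (- x) = \<ominus>\<^bsub>KI\<^esub> di x"
  using di_hom(2)[of "- x" x] by (intro KI.minus_equality[symmetric]) (simp_all add: di_hom)

lemma di_diff: "di (x - y) = di x -\<^sub>i di y"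
  using di_hom(2)[of x "- y"] by (simp add: di_minus a_minus_def)

definition inorm :: "'k place \<Rightarrow> 'k inf_adele \<Rightarrow> real" where
  "inorm v x = abs_value.cnorm v (x v)"

lemma KI_minus_apply:
  assumes v: "v \<in> IP" and x: "x \<in> carrier KI"
  shows "(\<ominus>\<^bsub>KI\<^esub> x) v = \<ominus>\<^bsub>completion v\<^esub> x v"
proof -
  interpret abs_value v by (rule infinite_place_abs_value[OF v])
  interpret KK: cring KK by (rule cring_completion)
  have "(\<ominus>\<^bsub>KI\<^esub> x +\<^sub>i x) v = \<zero>\<^bsub>KK\<^esub>" using x v by (simp add: KI.l_neg KI_apply)
  then show ?thesis using KI_component[OF v x] KI_component[OF v KI.a_inv_closed[OF x]] v
    by (intro KK.minus_equality[symmetric]) (simp_all add: KI_apply)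
qed

lemma inorm_simps:
  assumes v: "v \<in> IP" and x: "x \<in> carrier KI"
  shows "0 \<le> inorm v x" "y \<in> carrier KI \<Longrightarrow> inorm v (x *\<^sub>i y) = inorm v x * inorm v y"
    "y \<in> carrier KI \<Longrightarrow> inorm v (x +\<^sub>i y) \<le> inorm v x + inorm v y"
    "inorm v (\<ominus>\<^bsub>KI\<^esub> x) = inorm v x"
    "y \<in> carrier KI \<Longrightarrow> inorm v (x -\<^sub>i y) \<le> inorm v x + inorm v y"
    "y \<in> carrier KI \<Longrightarrow> inorm v (x -\<^sub>i y) = completion_dist v (x v) (y v)"
proof -
  interpret abs_value v by (rule infinite_place_abs_value[OF v])
  note c = KI_component[OF v]
  show "0 \<le> inorm v x" unfolding inorm_def by (rule cnorm_nonneg[OF c[OF x]])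
  have m: "inorm v (\<ominus>\<^bsub>KI\<^esub> x) = inorm v x" if "x \<in> carrier KI" for x
    using that v by (simp add: inorm_def KI_minus_apply cnorm_minus c)
  then show "inorm v (\<ominus>\<^bsub>KI\<^esub> x) = inorm v x" using x by simp
  assume y: "y \<in> carrier KI"
  show "inorm v (x *\<^sub>i y) = inorm v x * inorm v y"
    using x y v by (simp add: inorm_def KI_apply cnorm_mult c)
  have a: "inorm v (x +\<^sub>i y) \<le> inorm v x + inorm v y" if "x \<in> carrier KI" "y \<in> carrier KI" for x y
    using that v by (simp add: inorm_def KI_apply cnorm_triangle c)
  show "inorm v (x +\<^sub>i y) \<le> inorm v x + inorm v y" by (rule a[OF x y])
  show "inorm v (x -\<^sub>i y) \<le> inorm v x + inorm v y"
    using a[OF x KI.a_inv_closed[OF y]] m[OF y] by (simp add: a_minus_def)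
  show "inorm v (x -\<^sub>i y) = completion_dist v (x v) (y v)"
    using x y v by (simp add: inorm_def completion_dist_eq c) (simp add: a_minus_def KI_apply KI_minus_apply)
qed

lemma inorm_di: "v \<in> IP \<Longrightarrow> inorm v (di k) = v k"
  by (simp add: inorm_def di_apply abs_value.cnorm_embed[OF infinite_place_abs_value])

lemma inorm_zero: "v \<in> IP \<Longrightarrow> inorm v \<zero>\<^sub>i = 0"
  using inorm_di[of v 0] by (simp add: di_hom abs_value.zero[OF infinite_place_abs_value])

lemma inorm_one: "v \<in> IP \<Longrightarrow> inorm v \<one>\<^sub>i = 1"
  using inorm_di[of v 1] by (simp add: di_hom abs_value.one[OF infinite_place_abs_value])

lemma infinite_place_of_nat: "v \<in> IP \<Longrightarrow> v (of_nat n) = real n"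
  using infinite_place_of_rat[of v "of_nat n"] by simp

lemma di_eq_iff: "di x = di y \<longleftrightarrow> x = y"
proof
  assume "di x = di y"
  then have "di (x - y) = \<zero>\<^sub>i" by (simp add: di_diff a_minus_def KI.r_neg)
  moreover obtain v where v: "v \<in> IP" using infinite_places_nonempty by blast
  ultimately have "v (x - y) = 0" using inorm_di[OF v, of "x - y"] inorm_zero[OF v] by simp
  then show "x = y" using abs_value.eq_0_iff[OF infinite_place_abs_value[OF v]] by simp
qed simp

lemma KI_diff_trans:
  assumes "x \<in> carrier KI" "y \<in> carrier KI" "z \<in> carrier KI"
  shows "x -\<^sub>i z = (x -\<^sub>i y) +\<^sub>i (y -\<^sub>i z)"
  using assms by (simp add: a_minus_def KI.a_assoc KI.l_neg KI.r_neg2 KI.r_neg1)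

lemma inorm_diff_trans:
  assumes "v \<in> IP" "x \<in> carrier KI" "y \<in> carrier KI" "z \<in> carrier KI"
  shows "inorm v (x -\<^sub>i z) \<le> inorm v (x -\<^sub>i y) + inorm v (y -\<^sub>i z)"
  using inorm_simps(3)[OF assms(1), of "x -\<^sub>i y" "y -\<^sub>i z"] assms KI_diff_trans[of x y z] by simp

lemma inorm_diff_commute:
  assumes "v \<in> IP" "x \<in> carrier KI" "y \<in> carrier KI"
  shows "inorm v (x -\<^sub>i y) = inorm v (y -\<^sub>i x)"
proof -
  have "\<ominus>\<^bsub>KI\<^esub> (x -\<^sub>i y) = y -\<^sub>i x"
    using assms by (simp add: KI.minus_add a_minus_def KI.minus_minus KI.a_comm)
  then show ?thesis using inorm_simps(4)[OF assms(1), of "x -\<^sub>i y"] assms by simp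
qed

text \<open>Inverses are formed component by component, each completion being a field.\<close>

lemma Units_KI_iff: "x \<in> Units KI \<longleftrightarrow> x \<in> carrier KI \<and> (\<forall>v\<in>IP. 0 < inorm v x)"
proof
  assume x: "x \<in> Units KI"
  have "0 < inorm v x" if v: "v \<in> IP" for v
  proof -
    have "inorm v x * inorm v (inv\<^sub>i x) = 1"
      using inorm_simps(2)[OF v, of x "inv\<^sub>i x"] x inorm_one[OF v] by simp
    then show ?thesis using inorm_simps(1)[OF v, of x] x
      by (metis Units_KI_in less_eq_real_def mult_zero_left zero_neq_one)
  qed
  then show "x \<in> carrier KI \<and> (\<forall>v\<in>IP. 0 < inorm v x)" using x by simp
next
  assume x: "x \<in> carrier KI \<and> (\<forall>v\<in>IP. 0 < inorm v x)"
  have "\<exists>y\<in>carrier (completion v). x v \<otimes>\<^bsub>completion v\<^esub> y = \<one>\<^bsub>completion v\<^esub>" if v: "v \<in> IP" for v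
  proof -
    interpret abs_value v by (rule infinite_place_abs_value[OF v])
    have "x v \<in> carrier KK" "x v \<noteq> \<zero>\<^bsub>KK\<^esub>"
      using x v KI_component[OF v] cnorm_eq_0[of "x v"] by (auto simp: inorm_def)
    then show ?thesis by (rule completion_inverse)
  qed
  then obtain f where f: "\<And>v. v \<in> IP \<Longrightarrow> f v \<in> carrier (completion v) \<and> x v \<otimes>\<^bsub>completion v\<^esub> f v = \<one>\<^bsub>completion v\<^esub>"
    by metis
  define y where "y = (\<lambda>v\<in>IP. f v)"
  have y: "y \<in> carrier KI" using f by (auto simp: y_def carrier_KI)
  have "x *\<^sub>i y = \<one>\<^sub>i" using x y f by (intro KI_eqI) (auto simp: KI_apply y_def)
  moreover from this have "y *\<^sub>i x = \<one>\<^sub>i" using x y by (simp add: KI.m_comm)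
  ultimately show "x \<in> Units KI" using x y unfolding Units_def by blast
qed

lemma di_Units: "k \<noteq> 0 \<Longrightarrow> di k \<in> Units KI" and di_inv: "k \<noteq> 0 \<Longrightarrow> inv\<^sub>i di k = di (1 / k)"
proof -
  assume k: "k \<noteq> 0"
  have *: "di k *\<^sub>i di (1 / k) = \<one>\<^sub>i" "di (1 / k) *\<^sub>i di k = \<one>\<^sub>i"
    using k by (simp_all flip: di_hom)
  then show "di k \<in> Units KI" using di_in unfolding Units_def by blast
  show "inv\<^sub>i di k = di (1 / k)" by (rule KI.comm_inv_char[OF di_in di_in *(1)])
qed

lemma topspace_K_inf: "topspace K_inf_topology = carrier KI"
proof -
  have "topspace (completion_topology v) = carrier (completion v)" if "v \<in> IP" for v
  proof -
    interpret abs_value v by (rule infinite_place_abs_value[OF that])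
    show ?thesis by (simp add: completion_topology_eq)
  qed
  then show ?thesis by (simp add: K_inf_topology_def carrier_KI cong: PiE_cong)
qed

lemma Min_pos: "finite A \<Longrightarrow> (\<And>v. v \<in> A \<Longrightarrow> 0 < f v) \<Longrightarrow> \<exists>e>0. \<forall>v\<in>A. e \<le> (f v :: real)"
proof (induction A rule: finite_induct)
  case (insert v A)
  then obtain e where e: "e > 0" "\<forall>v\<in>A. e \<le> f v" by auto
  then show ?case using insert by (intro exI[of _ "min e (f v)"]) (auto intro: min.coboundedI1)
qed (auto intro: exI[of _ 1])

text \<open>There are finitely many infinite places, so the product topology is that of the maximum
  of the local norms.\<close>

lemma openin_K_inf:
  "openin K_inf_topology U \<longleftrightarrow> U \<subseteq> carrier KI \<and>
     (\<forall>x\<in>U. \<exists>e>0. \<forall>y\<in>carrier KI. (\<forall>v\<in>IP. inorm v (y -\<^sub>i x) < e) \<longrightarrow> y \<in> U)"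
proof
  assume U: "openin K_inf_topology U"
  then have sub: "U \<subseteq> carrier KI" using openin_subset topspace_K_inf by blast
  have "\<exists>e>0. \<forall>y\<in>carrier KI. (\<forall>v\<in>IP. inorm v (y -\<^sub>i x) < e) \<longrightarrow> y \<in> U" if x: "x \<in> U" for x
  proof -
    have xc: "x \<in> carrier KI" using x sub by blast
    obtain V where V: "\<And>v. v \<in> IP \<Longrightarrow> openin (completion_topology v) (V v)" "x \<in> PiE IP V" "PiE IP V \<subseteq> U"
      using bspec[OF U[unfolded K_inf_topology_def openin_product_topology_alt] x] by metis
    have "\<exists>e>0. \<forall>y\<in>carrier KI. inorm v (y -\<^sub>i x) < e \<longrightarrow> y v \<in> V v" if v: "v \<in> IP" for v
    proof -
      interpret abs_value v by (rule infinite_place_abs_value[OF v])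
      have "x v \<in> V v" using V(2) v by auto
      then obtain e where e: "e > 0" "M.mball (x v) e \<subseteq> V v"
        using V(1)[OF v] unfolding completion_topology_eq M.openin_mtopology by blast
      have "y v \<in> V v" if y: "y \<in> carrier KI" "inorm v (y -\<^sub>i x) < e" for y
      proof -
        have "completion_dist v (x v) (y v) < e"
          using y xc inorm_diff_commute[OF v y(1) xc] inorm_simps(6)[OF v xc y(1)] by simp
        then have "y v \<in> M.mball (x v) e" using KI_component[OF v] xc y by simp
        then show ?thesis using e by blast
      qed
      then show ?thesis using e(1) by blast
    qed
    then obtain e where e: "\<And>v. v \<in> IP \<Longrightarrow> 0 < e v \<and> (\<forall>y\<in>carrier KI. inorm v (y -\<^sub>i x) < e v \<longrightarrow> y v \<in> V v)"
      by metis
    obtain d where d: "d > 0" "\<forall>v\<in>IP. d \<le> e v" using Min_pos[OF finite_infinite_places, of e] e by blast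
    have "y \<in> U" if y: "y \<in> carrier KI" "\<forall>v\<in>IP. inorm v (y -\<^sub>i x) < d" for y
    proof -
      have "y v \<in> V v" if v: "v \<in> IP" for v using e[OF v] y d v by force
      then have "y \<in> PiE IP V" using y(1) by (auto simp: carrier_KI PiE_iff)
      then show ?thesis using V(3) by blast
    qed
    then show ?thesis using d(1) by blast
  qed
  then show "U \<subseteq> carrier KI \<and> (\<forall>x\<in>U. \<exists>e>0. \<forall>y\<in>carrier KI. (\<forall>v\<in>IP. inorm v (y -\<^sub>i x) < e) \<longrightarrow> y \<in> U)"
    using sub by blast
next
  assume U: "U \<subseteq> carrier KI \<and> (\<forall>x\<in>U. \<exists>e>0. \<forall>y\<in>carrier KI. (\<forall>v\<in>IP. inorm v (y -\<^sub>i x) < e) \<longrightarrow> y \<in> U)"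
  show "openin K_inf_topology U"
    unfolding K_inf_topology_def openin_product_topology_alt
  proof (intro ballI)
    fix x assume x: "x \<in> U"
    then have xc: "x \<in> carrier KI" using U by blast
    obtain e where e: "e > 0" "\<And>y. y \<in> carrier KI \<Longrightarrow> \<forall>v\<in>IP. inorm v (y -\<^sub>i x) < e \<Longrightarrow> y \<in> U"
      using U x by blast
    define V where "V v = Metric_space.mball (carrier (completion v)) (completion_dist v) (x v) e" for v
    have V: "openin (completion_topology v) (V v)" "x v \<in> V v"
      "\<And>z. z \<in> V v \<longleftrightarrow> z \<in> carrier (completion v) \<and> completion_dist v (x v) z < e" if v: "v \<in> IP" for v
    proof -
      interpret abs_value v by (rule infinite_place_abs_value[OF v])
      show "openin (completion_topology v) (V v)" by (simp add: V_def completion_topology_eq)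
      show "x v \<in> V v" using KI_component[OF v xc] e(1) by (simp add: V_def)
      show "z \<in> V v \<longleftrightarrow> z \<in> carrier (completion v) \<and> completion_dist v (x v) z < e" for z
        using KI_component[OF v xc] by (auto simp: V_def)
    qed
    have "PiE IP V \<subseteq> U"
    proof
      fix y assume y: "y \<in> PiE IP V"
      then have yc: "y \<in> carrier KI" using V(3) by (auto simp: carrier_KI PiE_iff)
      have "inorm v (y -\<^sub>i x) < e" if v: "v \<in> IP" for v
        using y V(3)[OF v, of "y v"] v inorm_diff_commute[OF v yc xc] inorm_simps(6)[OF v xc yc] by auto
      then show "y \<in> U" using e(2)[OF yc] by blast
    qed
    moreover have "x \<in> PiE IP V" using xc V(2) by (auto simp: carrier_KI PiE_iff)
    moreover have "finite {i \<in> IP. V i \<noteq> topspace (completion_topology i)}" using finite_infinite_places by simp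
    ultimately show "\<exists>Ua. finite {i \<in> IP. Ua i \<noteq> topspace (completion_topology i)} \<and>
        (\<forall>i\<in>IP. openin (completion_topology i) (Ua i)) \<and> x \<in> PiE IP Ua \<and> PiE IP Ua \<subseteq> U"
      using V(1) by blast
  qed
qed

lemma openin_box:
  assumes x: "x \<in> carrier KI"
  shows "openin K_inf_topology {y \<in> carrier KI. \<forall>v\<in>IP. inorm v (y -\<^sub>i x) < e}"
  unfolding openin_K_inf
proof (intro conjI ballI)
  fix y assume "y \<in> {y \<in> carrier KI. \<forall>v\<in>IP. inorm v (y -\<^sub>i x) < e}"
  then have y: "y \<in> carrier KI" "\<And>v. v \<in> IP \<Longrightarrow> inorm v (y -\<^sub>i x) < e" by auto
  obtain d where d: "d > 0" "\<forall>v\<in>IP. d \<le> e - inorm v (y -\<^sub>i x)"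
    using Min_pos[OF finite_infinite_places, of "\<lambda>v. e - inorm v (y -\<^sub>i x)"] y by auto
  have "inorm v (z -\<^sub>i x) < e" if z: "z \<in> carrier KI" "\<forall>v\<in>IP. inorm v (z -\<^sub>i y) < d" and v: "v \<in> IP" for z v
    using inorm_diff_trans[OF v z(1) y(1) x] z(2) d v by fastforce
  then show "\<exists>d>0. \<forall>z\<in>carrier KI. (\<forall>v\<in>IP. inorm v (z -\<^sub>i y) < d) \<longrightarrow>
      z \<in> {y \<in> carrier KI. \<forall>v\<in>IP. inorm v (y -\<^sub>i x) < e}"
    using d(1) by blast
qed auto

text \<open>A bounded sequence in a completion is approximated by elements of \<open>K\<close>,
  whose images under a complex embedding have a convergent subsequence; that subsequence is Cauchy
  in \<open>K\<close> and represents the limit. This avoids identifying the completion with the real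
  or complex numbers.\<close>

lemma compactin_closed_box:
  "compactin K_inf_topology {x \<in> carrier KI. \<forall>v\<in>IP. inorm v x \<le> R}"
proof -
  have *: "compactin (completion_topology v) {z \<in> carrier (completion v). abs_value.cnorm v z \<le> R}" if v: "v \<in> IP" for v
  proof -
    interpret abs_value v by (rule infinite_place_abs_value[OF v])
    interpret KK: cring KK by (rule cring_completion)
    obtain \<sigma> where \<sigma>: "\<sigma> \<in> embeddings" "v = (\<lambda>x. cmod (\<sigma> x))"
      using v infinite_places_eq by auto
    have "\<exists>l r. l \<in> {z \<in> carrier KK. cnorm z \<le> R} \<and> strict_mono r \<and> limitin M.mtopology (f \<circ> r) l sequentially"
      if f: "range f \<subseteq> {z \<in> carrier KK. cnorm z \<le> R}" for f :: "nat \<Rightarrow> 'k completion"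
    proof -
      have fc: "f n \<in> carrier KK" "cnorm (f n) \<le> R" for n using f by auto
      \<comment> \<open>The error \<open>1 / Suc n\<close> tends to 0, and being at most 1 it keeps
        the approximants bounded.\<close>
      have "\<exists>x. cnorm (f n \<ominus>\<^bsub>KK\<^esub> embed v x) < 1 / real (Suc n)" for n
        using completion_dense[OF fc(1), of "1 / real (Suc n)" n] by simp
      then obtain x where x: "\<And>n. cnorm (f n \<ominus>\<^bsub>KK\<^esub> embed v (x n)) < 1 / real (Suc n)" by metis
      have "v (x n) \<le> R + 1" for n
      proof -
        have "embed v (x n) = f n \<ominus>\<^bsub>KK\<^esub> (f n \<ominus>\<^bsub>KK\<^esub> embed v (x n))"
          using fc(1) by (simp add: a_minus_def KK.minus_add KK.minus_minus KK.r_neg2)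
        then have "cnorm (embed v (x n)) \<le> cnorm (f n) + cnorm (\<ominus>\<^bsub>KK\<^esub> (f n \<ominus>\<^bsub>KK\<^esub> embed v (x n)))"
          using cnorm_triangle[of "f n" "\<ominus>\<^bsub>KK\<^esub> (f n \<ominus>\<^bsub>KK\<^esub> embed v (x n))"] fc(1) by (simp add: a_minus_def[of _ "f n" "f n \<ominus>\<^bsub>KK\<^esub> _"])
        then have "v (x n) \<le> R + cnorm (f n \<ominus>\<^bsub>KK\<^esub> embed v (x n))" using fc by (simp add: cnorm_minus) (metis add_right_mono order_trans)
        moreover have "1 / real (Suc n) \<le> 1" by simp
        ultimately show ?thesis using x[of n] by linarith
      qed
      then have "\<forall>n. (\<sigma> \<circ> x) n \<in> cball 0 (R + 1)" by (simp add: \<sigma>(2))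
      then obtain r w where r: "strict_mono r" "((\<sigma> \<circ> x) \<circ> r) \<longlonglongrightarrow> w"
        using compact_cball[of "0::complex" "R + 1", unfolded compact_def] by blast
      have C: "x \<circ> r \<in> carrier CR"
        unfolding Cauchy_ring_carrier
      proof (intro allI impI)
        fix e :: real assume "e > 0"
        with LIMSEQ_imp_Cauchy[OF r(2)] obtain N where
          "\<And>m n. m \<ge> N \<Longrightarrow> n \<ge> N \<Longrightarrow> dist (((\<sigma> \<circ> x) \<circ> r) m) (((\<sigma> \<circ> x) \<circ> r) n) < e"
          unfolding Cauchy_def by blast
        then show "\<exists>N. \<forall>m\<ge>N. \<forall>n\<ge>N. v ((x \<circ> r) m - (x \<circ> r) n) < e"
          unfolding \<sigma>(2) by (auto simp: embeddings_hom[OF \<sigma>(1)] dist_norm)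
      qed
      define l where "l = cls (x \<circ> r)"
      have lc: "l \<in> carrier KK" unfolding l_def by (rule cls_in[OF C])
      have lim0: "(\<lambda>n. cnorm (l \<ominus>\<^bsub>KK\<^esub> embed v ((x \<circ> r) n))) \<longlonglongrightarrow> 0"
      proof (rule LIMSEQ_I)
        fix e :: real assume "e > 0"
        then have "0 < e / 2" by simp
        then obtain N where N: "\<And>m n. N \<le> m \<Longrightarrow> N \<le> n \<Longrightarrow> v ((x \<circ> r) m - (x \<circ> r) n) < e / 2"
          using Cauchy_ringD[OF C] by metis
        have "cnorm (l \<ominus>\<^bsub>KK\<^esub> embed v ((x \<circ> r) n)) \<le> e / 2" if "N \<le> n" for n
          unfolding l_def using N that by (intro cnorm_diff_embed_le[OF C, of N]) (simp add: less_imp_le)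
        then show "\<exists>N. \<forall>n\<ge>N. norm (cnorm (l \<ominus>\<^bsub>KK\<^esub> embed v ((x \<circ> r) n)) - 0) < e"
          using \<open>e > 0\<close> lc by (intro exI[of _ N]) (force simp: cnorm_nonneg)
      qed
      have rn: "(\<lambda>n. 1 / real (Suc (r n))) \<longlonglongrightarrow> 0"
        using LIMSEQ_subseq_LIMSEQ[OF lim_1_over_n[THEN LIMSEQ_Suc] r(1)] by (simp add: o_def)
      have lim: "(\<lambda>n. completion_dist v (f (r n)) l) \<longlonglongrightarrow> 0"
      proof (rule Lim_null_comparison)
        show "(\<lambda>n. 1 / real (Suc (r n)) + cnorm (l \<ominus>\<^bsub>KK\<^esub> embed v ((x \<circ> r) n))) \<longlonglongrightarrow> 0"
          using tendsto_add[OF rn lim0] by simp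
        have "completion_dist v (f (r n)) l \<le> 1 / real (Suc (r n)) + cnorm (l \<ominus>\<^bsub>KK\<^esub> embed v (x (r n)))" for n
          using M.triangle[of "f (r n)" "embed v (x (r n))" l] x[of "r n"] fc(1) lc
          by (simp add: completion_dist_eq[of "f (r n)" "embed v _"] completion_dist_eq[of l] M.commute[of "embed v _" l])
        then show "\<forall>\<^sub>F n in sequentially. norm (completion_dist v (f (r n)) l) \<le> 1 / real (Suc (r n)) + cnorm (l \<ominus>\<^bsub>KK\<^esub> embed v ((x \<circ> r) n))"
          by simp
      qed
      have "cnorm l \<le> R"
      proof (rule field_le_epsilon)
        fix e :: real assume "e > 0"
        then obtain n where n: "completion_dist v (f (r n)) l < e"
          using order_tendstoD(2)[OF lim] by (auto simp: eventually_sequentially)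
        have "completion_dist v l \<zero>\<^bsub>KK\<^esub> \<le> completion_dist v l (f (r n)) + completion_dist v (f (r n)) \<zero>\<^bsub>KK\<^esub>"
          using M.triangle[of l "f (r n)" "\<zero>\<^bsub>KK\<^esub>"] lc fc(1) by simp
        then show "cnorm l \<le> R + e" using n fc(2)[of "r n"] M.commute[of l] by (simp add: cnorm_def)
      qed
      moreover have "limitin M.mtopology (f \<circ> r) l sequentially"
        unfolding M.limit_metric_sequentially
      proof (intro conjI allI impI)
        fix e :: real assume "e > 0"
        then obtain N where "\<forall>n\<ge>N. completion_dist v (f (r n)) l < e"
          using order_tendstoD(2)[OF lim] by (auto simp: eventually_sequentially)
        then show "\<exists>N. \<forall>n\<ge>N. (f \<circ> r) n \<in> carrier KK \<and> completion_dist v ((f \<circ> r) n) l < e"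
          using fc by auto
      qed (rule lc)
      ultimately show ?thesis using r(1) lc by blast
    qed
    then show ?thesis unfolding completion_topology_eq M.compactin_sequentially by auto
  qed
  have "{x \<in> carrier KI. \<forall>v\<in>IP. inorm v x \<le> R} = PiE IP (\<lambda>v. {z \<in> carrier (completion v). abs_value.cnorm v z \<le> R})"
    by (simp add: carrier_KI set_eq_iff PiE_iff inorm_def) blast
  then show ?thesis
    unfolding K_inf_topology_def using * by (simp add: compactin_PiE)
qed

end

lemma topspace_quotient_topology: "topspace (quotient_topology E q) = q ` topspace E"
proof
  show "topspace (quotient_topology E q) \<subseteq> q ` topspace E"
    using openin_quotient_topology[of E q "topspace (quotient_topology E q)"] by simp
  have "{x \<in> topspace E. q x \<in> q ` topspace E} = topspace E" by auto
  then have "openin (quotient_topology E q) (q ` topspace E)"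
    unfolding openin_quotient_topology by simp
  then show "q ` topspace E \<subseteq> topspace (quotient_topology E q)" by (rule openin_subset)
qed

section \<open>Lattices in the archimedean part\<close>

context number_field_type
begin

context
  fixes L :: "'k inf_adele set"
  assumes L: "subgroup L (add_monoid KI)"
begin

lemma L_closed:
  "x \<in> L \<Longrightarrow> x \<in> carrier KI" "\<zero>\<^sub>i \<in> L" "x \<in> L \<Longrightarrow> y \<in> L \<Longrightarrow> x +\<^sub>i y \<in> L"
  "x \<in> L \<Longrightarrow> \<ominus>\<^bsub>KI\<^esub> x \<in> L" "x \<in> L \<Longrightarrow> y \<in> L \<Longrightarrow> x -\<^sub>i y \<in> L"
proof -
  show 1: "x \<in> carrier KI" if "x \<in> L" for x using subgroup.subset[OF L] that by auto
  show "\<zero>\<^sub>i \<in> L" using subgroup.one_closed[OF L] by simp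
  show 2: "x +\<^sub>i y \<in> L" if "x \<in> L" "y \<in> L" for x y using subgroup.m_closed[OF L that] by simp
  show 3: "\<ominus>\<^bsub>KI\<^esub> x \<in> L" if "x \<in> L" for x using subgroup.m_inv_closed[OF L that] by (simp add: a_inv_def)
  show "x -\<^sub>i y \<in> L" if "x \<in> L" "y \<in> L" using 2[OF that(1) 3[OF that(2)]] by (simp add: a_minus_def)
qed

lemma a_coset_eq_iff:
  assumes x: "x \<in> carrier KI" and y: "y \<in> carrier KI"
  shows "L +>\<^sub>i x = L +>\<^sub>i y \<longleftrightarrow> x -\<^sub>i y \<in> L"
proof
  assume "L +>\<^sub>i x = L +>\<^sub>i y"
  moreover have "x \<in> L +>\<^sub>i x" using L_closed(2) x unfolding a_r_coset_def' by (auto intro: bexI[of _ "\<zero>\<^sub>i"])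
  ultimately obtain l where l: "l \<in> L" "x = l +\<^sub>i y" unfolding a_r_coset_def' by auto
  then have "x -\<^sub>i y = l" using L_closed(1)[OF l(1)] y by (simp add: a_minus_def KI.a_assoc KI.r_neg)
  then show "x -\<^sub>i y \<in> L" using l by simp
next
  assume l: "x -\<^sub>i y \<in> L"
  have "x = (x -\<^sub>i y) +\<^sub>i y" using x y by (simp add: a_minus_def KI.a_assoc KI.l_neg)
  then have "x \<in> L +>\<^sub>i y" unfolding a_r_coset_def' using l by blast
  then show "L +>\<^sub>i x = L +>\<^sub>i y" using KI.a_repr_independence[OF _ y L] by metis
qed

text \<open>Translation by group elements reduces isolation of every point to isolation of
  0.\<close>

lemma discrete_iff:
  "subtopology K_inf_topology L = discrete_topology L \<longleftrightarrow>
     (\<exists>e>0. \<forall>x\<in>L. (\<forall>v\<in>IP. inorm v x < e) \<longrightarrow> x = \<zero>\<^sub>i)"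
proof
  assume "subtopology K_inf_topology L = discrete_topology L"
  then have "openin (subtopology K_inf_topology L) {\<zero>\<^sub>i}" using L_closed(2) by simp
  then obtain U where U: "openin K_inf_topology U" "{\<zero>\<^sub>i} = U \<inter> L" unfolding openin_subtopology by blast
  then have "\<zero>\<^sub>i \<in> U" by blast
  with U(1) obtain e where e: "e > 0" "\<And>y. y \<in> carrier KI \<Longrightarrow> \<forall>v\<in>IP. inorm v (y -\<^sub>i \<zero>\<^sub>i) < e \<Longrightarrow> y \<in> U"
    unfolding openin_K_inf by blast
  have "y -\<^sub>i \<zero>\<^sub>i = y" if "y \<in> carrier KI" for y using that by (simp add: a_minus_def)
  then show "\<exists>e>0. \<forall>x\<in>L. (\<forall>v\<in>IP. inorm v x < e) \<longrightarrow> x = \<zero>\<^sub>i"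
    using e U(2) L_closed(1) by (intro exI[of _ e]) auto
next
  assume "\<exists>e>0. \<forall>x\<in>L. (\<forall>v\<in>IP. inorm v x < e) \<longrightarrow> x = \<zero>\<^sub>i"
  then obtain e where e: "e > 0" "\<And>x. x \<in> L \<Longrightarrow> \<forall>v\<in>IP. inorm v x < e \<Longrightarrow> x = \<zero>\<^sub>i" by blast
  define Bx where "Bx x = {y \<in> carrier KI. \<forall>v\<in>IP. inorm v (y -\<^sub>i x) < e}" for x
  have mem: "y \<in> Bx x \<longleftrightarrow> y = x" if "x \<in> L" "y \<in> L" for x y
  proof
    assume "y \<in> Bx x"
    then have "y -\<^sub>i x = \<zero>\<^sub>i" using e(2)[OF L_closed(5)[OF that(2,1)]] by (simp add: Bx_def)
    then show "y = x" using L_closed(1) that by (simp add: KI.r_right_minus_eq)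
  next
    assume "y = x"
    then show "y \<in> Bx x" using L_closed(1)[OF that(1)] e(1) by (simp add: Bx_def a_minus_def KI.r_neg inorm_zero)
  qed
  show "subtopology K_inf_topology L = discrete_topology L"
    unfolding topology_eq openin_discrete_topology
  proof (intro allI iffI)
    fix S assume "openin (subtopology K_inf_topology L) S"
    then show "S \<subseteq> L" by (auto simp: openin_subtopology)
  next
    fix S assume S: "S \<subseteq> L"
    have "openin K_inf_topology (\<Union>x\<in>S. Bx x)"
      unfolding Bx_def by (intro openin_Union) (use S L_closed(1) in \<open>auto intro: openin_box\<close>)
    moreover have "S = (\<Union>x\<in>S. Bx x) \<inter> L" using mem S by blast
    ultimately show "openin (subtopology K_inf_topology L) S" unfolding openin_subtopology by blast
  qed
qed

text \<open>A compact quotient is covered by the images of finitely many open boxes, hence by one of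
  them; conversely, under the bound the quotient is the image of a compact box.\<close>

lemma cocompact_iff:
  "compact_space (quotient_topology K_inf_topology (\<lambda>x. L +>\<^sub>i x)) \<longleftrightarrow>
     (\<exists>R. \<forall>x\<in>carrier KI. \<exists>l\<in>L. \<forall>v\<in>IP. inorm v (x -\<^sub>i l) \<le> R)"
proof
  let ?q = "\<lambda>x. L +>\<^sub>i x"
  let ?Q = "quotient_topology K_inf_topology ?q"
  define bx where "bx n = {y \<in> carrier KI. \<forall>v\<in>IP. inorm v y < real n}" for n
  \<comment> \<open>The preimage of the image of a box is the union of its translates by
    \<open>L\<close>; so the image is open in the quotient.\<close>
  have pre: "{x \<in> carrier KI. ?q x \<in> ?q ` bx n} = (\<Union>l\<in>L. {y \<in> carrier KI. \<forall>v\<in>IP. inorm v (y -\<^sub>i l) < real n})" for n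
  proof (intro equalityI subsetI)
    fix x assume "x \<in> {x \<in> carrier KI. ?q x \<in> ?q ` bx n}"
    then obtain y where y: "x \<in> carrier KI" "y \<in> bx n" "?q x = ?q y" by auto
    then have yc: "y \<in> carrier KI" by (simp add: bx_def)
    then have l: "x -\<^sub>i y \<in> L" using a_coset_eq_iff y by blast
    have "x -\<^sub>i (x -\<^sub>i y) = y" using y(1) yc by (simp add: a_minus_def KI.minus_add KI.minus_minus KI.r_neg2)
    then show "x \<in> (\<Union>l\<in>L. {y \<in> carrier KI. \<forall>v\<in>IP. inorm v (y -\<^sub>i l) < real n})"
      using l y by (intro UN_I[OF l]) (simp add: bx_def)
  next
    fix x assume "x \<in> (\<Union>l\<in>L. {y \<in> carrier KI. \<forall>v\<in>IP. inorm v (y -\<^sub>i l) < real n})"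
    then obtain l where l: "l \<in> L" "x \<in> carrier KI" "\<forall>v\<in>IP. inorm v (x -\<^sub>i l) < real n" by auto
    have lc: "l \<in> carrier KI" using L_closed l by blast
    then have "x -\<^sub>i l \<in> bx n" using l by (simp add: bx_def)
    moreover have "x -\<^sub>i (x -\<^sub>i l) = l" using l lc by (simp add: a_minus_def KI.minus_add KI.minus_minus KI.r_neg2)
    then have "?q x = ?q (x -\<^sub>i l)" using a_coset_eq_iff[of x "x -\<^sub>i l"] l lc by simp
    ultimately show "x \<in> {x \<in> carrier KI. ?q x \<in> ?q ` bx n}" using l by blast
  qed
  {
    assume cpt: "compact_space ?Q"
    have op: "openin ?Q (?q ` bx n)" for n
      unfolding openin_quotient_topology topspace_K_inf pre
    proof
      show "?q ` bx n \<subseteq> ?q ` carrier KI" by (auto simp: bx_def)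
      show "openin K_inf_topology (\<Union>l\<in>L. {y \<in> carrier KI. \<forall>v\<in>IP. inorm v (y -\<^sub>i l) < real n})"
        by (intro openin_Union) (use L_closed(1) in \<open>auto intro: openin_box\<close>)
    qed
    have cov: "\<exists>n. x \<in> bx n" if x: "x \<in> carrier KI" for x
    proof -
      have "finite ((\<lambda>v. inorm v x) ` IP)" using finite_infinite_places by simp
      then obtain B where B: "\<forall>r\<in>(\<lambda>v. inorm v x) ` IP. r \<le> B" by (meson bdd_above_finite bdd_above.E)
      obtain n where "B < real n" using reals_Archimedean2 by blast
      then show ?thesis using B x by (intro exI[of _ n]) (force simp: bx_def)
    qed
    have "topspace ?Q \<subseteq> \<Union>(range (\<lambda>n. ?q ` bx n))"
      unfolding topspace_quotient_topology topspace_K_inf using cov by blast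
    then obtain F where F: "finite F" "F \<subseteq> range (\<lambda>n. ?q ` bx n)" "topspace ?Q \<subseteq> \<Union>F"
      using cpt op unfolding compact_space_alt by (metis (no_types, lifting) rangeE)
    then obtain A where A: "finite A" "F = (\<lambda>n. ?q ` bx n) ` A" using finite_subset_image by metis
    \<comment> \<open>The boxes increase, so the largest index covers everything; 0 is inserted for
      the case of an empty subcover.\<close>
    define n where "n = Max (insert 0 A)"
    have "bx m \<subseteq> bx n" if "m \<in> A" for m
    proof -
      have "m \<le> n" unfolding n_def using A(1) that by simp
      then show ?thesis by (force simp: bx_def)
    qed
    then have sub: "?q ` carrier KI \<subseteq> ?q ` bx n"
      using F(3) unfolding topspace_quotient_topology topspace_K_inf A(2) by blast
    show "\<exists>R. \<forall>x\<in>carrier KI. \<exists>l\<in>L. \<forall>v\<in>IP. inorm v (x -\<^sub>i l) \<le> R"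
    proof (intro exI[of _ "real n"] ballI)
      fix x assume x: "x \<in> carrier KI"
      then have "x \<in> {x \<in> carrier KI. ?q x \<in> ?q ` bx n}" using sub by blast
      then show "\<exists>l\<in>L. \<forall>v\<in>IP. inorm v (x -\<^sub>i l) \<le> real n" unfolding pre by (force intro: less_imp_le)
    qed
  next
    assume "\<exists>R. \<forall>x\<in>carrier KI. \<exists>l\<in>L. \<forall>v\<in>IP. inorm v (x -\<^sub>i l) \<le> R"
    then obtain R where R: "\<And>x. x \<in> carrier KI \<Longrightarrow> \<exists>l\<in>L. \<forall>v\<in>IP. inorm v (x -\<^sub>i l) \<le> R" by blast
    have "continuous_map K_inf_topology ?Q ?q"
      unfolding continuous_map by (auto simp: topspace_quotient_topology openin_quotient_topology)
    from image_compactin[OF compactin_closed_box this]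
    have "compactin ?Q (?q ` {x \<in> carrier KI. \<forall>v\<in>IP. inorm v x \<le> R})" .
    moreover have "?q ` {x \<in> carrier KI. \<forall>v\<in>IP. inorm v x \<le> R} = topspace ?Q"
      unfolding topspace_quotient_topology topspace_K_inf
    proof (intro equalityI subsetI)
      fix E assume "E \<in> ?q ` carrier KI"
      then obtain x where x: "x \<in> carrier KI" "E = ?q x" by blast
      obtain l where l: "l \<in> L" "\<forall>v\<in>IP. inorm v (x -\<^sub>i l) \<le> R" using R[OF x(1)] by blast
      have lc: "l \<in> carrier KI" using L_closed l by blast
      have "x -\<^sub>i (x -\<^sub>i l) = l" using x lc by (simp add: a_minus_def KI.minus_add KI.minus_minus KI.r_neg2)
      then have "E = ?q (x -\<^sub>i l)" using a_coset_eq_iff[of x "x -\<^sub>i l"] l lc x by simp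
      then show "E \<in> ?q ` {x \<in> carrier KI. \<forall>v\<in>IP. inorm v x \<le> R}" using x lc l by blast
    qed auto
    ultimately show "compact_space ?Q" by (simp add: compact_space_def)
  }
qed

text \<open>Bounded points are close to one of finitely many points of \<open>K\<close> at each
  place, so infinitely many bounded points of \<open>L\<close> would include two closer than
  \<open>e\<close>.\<close>

lemma discrete_finite:
  assumes e: "e > 0" "\<And>x. x \<in> L \<Longrightarrow> \<forall>v\<in>IP. inorm v x < e \<Longrightarrow> x = \<zero>\<^sub>i"
  shows "finite {x \<in> L. \<forall>v\<in>IP. inorm v x \<le> R v}"
proof (rule ccontr)
  let ?S = "{x \<in> L. \<forall>v\<in>IP. inorm v x \<le> R v}"
  assume inf: "infinite ?S"
  \<comment> \<open>An error of \<open>e / 4\<close> arises from moving the point into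
    \<open>K\<close> and another from the covering; a pair doubles the sum to
    \<open>e\<close>.\<close>
  have e4: "0 < e / 4" using e by simp
  have "\<exists>C::'k set. finite C \<and> (\<forall>x. v x \<le> R v + e / 4 \<longrightarrow> (\<exists>c\<in>C. v (x - c) < e / 4))" if "v \<in> IP" for v
    by (rule infinite_place_covering[OF that e4])
  then obtain C :: "'k place \<Rightarrow> 'k set" where C: "\<And>v. v \<in> IP \<Longrightarrow> finite (C v)"
    "\<And>v x. v \<in> IP \<Longrightarrow> v x \<le> R v + e / 4 \<Longrightarrow> \<exists>c\<in>C v. v (x - c) < e / 4" by metis
  have ex: "\<exists>c\<in>C v. inorm v (x -\<^sub>i di c) < e / 2" if x: "x \<in> ?S" and v: "v \<in> IP" for x v
  proof -
    interpret abs_value v by (rule infinite_place_abs_value[OF v])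
    interpret KK: cring KK by (rule cring_completion)
    have xc: "x \<in> carrier KI" "inorm v x \<le> R v" using x v L_closed(1) by auto
    have eqd: "inorm v (x -\<^sub>i di k) = cnorm (x v \<ominus>\<^bsub>KK\<^esub> embed v k)" for k
      using inorm_simps(6)[OF v xc(1) di_in, of k] KI_component[OF v xc(1)] v by (simp add: di_apply completion_dist_eq)
    obtain k where k: "inorm v (x -\<^sub>i di k) < e / 4"
      using completion_dense[OF KI_component[OF v xc(1)] e4] unfolding eqd by blast
    have "di k = x -\<^sub>i (x -\<^sub>i di k)" using xc by (simp add: a_minus_def KI.minus_add KI.minus_minus KI.r_neg2)
    then have "inorm v (di k) \<le> inorm v x + inorm v (x -\<^sub>i di k)"
      using inorm_simps(5)[OF v xc(1), of "x -\<^sub>i di k"] xc by simp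
    then have "v k \<le> R v + e / 4" using k xc v by (simp add: inorm_di)
    then obtain c where c: "c \<in> C v" "v (k - c) < e / 4" using C(2)[OF v] by blast
    have "inorm v (x -\<^sub>i di c) \<le> inorm v (x -\<^sub>i di k) + inorm v (di k -\<^sub>i di c)"
      by (rule inorm_diff_trans[OF v xc(1) di_in di_in])
    also have "\<dots> < e / 2" using k c(2) v by (simp add: inorm_di flip: di_diff)
    finally show ?thesis using c(1) by blast
  qed
  define c where "c x v = (SOME c. c \<in> C v \<and> inorm v (x -\<^sub>i di c) < e / 2)" for x v
  have c: "c x v \<in> C v \<and> inorm v (x -\<^sub>i di (c x v)) < e / 2" if x: "x \<in> ?S" and v: "v \<in> IP" for x v
    unfolding c_def by (rule someI_ex) (use ex[OF x v] in blast)
  have "\<not> inj_on (\<lambda>x. restrict (c x) IP) ?S"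
  proof
    assume inj: "inj_on (\<lambda>x. restrict (c x) IP) ?S"
    have "finite (PiE IP C)" by (intro finite_PiE finite_infinite_places C)
    then have "finite ?S" by (intro inj_on_finite[OF inj]) (use c in auto)
    with inf show False by simp
  qed
  then obtain x y where xy: "x \<in> ?S" "y \<in> ?S" "x \<noteq> y" "restrict (c x) IP = restrict (c y) IP"
    unfolding inj_on_def by blast
  have xyc: "x \<in> carrier KI" "y \<in> carrier KI" using xy L_closed(1) by auto
  have "inorm v (x -\<^sub>i y) < e" if v: "v \<in> IP" for v
  proof -
    have "c x v = c y v" using xy(4) v by (metis restrict_apply')
    then have "inorm v (x -\<^sub>i y) \<le> inorm v (x -\<^sub>i di (c x v)) + inorm v (y -\<^sub>i di (c y v))"
      using inorm_diff_trans[OF v xyc(1) di_in xyc(2), of "c x v"] inorm_diff_commute[OF v xyc(2) di_in] by simp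
    then show ?thesis using c[OF xy(1) v] c[OF xy(2) v] by linarith
  qed
  then have "x -\<^sub>i y = \<zero>\<^sub>i" using e(2)[OF L_closed(5), of x y] xy by blast
  then show False using xy xyc by (simp add: KI.r_right_minus_eq)
qed

end

text \<open>Each component is approximated separately, and weak approximation merges the
  approximants into one element of \<open>K\<close>.\<close>

lemma KI_dense:
  assumes x: "x \<in> carrier KI" and e: "0 < e"
  shows "\<exists>k. \<forall>v\<in>IP. inorm v (x -\<^sub>i di k) < e"
proof -
  have e2: "0 < e / 2" using e by simp
  have "\<exists>y. inorm v (x -\<^sub>i di y) < e / 2" if v: "v \<in> IP" for v
  proof -
    interpret abs_value v by (rule infinite_place_abs_value[OF v])
    obtain y where "cnorm (x v \<ominus>\<^bsub>KK\<^esub> embed v y) < e / 2"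
      using completion_dense[OF KI_component[OF v x] e2] by blast
    then show ?thesis
      using inorm_simps(6)[OF v x di_in, of y] KI_component[OF v x] v
      by (intro exI[of _ y]) (simp add: di_apply completion_dist_eq)
  qed
  then obtain y where y: "\<And>v. v \<in> IP \<Longrightarrow> inorm v (x -\<^sub>i di (y v)) < e / 2" by metis
  obtain k where k: "\<forall>v\<in>IP. v (k - y v) < e / 2" using weak_approximation[OF e2] by blast
  have "inorm v (x -\<^sub>i di k) < e" if v: "v \<in> IP" for v
  proof -
    interpret abs_value v by (rule infinite_place_abs_value[OF v])
    have "inorm v (di (y v) -\<^sub>i di k) = v (k - y v)"
      using v diff_commute[of k] by (simp add: inorm_di flip: di_diff)
    then show ?thesis using inorm_diff_trans[OF v x di_in di_in, of k "y v"] y[OF v] bspec[OF k v] by simp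
  qed
  then show ?thesis by blast
qed

lemma KI_integers_cobounded:
  "\<exists>R. \<forall>x\<in>carrier KI. \<exists>a. algebraic_int a \<and> (\<forall>v\<in>IP. inorm v (x -\<^sub>i di a) \<le> R)"
proof -
  obtain R where R: "\<And>x::'k. \<exists>c. algebraic_int c \<and> (\<forall>v\<in>infinite_places. v (x - c) \<le> R)"
    using integers_cobounded by blast
  show ?thesis
  \<comment> \<open>The extra 1 pays for replacing \<open>x\<close> by a point of
    \<open>K\<close>.\<close>
  proof (intro exI[of _ "R + 1"] ballI)
    fix x assume x: "x \<in> carrier KI"
    obtain k where k: "\<forall>v\<in>IP. inorm v (x -\<^sub>i di k) < 1" using KI_dense[OF x, of 1] by auto
    obtain c where c: "algebraic_int c" "\<forall>v\<in>infinite_places. v (k - c) \<le> R" using R by blast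
    have "inorm v (x -\<^sub>i di c) \<le> R + 1" if v: "v \<in> IP" for v
      using inorm_diff_trans[OF v x di_in di_in, of c k] bspec[OF k v] bspec[OF c(2) v] v
      by (simp add: inorm_di flip: di_diff)
    then show "\<exists>a. algebraic_int a \<and> (\<forall>v\<in>IP. inorm v (x -\<^sub>i di a) \<le> R + 1)" using c(1) by blast
  qed
qed

text \<open>The two conditions with \<open>N\<close> say that \<open>I\<close> contains a positive
  multiple of \<open>O\<close> and has a common denominator; they take the place of finite
  generation.\<close>

definition fractional :: "'k set \<Rightarrow> bool" where
  "fractional I \<longleftrightarrow> (\<forall>x\<in>I. \<forall>y\<in>I. x + y \<in> I) \<and> (\<forall>x\<in>I. \<forall>a. algebraic_int a \<longrightarrow> a * x \<in> I) \<and>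
     (\<exists>N>0. of_nat N \<in> I) \<and> (\<exists>N>0. \<forall>x\<in>I. algebraic_int (of_nat N * x))"

lemma fractionalD:
  assumes "fractional I"
  shows "x \<in> I \<Longrightarrow> y \<in> I \<Longrightarrow> x + y \<in> I" "x \<in> I \<Longrightarrow> algebraic_int a \<Longrightarrow> a * x \<in> I"
    "0 \<in> I" "x \<in> I \<Longrightarrow> - x \<in> I" "x \<in> I \<Longrightarrow> y \<in> I \<Longrightarrow> x - y \<in> I"
proof -
  show 1: "x + y \<in> I" if "x \<in> I" "y \<in> I" for x y using assms that by (auto simp: fractional_def)
  show 2: "a * x \<in> I" if "x \<in> I" "algebraic_int a" for x a using assms that by (auto simp: fractional_def)
  obtain N where "of_nat N \<in> I" using assms unfolding fractional_def by blast
  then show "0 \<in> I" using 2[of "of_nat N" 0] by simp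
  show 3: "- x \<in> I" if "x \<in> I" for x using 2[OF that, of "-1"] by simp
  show "x - y \<in> I" if "x \<in> I" "y \<in> I" using 1[OF that(1) 3[OF that(2)]] by simp
qed

definition LT :: "'k inf_adele \<Rightarrow> 'k set \<Rightarrow> 'k inf_adele set" where
  "LT s I = (\<lambda>k. s *\<^sub>i di k) ` I"

lemma LT_mem_iff: "s \<in> Units KI \<Longrightarrow> s *\<^sub>i di k \<in> LT s I \<longleftrightarrow> k \<in> I"
  by (auto simp: LT_def KI.Units_l_cancel di_eq_iff)

lemma LT_diff: "s \<in> Units KI \<Longrightarrow> s *\<^sub>i di k -\<^sub>i s *\<^sub>i di k' = s *\<^sub>i di (k - k')"
  using KI.Units_closed[of s] by (simp add: di_diff a_minus_def KI.r_distr KI.r_minus)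

lemma LT_add: "s \<in> Units KI \<Longrightarrow> s *\<^sub>i di k +\<^sub>i s *\<^sub>i di k' = s *\<^sub>i di (k + k')"
  by (simp add: di_hom KI.r_distr)

lemma subgroup_LT:
  assumes s: "s \<in> Units KI" and I: "0 \<in> I" "\<And>x y. x \<in> I \<Longrightarrow> y \<in> I \<Longrightarrow> x - y \<in> I"
  shows "subgroup (LT s I) (add_monoid KI)"
proof (rule KI.add.subgroupI)
  have neg: "- x \<in> I" if "x \<in> I" for x using I(2)[OF I(1) that] by simp
  show "LT s I \<subseteq> carrier KI" using s by (auto simp: LT_def)
  show "LT s I \<noteq> {}" using I by (auto simp: LT_def)
  show "\<ominus>\<^bsub>KI\<^esub> x \<in> LT s I" if x: "x \<in> LT s I" for x
  proof -
    obtain k where k: "k \<in> I" "x = s *\<^sub>i di k" using x by (auto simp: LT_def)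
    have "\<ominus>\<^bsub>KI\<^esub> x = s *\<^sub>i di (- k)" using s by (simp add: k di_minus KI.r_minus)
    then show ?thesis using neg[OF k(1)] by (simp add: LT_def)
  qed
  show "x +\<^sub>i y \<in> LT s I" if xy: "x \<in> LT s I" "y \<in> LT s I" for x y
  proof -
    obtain k k' where k: "k \<in> I" "x = s *\<^sub>i di k" "k' \<in> I" "y = s *\<^sub>i di k'" using xy by (auto simp: LT_def)
    have "k + k' \<in> I" using I(2)[OF k(1) neg[OF k(3)]] by simp
    then show ?thesis using LT_add[OF s] by (auto simp: k LT_def)
  qed
qed

text \<open>The products already form a group, so generating adds nothing.\<close>

lemma set_span_eqI:
  assumes "subgroup M (add_monoid KI)" and "\<And>a x. a \<in> A \<Longrightarrow> x \<in> L \<Longrightarrow> a *\<^sub>i x \<in> M"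
    and "\<And>y. y \<in> M \<Longrightarrow> \<exists>a\<in>A. \<exists>x\<in>L. y = a *\<^sub>i x"
  shows "set_span KI A L = M"
proof -
  have "A <#>\<^bsub>KI\<^esub> L = M" using assms(2,3) by (auto simp: set_mult_def)
  then show ?thesis
    unfolding set_span_def using KI.add.generate_subgroup_incl[OF _ assms(1), of M]
    by (auto intro: generate.incl)
qed

text \<open>Discreteness: a nonzero element of \<open>I\<close>, multiplied by the denominator
  \<open>M\<close>, is a nonzero integer and so has absolute value at least 1 at some infinite
  place. Cocompactness: \<open>I\<close> contains \<open>N O\<close>, and \<open>O\<close> is
  cocompact.\<close>

lemma O_lattice_LT:
  assumes s: "s \<in> Units KI" and I: "fractional I"
  shows "O_lattice (LT s I)"
proof -
  note sg = subgroup_LT[OF s fractionalD(3)[OF I] fractionalD(5)[OF I]]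
  have sc: "s \<in> carrier KI" "inv\<^sub>i s \<in> carrier KI" using s by auto
  obtain N M where N: "N > 0" "of_nat N \<in> I" and M: "M > 0" "\<And>x. x \<in> I \<Longrightarrow> algebraic_int (of_nat M * x)"
    using I unfolding fractional_def by blast
  have "\<exists>e>0. \<forall>x\<in>LT s I. (\<forall>v\<in>IP. inorm v x < e) \<longrightarrow> x = \<zero>\<^sub>i"
  proof -
    obtain e where e: "e > 0" "\<forall>v\<in>IP. e \<le> inorm v s / real M"
      using Min_pos[OF finite_infinite_places, of "\<lambda>v. inorm v s / real M"] s M by (auto simp: Units_KI_iff)
    have "s *\<^sub>i di k = \<zero>\<^sub>i" if k: "k \<in> I" "\<forall>v\<in>IP. inorm v (s *\<^sub>i di k) < e" for k
    proof (cases "k = 0")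
      case False
      then obtain v where v: "v \<in> IP" "1 \<le> v (of_nat M * k)"
        using exists_infinite_place_ge_1[OF M(2)[OF k(1)]] M(1) by auto
      interpret abs_value v by (rule infinite_place_abs_value[OF v(1)])
      have p: "0 < inorm v s" using s v by (simp add: Units_KI_iff)
      have "inorm v s * v k < inorm v s / real M"
        using k(2) e(2) v sc by (force simp: inorm_simps inorm_di)
      then have "v k * real M < 1" using p M(1) by (simp add: field_simps)
      then show ?thesis using v by (simp add: mult infinite_place_of_nat mult.commute)
    qed (use sc in \<open>simp add: di_hom\<close>)
    then show ?thesis using e(1) by (auto simp: LT_def)
  qed
  moreover have "\<exists>R. \<forall>x\<in>carrier KI. \<exists>l\<in>LT s I. \<forall>v\<in>IP. inorm v (x -\<^sub>i l) \<le> R"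
  proof -
    obtain R where R: "\<And>x. x \<in> carrier KI \<Longrightarrow> \<exists>a. algebraic_int a \<and> (\<forall>v\<in>IP. inorm v (x -\<^sub>i di a) \<le> R)"
      using KI_integers_cobounded by blast
    define B where "B = (\<Sum>v\<in>IP. inorm v s * real N * \<bar>R\<bar>)"
    show ?thesis
    proof (intro exI[of _ B] ballI)
      fix x assume x: "x \<in> carrier KI"
      \<comment> \<open>The point \<open>x\<close> divided by \<open>s N\<close>: rounding
        \<open>y\<close> to \<open>O\<close> rounds \<open>x\<close> to
        \<open>s N O\<close>.\<close>
      define y where "y = inv\<^sub>i s *\<^sub>i (di (1 / of_nat N) *\<^sub>i x)"
      have yc: "y \<in> carrier KI" using x sc by (simp add: y_def)
      obtain a where a: "algebraic_int a" "\<forall>v\<in>IP. inorm v (y -\<^sub>i di a) \<le> R" using R[OF yc] by blast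
      have Nx: "di (of_nat N) *\<^sub>i (di (1 / of_nat N) *\<^sub>i x) = x"
        using N(1) x by (simp add: di_hom flip: KI.m_assoc) (simp add: di_hom flip: di_hom(1))
      have xy: "(s *\<^sub>i di (of_nat N)) *\<^sub>i y = x"
      proof -
        have "(s *\<^sub>i di (of_nat N)) *\<^sub>i y = (s *\<^sub>i inv\<^sub>i s) *\<^sub>i (di (of_nat N) *\<^sub>i (di (1 / of_nat N) *\<^sub>i x))"
          unfolding y_def using sc x by (simp add: KI.m_ac)
        then show ?thesis using Nx s x by simp
      qed
      define l where "l = s *\<^sub>i di (of_nat N * a)"
      have lL: "l \<in> LT s I" unfolding l_def LT_def using fractionalD(2)[OF I N(2) a(1)] by (simp add: mult.commute)
      have l: "l = (s *\<^sub>i di (of_nat N)) *\<^sub>i di a" unfolding l_def using sc by (simp add: di_hom KI.m_assoc)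
      have "x -\<^sub>i l = (s *\<^sub>i di (of_nat N)) *\<^sub>i (y -\<^sub>i di a)"
        using sc yc by (subst xy[symmetric]) (simp add: l a_minus_def KI.r_distr KI.r_minus)
      then have eq: "inorm v (x -\<^sub>i l) = inorm v s * real N * inorm v (y -\<^sub>i di a)" if "v \<in> IP" for v
        using that sc yc by (simp add: inorm_simps inorm_di infinite_place_of_nat)
      have "inorm v (x -\<^sub>i l) \<le> B" if v: "v \<in> IP" for v
      proof -
        have "inorm v (x -\<^sub>i l) \<le> inorm v s * real N * \<bar>R\<bar>"
          unfolding eq[OF v] using bspec[OF a(2) v] inorm_simps(1)[OF v sc(1)] by (intro mult_left_mono) auto
        also have "\<dots> \<le> B" unfolding B_def using v finite_infinite_places inorm_simps(1)[OF _ sc(1)]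
          by (intro member_le_sum) auto
        finally show ?thesis .
      qed
      then show "\<exists>l\<in>LT s I. \<forall>v\<in>IP. inorm v (x -\<^sub>i l) \<le> B" using lL by blast
    qed
  qed
  ultimately have "is_lattice (LT s I)"
    unfolding is_lattice_def using sg discrete_iff[OF sg] cocompact_iff[OF sg] by blast
  moreover have "set_span KI (di ` carrier O_ring) (LT s I) = LT s I"
  proof (rule set_span_eqI[OF sg])
    fix a x assume "a \<in> di ` carrier O_ring" "x \<in> LT s I"
    then obtain b k where bk: "algebraic_int b" "a = di b" "k \<in> I" "x = s *\<^sub>i di k" by (auto simp: LT_def)
    have "a *\<^sub>i x = s *\<^sub>i di (b * k)" using sc by (simp add: bk di_hom KI.m_ac)
    then show "a *\<^sub>i x \<in> LT s I" using fractionalD(2)[OF I bk(3,1)] by (auto simp: LT_def)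
  next
    fix y assume y: "y \<in> LT s I"
    have "y = di 1 *\<^sub>i y" using subgroup.subset[OF sg] y by (auto simp: di_hom)
    then show "\<exists>a\<in>di ` carrier O_ring. \<exists>x\<in>LT s I. y = a *\<^sub>i x" using y by force
  qed
  ultimately show ?thesis by (simp add: O_lattice_def)
qed

text \<open>Cocompactness provides a unit \<open>l\<close> of \<open>K_inf\<close> inside
  \<open>L\<close>. Modulo \<open>l O\<close> every element of \<open>L\<close> reduces to the
  finite set \<open>F\<close> of bounded ones, so one \<open>M\<close> annihilates \<open>L\<close>
  modulo \<open>l O\<close>. Hence \<open>L\<close> lies between \<open>l O\<close> and
  \<open>l O / M\<close>, and division by \<open>l\<close> turns it into a fractional ideal.\<close>

lemma O_lattice_eq_LT:
  assumes L: "O_lattice L"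
  shows "\<exists>l\<in>Units KI. \<exists>I. fractional I \<and> 1 \<in> I \<and> L = LT l I"
proof -
  have sg: "subgroup L (add_monoid KI)"
    and disc: "subtopology K_inf_topology L = discrete_topology L"
    and cpt: "compact_space (quotient_topology K_inf_topology (\<lambda>x. L +>\<^sub>i x))"
    and span: "set_span KI (di ` carrier O_ring) L = L"
    using L unfolding O_lattice_def is_lattice_def by auto
  note Lc = L_closed[OF sg]
  have OL: "di a *\<^sub>i x \<in> L" if "algebraic_int a" "x \<in> L" for a x
  proof -
    have "di a *\<^sub>i x \<in> (di ` carrier O_ring) <#>\<^bsub>KI\<^esub> L" using that by (auto simp: set_mult_def)
    then have "di a *\<^sub>i x \<in> set_span KI (di ` carrier O_ring) L" unfolding set_span_def by (rule generate.incl)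
    then show ?thesis by (simp only: span)
  qed
  obtain e where e: "e > 0" "\<And>x. x \<in> L \<Longrightarrow> \<forall>v\<in>IP. inorm v x < e \<Longrightarrow> x = \<zero>\<^sub>i"
    using disc unfolding discrete_iff[OF sg] by blast
  obtain R where R: "\<And>x. x \<in> carrier KI \<Longrightarrow> \<exists>l\<in>L. \<forall>v\<in>IP. inorm v (x -\<^sub>i l) \<le> R"
    using cpt unfolding cocompact_iff[OF sg] by blast
  \<comment> \<open>An element of \<open>L\<close> within \<open>R\<close> of a natural number
    larger than \<open>R\<close> has no vanishing component.\<close>
  obtain N where N: "R < real N" using reals_Archimedean2 by blast
  obtain l where l: "l \<in> L" "\<forall>v\<in>IP. inorm v (di (of_nat N) -\<^sub>i l) \<le> R" using R[of "di (of_nat N)"] by auto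
  have lc: "l \<in> carrier KI" using Lc l by blast
  have "0 < inorm v l" if v: "v \<in> IP" for v
  proof -
    have "di (of_nat N) = (di (of_nat N) -\<^sub>i l) +\<^sub>i l" using lc by (simp add: a_minus_def KI.a_assoc KI.l_neg)
    then have "inorm v (di (of_nat N)) \<le> inorm v (di (of_nat N) -\<^sub>i l) + inorm v l"
      using inorm_simps(3)[OF v _ lc, of "di (of_nat N) -\<^sub>i l"] lc by simp
    then show ?thesis using bspec[OF l(2) v] N v by (simp add: inorm_di infinite_place_of_nat)
  qed
  then have lU: "l \<in> Units KI" using lc by (simp add: Units_KI_iff)
  have lil: "l *\<^sub>i (inv\<^sub>i l *\<^sub>i x) = x" if "x \<in> carrier KI" for x
    using lU lc that by (simp flip: KI.m_assoc)
  obtain R' where R': "\<And>x. x \<in> carrier KI \<Longrightarrow> \<exists>a. algebraic_int a \<and> (\<forall>v\<in>IP. inorm v (x -\<^sub>i di a) \<le> R')"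
    using KI_integers_cobounded by blast
  define F where "F = {z \<in> L. \<forall>v\<in>IP. inorm v z \<le> inorm v l * R'}"
  have F: "finite F" unfolding F_def by (rule discrete_finite[OF sg e])
  have red: "\<exists>a. algebraic_int a \<and> x -\<^sub>i l *\<^sub>i di a \<in> F" if x: "x \<in> L" for x
  proof -
    have xc: "x \<in> carrier KI" using Lc x by blast
    obtain a where a: "algebraic_int a" "\<forall>v\<in>IP. inorm v (inv\<^sub>i l *\<^sub>i x -\<^sub>i di a) \<le> R'"
      using R'[of "inv\<^sub>i l *\<^sub>i x"] lU xc by auto
    have ic: "inv\<^sub>i l *\<^sub>i x \<in> carrier KI" using lU xc by simp
    have eq: "x -\<^sub>i l *\<^sub>i di a = l *\<^sub>i (inv\<^sub>i l *\<^sub>i x -\<^sub>i di a)"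
      using lc ic lil[OF xc] by (simp add: a_minus_def KI.r_distr KI.r_minus)
    have "x -\<^sub>i l *\<^sub>i di a \<in> L" using Lc(5)[OF x OL[OF a(1) l(1)]] lc by (simp add: KI.m_comm)
    moreover have "inorm v (x -\<^sub>i l *\<^sub>i di a) \<le> inorm v l * R'" if v: "v \<in> IP" for v
      unfolding eq using bspec[OF a(2) v] v lc ic by (simp add: inorm_simps mult_left_mono)
    ultimately show ?thesis using a(1) unfolding F_def by blast
  qed
  \<comment> \<open>Pigeonhole on the reductions into \<open>F\<close> of all natural multiples of
    \<open>x\<close>.\<close>
  have tors: "\<exists>n>0. \<exists>a. algebraic_int a \<and> di (of_nat n) *\<^sub>i x = l *\<^sub>i di a" if x: "x \<in> L" for x
  proof -
    have xc: "x \<in> carrier KI" using Lc x by blast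
    have "\<exists>a. algebraic_int a \<and> di (of_nat n) *\<^sub>i x -\<^sub>i l *\<^sub>i di a \<in> F" for n :: nat
      by (rule red[OF OL[OF algebraic_int_of_nat x]])
    then obtain a where a: "\<And>n. algebraic_int (a n)" "\<And>n. di (of_nat n) *\<^sub>i x -\<^sub>i l *\<^sub>i di (a n) \<in> F" by metis
    let ?f = "\<lambda>n::nat. di (of_nat n) *\<^sub>i x -\<^sub>i l *\<^sub>i di (a n)"
    have "range ?f \<subseteq> F" using a(2) by blast
    then have "\<not> inj ?f" using F finite_subset range_inj_infinite by blast
    then obtain i j where ij: "i < j" "?f i = ?f j" unfolding inj_def by (metis linorder_neqE_nat)
    have f: "di (of_nat n) *\<^sub>i x = ?f n +\<^sub>i l *\<^sub>i di (a n)" for n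
      using lc xc by (simp add: a_minus_def KI.a_assoc KI.l_neg)
    have "(of_nat (j - i) :: 'k) = of_nat j - of_nat i" using ij by (simp add: of_nat_diff)
    then have "di (of_nat (j - i)) *\<^sub>i x = di (of_nat j) *\<^sub>i x -\<^sub>i di (of_nat i) *\<^sub>i x"
      using xc by (simp add: di_diff a_minus_def KI.l_distr KI.l_minus)
    also have "\<dots> = (?f j +\<^sub>i l *\<^sub>i di (a j)) -\<^sub>i (?f j +\<^sub>i l *\<^sub>i di (a i))"
      using f[of j] f[of i] ij(2) by metis
    also have "\<dots> = l *\<^sub>i di (a j) -\<^sub>i l *\<^sub>i di (a i)"
    proof -
      have *: "(p +\<^sub>i q) -\<^sub>i (p +\<^sub>i r) = q -\<^sub>i r" if "p \<in> carrier KI" "q \<in> carrier KI" "r \<in> carrier KI" for p q r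
        using that KI.a_lcomm[of p q "\<ominus>\<^bsub>KI\<^esub> p +\<^sub>i \<ominus>\<^bsub>KI\<^esub> r"]
        by (simp add: a_minus_def KI.minus_add KI.a_assoc KI.r_neg2)
      show ?thesis by (rule *) (use lc xc in simp_all)
    qed
    also have "\<dots> = l *\<^sub>i di (a j - a i)" by (rule LT_diff[OF lU])
    finally have "di (of_nat (j - i)) *\<^sub>i x = l *\<^sub>i di (a j - a i)" .
    moreover have "algebraic_int (a j - a i)" by (rule algebraic_int_diff[OF a(1) a(1)])
    ultimately show ?thesis using ij(1) by (metis zero_less_diff)
  qed
  then obtain n where n: "\<And>x. x \<in> L \<Longrightarrow> 0 < n x \<and> (\<exists>a. algebraic_int a \<and> di (of_nat (n x)) *\<^sub>i x = l *\<^sub>i di a)" by metis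
  \<comment> \<open>A common multiple of annihilators of the elements of \<open>F\<close>; it serves
    for all of \<open>L\<close>, since every \<open>x\<close> differs from one of them by an element
    of \<open>l O\<close>.\<close>
  define M where "M = (\<Prod>z\<in>F. n z)"
  have FL: "z \<in> L" if "z \<in> F" for z using that by (simp add: F_def)
  have M0: "M > 0" unfolding M_def using n FL by (intro prod_pos) auto
  have key: "\<exists>b. algebraic_int b \<and> di (of_nat M) *\<^sub>i x = l *\<^sub>i di b" if x: "x \<in> L" for x
  proof -
    have xc: "x \<in> carrier KI" using Lc x by blast
    obtain a where a: "algebraic_int a" "x -\<^sub>i l *\<^sub>i di a \<in> F" using red[OF x] by blast
    define z where "z = x -\<^sub>i l *\<^sub>i di a"
    have z: "z \<in> F" "z \<in> L" "z \<in> carrier KI" using a(2) FL Lc(1) by (auto simp: z_def)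
    obtain c where c: "algebraic_int c" "di (of_nat (n z)) *\<^sub>i z = l *\<^sub>i di c" using n[OF z(2)] by blast
    have "n z dvd M" unfolding M_def using F z(1) by (rule dvd_prodI)
    then obtain m where m: "M = n z * m" by auto
    have "di (of_nat M) *\<^sub>i z = di (of_nat m) *\<^sub>i (di (of_nat (n z)) *\<^sub>i z)"
      using z(3) by (simp add: m di_hom KI.m_ac)
    also have "\<dots> = l *\<^sub>i di (of_nat m * c)" unfolding c(2) using lc by (simp add: di_hom KI.m_ac)
    finally have 1: "di (of_nat M) *\<^sub>i z = l *\<^sub>i di (of_nat m * c)" .
    have "x = z +\<^sub>i l *\<^sub>i di a" using lc xc by (simp add: z_def a_minus_def KI.a_assoc KI.l_neg)
    then have "di (of_nat M) *\<^sub>i x = di (of_nat M) *\<^sub>i z +\<^sub>i di (of_nat M) *\<^sub>i (l *\<^sub>i di a)"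
      using z lc by (simp add: KI.r_distr)
    also have "di (of_nat M) *\<^sub>i (l *\<^sub>i di a) = l *\<^sub>i di (of_nat M * a)" using lc by (simp add: di_hom KI.m_ac)
    finally have "di (of_nat M) *\<^sub>i x = l *\<^sub>i di (of_nat m * c + of_nat M * a)" unfolding 1 LT_add[OF lU] .
    moreover have "algebraic_int (of_nat m * c + of_nat M * a)"
      by (intro algebraic_int_add algebraic_int_mult[OF algebraic_int_of_nat] c a)
    ultimately show ?thesis by blast
  qed
  define I where "I = {k. l *\<^sub>i di k \<in> L}"
  have exk: "\<exists>k\<in>I. x = l *\<^sub>i di k \<and> algebraic_int (of_nat M * k)" if x: "x \<in> L" for x
  proof -
    have xc: "x \<in> carrier KI" using Lc x by blast
    obtain b where b: "algebraic_int b" "di (of_nat M) *\<^sub>i x = l *\<^sub>i di b" using key[OF x] by blast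
    have "x = di (1 / of_nat M * of_nat M) *\<^sub>i x" using M0 xc by (simp add: di_hom)
    also have "\<dots> = di (1 / of_nat M) *\<^sub>i (l *\<^sub>i di b)" unfolding di_hom(1) b(2)[symmetric] using xc by (simp add: KI.m_assoc)
    also have "\<dots> = l *\<^sub>i di (1 / of_nat M * b)" unfolding di_hom(1) by (rule KI.m_lcomm[OF di_in lc di_in])
    finally have xe: "x = l *\<^sub>i di (1 / of_nat M * b)" .
    then have "1 / of_nat M * b \<in> I" using x by (simp add: I_def)
    moreover have "of_nat M * (1 / of_nat M * b) = b" using M0 by simp
    ultimately show ?thesis using xe b(1) by metis
  qed
  have "L = LT l I" using exk by (auto simp: LT_def I_def)
  moreover have "fractional I"
    unfolding fractional_def
  proof (intro conjI ballI allI impI)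
    show "x + y \<in> I" if "x \<in> I" "y \<in> I" for x y
      using that Lc(3)[of "l *\<^sub>i di x" "l *\<^sub>i di y"] by (simp add: I_def LT_add[OF lU])
    show "a * x \<in> I" if "x \<in> I" "algebraic_int a" for x a
    proof -
      have "l *\<^sub>i di (a * x) = di a *\<^sub>i (l *\<^sub>i di x)" using lc by (simp add: di_hom KI.m_ac)
      then show ?thesis using OL[OF that(2)] that(1) by (simp add: I_def)
    qed
    show "\<exists>N>0. of_nat N \<in> I" using l(1) lc by (intro exI[of _ 1]) (simp add: I_def di_hom)
    have "algebraic_int (of_nat M * x)" if x: "x \<in> I" for x
    proof -
      have "l *\<^sub>i di x \<in> L" using x by (simp add: I_def)
      from exk[OF this] obtain k where k: "l *\<^sub>i di x = l *\<^sub>i di k" "algebraic_int (of_nat M * k)" by blast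
      then have "x = k" using lU by (simp add: KI.Units_l_cancel di_eq_iff)
      then show ?thesis using k by simp
    qed
    then show "\<exists>N>0. \<forall>x\<in>I. algebraic_int (of_nat N * x)" using M0 by blast
  qed
  moreover have "1 \<in> I" using l(1) lc by (simp add: I_def di_hom)
  ultimately show ?thesis using lU by blast
qed

abbreviation CC :: "'k inf_adele set" where "CC \<equiv> K_inf_units_component"

text \<open>Translations by units are continuous. So \<open>CC\<close> translated by
  \<open>c\<close> is connected and contains \<open>c\<close>, and \<open>CC\<close> translated by
  the inverse of \<open>c\<close> is connected and contains 1; both translates therefore lie in the
  component of 1.\<close>

lemma CC_facts:
  "\<one>\<^sub>i \<in> CC" "c \<in> CC \<Longrightarrow> c \<in> Units KI" "c \<in> CC \<Longrightarrow> d \<in> CC \<Longrightarrow> c *\<^sub>i d \<in> CC" "c \<in> CC \<Longrightarrow> inv\<^sub>i c \<in> CC"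
proof -
  let ?T = "subtopology K_inf_topology (Units KI)"
  have top: "topspace ?T = Units KI" using topspace_K_inf by auto
  have CC: "CC = connected_component_of_set ?T \<one>\<^sub>i" by (simp add: K_inf_units_component_def)
  show one: "\<one>\<^sub>i \<in> CC" unfolding CC using top by (simp add: connected_component_of_refl)
  show sub: "c \<in> Units KI" if "c \<in> CC" for c
    using that connected_component_of_subset_topspace[of ?T "\<one>\<^sub>i"] top unfolding CC by blast
  have cont: "continuous_map ?T ?T (\<lambda>x. u *\<^sub>i x)" if u: "u \<in> Units KI" for u
  proof (rule continuous_map_into_subtopology)
    have uc: "u \<in> carrier KI" using u by simp
    show "continuous_map ?T K_inf_topology (\<lambda>x. u *\<^sub>i x)"
    proof (rule continuous_map_from_subtopology, unfold continuous_map topspace_K_inf, intro conjI allI impI)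
      show "(\<lambda>x. u *\<^sub>i x) ` carrier KI \<subseteq> carrier KI" using uc by auto
      fix U :: "'k inf_adele set" assume U: "openin K_inf_topology U"
      show "openin K_inf_topology {x \<in> carrier KI. u *\<^sub>i x \<in> U}"
        unfolding openin_K_inf
      proof (intro conjI ballI)
        fix x assume "x \<in> {x \<in> carrier KI. u *\<^sub>i x \<in> U}"
        then have x: "x \<in> carrier KI" "u *\<^sub>i x \<in> U" by auto
        then obtain e where e: "e > 0" "\<And>y. y \<in> carrier KI \<Longrightarrow> \<forall>v\<in>IP. inorm v (y -\<^sub>i u *\<^sub>i x) < e \<Longrightarrow> y \<in> U"
          using U unfolding openin_K_inf by blast
        obtain d where d: "d > 0" "\<forall>v\<in>IP. d \<le> e / inorm v u"
          using Min_pos[OF finite_infinite_places, of "\<lambda>v. e / inorm v u"] e(1) u by (auto simp: Units_KI_iff)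
        have "u *\<^sub>i y \<in> U" if y: "y \<in> carrier KI" "\<forall>v\<in>IP. inorm v (y -\<^sub>i x) < d" for y
        proof (rule e(2))
          show "\<forall>v\<in>IP. inorm v (u *\<^sub>i y -\<^sub>i u *\<^sub>i x) < e"
          proof
            fix v assume v: "v \<in> IP"
            have "u *\<^sub>i y -\<^sub>i u *\<^sub>i x = u *\<^sub>i (y -\<^sub>i x)"
              using uc y x by (simp add: a_minus_def KI.r_distr KI.r_minus)
            then have "inorm v (u *\<^sub>i y -\<^sub>i u *\<^sub>i x) = inorm v u * inorm v (y -\<^sub>i x)"
              using uc y x v by (simp add: inorm_simps)
            moreover have "0 < inorm v u" using u v by (simp add: Units_KI_iff)
            moreover have "inorm v (y -\<^sub>i x) < e / inorm v u" using bspec[OF y(2) v] bspec[OF d(2) v] by linarith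
            ultimately show "inorm v (u *\<^sub>i y -\<^sub>i u *\<^sub>i x) < e" by (simp add: field_simps)
          qed
        qed (use uc y in simp)
        then show "\<exists>d>0. \<forall>y\<in>carrier KI. (\<forall>v\<in>IP. inorm v (y -\<^sub>i x) < d) \<longrightarrow> y \<in> {x \<in> carrier KI. u *\<^sub>i x \<in> U}"
          using d(1) by blast
      qed auto
    qed
    show "(\<lambda>x. u *\<^sub>i x) \<in> topspace ?T \<rightarrow> Units KI" using u top by auto
  qed
  have conn: "connectedin ?T ((\<lambda>x. u *\<^sub>i x) ` CC)" if u: "u \<in> Units KI" for u
    by (rule connectedin_continuous_map_image[OF cont[OF u]]) (simp add: CC connectedin_connected_component_of)
  show "c *\<^sub>i d \<in> CC" if c: "c \<in> CC" and d: "d \<in> CC"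
  proof -
    have "c \<in> (\<lambda>x. c *\<^sub>i x) ` CC" using one sub[OF c] by (intro image_eqI[of _ _ "\<one>\<^sub>i"]) auto
    then have "(\<lambda>x. c *\<^sub>i x) ` CC \<subseteq> connected_component_of_set ?T c"
      by (rule connected_component_of_maximal[OF conn[OF sub[OF c]]])
    also have "connected_component_of_set ?T c = CC"
      using c connected_component_of_equiv[of ?T "\<one>\<^sub>i" c] unfolding CC by auto
    finally show ?thesis using d by blast
  qed
  show "inv\<^sub>i c \<in> CC" if c: "c \<in> CC"
  proof -
    have cU: "c \<in> Units KI" by (rule sub[OF c])
    have "\<one>\<^sub>i \<in> (\<lambda>x. inv\<^sub>i c *\<^sub>i x) ` CC" using c cU by (intro image_eqI[of _ _ c]) auto
    then have "(\<lambda>x. inv\<^sub>i c *\<^sub>i x) ` CC \<subseteq> connected_component_of_set ?T \<one>\<^sub>i"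
      by (rule connected_component_of_maximal[OF conn[OF KI.Units_inv_Units[OF cU]]])
    then have "inv\<^sub>i c *\<^sub>i \<one>\<^sub>i \<in> CC" using one unfolding CC by blast
    then show ?thesis using cU by simp
  qed
qed

end

section \<open>Classification of \<open>K\<close>-lattices\<close>

context cring
begin

lemma coset_smult_coset:
  assumes L: "subgroup L (add_monoid R)" and c: "c \<in> carrier R" "\<And>l. l \<in> L \<Longrightarrow> c \<otimes> l \<in> L"
    and x: "x \<in> carrier R"
  shows "coset_smult R L c (L +> x) = L +> (c \<otimes> x)"
proof -
  have "L +> (c \<otimes> y) = L +> (c \<otimes> x)" if y: "y \<in> L +> x" for y
  proof -
    obtain l where l: "l \<in> L" "y = l \<oplus> x" using y unfolding a_r_coset_def' by auto
    have "l \<in> carrier R" using subgroup.subset[OF L] l(1) by auto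
    then have "c \<otimes> y = c \<otimes> l \<oplus> c \<otimes> x" using l c x by (simp add: r_distr)
    then have "c \<otimes> y \<in> L +> (c \<otimes> x)" using c(2)[OF l(1)] unfolding a_r_coset_def' by blast
    from a_repr_independence[OF this _ L] show ?thesis using c x by simp
  qed
  moreover have "x \<in> L +> x"
    using subgroup.one_closed[OF L] x unfolding a_r_coset_def' by (auto intro: bexI[of _ "\<zero>"])
  ultimately show ?thesis unfolding coset_smult_def by blast
qed

lemma a_coset_add:
  assumes L: "subgroup L (add_monoid R)" and "x \<in> carrier R" "y \<in> carrier R"
  shows "(L +> x) <+>\<^bsub>R\<^esub> (L +> y) = L +> (x \<oplus> y)"
  using normal.rcos_sum[OF add.subgroup_imp_normal[OF L], of x y] assms by (simp add: set_add_def a_r_coset_def)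

text \<open>Serves to push cosets of each of two lattices forward to their sum, as in the definition
  of commensurability.\<close>

lemma a_coset_absorb:
  assumes L: "\<zero> \<in> L" "L \<subseteq> carrier R" and M: "M \<subseteq> carrier R" "\<And>l m. l \<in> L \<Longrightarrow> m \<in> M \<Longrightarrow> l \<oplus> m \<in> M"
    and z: "z \<in> carrier R"
  shows "(L +> z) <+>\<^bsub>R\<^esub> M = M +> z"
proof (intro equalityI subsetI)
  fix w assume "w \<in> (L +> z) <+>\<^bsub>R\<^esub> M"
  then obtain l m where lm: "l \<in> L" "m \<in> M" "w = (l \<oplus> z) \<oplus> m" unfolding set_add_def' a_r_coset_def' by auto
  then have "w = (l \<oplus> m) \<oplus> z" using L M z by (simp add: subset_iff a_ac)
  then show "w \<in> M +> z" using M(2)[OF lm(1,2)] unfolding a_r_coset_def' by blast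
next
  fix w assume "w \<in> M +> z"
  then obtain m where m: "m \<in> M" "w = m \<oplus> z" unfolding a_r_coset_def' by auto
  then have "w = (\<zero> \<oplus> z) \<oplus> m" using M z by (simp add: subset_iff a_comm)
  then show "w \<in> (L +> z) <+>\<^bsub>R\<^esub> M" using L(1) m(1) unfolding set_add_def' a_r_coset_def' by blast
qed

end

context number_field_type
begin

text \<open>The class of \<open>x\<close> in \<open>K/O\<close>.\<close>

definition oc :: "'k \<Rightarrow> 'k set" where
  "oc x = {y. algebraic_int (y - x)}"

lemma oc_self [simp]: "x \<in> oc x"
  by (simp add: oc_def)

lemma oc_eq_iff: "oc x = oc y \<longleftrightarrow> algebraic_int (x - y)"
proof
  assume "oc x = oc y"
  then have "x \<in> oc y" using oc_self[of x] by simp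
  then show "algebraic_int (x - y)" by (simp add: oc_def)
next
  assume a: "algebraic_int (x - y)"
  have "algebraic_int (z - x) \<longleftrightarrow> algebraic_int (z - y)" for z
    using algebraic_int_add[OF _ a, of "z - x"] algebraic_int_diff[OF _ a, of "z - y"] by auto
  then show "oc x = oc y" by (simp add: oc_def)
qed

lemma r_coset_oc: "carrier O_ring #>\<^bsub>add_monoid K_ring\<^esub> x = oc x"
proof (intro equalityI subsetI)
  fix y assume "y \<in> oc x"
  then have "algebraic_int (y - x)" "y = (y - x) + x" by (auto simp: oc_def)
  then show "y \<in> carrier O_ring #>\<^bsub>add_monoid K_ring\<^esub> x" unfolding r_coset_def by auto
qed (auto simp: r_coset_def oc_def)

lemma carrier_K_mod_O: "carrier K_mod_O = range oc"
  unfolding K_mod_O_def FactGroup_def RCOSETS_def r_coset_oc by auto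

lemma mult_K_mod_O: "oc x \<otimes>\<^bsub>K_mod_O\<^esub> oc y = oc (x + y)"
proof -
  have "oc x <#>\<^bsub>add_monoid K_ring\<^esub> oc y = oc (x + y)"
  proof (intro equalityI subsetI)
    fix z assume "z \<in> oc x <#>\<^bsub>add_monoid K_ring\<^esub> oc y"
    then obtain a b where ab: "algebraic_int (a - x)" "algebraic_int (b - y)" "z = a + b"
      by (auto simp: set_mult_def oc_def)
    have "z - (x + y) = (a - x) + (b - y)" by (simp add: ab)
    then show "z \<in> oc (x + y)" using algebraic_int_add[OF ab(1,2)] by (simp only: oc_def mem_Collect_eq)
  next
    fix z assume "z \<in> oc (x + y)"
    then have "z - y \<in> oc x" by (simp add: oc_def algebra_simps)
    moreover have "z = (z - y) + y" by simp
    ultimately show "z \<in> oc x <#>\<^bsub>add_monoid K_ring\<^esub> oc y" using oc_self[of y] by (force simp: set_mult_def)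
  qed
  then show ?thesis by (simp add: K_mod_O_def FactGroup_def)
qed

lemma coset_smult_oc:
  assumes a: "algebraic_int a"
  shows "coset_smult K_ring (carrier O_ring) a (oc x) = oc (a * x)"
proof -
  have "carrier O_ring +>\<^bsub>K_ring\<^esub> (a \<otimes>\<^bsub>K_ring\<^esub> y) = oc (a * x)" if "y \<in> oc x" for y
  proof -
    have "algebraic_int (a * (y - x))" using algebraic_int_mult[OF a, of "y - x"] that by (simp add: oc_def)
    then have "oc (a * y) = oc (a * x)" unfolding oc_eq_iff by (simp add: algebra_simps)
    then show ?thesis unfolding a_r_coset_def r_coset_oc by simp
  qed
  then show ?thesis unfolding coset_smult_def using oc_self[of x] by blast
qed

definition Ig :: "'k fin_adele \<Rightarrow> 'k set" where
  "Ig g = {k. jf k \<in> GO g}"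

text \<open>The graph of multiplication by \<open>w \<in> g O_hat\<close> as a map from \<open>K/O\<close> to \<open>A_f / g O_hat = K / (K \<inter> g O_hat)\<close>.\<close>

definition mrel :: "'k fin_adele \<Rightarrow> 'k fin_adele \<Rightarrow> 'k \<Rightarrow> 'k \<Rightarrow> bool" where
  "mrel g w x k \<longleftrightarrow> jf k -\<^sub>f w *\<^sub>f jf x \<in> GO g"

text \<open>The value at a class is the set of all admissible \<open>s k\<close> and not the coset
  of one of them, so that no representative has to be chosen; by \<open>klat_coset\<close> it is a
  coset of the lattice.\<close>

definition klat :: "'k inf_adele \<Rightarrow> 'k fin_adele \<Rightarrow> 'k fin_adele \<Rightarrow> 'k lattice" where
  "klat s g w = (LT s (Ig g), \<lambda>E\<in>carrier K_mod_O. {s *\<^sub>i di k | k. \<exists>x\<in>E. mrel g w x k})"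

lemma fractional_Ig:
  assumes g: "g \<in> Units AF"
  shows "fractional (Ig g)"
  unfolding fractional_def
proof (intro conjI ballI allI impI)
  have gc: "g \<in> carrier AF" using g by simp
  show "x + y \<in> Ig g" if "x \<in> Ig g" "y \<in> Ig g" for x y using that by (simp add: Ig_def jf_hom GO_add)
  show "a * x \<in> Ig g" if "x \<in> Ig g" "algebraic_int a" for x a
    using that GO_mult_int[OF that(2) _ gc] by (simp add: Ig_def jf_hom)
  show "\<exists>N>0. of_nat N \<in> Ig g"
    using Units_denominators(1)[OF g] by (metis Ig_def algebraic_int_1 mem_Collect_eq mult.right_neutral)
  show "\<exists>N>0. \<forall>x\<in>Ig g. algebraic_int (of_nat N * x)" using Units_denominators(2)[OF g] by (auto simp: Ig_def)
qed

text \<open>The identification of \<open>A_f / g O_hat\<close> with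
  \<open>K / (K \<inter> g O_hat)\<close> rests on this: strong approximation supplies a
  representative in \<open>K\<close>.\<close>

lemma mrel_exists:
  assumes "g \<in> Units AF" "w \<in> carrier AF"
  shows "\<exists>k. mrel g w x k"
proof -
  obtain k where "w *\<^sub>f jf x -\<^sub>f jf k \<in> GO g" using adele_approximation[of "w *\<^sub>f jf x" g] assms by auto
  from GO_minus[OF this] have "jf k -\<^sub>f w *\<^sub>f jf x \<in> GO g"
    using assms by (simp add: a_minus_def AF.minus_add AF.minus_minus AF.a_comm)
  then show ?thesis by (auto simp: mrel_def)
qed

lemma mrel_add:
  assumes "w \<in> carrier AF" "mrel g w x k" "mrel g w y l"
  shows "mrel g w (x + y) (k + l)"
proof -
  have "jf (k + l) -\<^sub>f w *\<^sub>f jf (x + y) = (jf k -\<^sub>f w *\<^sub>f jf x) +\<^sub>f (jf l -\<^sub>f w *\<^sub>f jf y)"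
    using assms(1) by (simp add: jf_hom a_minus_def AF.r_distr AF.minus_add AF.a_ac)
  then show ?thesis using GO_add assms(2,3) by (simp add: mrel_def)
qed

lemma mrel_mult:
  assumes "w \<in> carrier AF" "g \<in> carrier AF" "mrel g w x k" "algebraic_int a"
  shows "mrel g w (a * x) (a * k)"
proof -
  have "jf (a * k) -\<^sub>f w *\<^sub>f jf (a * x) = jf a *\<^sub>f (jf k -\<^sub>f w *\<^sub>f jf x)"
    using assms(1) by (simp add: jf_hom a_minus_def AF.r_distr AF.r_minus AF.m_lcomm)
  then show ?thesis using GO_mult_int[OF assms(4) _ assms(2)] assms(3) by (simp add: mrel_def)
qed

lemma mrel_int:
  assumes g: "g \<in> carrier AF" and w: "w \<in> GO g" and a: "algebraic_int a"
  shows "mrel g w a 0"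
  using GO_minus[OF GO_mult_int[OF a w g]] GO_sub[OF w]
  by (simp add: mrel_def jf_zero a_minus_def AF.m_comm)

lemma mrel_unique:
  assumes "w \<in> carrier AF" "g \<in> carrier AF" "mrel g w x k"
  shows "mrel g w x l \<longleftrightarrow> l - k \<in> Ig g"
proof
  assume "mrel g w x l"
  moreover have "jf (l - k) = (jf l -\<^sub>f w *\<^sub>f jf x) -\<^sub>f (jf k -\<^sub>f w *\<^sub>f jf x)"
    using assms(1) by (simp add: jf_diff a_minus_def AF.minus_add AF.minus_minus AF.a_assoc AF.r_neg AF.r_neg1 AF.r_neg2 AF.a_comm AF.a_lcomm)
  ultimately show "l - k \<in> Ig g" using GO_diff assms(3) by (simp add: Ig_def mrel_def)
next
  assume "l - k \<in> Ig g"
  moreover have "jf l -\<^sub>f w *\<^sub>f jf x = jf (l - k) +\<^sub>f (jf k -\<^sub>f w *\<^sub>f jf x)"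
    using assms(1) by (simp add: jf_diff flip: AF_diff_trans)
  ultimately show "mrel g w x l" using GO_add assms(3) by (simp add: Ig_def mrel_def)
qed

lemma mrel_oc:
  assumes g: "g \<in> carrier AF" and w: "w \<in> GO g" and "y \<in> oc x" "mrel g w y k"
  shows "mrel g w x k"
proof -
  have "mrel g w (x - y) 0"
    using mrel_int[OF g w, of "x - y"] assms(3) algebraic_int_diff[of 0 "y - x"] by (simp add: oc_def)
  from mrel_add[OF GO_sub[OF w] this assms(4)] show ?thesis by simp
qed

context
  fixes s g w
  assumes s: "s \<in> Units KI" and g: "g \<in> Units AF" and w: "w \<in> GO g"
begin

lemma klat_oc: "snd (klat s g w) (oc x) = {s *\<^sub>i di k | k. mrel g w x k}"
proof -
  have "(\<exists>y\<in>oc x. mrel g w y k) \<longleftrightarrow> mrel g w x k" for k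
    using mrel_oc[OF Units_AF_in[OF g] w] oc_self by blast
  then show ?thesis by (simp add: klat_def carrier_K_mod_O)
qed

lemma subgroup_klat: "subgroup (LT s (Ig g)) (add_monoid KI)"
  by (rule subgroup_LT[OF s fractionalD(3)[OF fractional_Ig[OF g]] fractionalD(5)[OF fractional_Ig[OF g]]])

lemma klat_coset:
  assumes k: "mrel g w x k"
  shows "snd (klat s g w) (oc x) = LT s (Ig g) +>\<^sub>i (s *\<^sub>i di k)"
proof -
  note iff = mrel_unique[OF GO_sub[OF w] Units_AF_in[OF g] k]
  have "s *\<^sub>i di l \<in> LT s (Ig g) +>\<^sub>i (s *\<^sub>i di k)" if "mrel g w x l" for l
  proof -
    have "s *\<^sub>i di l = s *\<^sub>i di (l - k) +\<^sub>i s *\<^sub>i di k" using LT_add[OF s] by simp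
    moreover have "s *\<^sub>i di (l - k) \<in> LT s (Ig g)" using that iff by (simp add: LT_def)
    ultimately show ?thesis unfolding a_r_coset_def' by blast
  qed
  moreover have "\<exists>m. y = s *\<^sub>i di m \<and> mrel g w x m" if y: "y \<in> LT s (Ig g) +>\<^sub>i (s *\<^sub>i di k)" for y
  proof -
    obtain l where l: "l \<in> Ig g" "y = s *\<^sub>i di l +\<^sub>i s *\<^sub>i di k"
      using y unfolding a_r_coset_def' LT_def by auto
    then have "y = s *\<^sub>i di (l + k)" using LT_add[OF s] by simp
    moreover have "mrel g w x (l + k)" using iff l by simp
    ultimately show ?thesis by blast
  qed
  ultimately show ?thesis unfolding klat_oc by blast
qed

lemma Units_mult_LT: "algebraic_int a \<Longrightarrow> x \<in> LT s (Ig g) \<Longrightarrow> di a *\<^sub>i x \<in> LT s (Ig g)"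
proof -
  assume a: "algebraic_int a" and x: "x \<in> LT s (Ig g)"
  then obtain k where k: "k \<in> Ig g" "x = s *\<^sub>i di k" by (auto simp: LT_def)
  have "di a *\<^sub>i x = s *\<^sub>i di (a * k)" using s by (simp add: k di_hom KI.m_lcomm)
  then show ?thesis using fractionalD(2)[OF fractional_Ig[OF g] k(1) a] by (simp add: LT_def)
qed

lemma coset_smult_klat:
  "algebraic_int a \<Longrightarrow> coset_smult KI (LT s (Ig g)) (di a) (LT s (Ig g) +>\<^sub>i (s *\<^sub>i di k)) = LT s (Ig g) +>\<^sub>i (s *\<^sub>i di (a * k))"
proof -
  assume a: "algebraic_int a"
  have "di a *\<^sub>i (s *\<^sub>i di k) = s *\<^sub>i di (a * k)" using s by (simp add: di_hom KI.m_lcomm)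
  then show ?thesis
    using KI.coset_smult_coset[OF subgroup_klat di_in Units_mult_LT[OF a], of "s *\<^sub>i di k"] s by simp
qed

text \<open>Every \<open>s k\<close> is a multiple over \<open>K\<close> of a lattice element
  \<open>s N\<close>.\<close>

lemma K_span_LT: "K_span (LT s (Ig g)) = LT s UNIV"
  unfolding K_span_def
proof (rule set_span_eqI)
  show "subgroup (LT s UNIV) (add_monoid KI)" by (rule subgroup_LT[OF s]) auto
next
  fix a x assume "a \<in> range di" "x \<in> LT s (Ig g)"
  then obtain b k where "a = di b" "x = s *\<^sub>i di k" by (auto simp: LT_def)
  then have "a *\<^sub>i x = s *\<^sub>i di (b * k)" using s by (simp add: di_hom KI.m_lcomm)
  then show "a *\<^sub>i x \<in> LT s UNIV" by (simp add: LT_def)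
next
  fix y assume "y \<in> LT s UNIV"
  then obtain k where k: "y = s *\<^sub>i di k" by (auto simp: LT_def)
  obtain N where N: "N > 0" "of_nat N \<in> Ig g" using fractional_Ig[OF g] unfolding fractional_def by blast
  have "y = s *\<^sub>i di (k / of_nat N * of_nat N)" using N by (simp add: k)
  also have "\<dots> = di (k / of_nat N) *\<^sub>i (s *\<^sub>i di (of_nat N))" unfolding di_hom(1) using s by (simp add: KI.m_lcomm)
  finally show "\<exists>a\<in>range di. \<exists>x\<in>LT s (Ig g). y = a *\<^sub>i x" using N(2) unfolding LT_def by blast
qed

lemma carrier_KL_mod_L: "carrier (KL_mod_L (LT s (Ig g))) = {LT s (Ig g) +>\<^sub>i (s *\<^sub>i di k) | k. True}"
  unfolding KL_mod_L_def FactGroup_def RCOSETS_def K_span_LT a_r_coset_def r_coset_def by (auto simp: LT_def)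

text \<open>Additivity and linearity of the map are inherited from \<open>mrel\<close>, evaluated at
  representatives of the classes.\<close>

lemma klat_in: "klat s g w \<in> K_lattices"
proof -
  let ?L = "LT s (Ig g)" and ?\<phi> = "snd (klat s g w)"
  have ex: "\<exists>k. mrel g w x k" for x by (rule mrel_exists[OF g GO_sub[OF w]])
  have "?\<phi> \<in> hom K_mod_O (KL_mod_L ?L)"
  proof (rule homI)
    fix E :: "'k set" assume "E \<in> carrier K_mod_O"
    then obtain x where x: "E = oc x" by (auto simp: carrier_K_mod_O)
    obtain k where "mrel g w x k" using ex by blast
    then show "?\<phi> E \<in> carrier (KL_mod_L ?L)" unfolding carrier_KL_mod_L x using klat_coset by blast
  next
    fix E F :: "'k set" assume "E \<in> carrier K_mod_O" "F \<in> carrier K_mod_O"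
    then obtain x y where xy: "E = oc x" "F = oc y" by (auto simp: carrier_K_mod_O)
    obtain k l where kl: "mrel g w x k" "mrel g w y l" using ex by meson
    have "?\<phi> E \<otimes>\<^bsub>KL_mod_L ?L\<^esub> ?\<phi> F = ?\<phi> E <+>\<^sub>i ?\<phi> F"
      by (simp add: KL_mod_L_def FactGroup_def set_add_def set_mult_def)
    also have "\<dots> = ?L +>\<^sub>i (s *\<^sub>i di (k + l))"
      unfolding xy klat_coset[OF kl(1)] klat_coset[OF kl(2)] LT_add[OF s, symmetric]
      using s by (intro KI.a_coset_add[OF subgroup_klat]) auto
    also have "\<dots> = ?\<phi> (E \<otimes>\<^bsub>K_mod_O\<^esub> F)"
      unfolding xy mult_K_mod_O by (rule klat_coset[OF mrel_add[OF GO_sub[OF w] kl], symmetric])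
    finally show "?\<phi> (E \<otimes>\<^bsub>K_mod_O\<^esub> F) = ?\<phi> E \<otimes>\<^bsub>KL_mod_L ?L\<^esub> ?\<phi> F" ..
  qed
  moreover have "?\<phi> (coset_smult K_ring (carrier O_ring) a E) = coset_smult KI ?L (di a) (?\<phi> E)"
    if a: "a \<in> carrier O_ring" and E: "E \<in> carrier K_mod_O" for a and E :: "'k set"
  proof -
    obtain x where x: "E = oc x" using E by (auto simp: carrier_K_mod_O)
    obtain k where k: "mrel g w x k" using ex by blast
    have ai: "algebraic_int a" using a by simp
    show ?thesis
      unfolding x coset_smult_oc[OF ai] klat_coset[OF k] coset_smult_klat[OF ai]
      by (rule klat_coset[OF mrel_mult[OF GO_sub[OF w] Units_AF_in[OF g] k ai]])
  qed
  moreover have "O_lattice ?L" by (rule O_lattice_LT[OF s fractional_Ig[OF g]])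
  moreover have "?\<phi> \<in> extensional (carrier K_mod_O)" by (simp add: klat_def)
  moreover have "klat s g w = (?L, ?\<phi>)" by (simp add: klat_def)
  ultimately show ?thesis unfolding K_lattices_def by auto
qed

end

lemma K_lattice_eq_klat:
  assumes P: "P \<in> K_lattices"
  shows "\<exists>s\<in>Units KI. \<exists>g\<in>Units AF. \<exists>w\<in>GO g. P = klat s g w"
proof -
  obtain L \<phi> where P': "P = (L, \<phi>)" by (cases P)
  have L: "O_lattice L" and ext: "\<phi> \<in> extensional (carrier K_mod_O)" and hom: "\<phi> \<in> hom K_mod_O (KL_mod_L L)"
    and lin: "\<And>a E. algebraic_int a \<Longrightarrow> E \<in> carrier K_mod_O \<Longrightarrow>
        \<phi> (coset_smult K_ring (carrier O_ring) a E) = coset_smult KI L (di a) (\<phi> E)"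
    using P unfolding P' K_lattices_def by auto
  obtain l I where l: "l \<in> Units KI" and I: "fractional I" "1 \<in> I" and LI: "L = LT l I"
    using O_lattice_eq_LT[OF L] by blast
  obtain N0 where N0: "N0 > 0" "\<And>x. x \<in> I \<Longrightarrow> algebraic_int (of_nat N0 * x)" using I(1) unfolding fractional_def by blast
  obtain g where g: "g \<in> Units AF" and "I = {k. jf k \<in> GO g}"
    using fractional_ideal_idele[OF fractionalD(1)[OF I(1)] fractionalD(2)[OF I(1)] I(2) N0] by blast
  then have Ig: "I = Ig g" by (simp add: Ig_def)
  note gc = Units_AF_in[OF g]
  have z: "\<zero>\<^sub>f \<in> GO g" by (rule GO_zero[OF gc])
  have sg: "subgroup L (add_monoid KI)" unfolding LI Ig by (rule subgroup_klat[OF l g z])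
  \<comment> \<open>By linearity the values on the classes of \<open>1 / N\<close> determine
    \<open>\<phi>\<close>, because every element of \<open>K\<close> is some \<open>c / N\<close>
    with \<open>c\<close> integral.\<close>
  have "\<exists>b. \<phi> (oc (1 / of_nat N)) = L +>\<^sub>i (l *\<^sub>i di b)" for N :: nat
  proof -
    have "\<phi> (oc (1 / of_nat N)) \<in> carrier (KL_mod_L L)" by (rule hom_in_carrier[OF hom]) (simp add: carrier_K_mod_O)
    then show ?thesis unfolding LI Ig carrier_KL_mod_L[OF l g z] by blast
  qed
  then obtain b where b: "\<And>N. \<phi> (oc (1 / of_nat N)) = L +>\<^sub>i (l *\<^sub>i di (b N))" by metis
  have phi: "\<phi> (oc (c / of_nat N)) = L +>\<^sub>i (l *\<^sub>i di (c * b N))" if c: "algebraic_int c" for c N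
  proof -
    have "\<phi> (oc (c * (1 / of_nat N))) = coset_smult KI L (di c) (\<phi> (oc (1 / of_nat N)))"
      using lin[OF c, of "oc (1 / of_nat N)"] coset_smult_oc[OF c] by (simp add: carrier_K_mod_O)
    also have "\<dots> = L +>\<^sub>i (l *\<^sub>i di (c * b N))"
      unfolding b LI Ig by (rule coset_smult_klat[OF l g z c])
    finally show ?thesis by simp
  qed
  \<comment> \<open>Equality of cosets of \<open>L\<close> becomes congruence in \<open>K\<close>
    modulo \<open>K \<inter> g O_hat\<close>.\<close>
  have cos: "x - y \<in> Ig g" if "L +>\<^sub>i (l *\<^sub>i di x) = L +>\<^sub>i (l *\<^sub>i di y)" for x y
  proof -
    have "l *\<^sub>i di x -\<^sub>i l *\<^sub>i di y \<in> L" using that a_coset_eq_iff[OF sg] l by simp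
    then show ?thesis unfolding LT_diff[OF l] LI LT_mem_iff[OF l] Ig .
  qed
  \<comment> \<open>If \<open>\<phi>\<close> is to be multiplication by \<open>w\<close>, then
    \<open>b N\<close> must be congruent to \<open>w / N\<close> modulo \<open>g O_hat\<close>, so
    \<open>N * b N\<close> is congruent to \<open>w\<close> modulo \<open>N g O_hat\<close>.\<close>
  define a where "a N = of_nat N * b N" for N
  have "jf (a N) \<in> GO g" if "N > 0" for N
  proof -
    have "oc (of_nat N / of_nat N) = oc (0 / of_nat N)" unfolding oc_eq_iff using that by simp
    then have "L +>\<^sub>i (l *\<^sub>i di (of_nat N * b N)) = L +>\<^sub>i (l *\<^sub>i di (0 * b N))"
      using phi[of "of_nat N" N] phi[of 0 N] by simp
    from cos[OF this] show ?thesis by (simp add: Ig_def a_def)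
  qed
  moreover have "jf (a (N * M) - a N) \<in> GO (jf (of_nat N) *\<^sub>f g)" if "N > 0" "M > 0" for N M
  proof -
    have "of_nat M / of_nat (N * M) = (1 / of_nat N :: 'k)" using that by simp
    then have "L +>\<^sub>i (l *\<^sub>i di (of_nat M * b (N * M))) = L +>\<^sub>i (l *\<^sub>i di (b N))"
      using phi[of "of_nat M" "N * M"] b[of N] by simp
    from cos[OF this] have "jf (of_nat M * b (N * M) - b N) \<in> GO g" by (simp add: Ig_def)
    from GO_mult[OF GO_self[OF jf_in] this jf_in gc, of "of_nat N"] show ?thesis
      by (simp add: a_def algebra_simps flip: jf_hom)
  qed
  ultimately obtain w where w: "w \<in> GO g" "\<And>N. N > 0 \<Longrightarrow> w -\<^sub>f jf (a N) \<in> GO (jf (of_nat N) *\<^sub>f g)"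
    using adele_completeness[OF gc] by metis
  note wc = GO_sub[OF w(1)]
  have "\<phi> (oc x) = snd (klat l g w) (oc x)" for x
  proof -
    obtain N where N: "N > 0" "algebraic_int (of_nat N * x)" using exists_nat_mult_algebraic_int by blast
    let ?c = "of_nat N * x"
    have x: "x = ?c / of_nat N" using N by simp
    \<comment> \<open>The discrepancy is \<open>x\<close> times an element of
      \<open>N g O_hat\<close>, and \<open>N * x\<close> is integral.\<close>
    have 1: "jf (?c * b N) -\<^sub>f w *\<^sub>f jf x = jf x *\<^sub>f (jf (a N) -\<^sub>f w)"
      using wc by (simp add: a_def a_minus_def jf_hom AF.r_distr AF.r_minus AF.m_ac)
    have 2: "jf (a N) -\<^sub>f w = \<ominus>\<^bsub>AF\<^esub> (w -\<^sub>f jf (a N))"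
      using wc by (simp add: a_minus_def AF.minus_add AF.a_comm)
    have 3: "jf x = jf ?c *\<^sub>f jf (1 / of_nat N)" using N by (simp flip: jf_hom)
    have eq: "jf (?c * b N) -\<^sub>f w *\<^sub>f jf x = jf ?c *\<^sub>f (jf (1 / of_nat N) *\<^sub>f (\<ominus>\<^bsub>AF\<^esub> (w -\<^sub>f jf (a N))))"
      unfolding 1 2 by (subst 3) (use wc in \<open>simp add: AF.m_assoc\<close>)
    have "jf (1 / of_nat N) *\<^sub>f (jf (of_nat N) *\<^sub>f g) = jf (1 / of_nat N * of_nat N) *\<^sub>f g"
      unfolding jf_hom(1) using gc by (simp add: AF.m_assoc)
    also have "\<dots> = g" using N gc by (simp add: jf_hom)
    finally have "jf (1 / of_nat N) *\<^sub>f (\<ominus>\<^bsub>AF\<^esub> (w -\<^sub>f jf (a N))) \<in> GO g"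
      using GO_mult[OF GO_self[OF jf_in] GO_minus[OF w(2)[OF N(1)]] jf_in, of "1 / of_nat N"] gc by simp
    from GO_mult_int[OF N(2) this gc] have "mrel g w x (?c * b N)" unfolding mrel_def eq .
    from klat_coset[OF l g w(1) this] show ?thesis using phi[OF N(2), of N] x LI Ig by simp
  qed
  then have "\<phi> = snd (klat l g w)"
    using ext by (intro extensionalityI[of _ "carrier K_mod_O"]) (auto simp: klat_def carrier_K_mod_O)
  then have "P = klat l g w" unfolding P' by (simp add: klat_def LI Ig)
  then show ?thesis using l g w(1) by blast
qed

section \<open>Commensurability and uniqueness of the parameters\<close>

lemma GO_common:
  assumes g: "g \<in> Units AF" and g': "g' \<in> Units AF"
  shows "\<exists>h\<in>Units AF. \<forall>v\<in>finite_places. fnorm v h \<le> fnorm v g \<and> fnorm v h \<le> fnorm v g'"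
proof -
  obtain N where N: "N > 0" "jf (of_nat N) \<in> GO g" using Units_denominators(1)[OF g] by (metis algebraic_int_1 mult.right_neutral)
  obtain N' where N': "N' > 0" "jf (of_nat N') \<in> GO g'" using Units_denominators(1)[OF g'] by (metis algebraic_int_1 mult.right_neutral)
  have "fnorm v (jf (of_nat (N * N'))) \<le> fnorm v g \<and> fnorm v (jf (of_nat (N * N'))) \<le> fnorm v g'" if v: "v \<in> finite_places" for v
  proof -
    interpret abs_value v by (rule finite_place_abs_value[OF v])
    have "v (of_nat N) \<le> 1" "v (of_nat N') \<le> 1" using finite_place_int_le_1[OF v] by auto
    then have "v (of_nat N) * v (of_nat N') \<le> v (of_nat N)" "v (of_nat N) * v (of_nat N') \<le> v (of_nat N')"
      using nonneg[of "of_nat N"] nonneg[of "of_nat N'"] mult_left_le[of "v (of_nat N')" "v (of_nat N)"]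
        mult_left_le[of "v (of_nat N)" "v (of_nat N')"] by (auto simp: mult.commute)
    moreover have "v (of_nat N) \<le> fnorm v g" "v (of_nat N') \<le> fnorm v g'"
      using N(2) N'(2) v by (auto simp: GO_def fnorm_jf)
    ultimately show ?thesis unfolding fnorm_jf[OF v] by (simp add: mult)
  qed
  moreover have "jf (of_nat (N * N')) \<in> Units AF" using N(1) N'(1) by (intro jf_Units) simp
  ultimately show ?thesis by blast
qed

text \<open>Inversion turns the common lower bound of two ideles into a common upper bound.\<close>

lemma GO_common_bound:
  assumes g: "g \<in> Units AF" and g': "g' \<in> Units AF"
  shows "\<exists>h\<in>Units AF. GO g \<subseteq> GO h \<and> GO g' \<subseteq> GO h"
proof -
  obtain h where h: "h \<in> Units AF"
      "\<forall>v\<in>finite_places. fnorm v h \<le> fnorm v (inv\<^sub>f g) \<and> fnorm v h \<le> fnorm v (inv\<^sub>f g')"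
    using GO_common[OF AF.Units_inv_Units[OF g] AF.Units_inv_Units[OF g']] by blast
  have "fnorm v g \<le> fnorm v (inv\<^sub>f h) \<and> fnorm v g' \<le> fnorm v (inv\<^sub>f h)" if v: "v \<in> finite_places" for v
  proof -
    have "0 < fnorm v h" "fnorm v h \<le> inverse (fnorm v g)" "fnorm v h \<le> inverse (fnorm v g')" "0 < fnorm v g" "0 < fnorm v g'"
      using h v fnorm_pos[OF _ v] fnorm_inv[OF _ v] g g' by auto
    then show ?thesis unfolding fnorm_inv[OF h(1) v] by (metis inverse_inverse_eq le_imp_inverse_le)
  qed
  then have "GO g \<subseteq> GO (inv\<^sub>f h) \<and> GO g' \<subseteq> GO (inv\<^sub>f h)" by (force simp: GO_def)
  then show ?thesis using h(1) by blast
qed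

text \<open>By strong approximation every element of \<open>g O_hat\<close> differs from an element
  of \<open>K\<close> by something that lies in both \<open>g O_hat\<close> and
  \<open>g' O_hat\<close>; so membership is decided in \<open>K\<close>.\<close>

lemma GO_eq_of_Ig_eq:
  assumes g: "g \<in> Units AF" and g': "g' \<in> Units AF" and eq: "Ig g = Ig g'"
  shows "GO g = GO g'"
proof -
  have "GO g \<subseteq> GO g'" if g: "g \<in> Units AF" and g': "g' \<in> Units AF" and eq: "Ig g = Ig g'" for g g'
  proof
    fix x assume x: "x \<in> GO g"
    note xc = GO_sub[OF x]
    obtain h where h: "h \<in> Units AF" "\<forall>v\<in>finite_places. fnorm v h \<le> fnorm v g \<and> fnorm v h \<le> fnorm v g'"
      using GO_common[OF g g'] by blast
    obtain k where "x -\<^sub>f jf k \<in> GO h" using adele_approximation[OF xc h(1)] by blast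
    then have k: "x -\<^sub>f jf k \<in> GO g" "x -\<^sub>f jf k \<in> GO g'" using h(2) by (force simp: GO_def)+
    have "jf k = x -\<^sub>f (x -\<^sub>f jf k)" using xc by (simp add: a_minus_def AF.minus_add AF.minus_minus AF.r_neg2)
    then have "jf k \<in> GO g" using GO_diff[OF x k(1)] by simp
    then have "jf k \<in> GO g'" using eq by (auto simp: Ig_def)
    moreover have "x = (x -\<^sub>f jf k) +\<^sub>f jf k" using xc by (simp add: a_minus_def AF.a_assoc AF.l_neg)
    ultimately show "x \<in> GO g'" using GO_add[OF k(2)] by metis
  qed
  from this[OF g g' eq] this[OF g' g eq[symmetric]] show ?thesis by blast
qed

lemma rcosets_KI: "rcosets\<^bsub>(add_monoid KI)\<lparr>carrier := L\<rparr>\<^esub> J = (\<lambda>x. J +>\<^sub>i x) ` L"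
  by (simp add: RCOSETS_def a_r_coset_def r_coset_def UNION_singleton_eq_range)

lemma LT_Int: "s \<in> Units KI \<Longrightarrow> LT s I \<inter> LT s J = LT s (I \<inter> J)"
  by (auto simp: LT_def KI.Units_l_cancel di_eq_iff)

text \<open>If \<open>M\<close> clears the denominators of \<open>I\<close> and
  \<open>N \<in> J\<close>, then elements \<open>x\<close> and \<open>y\<close> of \<open>I\<close>
  with \<open>M x\<close> and \<open>M y\<close> congruent modulo \<open>M N\<close> differ by an
  element of \<open>N O\<close>, hence of \<open>J\<close>.\<close>

lemma finite_rcosets_LT:
  assumes s: "s \<in> Units KI" and I: "fractional I" and J: "fractional J"
  shows "finite (rcosets\<^bsub>(add_monoid KI)\<lparr>carrier := LT s I\<rparr>\<^esub> (LT s I \<inter> LT s J))"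
proof -
  obtain M where M: "M > 0" "\<And>x. x \<in> I \<Longrightarrow> algebraic_int (of_nat M * x)" using I unfolding fractional_def by blast
  obtain N where N: "N > 0" "of_nat N \<in> J" using J unfolding fractional_def by blast
  have sg: "subgroup (LT s (I \<inter> J)) (add_monoid KI)"
    by (rule subgroup_LT[OF s]) (use fractionalD(3,5)[OF I] fractionalD(3,5)[OF J] in auto)
  obtain T where T: "finite T" "\<forall>b. algebraic_int b \<longrightarrow> (\<exists>t\<in>T. algebraic_int ((b - t) / (of_nat (M * N) :: 'k)))"
    using finite_index[of "of_nat (M * N)"] algebraic_int_of_nat M(1) N(1) by (metis mult_eq_0_iff not_less_zero of_nat_eq_0_iff)
  have "\<forall>x\<in>I. \<exists>t\<in>T. algebraic_int ((of_nat M * x - t) / of_nat (M * N))" using T(2) M(2) by blast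
  then obtain t where t: "\<And>x. x \<in> I \<Longrightarrow> t x \<in> T \<and> algebraic_int ((of_nat M * x - t x) / of_nat (M * N))" by metis
  let ?f = "\<lambda>x. LT s (I \<inter> J) +>\<^sub>i (s *\<^sub>i di x)"
  have eq: "?f x = ?f y" if xy: "x \<in> I" "y \<in> I" "t x = t y" for x y
  proof -
    have "algebraic_int ((of_nat M * x - t x) / of_nat (M * N) - (of_nat M * y - t y) / of_nat (M * N))"
      using t xy by (blast intro: algebraic_int_diff)
    moreover have "x - y = ((of_nat M * x - t x) / of_nat (M * N) - (of_nat M * y - t y) / of_nat (M * N)) * of_nat N"
      using M(1) N(1) xy(3) by (simp add: field_simps)
    ultimately have "x - y \<in> J" using fractionalD(2)[OF J N(2)] by metis
    then have "s *\<^sub>i di x -\<^sub>i s *\<^sub>i di y \<in> LT s (I \<inter> J)"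
      unfolding LT_diff[OF s] LT_mem_iff[OF s] using fractionalD(5)[OF I xy(1,2)] by simp
    then show ?thesis using a_coset_eq_iff[OF sg] s by simp
  qed
  \<comment> \<open>The cosets are indexed by the finitely many values of \<open>t\<close>;
    \<open>inv_into\<close> selects an element of \<open>I\<close> for each value.\<close>
  have "?f x \<in> (\<lambda>u. ?f (inv_into I t u)) ` (t ` I)" if x: "x \<in> I" for x
  proof -
    have i: "t x \<in> t ` I" using x by blast
    have "?f x = ?f (inv_into I t (t x))" by (rule eq[OF x inv_into_into[OF i] f_inv_into_f[OF i, symmetric]])
    then show ?thesis using i by blast
  qed
  moreover have "finite (t ` I)" using T(1) t by (meson finite_subset image_subsetI)
  ultimately have "finite (?f ` I)" by (meson finite_imageI finite_subset image_subsetI)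
  then show ?thesis unfolding rcosets_KI LT_Int[OF s] by (simp add: LT_def image_image)
qed

text \<open>Among the multiples of one nonzero vector of the first lattice two agree modulo the
  intersection. This gives a common nonzero vector \<open>s m = s' l\<close>, and then
  \<open>k = l / m\<close>.\<close>

lemma commensurable_scale:
  assumes s: "s \<in> Units KI" and s': "s' \<in> Units KI" and I: "fractional I" and J: "fractional J"
    and fin: "finite (rcosets\<^bsub>(add_monoid KI)\<lparr>carrier := LT s I\<rparr>\<^esub> (LT s I \<inter> LT s' J))"
  shows "\<exists>k. k \<noteq> 0 \<and> s' = s *\<^sub>i di (1 / k)"
proof -
  let ?D = "LT s I \<inter> LT s' J"
  obtain N where N: "N > 0" "of_nat N \<in> I" using I unfolding fractional_def by blast
  have "subgroup (LT s I) (add_monoid KI)" "subgroup (LT s' J) (add_monoid KI)"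
    using subgroup_LT[OF s fractionalD(3)[OF I] fractionalD(5)[OF I]] subgroup_LT[OF s' fractionalD(3)[OF J] fractionalD(5)[OF J]]
    by auto
  then have sg: "subgroup ?D (add_monoid KI)" by (rule KI.add.subgroups_Inter_pair)
  \<comment> \<open>Multiples of \<open>s N\<close>, which is a lattice vector because the natural
    number \<open>N\<close> is in \<open>I\<close>.\<close>
  define x where "x n = s *\<^sub>i di (of_nat n * of_nat N)" for n :: nat
  have "x n \<in> LT s I" for n unfolding x_def LT_mem_iff[OF s] by (rule fractionalD(2)[OF I N(2) algebraic_int_of_nat])
  then have "range (\<lambda>n. ?D +>\<^sub>i x n) \<subseteq> (\<lambda>x. ?D +>\<^sub>i x) ` LT s I" by blast
  then have "finite (range (\<lambda>n. ?D +>\<^sub>i x n))" using fin unfolding rcosets_KI by (rule finite_subset)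
  then have "\<not> inj (\<lambda>n. ?D +>\<^sub>i x n)" using range_inj_infinite by blast
  then obtain i j where ij: "i < j" "?D +>\<^sub>i x i = ?D +>\<^sub>i x j" unfolding inj_def by (metis linorder_neqE_nat)
  then have "x j -\<^sub>i x i \<in> ?D" using a_coset_eq_iff[OF sg, of "x j" "x i"] s by (simp add: x_def)
  moreover define m where "m = (of_nat j * of_nat N - of_nat i * of_nat N :: 'k)"
  ultimately have "s *\<^sub>i di m \<in> LT s' J" by (simp add: x_def LT_diff[OF s])
  then obtain l where l: "s *\<^sub>i di m = s' *\<^sub>i di l" by (auto simp: LT_def)
  have m: "m \<noteq> 0" using ij(1) N(1) by (simp add: m_def flip: left_diff_distrib)
  have "l \<noteq> 0"
  proof
    assume "l = 0"
    then have "s *\<^sub>i di m = s *\<^sub>i di 0" using l s s' by (simp add: di_hom)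
    then show False using m s by (simp add: KI.Units_l_cancel di_eq_iff)
  qed
  then have "s' = s' *\<^sub>i di (l * (1 / l))" using s' by (simp add: di_hom(3))
  also have "\<dots> = (s' *\<^sub>i di l) *\<^sub>i di (1 / l)" unfolding di_hom(1) using s' by (simp add: KI.m_assoc)
  also have "\<dots> = s *\<^sub>i di (m * (1 / l))" unfolding l[symmetric] di_hom(1) using s by (simp add: KI.m_assoc)
  also have "m * (1 / l) = 1 / (l / m)" using m \<open>l \<noteq> 0\<close> by simp
  finally show ?thesis using m \<open>l \<noteq> 0\<close> by (intro exI[of _ "l / m"]) simp
qed

text \<open>Multiplication by \<open>k\<close> is a bijection of \<open>K\<close> that carries
  \<open>g O_hat\<close> to \<open>k g O_hat\<close>; the factor \<open>1 / k\<close> at the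
  infinite places undoes it.\<close>

lemma klat_reparametrize:
  assumes s: "s \<in> Units KI" and g: "g \<in> carrier AF" and w: "w \<in> carrier AF" and k: "k \<noteq> 0"
  shows "klat (s *\<^sub>i di (1 / k)) (jf k *\<^sub>f g) (jf k *\<^sub>f w) = klat s g w"
proof -
  have GO: "jf k *\<^sub>f y \<in> GO (jf k *\<^sub>f g) \<longleftrightarrow> y \<in> GO g" if y: "y \<in> carrier AF" for y
  proof -
    have "0 < v k" if "v \<in> finite_places" for v using fnorm_pos[OF jf_Units[OF k] that] fnorm_jf[OF that] by simp
    then show ?thesis using y g by (auto simp: GO_def fnorm_simps fnorm_jf)
  qed
  have sm: "s *\<^sub>i di (1 / k) *\<^sub>i di (k * m) = s *\<^sub>i di m" for m
  proof -
    have "s *\<^sub>i di (1 / k) *\<^sub>i di (k * m) = s *\<^sub>i di (1 / k * (k * m))"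
      unfolding di_hom(1)[of "1 / k"] using s by (simp add: KI.m_assoc)
    then show ?thesis using k by simp
  qed
  have Ig: "k * m \<in> Ig (jf k *\<^sub>f g) \<longleftrightarrow> m \<in> Ig g" for m
    using GO[of "jf m"] by (simp add: Ig_def jf_hom)
  have mrel: "mrel (jf k *\<^sub>f g) (jf k *\<^sub>f w) x (k * m) \<longleftrightarrow> mrel g w x m" for x m
  proof -
    have "jf (k * m) -\<^sub>f jf k *\<^sub>f w *\<^sub>f jf x = jf k *\<^sub>f (jf m -\<^sub>f w *\<^sub>f jf x)"
      using w by (simp add: jf_hom a_minus_def AF.r_distr AF.r_minus AF.m_assoc)
    then show ?thesis using GO[of "jf m -\<^sub>f w *\<^sub>f jf x"] w by (simp add: mrel_def)
  qed
  have sur: "\<exists>m'. m = k * m'" for m using k by (intro exI[of _ "m / k"]) simp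
  have "LT (s *\<^sub>i di (1 / k)) (Ig (jf k *\<^sub>f g)) = LT s (Ig g)"
    unfolding LT_def
  proof (intro equalityI subsetI)
    fix y assume "y \<in> (\<lambda>m. s *\<^sub>i di (1 / k) *\<^sub>i di m) ` Ig (jf k *\<^sub>f g)"
    then obtain m0 where m0: "m0 \<in> Ig (jf k *\<^sub>f g)" "y = s *\<^sub>i di (1 / k) *\<^sub>i di m0" by auto
    obtain m where m: "m0 = k * m" using sur by blast
    have "m \<in> Ig g" "y = s *\<^sub>i di m" using m0 unfolding m Ig sm by auto
    then show "y \<in> (\<lambda>m. s *\<^sub>i di m) ` Ig g" by (rule rev_image_eqI)
  next
    fix y assume "y \<in> (\<lambda>m. s *\<^sub>i di m) ` Ig g"
    then obtain m where "m \<in> Ig g" "y = s *\<^sub>i di m" by blast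
    then have "k * m \<in> Ig (jf k *\<^sub>f g)" "y = s *\<^sub>i di (1 / k) *\<^sub>i di (k * m)" unfolding Ig sm .
    then show "y \<in> (\<lambda>m. s *\<^sub>i di (1 / k) *\<^sub>i di m) ` Ig (jf k *\<^sub>f g)" by (rule rev_image_eqI)
  qed
  moreover have "{s *\<^sub>i di (1 / k) *\<^sub>i di m | m. \<exists>x\<in>E. mrel (jf k *\<^sub>f g) (jf k *\<^sub>f w) x m} =
      {s *\<^sub>i di m | m. \<exists>x\<in>E. mrel g w x m}" for E
  proof (intro equalityI subsetI)
    fix y assume "y \<in> {s *\<^sub>i di (1 / k) *\<^sub>i di m | m. \<exists>x\<in>E. mrel (jf k *\<^sub>f g) (jf k *\<^sub>f w) x m}"
    then obtain m0 x where m0: "x \<in> E" "mrel (jf k *\<^sub>f g) (jf k *\<^sub>f w) x m0"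
      "y = s *\<^sub>i di (1 / k) *\<^sub>i di m0" by auto
    obtain m where m: "m0 = k * m" using sur by blast
    show "y \<in> {s *\<^sub>i di m | m. \<exists>x\<in>E. mrel g w x m}" using m0 unfolding m mrel sm by blast
  next
    fix y assume "y \<in> {s *\<^sub>i di m | m. \<exists>x\<in>E. mrel g w x m}"
    then obtain m x where "x \<in> E" "mrel g w x m" "y = s *\<^sub>i di m" by auto
    then have "x \<in> E" "mrel (jf k *\<^sub>f g) (jf k *\<^sub>f w) x (k * m)" "y = s *\<^sub>i di (1 / k) *\<^sub>i di (k * m)"
      by (simp_all add: mrel sm)
    then show "y \<in> {s *\<^sub>i di (1 / k) *\<^sub>i di m | m. \<exists>x\<in>E. mrel (jf k *\<^sub>f g) (jf k *\<^sub>f w) x m}" by blast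
  qed
  ultimately show ?thesis by (simp add: klat_def)
qed

lemma klat_GO_cong: "GO g = GO g' \<Longrightarrow> klat s g w = klat s g' w"
  by (simp add: klat_def Ig_def mrel_def)

text \<open>If \<open>w = w'\<close>, an idele \<open>h\<close> below \<open>g\<close> and
  \<open>g'\<close> yields one \<open>k\<close> that represents both maps at \<open>x\<close>.
  Conversely, evaluation at \<open>1 / N\<close> shows that \<open>(w - w') / N\<close> lies in one
  fixed \<open>h O_hat\<close> for all \<open>N\<close>, so \<open>w - w'\<close> is divisible by
  every positive integer and vanishes.\<close>

lemma commensurable_klat_same_scale:
  assumes s: "s \<in> Units KI" and g: "g \<in> Units AF" and g': "g' \<in> Units AF" and w: "w \<in> GO g" and w': "w' \<in> GO g'"
  shows "commensurable (klat s g w) (klat s g' w') \<longleftrightarrow> w = w'"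
proof -
  let ?L = "LT s (Ig g)" and ?L' = "LT s (Ig g')"
  note sg = subgroup_klat[OF s g w] and sg' = subgroup_klat[OF s g' w']
  note Lc = L_closed[OF sg] and Lc' = L_closed[OF sg']
  note wc = GO_sub[OF w] and wc' = GO_sub[OF w']
  let ?M = "?L <+>\<^sub>i ?L'"
  have M: "?M \<subseteq> carrier KI" using Lc(1) Lc'(1) unfolding set_add_def' by auto
  have LM: "x +\<^sub>i m \<in> ?M" if x: "x \<in> ?L" "m \<in> ?M" for x m
  proof -
    obtain a b where ab: "a \<in> ?L" "b \<in> ?L'" "m = a +\<^sub>i b" using x(2) unfolding set_add_def' by auto
    then have "x +\<^sub>i m = (x +\<^sub>i a) +\<^sub>i b" using Lc(1) Lc'(1) x(1) by (simp add: KI.a_assoc)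
    then show ?thesis using Lc(3)[OF x(1) ab(1)] ab(2) unfolding set_add_def' by blast
  qed
  have LM': "x +\<^sub>i m \<in> ?M" if x: "x \<in> ?L'" "m \<in> ?M" for x m
  proof -
    obtain a b where ab: "a \<in> ?L" "b \<in> ?L'" "m = a +\<^sub>i b" using x(2) unfolding set_add_def' by auto
    then have "x +\<^sub>i m = a +\<^sub>i (x +\<^sub>i b)" using Lc(1) Lc'(1) x(1) by (simp add: KI.a_lcomm)
    then show ?thesis using Lc'(3)[OF x(1) ab(2)] ab(1) unfolding set_add_def' by blast
  qed
  have zM: "\<zero>\<^sub>i \<in> ?M" using Lc(2) Lc'(2) KI.r_zero[OF KI.zero_closed] unfolding set_add_def' by force
  have coset: "snd (klat s g w) (oc x) <+>\<^sub>i ?M = ?M +>\<^sub>i (s *\<^sub>i di k)" if "mrel g w x k" for x k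
    unfolding klat_coset[OF s g w that] by (rule KI.a_coset_absorb[OF Lc(2) _ M LM]) (use Lc(1) s in auto)
  have coset': "snd (klat s g' w') (oc x) <+>\<^sub>i ?M = ?M +>\<^sub>i (s *\<^sub>i di k)" if "mrel g' w' x k" for x k
    unfolding klat_coset[OF s g' w' that] by (rule KI.a_coset_absorb[OF Lc'(2) _ M LM']) (use Lc'(1) s in auto)
  have comm: "commensurable (klat s g w) (klat s g' w') \<longleftrightarrow>
      (\<forall>x. snd (klat s g w) (oc x) <+>\<^sub>i ?M = snd (klat s g' w') (oc x) <+>\<^sub>i ?M)"
  proof -
    have "commensurable_subgroups (add_monoid KI) ?L ?L'"
      unfolding commensurable_subgroups_def
      using finite_rcosets_LT[OF s fractional_Ig[OF g] fractional_Ig[OF g']]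
        finite_rcosets_LT[OF s fractional_Ig[OF g'] fractional_Ig[OF g]] by (simp only: Int_commute simp_thms)
    then show ?thesis unfolding commensurable_def klat_def carrier_K_mod_O by simp
  qed
  show ?thesis
  proof
    assume eq: "w = w'"
    obtain h where h: "h \<in> Units AF" "\<forall>v\<in>finite_places. fnorm v h \<le> fnorm v g \<and> fnorm v h \<le> fnorm v g'"
      using GO_common[OF g g'] by blast
    show "commensurable (klat s g w) (klat s g' w')"
      unfolding comm
    proof
      fix x
      obtain k where "mrel h w x k" using mrel_exists[OF h(1) wc] by blast
      then have "mrel g w x k" "mrel g' w' x k" using h(2) eq by (force simp: mrel_def GO_def)+
      then show "snd (klat s g w) (oc x) <+>\<^sub>i ?M = snd (klat s g' w') (oc x) <+>\<^sub>i ?M"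
        using coset coset' by simp
    qed
  next
    assume "commensurable (klat s g w) (klat s g' w')"
    then have eq: "snd (klat s g w) (oc x) <+>\<^sub>i ?M = snd (klat s g' w') (oc x) <+>\<^sub>i ?M" for x
      unfolding comm by blast
    \<comment> \<open>Here \<open>h\<close> lies above both ideles, so that \<open>h O_hat\<close>
      absorbs the contributions of both lattices.\<close>
    obtain h where h: "h \<in> Units AF" "GO g \<subseteq> GO h" "GO g' \<subseteq> GO h" using GO_common_bound[OF g g'] by blast
    note hc = Units_AF_in[OF h(1)]
    have "w -\<^sub>f w' \<in> GO (jf (of_nat N) *\<^sub>f h)" if N: "N > 0" for N
    proof -
      let ?x = "1 / of_nat N :: 'k"
      obtain k where k: "mrel g w ?x k" using mrel_exists[OF g wc] by blast
      obtain l where l: "mrel g' w' ?x l" using mrel_exists[OF g' wc'] by blast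
      have "s *\<^sub>i di k = \<zero>\<^sub>i +\<^sub>i s *\<^sub>i di k" using s by simp
      then have "s *\<^sub>i di k \<in> ?M +>\<^sub>i (s *\<^sub>i di k)" unfolding a_r_coset_def' using zM by blast
      then have "s *\<^sub>i di k \<in> ?M +>\<^sub>i (s *\<^sub>i di l)" using coset[OF k] coset'[OF l] eq by simp
      then obtain a b where ab: "a \<in> Ig g" "b \<in> Ig g'"
        "s *\<^sub>i di k = (s *\<^sub>i di a +\<^sub>i s *\<^sub>i di b) +\<^sub>i s *\<^sub>i di l"
        unfolding a_r_coset_def' set_add_def' LT_def by auto
      then have "k = a + b + l" using s by (simp add: LT_add[OF s] KI.Units_l_cancel di_eq_iff)
      then have jk: "jf k = (jf a +\<^sub>f jf b) +\<^sub>f jf l" by (simp add: jf_hom)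
      define p q where "p = jf k -\<^sub>f w *\<^sub>f jf ?x" and "q = jf l -\<^sub>f w' *\<^sub>f jf ?x"
      have pq: "p \<in> GO h" "q \<in> GO h" using k l h by (auto simp: mrel_def p_def q_def)
      have ab': "jf a \<in> GO h" "jf b \<in> GO h" using ab h by (auto simp: Ig_def)
      have pqc: "p \<in> carrier AF" "q \<in> carrier AF" using GO_sub pq by auto
      have 1: "w *\<^sub>f jf ?x = jf k -\<^sub>f p" "w' *\<^sub>f jf ?x = jf l -\<^sub>f q"
        using wc wc' by (simp_all add: p_def q_def a_minus_def AF.minus_add AF.minus_minus AF.r_neg2)
      have "jf ?x *\<^sub>f (w -\<^sub>f w') = w *\<^sub>f jf ?x -\<^sub>f w' *\<^sub>f jf ?x"
        using wc wc' AF.m_comm[OF jf_in wc] AF.m_comm[OF jf_in wc'] by (simp add: a_minus_def AF.r_distr AF.r_minus)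
      also have "\<dots> = ((jf a +\<^sub>f jf b) -\<^sub>f p) +\<^sub>f q"
      proof -
        have "d +\<^sub>f u -\<^sub>f p -\<^sub>f (u -\<^sub>f q) = (d -\<^sub>f p) +\<^sub>f q" if du: "d \<in> carrier AF" "u \<in> carrier AF" for d u
        proof -
          have "d +\<^sub>f u -\<^sub>f p -\<^sub>f (u -\<^sub>f q) = d +\<^sub>f (u +\<^sub>f (\<ominus>\<^bsub>AF\<^esub> p +\<^sub>f (\<ominus>\<^bsub>AF\<^esub> u +\<^sub>f q)))"
            using du pqc by (simp add: a_minus_def AF.minus_add AF.minus_minus AF.a_assoc)
          also have "\<ominus>\<^bsub>AF\<^esub> p +\<^sub>f (\<ominus>\<^bsub>AF\<^esub> u +\<^sub>f q) = \<ominus>\<^bsub>AF\<^esub> u +\<^sub>f (\<ominus>\<^bsub>AF\<^esub> p +\<^sub>f q)"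
            using du pqc by (intro AF.a_lcomm) auto
          finally show ?thesis using du pqc by (simp add: a_minus_def AF.r_neg2 AF.a_assoc)
        qed
        then show ?thesis unfolding 1 jk by simp
      qed
      also have "\<dots> \<in> GO h" by (intro GO_add GO_diff ab' pq)
      finally have "jf (of_nat N) *\<^sub>f (jf ?x *\<^sub>f (w -\<^sub>f w')) \<in> GO (jf (of_nat N) *\<^sub>f h)"
        using GO_mult[OF GO_self[OF jf_in] _ jf_in hc] by blast
      moreover have "jf (of_nat N) *\<^sub>f (jf ?x *\<^sub>f (w -\<^sub>f w')) = jf (of_nat N * ?x) *\<^sub>f (w -\<^sub>f w')"
        unfolding jf_hom(1) using wc wc' by (simp add: AF.m_assoc)
      ultimately show ?thesis using N wc wc' by (simp add: jf_hom)
    qed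
    then have "w -\<^sub>f w' = \<zero>\<^sub>f" using divisible_adele_zero[OF _ hc] wc wc' by simp
    then show "w = w'" using wc wc' by (simp add: AF.r_right_minus_eq)
  qed
qed

lemma jf_cancel: "k \<noteq> 0 \<Longrightarrow> x \<in> carrier AF \<Longrightarrow> jf k *\<^sub>f (jf (1 / k) *\<^sub>f x) = x"
  and di_cancel: "k \<noteq> 0 \<Longrightarrow> s \<in> carrier KI \<Longrightarrow> s *\<^sub>i di k *\<^sub>i di (1 / k) = s"
proof -
  assume k: "k \<noteq> 0"
  show "jf k *\<^sub>f (jf (1 / k) *\<^sub>f x) = x" if "x \<in> carrier AF"
  proof -
    have "jf k *\<^sub>f (jf (1 / k) *\<^sub>f x) = jf (k * (1 / k)) *\<^sub>f x" unfolding jf_hom(1) using that by (simp add: AF.m_assoc)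
    then show ?thesis using k that by (simp add: jf_hom(3))
  qed
  show "s *\<^sub>i di k *\<^sub>i di (1 / k) = s" if "s \<in> carrier KI"
  proof -
    have "s *\<^sub>i di k *\<^sub>i di (1 / k) = s *\<^sub>i di (k * (1 / k))" unfolding di_hom(1) using that by (simp add: KI.m_assoc)
    then show ?thesis using k that by (simp add: di_hom(3))
  qed
qed

lemma GO_scale_iff:
  assumes k: "k \<noteq> 0" and g: "g \<in> carrier AF" and x: "x \<in> carrier AF"
  shows "jf k *\<^sub>f x \<in> GO (jf k *\<^sub>f g) \<longleftrightarrow> x \<in> GO g"
proof
  assume "jf k *\<^sub>f x \<in> GO (jf k *\<^sub>f g)"
  from GO_mult[OF GO_self[OF jf_in] this jf_in, of "1 / k"] show "x \<in> GO g"
    using jf_cancel[of "1 / k"] k g x by simp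
qed (use GO_mult[OF GO_self[OF jf_in] _ jf_in g] in blast)

text \<open>Commensurability of the lattices alone forces \<open>s'\<close> to be
  \<open>s / k\<close>. The second \<open>K\<close>-lattice is then rewritten with \<open>s\<close>,
  which reduces the claim to the case of equal scales.\<close>

lemma commensurable_klat_iff:
  assumes s: "s \<in> Units KI" and s': "s' \<in> Units KI" and g: "g \<in> Units AF" and g': "g' \<in> Units AF"
    and w: "w \<in> GO g" and w': "w' \<in> GO g'"
  shows "commensurable (klat s g w) (klat s' g' w') \<longleftrightarrow>
    (\<exists>k. k \<noteq> 0 \<and> s' = s *\<^sub>i di (1 / k) \<and> w' = jf k *\<^sub>f w)"
proof -
  have *: "commensurable (klat s g w) (klat s' g' w') \<longleftrightarrow> w = jf (1 / k) *\<^sub>f w'"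
    if k: "k \<noteq> 0" and eq: "s' = s *\<^sub>i di (1 / k)" for k
  proof -
    have k': "1 / k \<noteq> 0" using k by simp
    have r: "s' *\<^sub>i di (1 / (1 / k)) = s" using di_cancel[OF k', of s] s by (simp add: eq)
    have "klat s' g' w' = klat s (jf (1 / k) *\<^sub>f g') (jf (1 / k) *\<^sub>f w')"
      using klat_reparametrize[OF s' Units_AF_in[OF g'] GO_sub[OF w'] k'] unfolding r by simp
    then show ?thesis
      using commensurable_klat_same_scale[OF s g AF.Units_m_closed[OF jf_Units[OF k'] g'] w]
        GO_scale_iff[OF k' Units_AF_in[OF g'] GO_sub[OF w']] w' by simp
  qed
  have **: "w = jf (1 / k) *\<^sub>f w' \<longleftrightarrow> w' = jf k *\<^sub>f w" if "k \<noteq> 0" for k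
    using jf_cancel[of k w'] jf_cancel[of "1 / k" w] that GO_sub[OF w] GO_sub[OF w'] by auto
  have "\<exists>k. k \<noteq> 0 \<and> s' = s *\<^sub>i di (1 / k)" if "commensurable (klat s g w) (klat s' g' w')"
    using that commensurable_scale[OF s s' fractional_Ig[OF g] fractional_Ig[OF g']]
    by (simp add: commensurable_def klat_def commensurable_subgroups_def)
  then show ?thesis using * ** by blast
qed

text \<open>Equal \<open>K\<close>-lattices are commensurable, which yields \<open>k\<close>; what
  remains is to compare two fractional ideals.\<close>

lemma klat_eq_iff:
  assumes s: "s \<in> Units KI" and s': "s' \<in> Units KI" and g: "g \<in> Units AF" and g': "g' \<in> Units AF"
    and w: "w \<in> GO g" and w': "w' \<in> GO g'"
  shows "klat s g w = klat s' g' w' \<longleftrightarrow>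
    (\<exists>k. k \<noteq> 0 \<and> s' = s *\<^sub>i di (1 / k) \<and> GO g' = GO (jf k *\<^sub>f g) \<and> w' = jf k *\<^sub>f w)"
proof
  assume eq: "klat s g w = klat s' g' w'"
  have "commensurable (klat s g w) (klat s g w)" using commensurable_klat_same_scale[OF s g g w w] by simp
  then obtain k where k: "k \<noteq> 0" "s' = s *\<^sub>i di (1 / k)" "w' = jf k *\<^sub>f w"
    using commensurable_klat_iff[OF s s' g g' w w'] eq by auto
  let ?g = "jf k *\<^sub>f g"
  have gU: "?g \<in> Units AF" using jf_Units[OF k(1)] g by simp
  have "klat s g w = klat s' ?g w'"
    unfolding k using klat_reparametrize[OF s Units_AF_in[OF g] GO_sub[OF w] k(1)] by simp
  then have "LT s' (Ig ?g) = LT s' (Ig g')" using eq by (simp add: klat_def)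
  then have "Ig ?g = Ig g'" using LT_mem_iff[OF s'] by (metis subset_antisym subsetI)
  then have "GO g' = GO ?g" using GO_eq_of_Ig_eq[OF gU g'] by simp
  then show "\<exists>k. k \<noteq> 0 \<and> s' = s *\<^sub>i di (1 / k) \<and> GO g' = GO (jf k *\<^sub>f g) \<and> w' = jf k *\<^sub>f w"
    using k by blast
next
  assume "\<exists>k. k \<noteq> 0 \<and> s' = s *\<^sub>i di (1 / k) \<and> GO g' = GO (jf k *\<^sub>f g) \<and> w' = jf k *\<^sub>f w"
  then obtain k where k: "k \<noteq> 0" "s' = s *\<^sub>i di (1 / k)" "GO g' = GO (jf k *\<^sub>f g)" "w' = jf k *\<^sub>f w" by blast
  show "klat s g w = klat s' g' w'"
    unfolding k(2,4) klat_GO_cong[OF k(3)]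
    by (rule klat_reparametrize[OF s Units_AF_in[OF g] GO_sub[OF w] k(1), symmetric])
qed

lemma scale_klat:
  assumes c: "c \<in> Units KI" and s: "s \<in> Units KI"
  shows "scale c (klat s g w) = klat (c *\<^sub>i s) g w"
proof -
  have a: "c *\<^sub>i s *\<^sub>i di k = c *\<^sub>i (s *\<^sub>i di k)" for k using c s by (simp add: KI.m_assoc)
  have "c <#\<^bsub>KI\<^esub> LT s (Ig g) = LT (c *\<^sub>i s) (Ig g)" by (auto simp: l_coset_def LT_def a)
  moreover have "c <#\<^bsub>KI\<^esub> {s *\<^sub>i di k | k. P k} = {c *\<^sub>i s *\<^sub>i di k | k. P k}" for P
    by (auto simp: l_coset_def a)
  ultimately show ?thesis by (simp add: scale_def klat_def cong: restrict_cong)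
qed

end

section \<open>Idele classes and the balanced product\<close>

text \<open>Two parametrizations by one set with the same fibres have matching images. The object
  and arrow parts of the isomorphism are obtained from it, so that for each of them well-definedness
  and bijectivity come from a single equivalence.\<close>

lemma bij_betw_images:
  assumes "\<And>p q. p \<in> P \<Longrightarrow> q \<in> P \<Longrightarrow> a p = a q \<longleftrightarrow> b p = b q"
  shows "\<exists>F. bij_betw F (a ` P) (b ` P) \<and> (\<forall>p\<in>P. F (a p) = b p)"
proof -
  define F where "F = b \<circ> inv_into P a"
  have F: "F (a p) = b p" if p: "p \<in> P" for p
  proof -
    have i: "a p \<in> a ` P" using p by blast
    show ?thesis unfolding F_def o_apply using assms[OF inv_into_into[OF i] p] f_inv_into_f[OF i] by blast
  qed
  have "inj_on F (a ` P)"
  proof (rule inj_onI)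
    fix x y assume "x \<in> a ` P" "y \<in> a ` P" and eq: "F x = F y"
    then obtain p q where pq: "p \<in> P" "q \<in> P" "x = a p" "y = a q" by blast
    then show "x = y" using eq F assms by simp
  qed
  moreover have "F ` (a ` P) = b ` P" unfolding image_image using F by (rule image_cong[OF refl])
  ultimately show ?thesis using F by (auto simp: bij_betw_def)
qed

lemma (in comm_monoid) Units_inv_mult:
  assumes x: "x \<in> Units G" and y: "y \<in> Units G"
  shows "inv (x \<otimes> y) = inv x \<otimes> inv y"
proof (rule comm_inv_char)
  have "(x \<otimes> y) \<otimes> (inv x \<otimes> inv y) = (x \<otimes> inv x) \<otimes> (y \<otimes> inv y)"
    using x y by (simp only: m_ac m_closed Units_closed Units_inv_closed)
  then show "(x \<otimes> y) \<otimes> (inv x \<otimes> inv y) = \<one>" using x y by simp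
qed (use x y in auto)

section \<open>Ideles modulo principal ideles and the identity component\<close>

context number_field_type
begin

abbreviation AD :: "'k adele ring" where "AD \<equiv> adeles"

abbreviation ideles :: "'k adele monoid" where "ideles \<equiv> units_of AD"

lemma adeles_simps:
  "carrier AD = carrier KI \<times> carrier AF" "\<one>\<^bsub>AD\<^esub> = (\<one>\<^sub>i, \<one>\<^sub>f)"
  "(a, g) \<otimes>\<^bsub>AD\<^esub> (b, h) = (a *\<^sub>i b, g *\<^sub>f h)"
  by (simp_all add: adeles_def RDirProd_def DirProd_def monoid.defs)

lemma comm_monoid_adeles: "comm_monoid AD"
proof (rule comm_monoidI)
  show "x \<otimes>\<^bsub>AD\<^esub> y \<in> carrier AD" if "x \<in> carrier AD" "y \<in> carrier AD" for x y
    using that by (cases x; cases y) (simp add: adeles_simps)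
  show "\<one>\<^bsub>AD\<^esub> \<in> carrier AD" by (simp add: adeles_simps)
  show "x \<otimes>\<^bsub>AD\<^esub> y \<otimes>\<^bsub>AD\<^esub> z = x \<otimes>\<^bsub>AD\<^esub> (y \<otimes>\<^bsub>AD\<^esub> z)"
    if "x \<in> carrier AD" "y \<in> carrier AD" "z \<in> carrier AD" for x y z
    using that by (cases x; cases y; cases z) (simp add: adeles_simps KI.m_assoc AF.m_assoc)
  show "\<one>\<^bsub>AD\<^esub> \<otimes>\<^bsub>AD\<^esub> x = x" if "x \<in> carrier AD" for x
    using that by (cases x) (simp add: adeles_simps)
  show "x \<otimes>\<^bsub>AD\<^esub> y = y \<otimes>\<^bsub>AD\<^esub> x" if "x \<in> carrier AD" "y \<in> carrier AD" for x y
    using that by (cases x; cases y) (simp add: adeles_simps KI.m_comm AF.m_comm)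
qed

lemma comm_group_ideles: "comm_group ideles"
  by (rule comm_monoid.units_comm_group[OF comm_monoid_adeles])

lemma group_ideles: "group ideles"
  using comm_group_ideles by (rule comm_group.axioms)

lemma group_units_AF: "group (units_of AF)"
  by (rule AF.units_group)

lemma carrier_ideles: "carrier ideles = Units KI \<times> Units AF"
proof -
  have "(a, g) \<in> Units AD \<longleftrightarrow> a \<in> Units KI \<and> g \<in> Units AF" for a g
  proof
    assume "(a, g) \<in> Units AD"
    then obtain p where p: "p \<in> carrier AD" "p \<otimes>\<^bsub>AD\<^esub> (a, g) = \<one>\<^bsub>AD\<^esub>" "(a, g) \<otimes>\<^bsub>AD\<^esub> p = \<one>\<^bsub>AD\<^esub>"
      and ag: "(a, g) \<in> carrier AD" unfolding Units_def by blast
    obtain b h where bh: "p = (b, h)" by (cases p)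
    have "b \<in> carrier KI" "b *\<^sub>i a = \<one>\<^sub>i" "a *\<^sub>i b = \<one>\<^sub>i" "a \<in> carrier KI"
      "h \<in> carrier AF" "h *\<^sub>f g = \<one>\<^sub>f" "g *\<^sub>f h = \<one>\<^sub>f" "g \<in> carrier AF"
      using p ag unfolding bh adeles_simps by simp_all
    then show "a \<in> Units KI \<and> g \<in> Units AF" unfolding Units_def by blast
  next
    assume ag: "a \<in> Units KI \<and> g \<in> Units AF"
    then have "(inv\<^sub>i a, inv\<^sub>f g) \<in> carrier AD" "(inv\<^sub>i a, inv\<^sub>f g) \<otimes>\<^bsub>AD\<^esub> (a, g) = \<one>\<^bsub>AD\<^esub>"
      "(a, g) \<otimes>\<^bsub>AD\<^esub> (inv\<^sub>i a, inv\<^sub>f g) = \<one>\<^bsub>AD\<^esub>" "(a, g) \<in> carrier AD"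
      by (simp_all add: adeles_simps)
    then show "(a, g) \<in> Units AD" unfolding Units_def by blast
  qed
  then show ?thesis by (auto simp: units_of_carrier)
qed

lemma ideles_simps:
  "(a, g) \<in> carrier ideles \<longleftrightarrow> a \<in> Units KI \<and> g \<in> Units AF" "\<one>\<^bsub>ideles\<^esub> = (\<one>\<^sub>i, \<one>\<^sub>f)"
  "(a, g) \<otimes>\<^bsub>ideles\<^esub> (b, h) = (a *\<^sub>i b, g *\<^sub>f h)"
  by (simp_all add: carrier_ideles) (simp_all add: units_of_one units_of_mult adeles_simps)

lemma inv_ideles: "a \<in> Units KI \<Longrightarrow> g \<in> Units AF \<Longrightarrow> inv\<^bsub>ideles\<^esub> (a, g) = (inv\<^sub>i a, inv\<^sub>f g)"
  by (rule group.inv_equality[OF group_ideles]) (simp_all add: ideles_simps)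

text \<open>The subgroup of the ideles that \<open>idele_quotient\<close> divides out.\<close>

definition HH :: "'k adele set" where
  "HH = principal_ideles <#>\<^bsub>ideles\<^esub> (CC \<times> {\<one>\<^sub>f})"

lemma HH_iff: "(a, g) \<in> HH \<longleftrightarrow> (\<exists>k. \<exists>c\<in>CC. k \<noteq> 0 \<and> a = di k *\<^sub>i c \<and> g = jf k)"
proof -
  have principal: "principal_ideles = {(di k, jf k) | k. k \<noteq> 0}" by (simp add: principal_ideles_def jf_def)
  have ex: "(\<exists>x\<in>{(di k, jf k) | k. k \<noteq> 0}. \<exists>y\<in>CC \<times> {\<one>\<^sub>f}. P x y) \<longleftrightarrow>
      (\<exists>k. \<exists>c\<in>CC. k \<noteq> 0 \<and> P (di k, jf k) (c, \<one>\<^sub>f))" for P :: "'k adele \<Rightarrow> 'k adele \<Rightarrow> bool"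
    by blast
  have "p \<in> HH \<longleftrightarrow> (\<exists>x\<in>principal_ideles. \<exists>y\<in>CC \<times> {\<one>\<^sub>f}. p = x \<otimes>\<^bsub>ideles\<^esub> y)" for p
    by (simp only: HH_def set_mult_def UN_iff singleton_iff)
  then show ?thesis unfolding principal ex ideles_simps by (simp only: AF.r_one[OF jf_in] prod.inject)
qed

lemma subgroup_HH: "subgroup HH ideles"
proof (rule group.subgroupI[OF group_ideles])
  show "HH \<subseteq> carrier ideles"
  proof
    fix p assume p: "p \<in> HH"
    obtain a g where ag: "p = (a, g)" by (cases p)
    obtain k c where "k \<noteq> 0" "c \<in> CC" "a = di k *\<^sub>i c" "g = jf k" using p unfolding ag HH_iff by blast
    then show "p \<in> carrier ideles" using CC_facts(2) di_Units jf_Units by (simp add: ag ideles_simps)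
  qed
  have "(di 1 *\<^sub>i \<one>\<^sub>i, jf 1) \<in> HH"
    unfolding HH_iff by (intro exI[of _ 1] bexI[OF _ CC_facts(1)]) simp
  then show "HH \<noteq> {}" by blast
next
  fix p assume p: "p \<in> HH"
  obtain a g where ag: "p = (a, g)" by (cases p)
  obtain k c where kc: "k \<noteq> 0" "c \<in> CC" "a = di k *\<^sub>i c" "g = jf k" using p unfolding ag HH_iff by blast
  have cU: "c \<in> Units KI" by (rule CC_facts(2)[OF kc(2)])
  have "inv\<^sub>i (di k *\<^sub>i c) = di (1 / k) *\<^sub>i inv\<^sub>i c"
    using cU di_Units[OF kc(1)] by (simp add: KI.Units_inv_mult flip: di_inv[OF kc(1)])
  then have "inv\<^bsub>ideles\<^esub> p = (di (1 / k) *\<^sub>i inv\<^sub>i c, jf (1 / k))"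
    unfolding ag kc using inv_ideles[of "di k *\<^sub>i c" "jf k"] cU di_Units[OF kc(1)] jf_Units[OF kc(1)] jf_inv[OF kc(1)]
    by simp
  moreover have "(di (1 / k) *\<^sub>i inv\<^sub>i c, jf (1 / k)) \<in> HH"
    unfolding HH_iff using kc(1) by (intro exI[of _ "1 / k"] bexI[OF _ CC_facts(4)[OF kc(2)]]) simp
  ultimately show "inv\<^bsub>ideles\<^esub> p \<in> HH" by (simp only:)
next
  fix p q assume p: "p \<in> HH" and q: "q \<in> HH"
  obtain a g where ag: "p = (a, g)" by (cases p)
  obtain b h where bh: "q = (b, h)" by (cases q)
  obtain k c where kc: "k \<noteq> 0" "c \<in> CC" "a = di k *\<^sub>i c" "g = jf k" using p unfolding ag HH_iff by blast
  obtain l d where ld: "l \<noteq> 0" "d \<in> CC" "b = di l *\<^sub>i d" "h = jf l" using q unfolding bh HH_iff by blast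
  have "a *\<^sub>i b = di (k * l) *\<^sub>i (c *\<^sub>i d)"
    unfolding kc ld using CC_facts(2)[OF kc(2)] CC_facts(2)[OF ld(2)] by (simp add: di_hom KI.m_ac)
  moreover have "g *\<^sub>f h = jf (k * l)" by (simp add: kc ld jf_hom)
  ultimately show "p \<otimes>\<^bsub>ideles\<^esub> q \<in> HH"
    unfolding ag bh ideles_simps HH_iff using kc(1) ld(1)
    by (intro exI[of _ "k * l"] bexI[OF _ CC_facts(3)[OF kc(2) ld(2)]]) simp
qed

definition pt :: "'k inf_adele \<Rightarrow> 'k fin_adele \<Rightarrow> 'k adele set" where
  "pt a g = HH #>\<^bsub>ideles\<^esub> (a, g)"

lemma pt_eq_iff:
  assumes a: "a \<in> Units KI" "b \<in> Units KI" and g: "g \<in> Units AF" "h \<in> Units AF"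
  shows "pt a g = pt b h \<longleftrightarrow> (\<exists>k. \<exists>c\<in>CC. k \<noteq> 0 \<and> b = di k *\<^sub>i c *\<^sub>i a \<and> h = jf k *\<^sub>f g)"
proof -
  have ab: "(a, g) \<in> carrier ideles" "(b, h) \<in> carrier ideles" using a g by (simp_all add: ideles_simps)
  have "pt a g = pt b h \<longleftrightarrow> (b, h) \<in> HH #>\<^bsub>ideles\<^esub> (a, g)"
    unfolding pt_def using group.rcos_self[OF group_ideles ab(2) subgroup_HH] group.repr_independence[OF group_ideles _ ab(1) subgroup_HH] by metis
  also have "\<dots> \<longleftrightarrow> (\<exists>x y. (x, y) \<in> HH \<and> (b, h) = (x, y) \<otimes>\<^bsub>ideles\<^esub> (a, g))" unfolding r_coset_def by auto
  also have "\<dots> \<longleftrightarrow> (\<exists>k. \<exists>c\<in>CC. k \<noteq> 0 \<and> b = di k *\<^sub>i c *\<^sub>i a \<and> h = jf k *\<^sub>f g)"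
    unfolding HH_iff ideles_simps by auto
  finally show ?thesis .
qed

lemma carrier_idele_quotient: "carrier idele_quotient = {pt a g | a g. a \<in> Units KI \<and> g \<in> Units AF}"
proof -
  have "carrier idele_quotient = {HH #>\<^bsub>ideles\<^esub> p | p. p \<in> carrier ideles}"
    unfolding idele_quotient_def FactGroup_def RCOSETS_def HH_def by auto
  then show ?thesis unfolding pt_def carrier_ideles by blast
qed

lemma idele_act_pt:
  assumes "a \<in> Units KI" "g \<in> Units AF" "u \<in> Units AF"
  shows "idele_act u (pt a g, t) = (pt a (g *\<^sub>f inv\<^sub>f u), u *\<^sub>f t)"
proof -
  have "pt a g #>\<^bsub>ideles\<^esub> (\<one>\<^sub>i, inv\<^sub>f u) = HH #>\<^bsub>ideles\<^esub> ((a, g) \<otimes>\<^bsub>ideles\<^esub> (\<one>\<^sub>i, inv\<^sub>f u))"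
    unfolding pt_def using assms by (intro group.coset_mult_assoc[OF group_ideles] subgroup.subset[OF subgroup_HH]) (simp_all add: ideles_simps)
  then show ?thesis using assms by (simp add: idele_act_def inv_ideles ideles_simps pt_def)
qed

lemma O_hat_units_closed:
  "u \<in> O_hat_units \<Longrightarrow> u \<in> Units AF" "\<one>\<^sub>f \<in> O_hat_units" "u \<in> O_hat_units \<Longrightarrow> w \<in> O_hat_units \<Longrightarrow> u *\<^sub>f w \<in> O_hat_units"
  "u \<in> O_hat_units \<Longrightarrow> inv\<^sub>f u \<in> O_hat_units"
  by (simp_all add: O_hat_units_iff_fnorm fnorm_one fnorm_simps fnorm_inv)

lemma GO_eq_iff_fnorm: "g \<in> carrier AF \<Longrightarrow> h \<in> carrier AF \<Longrightarrow> GO g = GO h \<longleftrightarrow> (\<forall>v\<in>finite_places. fnorm v g = fnorm v h)"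
proof
  assume g: "g \<in> carrier AF" and h: "h \<in> carrier AF" and eq: "GO g = GO h"
  then have "g \<in> GO h" "h \<in> GO g" using GO_self[OF g] GO_self[OF h] by simp_all
  then show "\<forall>v\<in>finite_places. fnorm v g = fnorm v h" by (auto simp: GO_def intro: antisym)
qed (simp add: GO_def)

lemma GO_iff_OH:
  assumes g: "g \<in> Units AF" and w: "w \<in> carrier AF"
  shows "w \<in> GO g \<longleftrightarrow> inv\<^sub>f g *\<^sub>f w \<in> OH"
proof -
  have "fnorm v w \<le> fnorm v g \<longleftrightarrow> fnorm v (inv\<^sub>f g *\<^sub>f w) \<le> 1" if v: "v \<in> finite_places" for v
    using fnorm_pos[OF g v] g w v by (simp add: fnorm_simps fnorm_inv field_simps)
  then show ?thesis using g w by (simp add: GO_def OH_iff)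
qed

lemma inv_cancel:
  assumes "g \<in> Units AF" "x \<in> carrier AF"
  shows "inv\<^sub>f g *\<^sub>f (g *\<^sub>f x) = x" "g *\<^sub>f (inv\<^sub>f g *\<^sub>f x) = x"
  using assms by (simp_all flip: AF.m_assoc)

definition BB :: "'k inf_adele \<Rightarrow> 'k fin_adele \<Rightarrow> 'k fin_adele \<Rightarrow> ('k adele set \<times> 'k fin_adele) set" where
  "BB a g t = balanced_class (pt a g, t)"

lemma BB_eq:
  assumes "a \<in> Units KI" "g \<in> Units AF"
  shows "BB a g t = {(pt a (g *\<^sub>f inv\<^sub>f u), u *\<^sub>f t) | u. u \<in> O_hat_units}"
proof -
  have "BB a g t = {idele_act u (pt a g, t) | u. u \<in> O_hat_units}"
    by (simp add: BB_def balanced_class_def orbit_def)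
  moreover have "idele_act u (pt a g, t) = (pt a (g *\<^sub>f inv\<^sub>f u), u *\<^sub>f t)" if "u \<in> O_hat_units" for u
    by (rule idele_act_pt[OF assms O_hat_units_closed(1)[OF that]])
  ultimately show ?thesis unfolding Setcompr_eq_image by (metis (no_types, lifting) image_cong)
qed

text \<open>The acting coset and the class each bring a factor from the units of
  \<open>O_hat\<close>; by commutativity these combine into one, so the result is a single class. It
  computes the action of idele classes and, for \<open>w\<close> itself a unit of
  \<open>O_hat\<close>, serves to compare classes.\<close>

lemma BB_act:
  assumes a: "a \<in> Units KI" and g: "g \<in> Units AF" and t: "t \<in> carrier AF" and w: "w \<in> Units AF"
  shows "{idele_act w' e | w' e. w' \<in> {u *\<^sub>f w | u. u \<in> O_hat_units} \<and> e \<in> BB a g t} = BB a (g *\<^sub>f inv\<^sub>f w) (w *\<^sub>f t)"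
proof -
  have *: "idele_act (u *\<^sub>f w) (pt a (g *\<^sub>f inv\<^sub>f u'), u' *\<^sub>f t) =
      (pt a (g *\<^sub>f inv\<^sub>f w *\<^sub>f inv\<^sub>f (u *\<^sub>f u')), (u *\<^sub>f u') *\<^sub>f (w *\<^sub>f t))"
    if u: "u \<in> O_hat_units" "u' \<in> O_hat_units" for u u'
  proof -
    note uU = O_hat_units_closed(1)[OF u(1)] O_hat_units_closed(1)[OF u(2)]
    have uc: "u \<in> carrier AF" "u' \<in> carrier AF" "inv\<^sub>f u \<in> carrier AF" "inv\<^sub>f u' \<in> carrier AF"
        "inv\<^sub>f w \<in> carrier AF" "w \<in> carrier AF" "g \<in> carrier AF" using uU w g by simp_all
    have "g *\<^sub>f inv\<^sub>f u' *\<^sub>f inv\<^sub>f (u *\<^sub>f w) = g *\<^sub>f inv\<^sub>f w *\<^sub>f inv\<^sub>f (u *\<^sub>f u')"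
      using uU w uc by (simp add: AF.Units_inv_mult AF.m_ac)
    moreover have "u *\<^sub>f w *\<^sub>f (u' *\<^sub>f t) = (u *\<^sub>f u') *\<^sub>f (w *\<^sub>f t)"
      using uc t by (simp add: AF.m_ac)
    ultimately show ?thesis using idele_act_pt[OF a, of "g *\<^sub>f inv\<^sub>f u'" "u *\<^sub>f w"] uU w g by simp
  qed
  have gw: "g *\<^sub>f inv\<^sub>f w \<in> Units AF" using g w by simp
  show ?thesis
    unfolding BB_eq[OF a g] BB_eq[OF a gw]
  proof (intro equalityI subsetI)
    fix e assume "e \<in> {idele_act w' e | w' e. w' \<in> {u *\<^sub>f w | u. u \<in> O_hat_units} \<and>
      e \<in> {(pt a (g *\<^sub>f inv\<^sub>f u), u *\<^sub>f t) | u. u \<in> O_hat_units}}"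
    then obtain u u' where u: "u \<in> O_hat_units" "u' \<in> O_hat_units"
      and e: "e = idele_act (u *\<^sub>f w) (pt a (g *\<^sub>f inv\<^sub>f u'), u' *\<^sub>f t)" by blast
    show "e \<in> {(pt a (g *\<^sub>f inv\<^sub>f w *\<^sub>f inv\<^sub>f u), u *\<^sub>f (w *\<^sub>f t)) | u. u \<in> O_hat_units}"
      unfolding e *[OF u] using O_hat_units_closed(3)[OF u] by blast
  next
    fix e assume "e \<in> {(pt a (g *\<^sub>f inv\<^sub>f w *\<^sub>f inv\<^sub>f u), u *\<^sub>f (w *\<^sub>f t)) | u. u \<in> O_hat_units}"
    then obtain u where u: "u \<in> O_hat_units"
      and e: "e = (pt a (g *\<^sub>f inv\<^sub>f w *\<^sub>f inv\<^sub>f u), u *\<^sub>f (w *\<^sub>f t))" by blast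
    have "e = idele_act (u *\<^sub>f w) (pt a (g *\<^sub>f inv\<^sub>f \<one>\<^sub>f), \<one>\<^sub>f *\<^sub>f t)"
      unfolding *[OF u O_hat_units_closed(2)] e using O_hat_units_closed(1)[OF u] by simp
    then show "e \<in> {idele_act w' e | w' e. w' \<in> {u *\<^sub>f w | u. u \<in> O_hat_units} \<and>
      e \<in> {(pt a (g *\<^sub>f inv\<^sub>f u), u *\<^sub>f t) | u. u \<in> O_hat_units}}"
      using u O_hat_units_closed(2) by blast
  qed
qed

lemma BB_eq_iff:
  assumes a: "a \<in> Units KI" "b \<in> Units KI" and g: "g \<in> Units AF" "h \<in> Units AF" and t: "t \<in> carrier AF"
    and s: "s \<in> carrier AF"
  shows "BB a g t = BB b h s \<longleftrightarrow> (\<exists>u\<in>O_hat_units. pt a (g *\<^sub>f inv\<^sub>f u) = pt b h \<and> s = u *\<^sub>f t)"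
proof
  assume "\<exists>u\<in>O_hat_units. pt a (g *\<^sub>f inv\<^sub>f u) = pt b h \<and> s = u *\<^sub>f t"
  then obtain u where u: "u \<in> O_hat_units" "pt a (g *\<^sub>f inv\<^sub>f u) = pt b h" "s = u *\<^sub>f t" by blast
  note uU = O_hat_units_closed(1)[OF u(1)]
  \<comment> \<open>The cosets of \<open>u\<close> and of 1 coincide, so \<open>BB_act\<close>
    evaluates the same set in two ways.\<close>
  have eq: "{w *\<^sub>f u | w. w \<in> O_hat_units} = {w *\<^sub>f \<one>\<^sub>f | w. w \<in> O_hat_units}"
  proof (intro equalityI subsetI)
    fix x assume "x \<in> {w *\<^sub>f u | w. w \<in> O_hat_units}"
    then obtain w where w: "w \<in> O_hat_units" "x = w *\<^sub>f u" by blast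
    then have "x = (w *\<^sub>f u) *\<^sub>f \<one>\<^sub>f" using O_hat_units_closed(1)[OF w(1)] uU by simp
    then show "x \<in> {w *\<^sub>f \<one>\<^sub>f | w. w \<in> O_hat_units}" using O_hat_units_closed(3)[OF w(1) u(1)] by blast
  next
    fix x assume "x \<in> {w *\<^sub>f \<one>\<^sub>f | w. w \<in> O_hat_units}"
    then obtain w where w: "w \<in> O_hat_units" "x = w *\<^sub>f \<one>\<^sub>f" by blast
    then have "x = (w *\<^sub>f inv\<^sub>f u) *\<^sub>f u" using O_hat_units_closed(1)[OF w(1)] uU by (simp add: AF.m_assoc)
    then show "x \<in> {w *\<^sub>f u | w. w \<in> O_hat_units}"
      using O_hat_units_closed(3)[OF w(1) O_hat_units_closed(4)[OF u(1)]] by blast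
  qed
  have "BB a (g *\<^sub>f inv\<^sub>f u) (u *\<^sub>f t) = BB a (g *\<^sub>f inv\<^sub>f \<one>\<^sub>f) (\<one>\<^sub>f *\<^sub>f t)"
    unfolding BB_act[OF a(1) g(1) t uU, symmetric] BB_act[OF a(1) g(1) t AF.Units_one_closed, symmetric] eq ..
  also have "\<dots> = BB a g t" using g t by simp
  finally show "BB a g t = BB b h s" using u(2,3) by (simp add: BB_def)
next
  assume eq: "BB a g t = BB b h s"
  have "(pt b (h *\<^sub>f inv\<^sub>f \<one>\<^sub>f), \<one>\<^sub>f *\<^sub>f s) \<in> BB b h s"
    unfolding BB_eq[OF a(2) g(2)] using O_hat_units_closed(2) by blast
  then have "(pt b h, s) \<in> BB a g t" using g(2) s eq by simp
  then show "\<exists>u\<in>O_hat_units. pt a (g *\<^sub>f inv\<^sub>f u) = pt b h \<and> s = u *\<^sub>f t"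
    unfolding BB_eq[OF a(1) g(1)] by auto
qed

lemma subgroup_O_hat_units: "subgroup O_hat_units (units_of AF)"
proof (rule group.subgroupI[OF group_units_AF])
  show "O_hat_units \<subseteq> carrier (units_of AF)" using O_hat_units_closed(1) by (auto simp: units_of_carrier)
  show "O_hat_units \<noteq> ({} :: 'k fin_adele set)" using O_hat_units_closed(2) by blast
  show "inv\<^bsub>units_of AF\<^esub> u \<in> O_hat_units" if "u \<in> O_hat_units" for u
    using O_hat_units_closed(1,4)[OF that] by (simp add: AF.units_of_inv)
  show "u \<otimes>\<^bsub>units_of AF\<^esub> w \<in> O_hat_units" if "u \<in> O_hat_units" "w \<in> O_hat_units" for u w
    using O_hat_units_closed(3)[OF that] by (simp add: units_of_mult)
qed

definition FC :: "'k fin_adele \<Rightarrow> 'k fin_adele set" where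
  "FC w = O_hat_units #>\<^bsub>units_of AF\<^esub> w"

lemma FC_eq: "FC w = {u *\<^sub>f w | u. u \<in> O_hat_units}"
  unfolding FC_def r_coset_def units_of_mult by blast

lemma FC_eq_iff:
  assumes w: "w \<in> Units AF" "w' \<in> Units AF"
  shows "FC w = FC w' \<longleftrightarrow> GO w = GO w'"
proof
  assume "FC w = FC w'"
  moreover have "\<one>\<^sub>f *\<^sub>f w' \<in> FC w'" unfolding FC_eq using O_hat_units_closed(2) by blast
  ultimately have "w' \<in> FC w" using w by simp
  then obtain u where u: "u \<in> O_hat_units" "w' = u *\<^sub>f w" unfolding FC_eq by blast
  then show "GO w = GO w'"
    using w O_hat_units_closed(1)[OF u(1)] by (simp add: GO_eq_iff_fnorm fnorm_simps O_hat_units_iff_fnorm)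
next
  assume eq: "GO w = GO w'"
  define u where "u = w' *\<^sub>f inv\<^sub>f w"
  have "u \<in> Units AF" using w by (simp add: u_def)
  moreover have "fnorm v u = 1" if v: "v \<in> finite_places" for v
    using eq w v fnorm_pos[OF w(2) v] by (simp add: u_def GO_eq_iff_fnorm fnorm_simps fnorm_inv)
  ultimately have u: "u \<in> O_hat_units" by (simp add: O_hat_units_iff_fnorm)
  have "w' = u *\<^sub>f w" using w by (simp add: u_def AF.m_assoc)
  then have "w' \<in> O_hat_units #>\<^bsub>units_of AF\<^esub> w" using u FC_eq unfolding FC_def by blast
  from group.repr_independence[OF group_units_AF this _ subgroup_O_hat_units]
  show "FC w = FC w'" using w by (simp add: FC_def units_of_carrier)
qed

lemma carrier_fin_idele_classes: "carrier fin_idele_classes = {FC w | w. w \<in> Units AF}"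
  unfolding fin_idele_classes_def FactGroup_def RCOSETS_def FC_def units_of_carrier by auto

lemma mult_fin_idele_classes:
  assumes "w \<in> Units AF" "w' \<in> Units AF"
  shows "FC w \<otimes>\<^bsub>fin_idele_classes\<^esub> FC w' = FC (w *\<^sub>f w')"
  using normal.rcos_sum[OF comm_group.subgroup_imp_normal[OF AF.units_comm_group subgroup_O_hat_units], of w w'] assms
  by (simp add: fin_idele_classes_def FactGroup_def FC_def units_of_carrier units_of_mult)

lemma one_fin_idele_classes: "\<one>\<^bsub>fin_idele_classes\<^esub> = FC \<one>\<^sub>f"
proof -
  have "FC \<one>\<^sub>f = O_hat_units"
    using group.coset_mult_one[OF group_units_AF subgroup.subset[OF subgroup_O_hat_units]]
    by (simp add: FC_def units_of_one)
  then show ?thesis by (simp add: fin_idele_classes_def FactGroup_def)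
qed

lemma class_act_FC:
  assumes "a \<in> Units KI" "g \<in> Units AF" "t \<in> carrier AF" "w \<in> Units AF"
  shows "class_act (FC w) (BB a g t) = BB a (g *\<^sub>f inv\<^sub>f w) (w *\<^sub>f t)"
proof -
  have "class_act c E = {idele_act w' e | w' e. w' \<in> c \<and> e \<in> E}" for c and E :: "('k adele set \<times> 'k fin_adele) set"
    unfolding class_act_def by blast
  then show ?thesis unfolding FC_eq using BB_act[OF assms] by simp
qed

text \<open>The value of the isomorphism on the orbit of \<open>klat s g w\<close>.\<close>

definition B0 :: "'k inf_adele \<Rightarrow> 'k fin_adele \<Rightarrow> 'k fin_adele \<Rightarrow> ('k adele set \<times> 'k fin_adele) set" where
  "B0 s g w = BB (inv\<^sub>i s) g (inv\<^sub>f g *\<^sub>f w)"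

lemma inv_scale:
  assumes "k \<noteq> 0" "c \<in> Units KI" "s \<in> Units KI"
  shows "inv\<^sub>i (inv\<^sub>i c *\<^sub>i s *\<^sub>i di (1 / k)) = di k *\<^sub>i c *\<^sub>i inv\<^sub>i s"
proof -
  have k: "di (1 / k) \<in> Units KI" "inv\<^sub>i di (1 / k) = di k" using assms(1) di_Units[of "1 / k"] di_inv[of "1 / k"] by auto
  have "inv\<^sub>i (inv\<^sub>i c *\<^sub>i s *\<^sub>i di (1 / k)) = c *\<^sub>i inv\<^sub>i s *\<^sub>i di k"
    using assms k by (simp add: KI.Units_inv_mult KI.Units_m_closed)
  also have "\<dots> = di k *\<^sub>i c *\<^sub>i inv\<^sub>i s" using assms by (simp add: KI.m_ac)
  finally show ?thesis .
qed

text \<open>The condition on the right is literally the one in \<open>Ob_eq_iff\<close> for equality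
  of orbits of \<open>K\<close>-lattices; this is what makes the object map a bijection.\<close>

lemma B0_eq_iff:
  assumes s: "s \<in> Units KI" "s' \<in> Units KI" and g: "g \<in> Units AF" "g' \<in> Units AF" and w: "w \<in> carrier AF" "w' \<in> carrier AF"
  shows "B0 s g w = B0 s' g' w' \<longleftrightarrow>
    (\<exists>c\<in>CC. \<exists>k. k \<noteq> 0 \<and> s' = c *\<^sub>i s *\<^sub>i di (1 / k) \<and> GO g' = GO (jf k *\<^sub>f g) \<and> w' = jf k *\<^sub>f w)"
proof -
  note gc = Units_AF_in[OF g(1)] Units_AF_in[OF g(2)]
  note inv_s = KI.Units_inv_Units[OF s(1)] KI.Units_inv_Units[OF s(2)]
  have t: "inv\<^sub>f g *\<^sub>f w \<in> carrier AF" "inv\<^sub>f g' *\<^sub>f w' \<in> carrier AF" using g w by simp_all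
  have "B0 s g w = B0 s' g' w' \<longleftrightarrow> (\<exists>u\<in>O_hat_units. pt (inv\<^sub>i s) (g *\<^sub>f inv\<^sub>f u) = pt (inv\<^sub>i s') g' \<and>
      inv\<^sub>f g' *\<^sub>f w' = u *\<^sub>f (inv\<^sub>f g *\<^sub>f w))"
    unfolding B0_def by (rule BB_eq_iff[OF inv_s g t])
  also have "\<dots> \<longleftrightarrow> (\<exists>u\<in>O_hat_units. (\<exists>k. \<exists>c\<in>CC. k \<noteq> 0 \<and> inv\<^sub>i s' = di k *\<^sub>i c *\<^sub>i inv\<^sub>i s \<and>
      g' = jf k *\<^sub>f (g *\<^sub>f inv\<^sub>f u)) \<and> inv\<^sub>f g' *\<^sub>f w' = u *\<^sub>f (inv\<^sub>f g *\<^sub>f w))"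
    using pt_eq_iff[OF inv_s _ g(2)] g(1) O_hat_units_closed(1) by (simp cong: bex_cong)
  also have "\<dots> \<longleftrightarrow> (\<exists>c\<in>CC. \<exists>k. k \<noteq> 0 \<and> s' = c *\<^sub>i s *\<^sub>i di (1 / k) \<and> GO g' = GO (jf k *\<^sub>f g) \<and> w' = jf k *\<^sub>f w)"
    (is "?A \<longleftrightarrow> ?B")
  proof
    assume ?A
    then obtain u k c where u: "u \<in> O_hat_units" and c: "c \<in> CC" and k: "k \<noteq> 0"
      and 1: "inv\<^sub>i s' = di k *\<^sub>i c *\<^sub>i inv\<^sub>i s" and 2: "g' = jf k *\<^sub>f (g *\<^sub>f inv\<^sub>f u)"
      and 3: "inv\<^sub>f g' *\<^sub>f w' = u *\<^sub>f (inv\<^sub>f g *\<^sub>f w)" by blast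
    note cU = CC_facts(2)[OF c] and uU = O_hat_units_closed(1)[OF u]
    \<comment> \<open>The element of the identity component gets inverted because \<open>B0\<close>
      uses the inverse of \<open>s\<close>.\<close>
    have r: "inv\<^sub>i c *\<^sub>i s *\<^sub>i di (1 / k) \<in> Units KI" using cU s di_Units[of "1 / k"] k by simp
    have "s' = inv\<^sub>i (inv\<^sub>i s')" using s by simp
    also have "\<dots> = inv\<^sub>i (inv\<^sub>i (inv\<^sub>i c *\<^sub>i s *\<^sub>i di (1 / k)))" unfolding 1 inv_scale[OF k cU s(1)] ..
    also have "\<dots> = inv\<^sub>i c *\<^sub>i s *\<^sub>i di (1 / k)" using r by simp
    finally have "s' = inv\<^sub>i c *\<^sub>i s *\<^sub>i di (1 / k)" .
    moreover have "GO g' = GO (jf k *\<^sub>f g)"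
      using gc u uU unfolding 2 by (simp add: GO_eq_iff_fnorm fnorm_simps fnorm_inv O_hat_units_iff_fnorm)
    moreover have "w' = jf k *\<^sub>f w"
    proof -
      have "w' = g' *\<^sub>f (inv\<^sub>f g' *\<^sub>f w')" using inv_cancel(2)[OF g(2) w(2)] by simp
      also have "\<dots> = jf k *\<^sub>f (g *\<^sub>f (inv\<^sub>f u *\<^sub>f (u *\<^sub>f (inv\<^sub>f g *\<^sub>f w))))"
        unfolding 3 unfolding 2 using gc uU t by (simp add: AF.m_assoc)
      also have "\<dots> = jf k *\<^sub>f w" unfolding inv_cancel(1)[OF uU t(1)] inv_cancel(2)[OF g(1) w(1)] ..
      finally show ?thesis .
    qed
    ultimately show ?B using CC_facts(4)[OF c] k by blast
  next
    assume ?B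
    then obtain c k where c: "c \<in> CC" and k: "k \<noteq> 0" and 1: "s' = c *\<^sub>i s *\<^sub>i di (1 / k)"
      and 2: "GO g' = GO (jf k *\<^sub>f g)" and 3: "w' = jf k *\<^sub>f w" by blast
    note cU = CC_facts(2)[OF c]
    define z where "z = jf k *\<^sub>f g"
    have z: "z \<in> Units AF" unfolding z_def using jf_Units[OF k] g by simp
    note zc = Units_AF_in[OF z]
    \<comment> \<open>The unit of \<open>O_hat\<close> that compares \<open>k g\<close> with
      \<open>g'\<close>; its norms are 1 because both generate the same \<open>GO\<close>.\<close>
    define u where "u = z *\<^sub>f inv\<^sub>f g'"
    have uU: "u \<in> Units AF" using z g by (simp add: u_def)
    have "fnorm v u = 1" if v: "v \<in> finite_places" for v
      using 2 z zc gc g v fnorm_pos[OF g(2) v] unfolding z_def[symmetric] by (simp add: u_def GO_eq_iff_fnorm fnorm_simps fnorm_inv)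
    then have u: "u \<in> O_hat_units" using uU by (simp add: O_hat_units_iff_fnorm)
    have "inv\<^sub>f u = g' *\<^sub>f inv\<^sub>f z" unfolding u_def using z g by (simp add: AF.Units_inv_mult AF.m_comm)
    then have "jf k *\<^sub>f (g *\<^sub>f inv\<^sub>f u) = z *\<^sub>f (g' *\<^sub>f inv\<^sub>f z)"
      unfolding z_def using gc z unfolding z_def by (simp add: AF.m_assoc)
    also have "\<dots> = g'" using AF.m_lcomm[OF zc gc(2), of "inv\<^sub>f z"] z gc by simp
    finally have 4: "g' = jf k *\<^sub>f (g *\<^sub>f inv\<^sub>f u)" by simp
    have "u *\<^sub>f (inv\<^sub>f g *\<^sub>f w) = inv\<^sub>f g' *\<^sub>f (jf k *\<^sub>f (g *\<^sub>f (inv\<^sub>f g *\<^sub>f w)))"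
    proof -
      have "inv\<^sub>f g' \<in> carrier AF" using g by simp
      then show ?thesis unfolding u_def z_def
        using gc t AF.m_comm[of "jf k *\<^sub>f g" "inv\<^sub>f g'"] by (simp add: AF.m_assoc)
    qed
    also have "\<dots> = inv\<^sub>f g' *\<^sub>f w'" unfolding inv_cancel(2)[OF g(1) w(1)] 3 ..
    finally have 5: "inv\<^sub>f g' *\<^sub>f w' = u *\<^sub>f (inv\<^sub>f g *\<^sub>f w)" by simp
    have "s' = inv\<^sub>i (inv\<^sub>i c) *\<^sub>i s *\<^sub>i di (1 / k)" unfolding 1 using cU by simp
    then have "inv\<^sub>i s' = di k *\<^sub>i inv\<^sub>i c *\<^sub>i inv\<^sub>i s"
      using inv_scale[OF k KI.Units_inv_Units[OF cU] s(1)] by simp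
    then show ?A using u k CC_facts(4)[OF c] 4 5 by blast
  qed
  finally show ?thesis .
qed

text \<open>Acting by \<open>g / h\<close> replaces \<open>g\<close> by \<open>h\<close> and
  \<open>w / g\<close> by \<open>w / h\<close>. So it moves between triples with the same
  \<open>s\<close> and \<open>w\<close>, which is exactly what commensurability does.\<close>

lemma class_act_B0:
  assumes s: "s \<in> Units KI" and g: "g \<in> Units AF" "h \<in> Units AF" and w: "w \<in> carrier AF"
  shows "class_act (FC (g *\<^sub>f inv\<^sub>f h)) (B0 s g w) = B0 s h w"
proof -
  have c: "g \<in> carrier AF" "h \<in> carrier AF" "inv\<^sub>f g \<in> carrier AF" "inv\<^sub>f h \<in> carrier AF" using g by simp_all
  have "class_act (FC (g *\<^sub>f inv\<^sub>f h)) (B0 s g w) = BB (inv\<^sub>i s) (g *\<^sub>f inv\<^sub>f (g *\<^sub>f inv\<^sub>f h)) (g *\<^sub>f inv\<^sub>f h *\<^sub>f (inv\<^sub>f g *\<^sub>f w))"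
    unfolding B0_def using s g w by (intro class_act_FC) simp_all
  also have "g *\<^sub>f inv\<^sub>f (g *\<^sub>f inv\<^sub>f h) = h"
    using g inv_cancel(2)[OF g(1) c(2)] by (simp add: AF.Units_inv_mult)
  also have "g *\<^sub>f inv\<^sub>f h *\<^sub>f (inv\<^sub>f g *\<^sub>f w) = inv\<^sub>f h *\<^sub>f (g *\<^sub>f (inv\<^sub>f g *\<^sub>f w))"
    using c w AF.m_comm[OF c(1,4)] by (simp add: AF.m_assoc)
  also have "\<dots> = inv\<^sub>f h *\<^sub>f w" unfolding inv_cancel(2)[OF g(1) w] ..
  finally show ?thesis by (simp add: B0_def)
qed

lemma balanced_integral_eq: "balanced_integral = {B0 s g w | s g w. s \<in> Units KI \<and> g \<in> Units AF \<and> w \<in> GO g}"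
proof (intro equalityI subsetI)
  fix y :: "('k adele set \<times> 'k fin_adele) set" assume "y \<in> balanced_integral"
  then obtain x t where x: "x \<in> carrier idele_quotient" and t: "t \<in> OH" and y: "y = balanced_class (x, t)"
    unfolding balanced_integral_def by blast
  obtain a g where a: "a \<in> Units KI" "g \<in> Units AF" "x = pt a g" using x unfolding carrier_idele_quotient by blast
  have tc: "t \<in> carrier AF" by (rule OH_sub[OF t])
  have "y = B0 (inv\<^sub>i a) g (g *\<^sub>f t)" using a inv_cancel(1)[OF a(2) tc] by (simp add: y B0_def BB_def)
  moreover have "g *\<^sub>f t \<in> GO g" using GO_iff_OH[OF a(2), of "g *\<^sub>f t"] inv_cancel(1)[OF a(2) tc] t tc a by simp
  ultimately show "y \<in> {B0 s g w | s g w. s \<in> Units KI \<and> g \<in> Units AF \<and> w \<in> GO g}"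
    using KI.Units_inv_Units[OF a(1)] a(2) by blast
next
  fix y :: "('k adele set \<times> 'k fin_adele) set" assume "y \<in> {B0 s g w | s g w. s \<in> Units KI \<and> g \<in> Units AF \<and> w \<in> GO g}"
  then obtain s g w where y: "s \<in> Units KI" "g \<in> Units AF" "w \<in> GO g" "y = B0 s g w" by blast
  have "inv\<^sub>f g *\<^sub>f w \<in> OH" using GO_iff_OH[OF y(2) GO_sub[OF y(3)]] y(3) by simp
  moreover have "pt (inv\<^sub>i s) g \<in> carrier idele_quotient"
    unfolding carrier_idele_quotient using KI.Units_inv_Units[OF y(1)] y(2) by blast
  ultimately show "y \<in> balanced_integral" unfolding balanced_integral_def y(4) B0_def BB_def by blast
qed

text \<open>Units of \<open>O_hat\<close> preserve integrality, so it can be tested on any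
  representative of a class.\<close>

lemma BB_integral:
  assumes a: "a \<in> Units KI" and g: "g \<in> Units AF" and t: "t \<in> carrier AF" and B: "BB a g t \<in> balanced_integral"
  shows "t \<in> OH"
proof -
  obtain s h w where h: "s \<in> Units KI" "h \<in> Units AF" "w \<in> GO h" "BB a g t = B0 s h w"
    using B unfolding balanced_integral_eq by blast
  define x where "x = inv\<^sub>f h *\<^sub>f w"
  have x: "x \<in> OH" using GO_iff_OH[OF h(2) GO_sub[OF h(3)]] h(3) by (simp add: x_def)
  have "BB (inv\<^sub>i s) h x = BB a g t" using h(4) by (simp add: B0_def x_def)
  then obtain u where u: "u \<in> O_hat_units" "t = u *\<^sub>f x"
    using BB_eq_iff[OF KI.Units_inv_Units[OF h(1)] a h(2) g OH_sub[OF x] t] by blast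
  have "u \<in> OH" using u(1) O_hat_units_iff by blast
  then show ?thesis unfolding u(2) using OH_closed(2) x by blast
qed

end

section \<open>The isomorphism of groupoids\<close>

lemma image_case_prod3: "(\<lambda>(a, b, c). f a b c) ` {(a, b, c). P a b c} = {f a b c | a b c. P a b c}"
  by force

lemma image_case_prod4: "(\<lambda>(a, b, c, d). f a b c d) ` {(a, b, c, d). P a b c d} = {f a b c d | a b c d. P a b c d}"
  by force

context number_field_type
begin

abbreviation lattice_param where "lattice_param s g w \<equiv> s \<in> Units KI \<and> g \<in> Units AF \<and> w \<in> GO g"
abbreviation arrow_param where "arrow_param s h g w \<equiv> s \<in> Units KI \<and> h \<in> Units AF \<and> g \<in> Units AF \<and> w \<in> GO h \<and> w \<in> GO g"

text \<open>An orbit under the identity component, written through parameters: scaling affects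
  \<open>s\<close> alone.\<close>

definition Ob :: "'k inf_adele \<Rightarrow> 'k fin_adele \<Rightarrow> 'k fin_adele \<Rightarrow> 'k lattice set" where
  "Ob s g w = (\<lambda>c. klat (c *\<^sub>i s) g w) ` CC"

definition Ar :: "'k inf_adele \<Rightarrow> 'k fin_adele \<Rightarrow> 'k fin_adele \<Rightarrow> 'k fin_adele \<Rightarrow> ('k lattice \<times> 'k lattice) set" where
  "Ar s h g w = (\<lambda>c. (klat (c *\<^sub>i s) h w, klat (c *\<^sub>i s) g w)) ` CC"

abbreviation CM :: "('k lattice set, ('k lattice \<times> 'k lattice) set) groupoid" where
  "CM \<equiv> commensurability_mod_scaling"

text \<open>Replacing \<open>s\<close> by \<open>c s\<close> merely reindexes an orbit, since
  \<open>CC\<close> is a group.\<close>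

lemma image_CC_scale:
  assumes "c \<in> CC" "s \<in> Units KI"
  shows "(\<lambda>d. f (d *\<^sub>i (c *\<^sub>i s))) ` CC = (\<lambda>d. f (d *\<^sub>i s)) ` CC"
proof (intro equalityI image_subsetI)
  note cU = CC_facts(2)[OF assms(1)]
  fix d assume d: "d \<in> CC"
  note dU = CC_facts(2)[OF d]
  have "d *\<^sub>i (c *\<^sub>i s) = (d *\<^sub>i c) *\<^sub>i s" using cU dU assms(2) by (simp add: KI.m_assoc)
  then show "f (d *\<^sub>i (c *\<^sub>i s)) \<in> (\<lambda>d. f (d *\<^sub>i s)) ` CC" using CC_facts(3)[OF d assms(1)] by auto
  have "d *\<^sub>i inv\<^sub>i c *\<^sub>i (c *\<^sub>i s) = d *\<^sub>i ((inv\<^sub>i c *\<^sub>i c) *\<^sub>i s)"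
    using cU dU assms(2) Units_KI_in[OF KI.Units_inv_Units[OF cU]] by (simp only: KI.m_assoc Units_KI_in KI.m_closed)
  also have "\<dots> = d *\<^sub>i s" using cU assms(2) by simp
  finally have eq: "d *\<^sub>i s = d *\<^sub>i inv\<^sub>i c *\<^sub>i (c *\<^sub>i s)" by (rule sym)
  show "f (d *\<^sub>i s) \<in> (\<lambda>d. f (d *\<^sub>i (c *\<^sub>i s))) ` CC"
    by (rule image_eqI[OF arg_cong[OF eq] CC_facts(3)[OF d CC_facts(4)[OF assms(1)]]])
qed

lemma CC_Units [simp]: "c \<in> CC \<Longrightarrow> c \<in> Units KI"
  by (rule CC_facts(2))

text \<open>Each of the two components yields a field element. They agree because
  \<open>c * s\<close> and \<open>s'\<close> determine it, \<open>di\<close> being injective; so one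
  \<open>k\<close> serves both ends of the arrow.\<close>

lemma Ar_eq_iff:
  assumes s: "s \<in> Units KI" "s' \<in> Units KI" and g: "h \<in> Units AF" "g \<in> Units AF" "h' \<in> Units AF" "g' \<in> Units AF"
    and w: "w \<in> GO h" "w \<in> GO g" "w' \<in> GO h'" "w' \<in> GO g'"
  shows "Ar s h g w = Ar s' h' g' w' \<longleftrightarrow> (\<exists>c\<in>CC. \<exists>k. k \<noteq> 0 \<and> s' = c *\<^sub>i s *\<^sub>i di (1 / k) \<and>
    GO h' = GO (jf k *\<^sub>f h) \<and> GO g' = GO (jf k *\<^sub>f g) \<and> w' = jf k *\<^sub>f w)"
proof
  assume eq: "Ar s h g w = Ar s' h' g' w'"
  have "(klat (\<one>\<^sub>i *\<^sub>i s') h' w', klat (\<one>\<^sub>i *\<^sub>i s') g' w') \<in> Ar s' h' g' w'"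
    unfolding Ar_def by (rule imageI[OF CC_facts(1)])
  then have "(klat s' h' w', klat s' g' w') \<in> Ar s h g w" using s eq by simp
  then obtain c where c: "c \<in> CC" and 1: "klat (c *\<^sub>i s) h w = klat s' h' w'" and 2: "klat (c *\<^sub>i s) g w = klat s' g' w'"
    unfolding Ar_def by auto
  have cU: "c *\<^sub>i s \<in> Units KI" using c s by simp
  obtain k where k: "k \<noteq> 0" "s' = c *\<^sub>i s *\<^sub>i di (1 / k)" "GO h' = GO (jf k *\<^sub>f h)" "w' = jf k *\<^sub>f w"
    using 1 klat_eq_iff[OF cU s(2) g(1,3) w(1,3)] by blast
  obtain l where l: "l \<noteq> 0" "s' = c *\<^sub>i s *\<^sub>i di (1 / l)" "GO g' = GO (jf l *\<^sub>f g)"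
    using 2 klat_eq_iff[OF cU s(2) g(2,4) w(2,4)] by blast
  have "di (1 / k) = di (1 / l)" using k(2) l(2) KI.Units_l_cancel[OF cU di_in di_in] by simp
  then have "k = l" by (simp add: di_eq_iff)
  then show "\<exists>c\<in>CC. \<exists>k. k \<noteq> 0 \<and> s' = c *\<^sub>i s *\<^sub>i di (1 / k) \<and>
    GO h' = GO (jf k *\<^sub>f h) \<and> GO g' = GO (jf k *\<^sub>f g) \<and> w' = jf k *\<^sub>f w"
    using c k l by blast
next
  assume "\<exists>c\<in>CC. \<exists>k. k \<noteq> 0 \<and> s' = c *\<^sub>i s *\<^sub>i di (1 / k) \<and>
    GO h' = GO (jf k *\<^sub>f h) \<and> GO g' = GO (jf k *\<^sub>f g) \<and> w' = jf k *\<^sub>f w"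
  then obtain c k where c: "c \<in> CC" and k: "k \<noteq> 0" "s' = c *\<^sub>i s *\<^sub>i di (1 / k)"
    "GO h' = GO (jf k *\<^sub>f h)" "GO g' = GO (jf k *\<^sub>f g)" "w' = jf k *\<^sub>f w" by blast
  have eq: "klat (d *\<^sub>i s') f' w' = klat (d *\<^sub>i (c *\<^sub>i s)) f w"
    if d: "d \<in> CC" and f: "f \<in> Units AF" "GO f' = GO (jf k *\<^sub>f f)" for d f f'
  proof -
    have dc: "d *\<^sub>i (c *\<^sub>i s) \<in> Units KI" using d c s by simp
    have "d *\<^sub>i s' = d *\<^sub>i (c *\<^sub>i s) *\<^sub>i di (1 / k)" unfolding k(2) using d c s by (simp add: KI.m_assoc)
    then show ?thesis
      using klat_reparametrize[OF dc Units_AF_in[OF f(1)] GO_sub[OF w(1)] k(1)] klat_GO_cong[OF f(2)] k(5) by simp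
  qed
  have "Ar s' h' g' w' = (\<lambda>d. (klat (d *\<^sub>i (c *\<^sub>i s)) h w, klat (d *\<^sub>i (c *\<^sub>i s)) g w)) ` CC"
    unfolding Ar_def using eq[OF _ g(1) k(3)] eq[OF _ g(2) k(4)] by (intro image_cong) auto
  also have "\<dots> = Ar s h g w" unfolding Ar_def by (rule image_CC_scale[OF c s(1)])
  finally show "Ar s h g w = Ar s' h' g' w'" by simp
qed

text \<open>Objects are handled as identity arrows, so that the criterion for equality of orbits is
  proved only once.\<close>

lemma Ob_eq_Ar_iff: "Ob s g w = Ob s' g' w' \<longleftrightarrow> Ar s g g w = Ar s' g' g' w'"
proof -
  have "Ar s g g w = (\<lambda>x. (x, x)) ` Ob s g w" for s g w by (simp add: Ar_def Ob_def image_image)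
  moreover have "inj (\<lambda>x :: 'k lattice. (x, x))" by (simp add: inj_on_def)
  ultimately show ?thesis by (simp add: inj_image_eq_iff)
qed

lemma Ob_eq_iff:
  assumes "s \<in> Units KI" "s' \<in> Units KI" "g \<in> Units AF" "g' \<in> Units AF" "w \<in> GO g" "w' \<in> GO g'"
  shows "Ob s g w = Ob s' g' w' \<longleftrightarrow> (\<exists>c\<in>CC. \<exists>k. k \<noteq> 0 \<and> s' = c *\<^sub>i s *\<^sub>i di (1 / k) \<and>
    GO g' = GO (jf k *\<^sub>f g) \<and> w' = jf k *\<^sub>f w)"
  unfolding Ob_eq_Ar_iff Ar_eq_iff[OF assms(1,2,3,3,4,4,5,5,6,6)] conj_left_absorb ..

lemma Obj_CM: "Obj CM = {Ob s g w | s g w. lattice_param s g w}"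
proof -
  have Obj: "Obj CM = {(\<lambda>c. scale c x) ` CC | x. x \<in> K_lattices}"
    by (simp add: commensurability_mod_scaling_def orbit_groupoid_def orbits_def orbit_def commensurability_def
        relation_groupoid_def Setcompr_eq_image)
  have orb: "(\<lambda>c. scale c (klat s g w)) ` CC = Ob s g w" if "s \<in> Units KI" for s g w
    unfolding Ob_def using that by (intro image_cong) (simp_all add: scale_klat)
  show ?thesis
  proof (intro equalityI subsetI)
    fix A assume "A \<in> Obj CM"
    then obtain P where P: "P \<in> K_lattices" "A = (\<lambda>c. scale c P) ` CC" unfolding Obj by blast
    obtain s g w where p: "s \<in> Units KI" "g \<in> Units AF" "w \<in> GO g" "P = klat s g w" using K_lattice_eq_klat[OF P(1)] by blast
    have "A = Ob s g w" unfolding P(2) p(4) by (rule orb[OF p(1)])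
    then show "A \<in> {Ob s g w | s g w. lattice_param s g w}" using p by blast
  next
    fix A assume "A \<in> {Ob s g w | s g w. lattice_param s g w}"
    then obtain s g w where p: "s \<in> Units KI" "g \<in> Units AF" "w \<in> GO g" "A = Ob s g w" by blast
    show "A \<in> Obj CM" unfolding Obj p(4) orb[OF p(1), symmetric] using klat_in[OF p(1-3)] by blast
  qed
qed

lemma Arr_CM: "Arr CM = {Ar s h g w | s h g w. arrow_param s h g w}"
proof -
  have Arr: "Arr CM = {(\<lambda>c. (scale c x, scale c y)) ` CC | x y. x \<in> K_lattices \<and> y \<in> K_lattices \<and> commensurable x y}"
    by (simp add: commensurability_mod_scaling_def orbit_groupoid_def orbits_def orbit_def commensurability_def
        relation_groupoid_def Setcompr_eq_image)
  have orb: "(\<lambda>c. (scale c (klat s h w), scale c (klat s g w))) ` CC = Ar s h g w" if "s \<in> Units KI" for s h g w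
    unfolding Ar_def using that by (intro image_cong) (simp_all add: scale_klat)
  show ?thesis
  proof (intro equalityI subsetI)
    fix A assume "A \<in> Arr CM"
    then obtain x y where xy: "x \<in> K_lattices" "y \<in> K_lattices" "commensurable x y" and A: "A = (\<lambda>c. (scale c x, scale c y)) ` CC"
      unfolding Arr by blast
    obtain s h w where x: "s \<in> Units KI" "h \<in> Units AF" "w \<in> GO h" "x = klat s h w" using K_lattice_eq_klat[OF xy(1)] by blast
    obtain s' g w' where y: "s' \<in> Units KI" "g \<in> Units AF" "w' \<in> GO g" "y = klat s' g w'" using K_lattice_eq_klat[OF xy(2)] by blast
    obtain k where k: "k \<noteq> 0" "s' = s *\<^sub>i di (1 / k)" "w' = jf k *\<^sub>f w"
      using xy(3) commensurable_klat_iff[OF x(1) y(1) x(2) y(2) x(3) y(3)] unfolding x(4) y(4) by blast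
    \<comment> \<open>The second \<open>K\<close>-lattice is rewritten with the \<open>s\<close> and
      \<open>w\<close> of the first one; its idele \<open>g\<close> becomes
      \<open>g / k\<close>.\<close>
    define g1 where "g1 = jf (1 / k) *\<^sub>f g"
    have g1: "g1 \<in> Units AF" using jf_Units[of "1 / k"] k(1) y(2) by (simp add: g1_def)
    have g: "g = jf k *\<^sub>f g1" unfolding g1_def using jf_cancel[OF k(1) Units_AF_in[OF y(2)]] by simp
    have w: "w \<in> GO g1" using y(3) GO_scale_iff[OF k(1) Units_AF_in[OF g1] GO_sub[OF x(3)]] unfolding k(3) g by blast
    have "y = klat s g1 w"
      unfolding y(4) k(2,3) g by (rule klat_reparametrize[OF x(1) Units_AF_in[OF g1] GO_sub[OF x(3)] k(1)])
    then have "A = Ar s h g1 w" unfolding A x(4) using orb[OF x(1)] by simp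
    then show "A \<in> {Ar s h g w | s h g w. arrow_param s h g w}"
      using x g1 w by blast
  next
    fix A assume "A \<in> {Ar s h g w | s h g w. arrow_param s h g w}"
    then obtain s h g w where A: "A = Ar s h g w" and p: "s \<in> Units KI" "h \<in> Units AF" "g \<in> Units AF" "w \<in> GO h" "w \<in> GO g"
      by blast
    have "commensurable (klat s h w) (klat s g w)" using commensurable_klat_same_scale[OF p] by simp
    then show "A \<in> Arr CM" unfolding A Arr orb[OF p(1), symmetric] using klat_in[OF p(1,2,4)] klat_in[OF p(1,3,5)] by blast
  qed
qed

lemma src_CM: "src CM (Ar s h g w) = Ob s g w"
  and rng_CM: "rng CM (Ar s h g w) = Ob s h w"
  and ide_CM: "ide CM (Ob s g w) = Ar s g g w"
proof -
  have "src CM = (\<lambda>A. snd ` A)" "rng CM = (\<lambda>A. fst ` A)" "ide CM = (\<lambda>E. (\<lambda>x. (x, x)) ` E)"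
    by (simp_all add: commensurability_mod_scaling_def orbit_groupoid_def commensurability_def relation_groupoid_def)
  then show "src CM (Ar s h g w) = Ob s g w" "rng CM (Ar s h g w) = Ob s h w" "ide CM (Ob s g w) = Ar s g g w"
    by (simp_all only: Ar_def Ob_def image_image fst_conv snd_conv)
qed

text \<open>An element of \<open>K\<close> that fixes one of the two \<open>K\<close>-lattices up to scaling is a unit at every finite
  place, so it also fixes the other one. Hence the composition of orbits is a single orbit.\<close>

lemma klat_transfer:
  assumes s: "s \<in> Units KI" "s' \<in> Units KI" and g: "g \<in> Units AF" "f \<in> Units AF" and w: "w \<in> GO g" "w \<in> GO f"
    and eq: "klat s g w = klat s' g w"
  shows "klat s f w = klat s' f w"
proof -
  obtain k where k: "k \<noteq> 0" "s' = s *\<^sub>i di (1 / k)" "GO g = GO (jf k *\<^sub>f g)" "w = jf k *\<^sub>f w"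
    using eq klat_eq_iff[OF s g(1,1) w(1,1)] by blast
  have "v k = 1" if v: "v \<in> finite_places" for v
  proof -
    have "fnorm v g = fnorm v (jf k *\<^sub>f g)" using iffD1[OF GO_eq_iff_fnorm k(3)] g(1) v by simp
    then show ?thesis using g(1) v fnorm_pos[OF g(1) v] by (simp add: fnorm_simps fnorm_jf)
  qed
  then have "GO f = GO (jf k *\<^sub>f f)" using g(2) by (simp add: GO_eq_iff_fnorm fnorm_simps fnorm_jf)
  then show ?thesis using k klat_eq_iff[OF s g(2,2) w(2,2)] by blast
qed

lemma comp_CM:
  assumes s: "s \<in> Units KI" and g: "h \<in> Units AF" "g \<in> Units AF" "f \<in> Units AF" and w: "w \<in> GO h" "w \<in> GO g" "w \<in> GO f"
  shows "comp CM (Ar s h g w) (Ar s g f w) = Ar s h f w"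
proof -
  have comp: "comp CM A B = {(fst p, snd q) | p q. p \<in> A \<and> q \<in> B \<and> snd p = fst q}" for A B
    by (simp add: commensurability_mod_scaling_def orbit_groupoid_def commensurability_def relation_groupoid_def)
  show ?thesis
  proof (intro equalityI subsetI)
    fix z assume "z \<in> comp CM (Ar s h g w) (Ar s g f w)"
    then obtain p q where pq: "p \<in> Ar s h g w" "q \<in> Ar s g f w" "snd p = fst q" "z = (fst p, snd q)"
      unfolding comp by blast
    obtain c where c: "c \<in> CC" "p = (klat (c *\<^sub>i s) h w, klat (c *\<^sub>i s) g w)" using pq(1) unfolding Ar_def by blast
    obtain d where d: "d \<in> CC" "q = (klat (d *\<^sub>i s) g w, klat (d *\<^sub>i s) f w)" using pq(2) unfolding Ar_def by blast
    have cd: "c *\<^sub>i s \<in> Units KI" "d *\<^sub>i s \<in> Units KI" using c d s by simp_all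
    \<comment> \<open>Agreement at the middle \<open>K\<close>-lattice need not give
      \<open>c = d\<close>; it is transferred to agreement at the source.\<close>
    have "klat (c *\<^sub>i s) f w = klat (d *\<^sub>i s) f w"
      by (rule klat_transfer[OF cd g(2,3) w(2,3)]) (use pq(3) c d in simp)
    then have "z = (klat (c *\<^sub>i s) h w, klat (c *\<^sub>i s) f w)" unfolding pq(4) c(2) d(2) by simp
    then show "z \<in> Ar s h f w" unfolding Ar_def using c(1) by (rule image_eqI)
  next
    fix z assume "z \<in> Ar s h f w"
    then obtain c where c: "c \<in> CC" "z = (klat (c *\<^sub>i s) h w, klat (c *\<^sub>i s) f w)" unfolding Ar_def by blast
    let ?p = "(klat (c *\<^sub>i s) h w, klat (c *\<^sub>i s) g w)" and ?q = "(klat (c *\<^sub>i s) g w, klat (c *\<^sub>i s) f w)"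
    have "?p \<in> Ar s h g w" "?q \<in> Ar s g f w" unfolding Ar_def by (rule imageI[OF c(1)])+
    moreover have "z = (fst ?p, snd ?q)" "snd ?p = fst ?q" by (simp_all add: c(2))
    ultimately show "z \<in> comp CM (Ar s h g w) (Ar s g f w)" unfolding comp by blast
  qed
qed

text \<open>One pair of \<open>c\<close> and \<open>k\<close> moves the target to the prescribed
  triple; the same \<open>k\<close> is then applied to the idele of the source.\<close>

lemma arrow_into:
  assumes A: "A \<in> Arr CM" and s: "s \<in> Units KI" and g: "g \<in> Units AF" and w: "w \<in> GO g" and rng: "rng CM A = Ob s g w"
  shows "\<exists>f\<in>Units AF. w \<in> GO f \<and> A = Ar s g f w"
proof -
  obtain s' h f' w' where p: "s' \<in> Units KI" "h \<in> Units AF" "f' \<in> Units AF" "w' \<in> GO h" "w' \<in> GO f'" and A': "A = Ar s' h f' w'"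
    using A unfolding Arr_CM by blast
  have "Ob s' h w' = Ob s g w" using rng unfolding A' rng_CM .
  then obtain c k where ck: "c \<in> CC" "k \<noteq> 0" "s = c *\<^sub>i s' *\<^sub>i di (1 / k)" "GO g = GO (jf k *\<^sub>f h)" "w = jf k *\<^sub>f w'"
    using Ob_eq_iff[OF p(1) s p(2) g p(4) w] by blast
  define f where "f = jf k *\<^sub>f f'"
  have f: "f \<in> Units AF" using jf_Units[OF ck(2)] p(3) by (simp add: f_def)
  have wf: "w \<in> GO f" unfolding f_def ck(5) using GO_scale_iff[OF ck(2) Units_AF_in[OF p(3)] GO_sub[OF p(4)]] p(5) by blast
  have "A = Ar s g f w"
    unfolding A' using Ar_eq_iff[OF p(1) s p(2,3) g f p(4,5) w wf] ck f_def by blast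
  then show ?thesis using f wf by blast
qed

text \<open>By \<open>arrow_into\<close>, composable arrows can be written with one
  \<open>s\<close>, one \<open>w\<close> and a chain of ideles; by \<open>comp_CM\<close>
  composition then just drops the middle idele.\<close>

lemma is_groupoid_CM: "is_groupoid CM"
  unfolding is_groupoid_def
proof (intro conjI ballI impI)
  fix A assume "A \<in> Arr CM"
  then obtain s h g w where p: "s \<in> Units KI" "h \<in> Units AF" "g \<in> Units AF" "w \<in> GO h" "w \<in> GO g" and A: "A = Ar s h g w"
    unfolding Arr_CM by blast
  show "src CM A \<in> Obj CM" "rng CM A \<in> Obj CM" unfolding A src_CM rng_CM Obj_CM using p by blast+
  show "comp CM A (ide CM (src CM A)) = A" unfolding A src_CM ide_CM by (rule comp_CM[OF p(1,2,3,3,4,5,5)])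
  show "comp CM (ide CM (rng CM A)) A = A" unfolding A rng_CM ide_CM by (rule comp_CM[OF p(1,2,2,3,4,4,5)])
  show "\<exists>B\<in>Arr CM. src CM B = rng CM A \<and> rng CM B = src CM A \<and>
      comp CM A B = ide CM (rng CM A) \<and> comp CM B A = ide CM (src CM A)"
    unfolding A src_CM rng_CM ide_CM
  proof (intro bexI[of _ "Ar s g h w"] conjI)
    show "Ar s g h w \<in> Arr CM" unfolding Arr_CM using p by blast
    show "comp CM (Ar s h g w) (Ar s g h w) = Ar s h h w" by (rule comp_CM[OF p(1,2,3,2,4,5,4)])
    show "comp CM (Ar s g h w) (Ar s h g w) = Ar s g g w" by (rule comp_CM[OF p(1,3,2,3,5,4,5)])
  qed (rule src_CM rng_CM)+
  fix B assume B: "B \<in> Arr CM" "src CM A = rng CM B"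
  obtain f where f: "f \<in> Units AF" "w \<in> GO f" "B = Ar s g f w"
    using arrow_into[OF B(1) p(1,3,5) B(2)[unfolded A src_CM, symmetric]] by blast
  have AB: "comp CM A B = Ar s h f w" unfolding A f(3) by (rule comp_CM[OF p(1,2,3) f(1) p(4,5) f(2)])
  show "comp CM A B \<in> Arr CM" unfolding AB Arr_CM using p f by blast
  show "src CM (comp CM A B) = src CM B" "rng CM (comp CM A B) = rng CM A"
    unfolding AB unfolding A f(3) src_CM rng_CM by (rule refl)+
  fix C assume C: "C \<in> Arr CM" "src CM B = rng CM C"
  obtain e where e: "e \<in> Units AF" "w \<in> GO e" "C = Ar s f e w"
    using arrow_into[OF C(1) p(1) f(1,2) C(2)[unfolded f(3) src_CM, symmetric]] by blast
  have BC: "comp CM B C = Ar s g e w" unfolding f(3) e(3) by (rule comp_CM[OF p(1,3) f(1) e(1) p(5) f(2) e(2)])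
  have "comp CM (comp CM A B) C = Ar s h e w" unfolding AB e(3) by (rule comp_CM[OF p(1,2) f(1) e(1) p(4) f(2) e(2)])
  moreover have "comp CM A (comp CM B C) = Ar s h e w" unfolding BC A by (rule comp_CM[OF p(1,2,3) e(1) p(4,5) e(2)])
  ultimately show "comp CM (comp CM A B) C = comp CM A (comp CM B C)" by simp
next
  fix x assume "x \<in> Obj CM"
  then obtain s g w where p: "s \<in> Units KI" "g \<in> Units AF" "w \<in> GO g" and x: "x = Ob s g w" unfolding Obj_CM by blast
  show "ide CM x \<in> Arr CM" unfolding x ide_CM Arr_CM using p by blast
  show "src CM (ide CM x) = x" "rng CM (ide CM x) = x" unfolding x ide_CM src_CM rng_CM by (rule refl)+
qed

section \<open>The transformation groupoid and the comparison\<close>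

abbreviation BM :: "(('k adele set \<times> 'k fin_adele) set, 'k fin_adele set \<times> ('k adele set \<times> 'k fin_adele) set) groupoid" where
  "BM \<equiv> boxtimes fin_idele_classes class_act balanced_integral"

text \<open>An idele class of \<open>u\<close> acting at \<open>B0 s g w\<close> is that of
  \<open>g / h\<close> with \<open>h = g / u\<close>; that the result is integral again means
  precisely that \<open>w\<close> lies in \<open>h O_hat\<close>.\<close>

lemma Arr_BM:
  "Arr BM = {(FC (g *\<^sub>f inv\<^sub>f h), B0 s g w) | s h g w. arrow_param s h g w}"
proof (intro equalityI subsetI)
  fix A assume "A \<in> Arr BM"
  then obtain c y where A: "A = (c, y)" and c: "c \<in> carrier fin_idele_classes" and y: "y \<in> balanced_integral" "class_act c y \<in> balanced_integral"
    by (auto simp: boxtimes_def)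
  obtain s g w where p: "s \<in> Units KI" "g \<in> Units AF" "w \<in> GO g" "y = B0 s g w" using y(1) unfolding balanced_integral_eq by blast
  obtain u where u: "u \<in> Units AF" "c = FC u" using c unfolding carrier_fin_idele_classes by blast
  define h where "h = g *\<^sub>f inv\<^sub>f u"
  have h: "h \<in> Units AF" using p u by (simp add: h_def)
  have cl: "g \<in> carrier AF" "u \<in> carrier AF" "inv\<^sub>f g \<in> carrier AF" "inv\<^sub>f u \<in> carrier AF" using p u by simp_all
  have "g *\<^sub>f inv\<^sub>f h = u"
    unfolding h_def using p(2) u(1) inv_cancel(2)[OF p(2) cl(2)] by (simp add: AF.Units_inv_mult)
  moreover have "w \<in> GO h"
  proof -
    have wc: "w \<in> carrier AF" by (rule GO_sub[OF p(3)])
    have t: "inv\<^sub>f g *\<^sub>f w \<in> carrier AF" using cl wc by simp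
    have "class_act c y = BB (inv\<^sub>i s) h (u *\<^sub>f (inv\<^sub>f g *\<^sub>f w))"
      unfolding u(2) p(4) B0_def h_def by (rule class_act_FC[OF KI.Units_inv_Units[OF p(1)] p(2) t u(1)])
    then have "u *\<^sub>f (inv\<^sub>f g *\<^sub>f w) \<in> OH"
      using BB_integral[OF KI.Units_inv_Units[OF p(1)] h, of "u *\<^sub>f (inv\<^sub>f g *\<^sub>f w)"] y(2) t cl by simp
    moreover have "inv\<^sub>f h *\<^sub>f w = u *\<^sub>f (inv\<^sub>f g *\<^sub>f w)"
      unfolding h_def using p(2) u(1) cl wc AF.m_lcomm[OF cl(3,2) wc] by (simp add: AF.Units_inv_mult AF.m_assoc)
    ultimately show ?thesis using GO_iff_OH[OF h wc] by simp
  qed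
  ultimately show "A \<in> {(FC (g *\<^sub>f inv\<^sub>f h), B0 s g w) | s h g w. arrow_param s h g w}"
    unfolding A p(4) u(2) using p h by blast
next
  fix A assume "A \<in> {(FC (g *\<^sub>f inv\<^sub>f h), B0 s g w) | s h g w. arrow_param s h g w}"
  then obtain s h g w where A: "A = (FC (g *\<^sub>f inv\<^sub>f h), B0 s g w)"
    and p: "s \<in> Units KI" "h \<in> Units AF" "g \<in> Units AF" "w \<in> GO h" "w \<in> GO g" by blast
  have "FC (g *\<^sub>f inv\<^sub>f h) \<in> carrier fin_idele_classes"
    unfolding carrier_fin_idele_classes using p(2,3) by (blast intro: AF.Units_m_closed AF.Units_inv_Units)
  moreover have "B0 s g w \<in> balanced_integral" "B0 s h w \<in> balanced_integral" unfolding balanced_integral_eq using p by blast+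
  ultimately show "A \<in> Arr BM" unfolding A using class_act_B0[OF p(1,3,2) GO_sub[OF p(4)]] by (simp add: boxtimes_def)
qed

lemma groupoid_isomorphic_CM_BM: "groupoid_isomorphic CM BM"
proof -
  define PO where "PO = {(s, g, w). lattice_param s g w}"
  define PA where "PA = {(s, h, g, w). arrow_param s h g w}"
  \<comment> \<open>The arrow from the class of \<open>(s, g, w)\<close> to the class of
    \<open>(s, h, w)\<close>.\<close>
  define B1 where "B1 s h g w = (FC (g *\<^sub>f inv\<^sub>f h), B0 s g w)" for s h g w
  have "\<exists>F. bij_betw F ((\<lambda>(s, g, w). Ob s g w) ` PO) ((\<lambda>(s, g, w). B0 s g w) ` PO) \<and>
      (\<forall>p\<in>PO. F ((\<lambda>(s, g, w). Ob s g w) p) = (\<lambda>(s, g, w). B0 s g w) p)"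
  proof (rule bij_betw_images)
    fix p q assume "p \<in> PO" "q \<in> PO"
    then obtain s g w s' g' w' where pq: "p = (s, g, w)" "q = (s', g', w')"
      and *: "s \<in> Units KI" "s' \<in> Units KI" "g \<in> Units AF" "g' \<in> Units AF" "w \<in> GO g" "w' \<in> GO g'"
      unfolding PO_def by blast
    show "(\<lambda>(s, g, w). Ob s g w) p = (\<lambda>(s, g, w). Ob s g w) q \<longleftrightarrow>
        (\<lambda>(s, g, w). B0 s g w) p = (\<lambda>(s, g, w). B0 s g w) q"
      unfolding pq prod.case Ob_eq_iff[OF *] B0_eq_iff[OF *(1-4) GO_sub[OF *(5)] GO_sub[OF *(6)]] ..
  qed
  then obtain F0 where F0b: "bij_betw F0 ((\<lambda>(s, g, w). Ob s g w) ` PO) ((\<lambda>(s, g, w). B0 s g w) ` PO)"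
    and F0': "\<forall>p\<in>PO. F0 ((\<lambda>(s, g, w). Ob s g w) p) = (\<lambda>(s, g, w). B0 s g w) p" by blast
  have F0: "F0 (Ob s g w) = B0 s g w" if "(s, g, w) \<in> PO" for s g w using bspec[OF F0' that] by (simp only: prod.case)
  have "\<exists>F. bij_betw F ((\<lambda>(s, h, g, w). Ar s h g w) ` PA) ((\<lambda>(s, h, g, w). B1 s h g w) ` PA) \<and>
      (\<forall>p\<in>PA. F ((\<lambda>(s, h, g, w). Ar s h g w) p) = (\<lambda>(s, h, g, w). B1 s h g w) p)"
  proof (rule bij_betw_images)
    fix p q assume "p \<in> PA" "q \<in> PA"
    then obtain s h g w s' h' g' w' where pq: "p = (s, h, g, w)" "q = (s', h', g', w')"
      and *: "s \<in> Units KI" "s' \<in> Units KI" "h \<in> Units AF" "g \<in> Units AF" "h' \<in> Units AF" "g' \<in> Units AF"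
        "w \<in> GO h" "w \<in> GO g" "w' \<in> GO h'" "w' \<in> GO g'"
      unfolding PA_def by blast
    have gh: "g *\<^sub>f inv\<^sub>f h \<in> Units AF" "g' *\<^sub>f inv\<^sub>f h' \<in> Units AF" using * by simp_all
    \<comment> \<open>Once \<open>k\<close> relates \<open>g\<close> to \<open>g'\<close>, equality
      of the idele classes of \<open>g / h\<close> and \<open>g' / h'\<close> is the remaining
      condition, that on \<open>h'\<close>.\<close>
    have FC: "FC (g *\<^sub>f inv\<^sub>f h) = FC (g' *\<^sub>f inv\<^sub>f h') \<longleftrightarrow> GO h' = GO (jf k *\<^sub>f h)"
      if k: "k \<noteq> 0" "GO g' = GO (jf k *\<^sub>f g)" for k
    proof -
      have "fnorm v (g *\<^sub>f inv\<^sub>f h) = fnorm v (g' *\<^sub>f inv\<^sub>f h') \<longleftrightarrow> fnorm v h' = fnorm v (jf k *\<^sub>f h)"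
        if v: "v \<in> finite_places" for v
      proof -
        have "fnorm v g' = fnorm v (jf k *\<^sub>f g)" using iffD1[OF GO_eq_iff_fnorm k(2)] *(4,6) v by simp
        then have g': "fnorm v g' = v k * fnorm v g" using *(4) v by (simp add: fnorm_simps fnorm_jf)
        have pos: "0 < fnorm v g" "0 < fnorm v h" "0 < fnorm v h'" using fnorm_pos[OF _ v] * by simp_all
        have 1: "fnorm v (g *\<^sub>f inv\<^sub>f h) = fnorm v g * inverse (fnorm v h)"
          "fnorm v (g' *\<^sub>f inv\<^sub>f h') = v k * fnorm v g * inverse (fnorm v h')" "fnorm v (jf k *\<^sub>f h) = v k * fnorm v h"
          using * v by (simp_all add: fnorm_simps fnorm_inv fnorm_jf g')
        have "a * inverse b = r * a * inverse c \<longleftrightarrow> c = r * b" if "0 < a" "0 < b" "0 < c" for a b c r :: real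
          using that by (simp add: field_simps)
        then show ?thesis unfolding 1 using pos by blast
      qed
      then show ?thesis unfolding FC_eq_iff[OF gh] using * gh by (simp add: GO_eq_iff_fnorm)
    qed
    show "(\<lambda>(s, h, g, w). Ar s h g w) p = (\<lambda>(s, h, g, w). Ar s h g w) q \<longleftrightarrow>
        (\<lambda>(s, h, g, w). B1 s h g w) p = (\<lambda>(s, h, g, w). B1 s h g w) q"
      unfolding pq prod.case Ar_eq_iff[OF *] B1_def prod.inject B0_eq_iff[OF *(1,2,4,6) GO_sub[OF *(8)] GO_sub[OF *(10)]]
      using FC by blast
  qed
  then obtain F1 where F1b: "bij_betw F1 ((\<lambda>(s, h, g, w). Ar s h g w) ` PA) ((\<lambda>(s, h, g, w). B1 s h g w) ` PA)"
    and F1': "\<forall>p\<in>PA. F1 ((\<lambda>(s, h, g, w). Ar s h g w) p) = (\<lambda>(s, h, g, w). B1 s h g w) p" by blast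
  have F1: "F1 (Ar s h g w) = B1 s h g w" if "(s, h, g, w) \<in> PA" for s h g w using bspec[OF F1' that] by (simp only: prod.case)
  have Obj: "Obj CM = (\<lambda>(s, g, w). Ob s g w) ` PO" "Obj BM = (\<lambda>(s, g, w). B0 s g w) ` PO"
    unfolding Obj_CM PO_def image_case_prod3 by (simp_all add: boxtimes_def balanced_integral_eq)
  have Arr: "Arr CM = (\<lambda>(s, h, g, w). Ar s h g w) ` PA" "Arr BM = (\<lambda>(s, h, g, w). B1 s h g w) ` PA"
    unfolding Arr_CM Arr_BM PA_def B1_def image_case_prod4 by (rule refl)+
  have src: "src BM (B1 s h g w) = B0 s g w" for s h g w by (simp add: boxtimes_def B1_def)
  have rng: "rng BM (B1 s h g w) = B0 s h w" if "(s, h, g, w) \<in> PA" for s h g w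
    using that class_act_B0[of s g h w] GO_sub[of w g] by (simp add: PA_def boxtimes_def B1_def)
  have ide: "ide BM (B0 s g w) = B1 s g g w" if "(s, g, w) \<in> PO" for s g w
    using that by (simp add: PO_def boxtimes_def B1_def one_fin_idele_classes)
  have comp: "comp BM (B1 s h g w) (B1 s g f w) = B1 s h f w"
    if p: "s \<in> Units KI" "h \<in> Units AF" "g \<in> Units AF" "f \<in> Units AF" for s h g f w
  proof -
    have c: "g \<in> carrier AF" "f \<in> carrier AF" "inv\<^sub>f g \<in> carrier AF" "inv\<^sub>f h \<in> carrier AF" using p by simp_all
    \<comment> \<open>The classes multiply as \<open>(g / h) (f / g) = f / h\<close>, in the order
      of \<open>comp\<close>.\<close>
    have "g *\<^sub>f inv\<^sub>f h *\<^sub>f (f *\<^sub>f inv\<^sub>f g) = (g *\<^sub>f inv\<^sub>f g) *\<^sub>f (f *\<^sub>f inv\<^sub>f h)"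
      using c by (simp only: AF.m_ac AF.m_closed)
    also have "\<dots> = f *\<^sub>f inv\<^sub>f h" using p c by simp
    finally show ?thesis using p
      by (simp add: boxtimes_def B1_def mult_fin_idele_classes)
  qed
  show ?thesis
    unfolding groupoid_isomorphic_def
  proof (intro exI[of _ F0] exI[of _ F1] conjI ballI impI)
    show "bij_betw F0 (Obj CM) (Obj BM)" unfolding Obj by (rule F0b)
    show "bij_betw F1 (Arr CM) (Arr BM)" unfolding Arr by (rule F1b)
  next
    fix A assume "A \<in> Arr CM"
    then obtain s h g w where p: "s \<in> Units KI" "h \<in> Units AF" "g \<in> Units AF" "w \<in> GO h" "w \<in> GO g" and A: "A = Ar s h g w"
      unfolding Arr_CM by blast
    have PA: "(s, h, g, w) \<in> PA" and PO: "(s, h, w) \<in> PO" "(s, g, w) \<in> PO" using p by (simp_all add: PA_def PO_def)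
    show "src BM (F1 A) = F0 (src CM A)" unfolding A src_CM F1[OF PA] F0[OF PO(2)] src ..
    show "rng BM (F1 A) = F0 (rng CM A)" unfolding A rng_CM F1[OF PA] F0[OF PO(1)] rng[OF PA] ..
    fix B assume B: "B \<in> Arr CM" "src CM A = rng CM B"
    obtain f where f: "f \<in> Units AF" "w \<in> GO f" "B = Ar s g f w"
      using arrow_into[OF B(1) p(1,3,5) B(2)[unfolded A src_CM, symmetric]] by blast
    have PA': "(s, g, f, w) \<in> PA" "(s, h, f, w) \<in> PA" using p f by (simp_all add: PA_def)
    show "F1 (comp CM A B) = comp BM (F1 A) (F1 B)"
      unfolding A f(3) comp_CM[OF p(1-3) f(1) p(4,5) f(2)] F1[OF PA] F1[OF PA'(1)] F1[OF PA'(2)] comp[OF p(1-3) f(1)] ..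
  next
    fix x assume "x \<in> Obj CM"
    then obtain s g w where p: "s \<in> Units KI" "g \<in> Units AF" "w \<in> GO g" and x: "x = Ob s g w" unfolding Obj_CM by blast
    have PO: "(s, g, w) \<in> PO" and PA: "(s, g, g, w) \<in> PA" using p by (simp_all add: PA_def PO_def)
    show "F1 (ide CM x) = ide BM (F0 x)" unfolding x ide_CM F1[OF PA] F0[OF PO] ide[OF PO] ..
  qed
qed

end

theorem corollary3p7:
  assumes "number_field TYPE('k::field_char_0)"
  shows "is_groupoid (commensurability_mod_scaling ::
            ('k lattice set, ('k lattice \<times> 'k lattice) set) groupoid) \<and>
         groupoid_isomorphic
           (commensurability_mod_scaling ::
              ('k lattice set, ('k lattice \<times> 'k lattice) set) groupoid)
           (boxtimes fin_idele_classes class_act balanced_integral ::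
              (('k adele set \<times> 'k fin_adele) set,
               'k fin_adele set \<times> ('k adele set \<times> 'k fin_adele) set) groupoid)"
proof -
  interpret number_field_type "TYPE('k)" by unfold_locales (rule assms)
  show ?thesis using is_groupoid_CM groupoid_isomorphic_CM_BM by blast
qed

end
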